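(* Let $T$ be a complete, model complete o-minimal theory extending $\mathrm{RCF}$. Then the theory $T^\delta_G$ of models of $T$ with a generic $T$-derivation is distal.
   Context: $T$ is a theory in a language $L$ extending the language of ordered rings. For $\mathcal M\models T$ with underlying set $M$ and $A\subseteq M$, "$L(A)$-definable" means definable in $\mathcal M$ by an $L$-formula with parameters from $A$. For a map $\delta:M\to M$ and a tuple $\bar u=(u_1,\dots,u_n)$ put $\delta\bar u=(\delta u_1,\dots,\delta u_n)$; $\mathbf J_f$ denotes the Jacobian matrix of $f$. A map $\delta:M\to M$ is a $T$-derivation on $\mathcal M$ if for every $n$, every open $U\subseteq M^n$ and every $L(\emptyset)$-definable $\mathcal C^1$-function $f:U\to M$ we have $\delta f(\bar u)=\mathbf J_f(\bar u)\,\delta\bar u$ for all $\bar u\in U$. Set $L^\delta=L\cup\{\delta\}$. For $a\in M$ let $\mathscr J^n_\delta(a)=(a,\delta a,\dots,\delta^n a)$. Let $\pi_n$ be projection onto the first $n$ coordinates and $\dim_L$ the usual o-minimal dimension. A $T$-derivation $\delta$ is generic if for every $n$ and every $L(M)$-definable $A\subseteq M^{n+1}$ with $\dim_L(\pi_n(A))=n$ there is $a\in M$ with $\mathscr J^n_\delta(a)\in A$. $T^\delta_G$ is the $L^\delta$-theory whose models are the $(\mathcal M,\delta)$ with $\mathcal M\models T$ and $\delta$ a generic $T$-derivation on $\mathcal M$. ($T^\delta_G$ is complete.) Let $(\mathbb M,\delta)$ be a monster model of $T^\delta_G$. $T^\delta_G$ is distal if whenever $\bar b$ is a tuple from $\mathbb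 M$ and $(\bar a_i)_{i\in I}$ is an $L^\delta(\emptyset)$-indiscernible sequence of tuples from $\mathbb M$ such that (1) $I=I_1+(c)+I_2$ where $I_1$ and $I_2$ are infinite linear orders without endpoints, and (2) $(\bar a_i)_{i\in I_1+I_2}$ is $L^\delta(\bar b)$-indiscernible, then $(\bar a_i)_{i\in I}$ is $L^\delta(\bar b)$-indiscernible. *)

theory Defs
  imports "HOL-Algebra.Ring" "HOL-Library.Extended_Real"
begin

unbundle cardinal_syntax

text \<open>The symbols of a language are all the elements of the types \<^typ>\<open>'f\<close> and \<^typ>\<open>'r\<close>;
  a record fixes their arities. Variables are natural numbers, equality is a logical symbol.\<close>

record ('f, 'r) lang =
  far :: "'f \<Rightarrow> nat"
  rar :: "'r \<Rightarrow> nat"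

datatype 'f tm = Var nat | App 'f "'f tm list"

datatype ('f, 'r) fm =
    FEq "'f tm" "'f tm"
  | FRel 'r "'f tm list"
  | FNeg "('f, 'r) fm"
  | FConj "('f, 'r) fm" "('f, 'r) fm"
  | FEx nat "('f, 'r) fm"

fun wf_tm :: "('f, 'r, 'z) lang_scheme \<Rightarrow> 'f tm \<Rightarrow> bool" where
  "wf_tm L (Var x) \<longleftrightarrow> True"
| "wf_tm L (App f ts) \<longleftrightarrow> length ts = far L f \<and> (\<forall>t \<in> set ts. wf_tm L t)"

fun wf_fm :: "('f, 'r, 'z) lang_scheme \<Rightarrow> ('f, 'r) fm \<Rightarrow> bool" where
  "wf_fm L (FEq s t) \<longleftrightarrow> wf_tm L s \<and> wf_tm L t"
| "wf_fm L (FRel p ts) \<longleftrightarrow> length ts = rar L p \<and> (\<forall>t \<in> set ts. wf_tm L t)"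
| "wf_fm L (FNeg \<phi>) \<longleftrightarrow> wf_fm L \<phi>"
| "wf_fm L (FConj \<phi> \<psi>) \<longleftrightarrow> wf_fm L \<phi> \<and> wf_fm L \<psi>"
| "wf_fm L (FEx x \<phi>) \<longleftrightarrow> wf_fm L \<phi>"

fun fv_tm :: "'f tm \<Rightarrow> nat set" where
  "fv_tm (Var x) = {x}"
| "fv_tm (App f ts) = (\<Union>t \<in> set ts. fv_tm t)"

fun fv :: "('f, 'r) fm \<Rightarrow> nat set" where
  "fv (FEq s t) = fv_tm s \<union> fv_tm t"
| "fv (FRel p ts) = (\<Union>t \<in> set ts. fv_tm t)"
| "fv (FNeg \<phi>) = fv \<phi>"
| "fv (FConj \<phi> \<psi>) = fv \<phi> \<union> fv \<psi>"
| "fv (FEx x \<phi>) = fv \<phi> - {x}"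

definition sentences :: "('f, 'r, 'z) lang_scheme \<Rightarrow> ('f, 'r) fm set" where
  "sentences L = {\<phi>. wf_fm L \<phi> \<and> fv \<phi> = {}}"

record ('m, 'f, 'r) struct =
  dom :: "'m set"
  fint :: "'f \<Rightarrow> 'm list \<Rightarrow> 'm"
  rint :: "'r \<Rightarrow> 'm list \<Rightarrow> bool"

definition is_struct :: "('f, 'r, 'z) lang_scheme \<Rightarrow> ('m, 'f, 'r) struct \<Rightarrow> bool" where
  "is_struct L M \<longleftrightarrow> dom M \<noteq> {} \<and>
     (\<forall>f xs. length xs = far L f \<longrightarrow> set xs \<subseteq> dom M \<longrightarrow> fint M f xs \<in> dom M)"

fun eval_tm :: "('m, 'f, 'r) struct \<Rightarrow> (nat \<Rightarrow> 'm) \<Rightarrow> 'f tm \<Rightarrow> 'm" where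
  "eval_tm M v (Var x) = v x"
| "eval_tm M v (App f ts) = fint M f (map (eval_tm M v) ts)"

fun sat :: "('m, 'f, 'r) struct \<Rightarrow> (nat \<Rightarrow> 'm) \<Rightarrow> ('f, 'r) fm \<Rightarrow> bool" where
  "sat M v (FEq s t) \<longleftrightarrow> eval_tm M v s = eval_tm M v t"
| "sat M v (FRel p ts) \<longleftrightarrow> rint M p (map (eval_tm M v) ts)"
| "sat M v (FNeg \<phi>) \<longleftrightarrow> \<not> sat M v \<phi>"
| "sat M v (FConj \<phi> \<psi>) \<longleftrightarrow> sat M v \<phi> \<and> sat M v \<psi>"
| "sat M v (FEx x \<phi>) \<longleftrightarrow> (\<exists>a \<in> dom M. sat M (v(x := a)) \<phi>)"

text \<open>Tuples are lists; a formula is evaluated at a tuple \<open>xs\<close> through the assignment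
  \<^term>\<open>nth xs\<close>, always under the proviso that its free variables are smaller than
  \<^term>\<open>length xs\<close>.\<close>

definition holds :: "('m, 'f, 'r) struct \<Rightarrow> ('f, 'r) fm \<Rightarrow> bool" where
  "holds M \<phi> \<longleftrightarrow> (\<forall>v. range v \<subseteq> dom M \<longrightarrow> sat M v \<phi>)"

definition models ::
  "('f, 'r, 'z) lang_scheme \<Rightarrow> ('f, 'r) fm set \<Rightarrow> ('m, 'f, 'r) struct \<Rightarrow> bool" where
  "models L T M \<longleftrightarrow> is_struct L M \<and> (\<forall>\<phi> \<in> T. holds M \<phi>)"

definition tuples :: "'m set \<Rightarrow> nat \<Rightarrow> 'm list set" where
  "tuples S n = {xs. length xs = n \<and> set xs \<subseteq> S}"

definition definable ::
  "('f, 'r, 'z) lang_scheme \<Rightarrow> ('m, 'f, 'r) struct \<Rightarrow> 'm set \<Rightarrow> nat \<Rightarrow> 'm list set \<Rightarrow> bool" where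
  "definable L M A n X \<longleftrightarrow> (\<exists>\<phi> ps. wf_fm L \<phi> \<and> set ps \<subseteq> A \<and> fv \<phi> \<subseteq> {..<n + length ps} \<and>
     X = {xs \<in> tuples (dom M) n. sat M (nth (xs @ ps)) \<phi>})"

definition definable_fun ::
  "('f, 'r, 'z) lang_scheme \<Rightarrow> ('m, 'f, 'r) struct \<Rightarrow> 'm set \<Rightarrow> nat \<Rightarrow> 'm list set \<Rightarrow>
    ('m list \<Rightarrow> 'm) \<Rightarrow> bool" where
  "definable_fun L M A n U f \<longleftrightarrow> definable L M A (Suc n) {u @ [f u] | u. u \<in> U}"

text \<open>A formula cannot quantify over all types, so ``every model of \<open>T\<close>'' means every model whose
  universe is a subset of a given type \<^typ>\<open>'m\<close>. By the downward Loewenheim-Skolem theorem the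
  notions below do not depend on \<^typ>\<open>'m\<close> once it has at least as many elements as there are
  formulas; a type containing a monster model (defined below) always has.\<close>

definition entails ::
  "'m itself \<Rightarrow> ('f, 'r, 'z) lang_scheme \<Rightarrow> ('f, 'r) fm set \<Rightarrow> ('f, 'r) fm \<Rightarrow> bool" where
  "entails _ L T \<phi> \<longleftrightarrow> (\<forall>M :: ('m, 'f, 'r) struct. models L T M \<longrightarrow> holds M \<phi>)"

definition complete_theory ::
  "'m itself \<Rightarrow> ('f, 'r, 'z) lang_scheme \<Rightarrow> ('f, 'r) fm set \<Rightarrow> bool" where
  "complete_theory m L T \<longleftrightarrow> (\<exists>M :: ('m, 'f, 'r) struct. models L T M) \<and>
     (\<forall>\<phi> \<in> sentences L. entails m L T \<phi> \<or> entails m L T (FNeg \<phi>))"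

definition substructure ::
  "('f, 'r, 'z) lang_scheme \<Rightarrow> ('m, 'f, 'r) struct \<Rightarrow> ('m, 'f, 'r) struct \<Rightarrow> bool" where
  "substructure L M N \<longleftrightarrow> dom M \<subseteq> dom N \<and>
     (\<forall>f xs. length xs = far L f \<longrightarrow> set xs \<subseteq> dom M \<longrightarrow> fint M f xs = fint N f xs) \<and>
     (\<forall>p xs. length xs = rar L p \<longrightarrow> set xs \<subseteq> dom M \<longrightarrow> rint M p xs = rint N p xs)"

definition elementary_substructure ::
  "('f, 'r, 'z) lang_scheme \<Rightarrow> ('m, 'f, 'r) struct \<Rightarrow> ('m, 'f, 'r) struct \<Rightarrow> bool" where
  "elementary_substructure L M N \<longleftrightarrow> substructure L M N \<and>
     (\<forall>\<phi> xs. wf_fm L \<phi> \<longrightarrow> set xs \<subseteq> dom M \<longrightarrow> fv \<phi> \<subseteq> {..<length xs} \<longrightarrow>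
        sat M (nth xs) \<phi> = sat N (nth xs) \<phi>)"

definition model_complete ::
  "'m itself \<Rightarrow> ('f, 'r, 'z) lang_scheme \<Rightarrow> ('f, 'r) fm set \<Rightarrow> bool" where
  "model_complete _ L T \<longleftrightarrow> (\<forall>M N :: ('m, 'f, 'r) struct.
     models L T M \<longrightarrow> models L T N \<longrightarrow> substructure L M N \<longrightarrow> elementary_substructure L M N)"

record ('f, 'r) olang = "('f, 'r) lang" +
  zero_sym :: 'f
  one_sym :: 'f
  add_sym :: 'f
  neg_sym :: 'f
  mul_sym :: 'f
  less_sym :: 'r

definition extends_oring_lang :: "('f, 'r) olang \<Rightarrow> bool" where
  "extends_oring_lang L \<longleftrightarrow>
     distinct [zero_sym L, one_sym L, add_sym L, neg_sym L, mul_sym L] \<and>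
     far L (zero_sym L) = 0 \<and> far L (one_sym L) = 0 \<and> far L (add_sym L) = 2 \<and>
     far L (neg_sym L) = 1 \<and> far L (mul_sym L) = 2 \<and> rar L (less_sym L) = 2"

record 'm oring = "'m ring" +
  olt :: "'m \<Rightarrow> 'm \<Rightarrow> bool"

definition oring_of :: "('f, 'r) olang \<Rightarrow> ('m, 'f, 'r) struct \<Rightarrow> 'm oring" where
  "oring_of L M = \<lparr>carrier = dom M,
     mult = (\<lambda>x y. fint M (mul_sym L) [x, y]), one = fint M (one_sym L) [],
     zero = fint M (zero_sym L) [], add = (\<lambda>x y. fint M (add_sym L) [x, y]),
     olt = (\<lambda>x y. rint M (less_sym L) [x, y])\<rparr>"

definition ordered_field :: "'m oring \<Rightarrow> bool" where
  "ordered_field R \<longleftrightarrow> field R \<and>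
     (\<forall>x \<in> carrier R. \<not> olt R x x) \<and>
     (\<forall>x \<in> carrier R. \<forall>y \<in> carrier R. \<forall>z \<in> carrier R. olt R x y \<longrightarrow> olt R y z \<longrightarrow> olt R x z) \<and>
     (\<forall>x \<in> carrier R. \<forall>y \<in> carrier R. olt R x y \<or> x = y \<or> olt R y x) \<and>
     (\<forall>x \<in> carrier R. \<forall>y \<in> carrier R. \<forall>z \<in> carrier R.
        olt R x y \<longrightarrow> olt R (x \<oplus>\<^bsub>R\<^esub> z) (y \<oplus>\<^bsub>R\<^esub> z)) \<and>
     (\<forall>x \<in> carrier R. \<forall>y \<in> carrier R.
        olt R \<zero>\<^bsub>R\<^esub> x \<longrightarrow> olt R \<zero>\<^bsub>R\<^esub> y \<longrightarrow> olt R \<zero>\<^bsub>R\<^esub> (x \<otimes>\<^bsub>R\<^esub> y))"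

definition real_closed_field :: "'m oring \<Rightarrow> bool" where
  "real_closed_field R \<longleftrightarrow> ordered_field R \<and>
     (\<forall>x \<in> carrier R. olt R \<zero>\<^bsub>R\<^esub> x \<longrightarrow> (\<exists>y \<in> carrier R. y \<otimes>\<^bsub>R\<^esub> y = x)) \<and>
     (\<forall>n c. odd n \<longrightarrow> c \<in> {..<n} \<rightarrow> carrier R \<longrightarrow> (\<exists>x \<in> carrier R.
        x [^]\<^bsub>R\<^esub> (n :: nat) \<oplus>\<^bsub>R\<^esub> (\<Oplus>\<^bsub>R\<^esub>i \<in> {..<n}. c i \<otimes>\<^bsub>R\<^esub> x [^]\<^bsub>R\<^esub> i) = \<zero>\<^bsub>R\<^esub>))"

definition extends_RCF ::
  "'m itself \<Rightarrow> ('f, 'r) olang \<Rightarrow> ('f, 'r) fm set \<Rightarrow> bool" where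
  "extends_RCF _ L T \<longleftrightarrow> (\<forall>M :: ('m, 'f, 'r) struct. models L T M \<longrightarrow>
     real_closed_field (oring_of L M) \<and>
     (\<forall>x \<in> dom M. fint M (neg_sym L) [x] = \<ominus>\<^bsub>oring_of L M\<^esub> x))"

text \<open>The bounds of an interval are optional, \<^term>\<open>None\<close> standing for an infinite endpoint.\<close>

definition above :: "'m oring \<Rightarrow> 'm option \<Rightarrow> 'm \<Rightarrow> bool" where
  "above R a x \<longleftrightarrow> (case a of None \<Rightarrow> True | Some a' \<Rightarrow> olt R a' x)"

definition below :: "'m oring \<Rightarrow> 'm option \<Rightarrow> 'm \<Rightarrow> bool" where
  "below R b x \<longleftrightarrow> (case b of None \<Rightarrow> True | Some b' \<Rightarrow> olt R x b')"

definition point_or_interval :: "'m oring \<Rightarrow> 'm set \<Rightarrow> bool" where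
  "point_or_interval R J \<longleftrightarrow> (\<exists>a \<in> carrier R. J = {a}) \<or>
     (\<exists>a b. set_option a \<subseteq> carrier R \<and> set_option b \<subseteq> carrier R \<and>
        J = {x \<in> carrier R. above R a x \<and> below R b x})"

definition o_minimal :: "('f, 'r) olang \<Rightarrow> ('m, 'f, 'r) struct \<Rightarrow> bool" where
  "o_minimal L M \<longleftrightarrow> (\<forall>X. definable L M (dom M) 1 X \<longrightarrow>
     (\<exists>F. finite F \<and> (\<forall>J \<in> F. point_or_interval (oring_of L M) J) \<and> X = {[x] | x. x \<in> \<Union>F}))"

definition o_minimal_theory ::
  "'m itself \<Rightarrow> ('f, 'r) olang \<Rightarrow> ('f, 'r) fm set \<Rightarrow> bool" where
  "o_minimal_theory _ L T \<longleftrightarrow> (\<forall>M :: ('m, 'f, 'r) struct. models L T M \<longrightarrow> o_minimal L M)"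

text \<open>\<open>abs_less R x e\<close> renders \<open>|x| < e\<close>; all epsilons below range over the ordered field itself.\<close>

definition abs_less :: "'m oring \<Rightarrow> 'm \<Rightarrow> 'm \<Rightarrow> bool" where
  "abs_less R x e \<longleftrightarrow> olt R (\<ominus>\<^bsub>R\<^esub> e) x \<and> olt R x e"

definition positives :: "'m oring \<Rightarrow> 'm set" where
  "positives R = {e \<in> carrier R. olt R \<zero>\<^bsub>R\<^esub> e}"

definition near :: "'m oring \<Rightarrow> 'm \<Rightarrow> 'm list \<Rightarrow> 'm list \<Rightarrow> bool" where
  "near R e u v \<longleftrightarrow> list_all2 (\<lambda>x y. abs_less R (y \<ominus>\<^bsub>R\<^esub> x) e) u v"

definition open_in :: "'m oring \<Rightarrow> nat \<Rightarrow> 'm list set \<Rightarrow> bool" where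
  "open_in R n U \<longleftrightarrow> U \<subseteq> tuples (carrier R) n \<and>
     (\<forall>u \<in> U. \<exists>e \<in> positives R. \<forall>v \<in> tuples (carrier R) n. near R e u v \<longrightarrow> v \<in> U)"

definition cont_on :: "'m oring \<Rightarrow> 'm list set \<Rightarrow> ('m list \<Rightarrow> 'm) \<Rightarrow> bool" where
  "cont_on R U f \<longleftrightarrow> (\<forall>u \<in> U. \<forall>e \<in> positives R. \<exists>d \<in> positives R. \<forall>v \<in> U.
     near R d u v \<longrightarrow> abs_less R (f v \<ominus>\<^bsub>R\<^esub> f u) e)"

definition has_partial ::
  "'m oring \<Rightarrow> 'm list set \<Rightarrow> ('m list \<Rightarrow> 'm) \<Rightarrow> nat \<Rightarrow> 'm list \<Rightarrow> 'm \<Rightarrow> bool" where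
  "has_partial R U f i u D \<longleftrightarrow> D \<in> carrier R \<and>
     (\<forall>e \<in> positives R. \<exists>d \<in> positives R. \<forall>h \<in> carrier R - {\<zero>\<^bsub>R\<^esub>}.
        abs_less R h d \<longrightarrow> u[i := u ! i \<oplus>\<^bsub>R\<^esub> h] \<in> U \<longrightarrow>
        abs_less R ((f (u[i := u ! i \<oplus>\<^bsub>R\<^esub> h]) \<ominus>\<^bsub>R\<^esub> f u) \<otimes>\<^bsub>R\<^esub> inv\<^bsub>R\<^esub> h \<ominus>\<^bsub>R\<^esub> D) e)"

definition partial_deriv ::
  "'m oring \<Rightarrow> 'm list set \<Rightarrow> ('m list \<Rightarrow> 'm) \<Rightarrow> nat \<Rightarrow> 'm list \<Rightarrow> 'm" where
  "partial_deriv R U f i u = (THE D. has_partial R U f i u D)"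

definition C1_on :: "'m oring \<Rightarrow> nat \<Rightarrow> 'm list set \<Rightarrow> ('m list \<Rightarrow> 'm) \<Rightarrow> bool" where
  "C1_on R n U f \<longleftrightarrow> (\<forall>i < n. (\<forall>u \<in> U. \<exists>D. has_partial R U f i u D) \<and>
     cont_on R U (partial_deriv R U f i))"

definition cell_bound ::
  "('f, 'r) olang \<Rightarrow> ('m, 'f, 'r) struct \<Rightarrow> nat \<Rightarrow> 'm list set \<Rightarrow> ('m list \<Rightarrow> 'm) \<Rightarrow> bool" where
  "cell_bound L M n C f \<longleftrightarrow>
     definable_fun L M (dom M) n C f \<and> cont_on (oring_of L M) C f"

text \<open>\<open>cell L M is C\<close>: \<open>C\<close> is an \<open>is\<close>-cell, \<open>is\<close> a sequence of zeros (graph over the projection) and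
  ones (band over the projection). In a band, \<^term>\<open>None\<close> is the constant function
  minus infinity (as \<open>lo\<close>) or plus infinity (as \<open>hi\<close>).\<close>

inductive cell ::
  "('f, 'r) olang \<Rightarrow> ('m, 'f, 'r) struct \<Rightarrow> nat list \<Rightarrow> 'm list set \<Rightarrow> bool"
  for L M where
  point: "cell L M [] {[]}"
| graph: "cell L M is C \<Longrightarrow> cell_bound L M (length is) C f \<Longrightarrow>
    cell L M (is @ [0]) {u @ [f u] | u. u \<in> C}"
| band: "cell L M is C \<Longrightarrow> (\<forall>f \<in> set_option lo \<union> set_option hi. cell_bound L M (length is) C f) \<Longrightarrow>
    (\<forall>f \<in> set_option lo. \<forall>g \<in> set_option hi. \<forall>u \<in> C. olt (oring_of L M) (f u) (g u)) \<Longrightarrow>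
    cell L M (is @ [1]) {u @ [y] | u y. u \<in> C \<and> y \<in> dom M \<and>
      above (oring_of L M) (map_option (\<lambda>f. f u) lo) y \<and>
      below (oring_of L M) (map_option (\<lambda>g. g u) hi) y}"

text \<open>The largest dimension of a cell contained in \<open>X\<close>; the empty set has dimension minus
  infinity.\<close>

definition odim :: "('f, 'r) olang \<Rightarrow> ('m, 'f, 'r) struct \<Rightarrow> 'm list set \<Rightarrow> ereal" where
  "odim L M X = Sup {ereal (real (sum_list is)) | is. \<exists>C. cell L M is C \<and> C \<subseteq> X}"

text \<open>The Jacobian of \<open>f\<close> is a single row, so the matrix product is a sum of \<open>n\<close> terms.\<close>

definition T_derivation ::
  "('f, 'r) olang \<Rightarrow> ('m, 'f, 'r) struct \<Rightarrow> ('m \<Rightarrow> 'm) \<Rightarrow> bool" where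
  "T_derivation L M \<delta> \<longleftrightarrow> \<delta> \<in> dom M \<rightarrow> dom M \<and> (\<forall>n U f.
     open_in (oring_of L M) n U \<longrightarrow> definable_fun L M {} n U f \<longrightarrow> C1_on (oring_of L M) n U f \<longrightarrow>
     (\<forall>u \<in> U. \<delta> (f u) = (\<Oplus>\<^bsub>oring_of L M\<^esub>i \<in> {..<n}.
        partial_deriv (oring_of L M) U f i u \<otimes>\<^bsub>oring_of L M\<^esub> \<delta> (u ! i))))"

definition jet :: "('m \<Rightarrow> 'm) \<Rightarrow> nat \<Rightarrow> 'm \<Rightarrow> 'm list" where
  "jet \<delta> n a = map (\<lambda>k. (\<delta> ^^ k) a) [0..<Suc n]"

definition generic_T_derivation ::
  "('f, 'r) olang \<Rightarrow> ('m, 'f, 'r) struct \<Rightarrow> ('m \<Rightarrow> 'm) \<Rightarrow> bool" where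
  "generic_T_derivation L M \<delta> \<longleftrightarrow> T_derivation L M \<delta> \<and> (\<forall>n A.
     definable L M (dom M) (Suc n) A \<longrightarrow> odim L M (take n ` A) = ereal (real n) \<longrightarrow>
     (\<exists>a \<in> dom M. jet \<delta> n a \<in> A))"

datatype 'f dfun = Old 'f | Delta

definition delta_lang :: "('f, 'r) olang \<Rightarrow> ('f dfun, 'r) lang" where
  "delta_lang L = \<lparr>far = case_dfun (far L) 1, rar = rar L\<rparr>"

definition reduct :: "('m, 'f dfun, 'r) struct \<Rightarrow> ('m, 'f, 'r) struct" where
  "reduct N = \<lparr>dom = dom N, fint = (\<lambda>f. fint N (Old f)), rint = rint N\<rparr>"

text \<open>A theory enters the definition of distality only through its class of models, so the theory
  of models of \<open>T\<close> with a generic \<open>T\<close>-derivation is represented by that class.\<close>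

definition TdG_model ::
  "('f, 'r) olang \<Rightarrow> ('f, 'r) fm set \<Rightarrow> ('m, 'f dfun, 'r) struct \<Rightarrow> bool" where
  "TdG_model L T N \<longleftrightarrow> is_struct (delta_lang L) N \<and> models L T (reduct N) \<and>
     generic_T_derivation L (reduct N) (\<lambda>x. fint N Delta [x])"

definition saturated ::
  "('f, 'r, 'z) lang_scheme \<Rightarrow> 'm rel \<Rightarrow> ('m, 'f, 'r) struct \<Rightarrow> bool" where
  "saturated L \<kappa> M \<longleftrightarrow> (\<forall>A p. A \<subseteq> dom M \<longrightarrow> |A| <o \<kappa> \<longrightarrow>
     (\<forall>(\<phi>, ps) \<in> p. wf_fm L \<phi> \<and> set ps \<subseteq> A \<and> fv \<phi> \<subseteq> {..<Suc (length ps)}) \<longrightarrow>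
     (\<forall>q. finite q \<longrightarrow> q \<subseteq> p \<longrightarrow> (\<exists>x \<in> dom M. \<forall>(\<phi>, ps) \<in> q. sat M (nth (x # ps)) \<phi>)) \<longrightarrow>
     (\<exists>x \<in> dom M. \<forall>(\<phi>, ps) \<in> p. sat M (nth (x # ps)) \<phi>))"

definition partial_elementary ::
  "('f, 'r, 'z) lang_scheme \<Rightarrow> ('m, 'f, 'r) struct \<Rightarrow> 'm set \<Rightarrow> ('m \<Rightarrow> 'm) \<Rightarrow> bool" where
  "partial_elementary L M A h \<longleftrightarrow> A \<subseteq> dom M \<and> h \<in> A \<rightarrow> dom M \<and>
     (\<forall>\<phi> xs. wf_fm L \<phi> \<longrightarrow> set xs \<subseteq> A \<longrightarrow> fv \<phi> \<subseteq> {..<length xs} \<longrightarrow>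
        sat M (nth xs) \<phi> = sat M (nth (map h xs)) \<phi>)"

definition automorphism ::
  "('f, 'r, 'z) lang_scheme \<Rightarrow> ('m, 'f, 'r) struct \<Rightarrow> ('m \<Rightarrow> 'm) \<Rightarrow> bool" where
  "automorphism L M \<sigma> \<longleftrightarrow> bij_betw \<sigma> (dom M) (dom M) \<and>
     (\<forall>f xs. length xs = far L f \<longrightarrow> set xs \<subseteq> dom M \<longrightarrow>
        \<sigma> (fint M f xs) = fint M f (map \<sigma> xs)) \<and>
     (\<forall>p xs. length xs = rar L p \<longrightarrow> set xs \<subseteq> dom M \<longrightarrow>
        rint M p xs = rint M p (map \<sigma> xs))"

definition strongly_homogeneous ::
  "('f, 'r, 'z) lang_scheme \<Rightarrow> 'm rel \<Rightarrow> ('m, 'f, 'r) struct \<Rightarrow> bool" where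
  "strongly_homogeneous L \<kappa> M \<longleftrightarrow> (\<forall>A h. |A| <o \<kappa> \<longrightarrow> partial_elementary L M A h \<longrightarrow>
     (\<exists>\<sigma>. automorphism L M \<sigma> \<and> (\<forall>x \<in> A. \<sigma> x = h x)))"

text \<open>The cardinal \<open>\<kappa>\<close> is only required to exceed the number of formulas. It can be taken on the type
  \<^typ>\<open>'m\<close>, since an infinite \<open>\<kappa>\<close>-saturated structure has at least \<open>\<kappa>\<close> elements.\<close>

definition monster_model ::
  "('f, 'r, 'z) lang_scheme \<Rightarrow> (('m, 'f, 'r) struct \<Rightarrow> bool) \<Rightarrow> ('m, 'f, 'r) struct \<Rightarrow> bool" where
  "monster_model L K M \<longleftrightarrow> K M \<and> (\<exists>\<kappa> :: 'm rel. Card_order \<kappa> \<and>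
     |UNIV :: ('f, 'r) fm set| <o \<kappa> \<and> saturated L \<kappa> M \<and> strongly_homogeneous L \<kappa> M)"

definition strict :: "'i rel \<Rightarrow> 'i \<Rightarrow> 'i \<Rightarrow> bool" where
  "strict r i j \<longleftrightarrow> (i, j) \<in> r \<and> i \<noteq> j"

text \<open>\<open>indiscernible L M B J r a\<close>: the sequence of the tuples \<open>a i\<close>, \<open>i \<in> J\<close>, is \<open>L(B)\<close>-indiscernible
  with respect to the order \<open>r\<close>. The tuples \<open>a i\<close> are meant to have the same length.\<close>

definition indiscernible ::
  "('f, 'r, 'z) lang_scheme \<Rightarrow> ('m, 'f, 'r) struct \<Rightarrow> 'm set \<Rightarrow> 'i set \<Rightarrow> 'i rel \<Rightarrow>
    ('i \<Rightarrow> 'm list) \<Rightarrow> bool" where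
  "indiscernible L M B J r a \<longleftrightarrow> (\<forall>\<phi> ps is js. wf_fm L \<phi> \<longrightarrow> set ps \<subseteq> B \<longrightarrow>
     set is \<subseteq> J \<longrightarrow> set js \<subseteq> J \<longrightarrow> sorted_wrt (strict r) is \<longrightarrow> sorted_wrt (strict r) js \<longrightarrow>
     length is = length js \<longrightarrow> fv \<phi> \<subseteq> {..<length (concat (map a is) @ ps)} \<longrightarrow>
     sat M (nth (concat (map a is) @ ps)) \<phi> = sat M (nth (concat (map a js) @ ps)) \<phi>)"

definition infinite_no_endpoints :: "'i rel \<Rightarrow> 'i set \<Rightarrow> bool" where
  "infinite_no_endpoints r J \<longleftrightarrow> infinite J \<and>
     (\<forall>i \<in> J. (\<exists>j \<in> J. strict r j i) \<and> (\<exists>j \<in> J. strict r i j))"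

text \<open>The index orders are linear orders on subsets \<open>I\<close> of the type \<^typ>\<open>'i\<close>, and \<open>I = I\<^sub>1 + (c) + I\<^sub>2\<close> is
  expressed by taking for \<open>I\<^sub>1\<close> and \<open>I\<^sub>2\<close> the parts of \<open>I\<close> before and after \<open>c\<close>.\<close>

definition distal ::
  "'i itself \<Rightarrow> ('f, 'r, 'z) lang_scheme \<Rightarrow> (('m, 'f, 'r) struct \<Rightarrow> bool) \<Rightarrow> bool" where
  "distal _ L K \<longleftrightarrow> (\<forall>M. monster_model L K M \<longrightarrow>
     (\<forall>b (I :: 'i set) r c a n.
        set b \<subseteq> dom M \<longrightarrow> linear_order_on I r \<longrightarrow> a \<in> I \<rightarrow> tuples (dom M) n \<longrightarrow>
        indiscernible L M {} I r a \<longrightarrow>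
        c \<in> I \<longrightarrow> infinite_no_endpoints r {i \<in> I. strict r i c} \<longrightarrow>
        infinite_no_endpoints r {i \<in> I. strict r c i} \<longrightarrow>
        indiscernible L M (set b) (I - {c}) r a \<longrightarrow>
        indiscernible L M (set b) I r a))"

end

theory Submission
  imports Defs
begin

text \<open>Everything is derived from points of the saturated model that are independent over a
  countable set of parameters, where independence refers to definable closure. A definable set
  containing an independent point contains a box around it, so a definable function is continuous
  and differentiable at an independent point. Hence the chain rule of a \<open>T\<close>-derivation is available
  at such points, and together with the genericity axiom it gives a back-and-forth argument: an
  \<open>L\<close>-elementary map that is closed under the derivation preserves all formulas of the expanded
  language. In this way indiscernibility in the expanded language reduces to \<open>L\<close>-indiscernibility of
  sequences of jets. For \<open>L\<close>, parameters are adjoined one at a time: the trace of a formula on the line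
  is determined by finitely many breakpoints, each a definable function of the sequence, and along an
  indiscernible sequence such a function is constant or strictly monotone, so that its value at \<open>c\<close>
  lies between its values at indices on either side of \<open>c\<close>.\<close>

section \<open>Definability with parameters\<close>

text \<open>The obstacle is that a \<open>T\<close>-derivation is controlled only along C1-functions
  that are definable without parameters on open sets, while a definable function need not be smooth
  at a given point. An element of \<open>dcl C\<close> is therefore written as \<open>F w\<close>
  with \<open>w\<close> an independent tuple from \<open>C\<close>. There \<open>F\<close> is
  smooth, and the interior of the set where it is smooth is definable without parameters, so an
  elementary map carries \<open>w\<close> to a point of the same set and \<delta> is computed by one
  term on both sides. Genericity is applied to an independent initial part of a jet: a definable
  condition true there holds on a box, so the set to be met has a projection of full dimension. In
  the order argument the breakpoints move with \<open>c\<close>; their position relative to the new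
  parameter is pinned down because the indices on the two sides of \<open>c\<close> are
  indistinguishable over it. Saturation is invoked over countable sets, so the maps are kept
  countable. Assignments are infinite, which removes arities: two of them are paired by
  interleaving, and finite support restores ordinary quantifiers.\<close>

lemma finite_fv_tm: "finite (fv_tm t)"
  by (induction t) auto

lemma finite_fv: "finite (fv \<phi>)"
  by (induction \<phi>) (auto simp: finite_fv_tm)

lemma eval_tm_cong: "(\<And>x. x \<in> fv_tm t \<Longrightarrow> v x = w x) \<Longrightarrow> eval_tm M v t = eval_tm M w t"
proof (induction t)
  case (App f ts)
  have "map (eval_tm M v) ts = map (eval_tm M w) ts"
    using App by auto
  then show ?case by (simp only: eval_tm.simps)
qed simp

lemma sat_cong: "(\<And>x. x \<in> fv \<phi> \<Longrightarrow> v x = w x) \<Longrightarrow> sat M v \<phi> = sat M w \<phi>"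
proof (induction \<phi> arbitrary: v w)
  case (FEq s t)
  have "eval_tm M v s = eval_tm M w s" "eval_tm M v t = eval_tm M w t"
    by (auto intro!: eval_tm_cong FEq)
  then show ?case by simp
next
  case (FRel p ts)
  have "map (eval_tm M v) ts = map (eval_tm M w) ts"
    by (intro map_cong[OF refl] eval_tm_cong FRel) auto
  then show ?case by (simp only: sat.simps)
next
  case (FNeg \<phi>)
  have "sat M v \<phi> = sat M w \<phi>"
    by (rule FNeg.IH) (simp add: FNeg.prems)
  then show ?case by simp
next
  case (FConj \<phi> \<psi>)
  have "sat M v \<phi> = sat M w \<phi>"
    by (rule FConj.IH(1)) (simp add: FConj.prems)
  moreover have "sat M v \<psi> = sat M w \<psi>"
    by (rule FConj.IH(2)) (simp add: FConj.prems)
  ultimately show ?case by simp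
next
  case (FEx x \<phi>)
  have "sat M (v(x := a)) \<phi> = sat M (w(x := a)) \<phi>" for a
    using FEx.prems by (intro FEx.IH) auto
  then show ?case by simp
qed

section \<open>Renaming of variables\<close>

primrec ren_tm :: "(nat \<Rightarrow> nat) \<Rightarrow> 'f tm \<Rightarrow> 'f tm" where
  "ren_tm f (Var x) = Var (f x)"
| "ren_tm f (App g ts) = App g (map (ren_tm f) ts)"

lemma eval_ren_tm: "eval_tm M v (ren_tm f t) = eval_tm M (v \<circ> f) t"
  by (induction t) (auto simp: comp_def cong: map_cong)

lemma wf_ren_tm: "wf_tm L (ren_tm f t) = wf_tm L t"
  by (induction t) auto

lemma fv_ren_tm: "fv_tm (ren_tm f t) = f ` fv_tm t"
  by (induction t) auto

text \<open>Bound variables have to be renamed to avoid capture, so the new formula involves choices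
  beyond \<open>f\<close> and is only asserted to exist. The map \<open>f\<close> may identify
  variables.\<close>

lemma ren_fm:
  fixes \<phi> :: "('f, 'r) fm"
  assumes "wf_fm L \<phi>"
  shows "\<exists>\<psi>. wf_fm L \<psi> \<and> fv \<psi> \<subseteq> f ` fv \<phi> \<and>
    (\<forall>(M :: ('m, 'f, 'r) struct) v. sat M v \<psi> = sat M (v \<circ> f) \<phi>)"
  using assms
proof (induction \<phi> arbitrary: f)
  case (FEq s t)
  then show ?case
    by (intro exI[of _ "FEq (ren_tm f s) (ren_tm f t)"])
      (auto simp: eval_ren_tm wf_ren_tm fv_ren_tm comp_def)
next
  case (FRel p ts)
  then show ?case
    by (intro exI[of _ "FRel p (map (ren_tm f) ts)"])
      (auto simp: eval_ren_tm wf_ren_tm fv_ren_tm comp_def)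
next
  case (FNeg \<phi>)
  from FNeg.prems have "wf_fm L \<phi>" by simp
  from FNeg.IH[OF this, of f] obtain \<psi> where "wf_fm L \<psi>" "fv \<psi> \<subseteq> f ` fv \<phi>"
    "\<forall>(M :: ('m, 'f, 'r) struct) v. sat M v \<psi> = sat M (v \<circ> f) \<phi>" by blast
  then show ?case by (intro exI[of _ "FNeg \<psi>"]) (auto simp: comp_def)
next
  case (FConj \<phi>1 \<phi>2)
  from FConj.prems have w: "wf_fm L \<phi>1" "wf_fm L \<phi>2" by simp_all
  from FConj.IH(1)[OF w(1), of f] obtain \<psi>1 where 1: "wf_fm L \<psi>1" "fv \<psi>1 \<subseteq> f ` fv \<phi>1"
    "\<forall>(M :: ('m, 'f, 'r) struct) v. sat M v \<psi>1 = sat M (v \<circ> f) \<phi>1" by blast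
  from FConj.IH(2)[OF w(2), of f] obtain \<psi>2 where 2: "wf_fm L \<psi>2" "fv \<psi>2 \<subseteq> f ` fv \<phi>2"
    "\<forall>(M :: ('m, 'f, 'r) struct) v. sat M v \<psi>2 = sat M (v \<circ> f) \<phi>2" by blast
  from 1 2 show ?case by (intro exI[of _ "FConj \<psi>1 \<psi>2"]) (auto simp: comp_def)
next
  case (FEx x \<phi>)
  have "finite (f ` fv \<phi>)" by (simp add: finite_fv)
  \<comment> \<open>With \<open>y\<close> outside the image of the free variables, a free occurrence
    of \<open>y\<close> after renaming can only come from the bound variable.\<close>
  then obtain y where y: "y \<notin> f ` fv \<phi>" using ex_new_if_finite infinite_UNIV_nat by metis
  from FEx.prems have "wf_fm L \<phi>" by simp
  from FEx.IH[OF this, of "f(x := y)"] obtain \<psi>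
    where p: "wf_fm L \<psi>" "fv \<psi> \<subseteq> (f(x := y)) ` fv \<phi>"
    "\<forall>(M :: ('m, 'f, 'r) struct) v. sat M v \<psi> = sat M (v \<circ> f(x := y)) \<phi>" by blast
  have *: "sat M (v(y := a) \<circ> f(x := y)) \<phi> = sat M ((v \<circ> f)(x := a)) \<phi>"
    for M :: "('m, 'f, 'r) struct" and v a
    using y by (intro sat_cong) auto
  have "sat M v (FEx y \<psi>) = sat M (v \<circ> f) (FEx x \<phi>)" for M :: "('m, 'f, 'r) struct" and v
    using p(3) * by (simp only: sat.simps)
  moreover have "fv (FEx y \<psi>) \<subseteq> f ` fv (FEx x \<phi>)"
    using p(2) by (auto split: if_splits)
  moreover have "wf_fm L (FEx y \<psi>)" using p(1) by simp
  ultimately show ?case by blast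
qed

text \<open>Interleaving is the pairing of assignments: a block of parameters or of quantified
  variables occupies the even places and the remaining variables the odd ones, so no length has to
  be recorded.\<close>

definition merge :: "(nat \<Rightarrow> 'a) \<Rightarrow> (nat \<Rightarrow> 'a) \<Rightarrow> nat \<Rightarrow> 'a" where
  "merge s v i = (if even i then s (i div 2) else v (i div 2))"

definition evens :: "(nat \<Rightarrow> 'a) \<Rightarrow> nat \<Rightarrow> 'a" where
  "evens v i = v (2 * i)"

definition odds :: "(nat \<Rightarrow> 'a) \<Rightarrow> nat \<Rightarrow> 'a" where
  "odds v i = v (2 * i + 1)"

lemma evens_merge [simp]: "evens (merge s v) = s"
  and odds_merge [simp]: "odds (merge s v) = v"
  by (auto simp: fun_eq_iff evens_def odds_def merge_def)

abbreviation (input) scons :: "'a \<Rightarrow> (nat \<Rightarrow> 'a) \<Rightarrow> nat \<Rightarrow> 'a" where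
  "scons \<equiv> case_nat"

abbreviation (input) stail :: "(nat \<Rightarrow> 'a) \<Rightarrow> nat \<Rightarrow> 'a" where
  "stail v \<equiv> (\<lambda>i. v (Suc i))"

lemma scons_stail [simp]: "scons (v 0) (stail v) = v"
  by (auto simp: fun_eq_iff split: nat.splits)

text \<open>Moves the head of the remaining assignment to the end of an initial block, the step by
  which a block of quantified coordinates grows.\<close>

lemma append_scons:
  "(\<lambda>i. if i < k then z i else scons a v (i - k)) =
   (\<lambda>i. if i < Suc k then (z(k := a)) i else v (i - Suc k))"
proof
  fix i consider "i < k" | "i = k" | j where "i = Suc (k + j)"
    by (metis less_imp_Suc_add nat_neq_iff)
  then show "(if i < k then z i else scons a v (i - k)) =
    (if i < Suc k then (z(k := a)) i else v (i - Suc k))"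
    by cases (auto simp: Suc_diff_le)
qed

locale first_order_structure =
  fixes L :: "('f, 'r, 'z) lang_scheme" and M :: "('m, 'f, 'r) struct"
  assumes str: "is_struct L M"
begin

definition Env :: "(nat \<Rightarrow> 'm) set" where
  "Env = {v. \<forall>i. v i \<in> dom M}"

lemma EnvI: "(\<And>i. v i \<in> dom M) \<Longrightarrow> v \<in> Env"
  by (simp add: Env_def)

lemma EnvD: "v \<in> Env \<Longrightarrow> v i \<in> dom M"
  by (simp add: Env_def)

lemma Env_const [simp]: "(\<lambda>_. c) \<in> Env \<longleftrightarrow> c \<in> dom M"
  by (auto simp: Env_def)

lemma Env_scons [simp]: "scons a v \<in> Env \<longleftrightarrow> a \<in> dom M \<and> v \<in> Env"
proof
  assume *: "scons a v \<in> Env"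
  have "scons a v 0 \<in> dom M" "\<And>i. scons a v (Suc i) \<in> dom M" using * unfolding Env_def by blast+
  then show "a \<in> dom M \<and> v \<in> Env" by (simp add: Env_def)
qed (auto simp: Env_def split: nat.splits)

lemma Env_stail: "v \<in> Env \<Longrightarrow> stail v \<in> Env"
  by (auto simp: Env_def)

lemma Env_upd [simp]: "v \<in> Env \<Longrightarrow> a \<in> dom M \<Longrightarrow> v(i := a) \<in> Env"
  by (auto simp: Env_def)

lemma Env_merge [simp]: "v \<in> Env \<Longrightarrow> w \<in> Env \<Longrightarrow> merge v w \<in> Env"
  by (auto simp: Env_def merge_def)

lemma Env_if [simp]: "v \<in> Env \<Longrightarrow> w \<in> Env \<Longrightarrow> (\<lambda>i. if P i then v i else w i) \<in> Env"
  by (auto simp: Env_def)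

lemma Env_ren: "v \<in> Env \<Longrightarrow> (\<lambda>i. v (f i)) \<in> Env"
  by (auto simp: Env_def)

lemma Env_ne: "\<exists>v. v \<in> Env"
proof -
  obtain c where "c \<in> dom M" using str by (auto simp: is_struct_def)
  then show ?thesis by (intro exI[of _ "\<lambda>_. c"]) simp
qed

declare EnvD [simp]

text \<open>In \<open>defP\<close> a variable of the formula is interpreted by a parameter (\<^const>\<open>Inl\<close>)
  or by a coordinate of the assignment (\<^const>\<open>Inr\<close>).\<close>

definition gval :: "(nat \<Rightarrow> 'm + nat) \<Rightarrow> (nat \<Rightarrow> 'm) \<Rightarrow> nat \<Rightarrow> 'm" where
  "gval g v i = (case g i of Inl c \<Rightarrow> c | Inr j \<Rightarrow> v j)"

text \<open>Parameters outside the universe are discarded, so parameter sets are only compared on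
  \<open>dom M\<close>.\<close>

definition gens :: "'m set \<Rightarrow> ('m + nat) set" where
  "gens A = Inl ` (A \<inter> dom M) \<union> range Inr"

definition defP :: "'m set \<Rightarrow> ((nat \<Rightarrow> 'm) \<Rightarrow> bool) \<Rightarrow> bool" where
  "defP A P \<longleftrightarrow> (\<exists>\<phi> g. wf_fm L \<phi> \<and> (\<forall>i. g i \<in> gens A) \<and>
     (\<forall>v \<in> Env. P v \<longleftrightarrow> sat M (gval g v) \<phi>))"

text \<open>The graph puts the value in coordinate 0 and shifts the arguments by one. Values in the
  universe are demanded on \<open>Env\<close> only, since a definable graph says nothing
  elsewhere.\<close>

definition defT :: "'m set \<Rightarrow> ((nat \<Rightarrow> 'm) \<Rightarrow> 'm) \<Rightarrow> bool" where
  "defT A t \<longleftrightarrow> (\<forall>v \<in> Env. t v \<in> dom M) \<and> defP A (\<lambda>v. v 0 = t (stail v))"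

definition dcl :: "'m set \<Rightarrow> 'm set" where
  "dcl A = {x \<in> dom M. defT A (\<lambda>_. x)}"

lemma gval_Env: "(\<And>i. g i \<in> gens A) \<Longrightarrow> v \<in> Env \<Longrightarrow> gval g v \<in> Env"
proof (rule EnvI)
  fix i assume g: "\<And>i. g i \<in> gens A" and v: "v \<in> Env"
  show "gval g v i \<in> dom M"
    using g[of i] v by (cases "g i") (auto simp: gval_def gens_def)
qed

lemma gens_mono: "A \<inter> dom M \<subseteq> B \<Longrightarrow> gens A \<subseteq> gens B"
  by (auto simp: gens_def)

lemma gens_Inr [simp]: "Inr j \<in> gens A"
  by (auto simp: gens_def)

lemma gens_Inl [simp]: "Inl c \<in> gens A \<longleftrightarrow> c \<in> A \<and> c \<in> dom M"
  by (auto simp: gens_def)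

section \<open>Closure of definable predicates under connectives and quantifiers\<close>

lemma defP_cong: "(\<And>v. v \<in> Env \<Longrightarrow> P v = Q v) \<Longrightarrow> defP A P = defP A Q"
  unfolding defP_def by simp

lemma defP_mono: "defP A P \<Longrightarrow> A \<inter> dom M \<subseteq> B \<Longrightarrow> defP B P"
  unfolding defP_def using gens_mono by blast

lemma defP_fm:
  assumes "wf_fm L \<phi>"
  shows "defP A (\<lambda>v. sat M v \<phi>)"
  unfolding defP_def
  by (intro exI[of _ \<phi>] exI[of _ Inr]) (auto simp: assms gval_def[abs_def])

text \<open>Interpretations compose: parameters stay and coordinates are sent on by
  \<open>h\<close>. Renaming coordinates and freezing some of them at parameters are both
  instances.\<close>

lemma defP_gval:
  assumes "defP A P" "\<And>i. h i \<in> gens A"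
  shows "defP A (\<lambda>v. P (gval h v))"
proof -
  from assms(1) obtain \<phi> g where g: "wf_fm L \<phi>" "\<forall>i. g i \<in> gens A"
    "\<forall>v \<in> Env. P v \<longleftrightarrow> sat M (gval g v) \<phi>" unfolding defP_def by blast
  define k where "k i = (case g i of Inl c \<Rightarrow> Inl c | Inr j \<Rightarrow> h j)" for i
  have "gval g (gval h v) = gval k v" for v
    by (auto simp: gval_def k_def fun_eq_iff split: sum.splits)
  moreover have "k i \<in> gens A" for i
    using g(2)[rule_format, of i] assms(2) by (auto simp: k_def split: sum.splits)
  ultimately show ?thesis
    unfolding defP_def using g gval_Env[OF assms(2)] by (intro exI[of _ \<phi>] exI[of _ k]) auto
qed

lemma defP_ren: "defP A P \<Longrightarrow> defP A (\<lambda>v. P (\<lambda>i. v (f i)))"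
  using defP_gval[of A P "\<lambda>i. Inr (f i)"] by (simp add: gval_def[abs_def])

lemma defP_neg: "defP A P \<Longrightarrow> defP A (\<lambda>v. \<not> P v)"
proof -
  assume "defP A P"
  then obtain \<phi> g where "wf_fm L \<phi>" "\<forall>i. g i \<in> gens A"
    "\<forall>v \<in> Env. P v \<longleftrightarrow> sat M (gval g v) \<phi>" unfolding defP_def by blast
  then show ?thesis unfolding defP_def by (intro exI[of _ "FNeg \<phi>"] exI[of _ g]) simp
qed

text \<open>The two formulas may interpret the same variable differently, so their variables are
  made disjoint, even for one and odd for the other, before they are joined.\<close>

lemma defP_conj:
  assumes "defP A P" "defP A Q"
  shows "defP A (\<lambda>v. P v \<and> Q v)"
proof -
  from assms(1) obtain \<phi> g where 1: "wf_fm L \<phi>" "\<forall>i. g i \<in> gens A"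
    "\<forall>v \<in> Env. P v \<longleftrightarrow> sat M (gval g v) \<phi>" unfolding defP_def by blast
  from assms(2) obtain \<psi> h where 2: "wf_fm L \<psi>" "\<forall>i. h i \<in> gens A"
    "\<forall>v \<in> Env. Q v \<longleftrightarrow> sat M (gval h v) \<psi>" unfolding defP_def by blast
  obtain \<phi>' where 3: "wf_fm L \<phi>'"
    "\<forall>(M :: ('m, 'f, 'r) struct) v. sat M v \<phi>' = sat M (v \<circ> (\<lambda>i. 2 * i)) \<phi>"
    using ren_fm[OF 1(1), of "\<lambda>i. 2 * i"] by blast
  obtain \<psi>' where 4: "wf_fm L \<psi>'"
    "\<forall>(M :: ('m, 'f, 'r) struct) v. sat M v \<psi>' = sat M (v \<circ> (\<lambda>i. 2 * i + 1)) \<psi>"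
    using ren_fm[OF 2(1), of "\<lambda>i. 2 * i + 1"] by blast
  have "gval (merge g h) v \<circ> (\<lambda>i. 2 * i) = gval g v"
    "gval (merge g h) v \<circ> (\<lambda>i. 2 * i + 1) = gval h v" for v
    by (auto simp: fun_eq_iff gval_def merge_def)
  moreover have "merge g h i \<in> gens A" for i using 1(2) 2(2) by (simp add: merge_def)
  ultimately show ?thesis
    unfolding defP_def using 1 2 3 4
    by (intro exI[of _ "FConj \<phi>' \<psi>'"] exI[of _ "merge g h"]) auto
qed

lemma defP_eq: "defP A (\<lambda>v. v i = v j)"
  using defP_fm[of "FEq (Var i) (Var j)" A] by simp

lemma defP_const: "defP A (\<lambda>v. b)"
proof -
  have "defP A (\<lambda>v. True)" using defP_eq[of A 0 0] by (simp only: refl)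
  from this defP_neg[OF this] show ?thesis by (cases b) (simp_all only: not_True_eq_False)
qed

lemma defP_disj: "defP A P \<Longrightarrow> defP A Q \<Longrightarrow> defP A (\<lambda>v. P v \<or> Q v)"
proof -
  assume "defP A P" "defP A Q"
  then have "defP A (\<lambda>v. \<not> (\<not> P v \<and> \<not> Q v))" by (intro defP_neg defP_conj)
  then show ?thesis by (simp only: de_Morgan_conj not_not)
qed

lemma defP_imp: "defP A P \<Longrightarrow> defP A Q \<Longrightarrow> defP A (\<lambda>v. P v \<longrightarrow> Q v)"
  unfolding imp_conv_disj by (intro defP_disj defP_neg)

lemma defP_iff: "defP A P \<Longrightarrow> defP A Q \<Longrightarrow> defP A (\<lambda>v. P v \<longleftrightarrow> Q v)"
  unfolding iff_conv_conj_imp by (intro defP_conj defP_imp)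

lemma defP_fin_ball:
  "finite S \<Longrightarrow> (\<And>i. i \<in> S \<Longrightarrow> defP A (P i)) \<Longrightarrow> defP A (\<lambda>v. \<forall>i \<in> S. P i v)"
  by (induction S rule: finite_induct) (auto intro: defP_const defP_conj)

lemma defP_ex:
  assumes "defP A (\<lambda>v. P (stail v) (v 0))"
  shows "defP A (\<lambda>v. \<exists>a \<in> dom M. P v a)"
proof -
  from assms obtain \<phi> g where g: "wf_fm L \<phi>" "\<forall>i. g i \<in> gens A"
    "\<forall>v \<in> Env. P (stail v) (v 0) \<longleftrightarrow> sat M (gval g v) \<phi>" unfolding defP_def by blast
  obtain y where y: "y \<notin> fv \<phi>" using ex_new_if_finite infinite_UNIV_nat finite_fv by metis
  \<comment> \<open>All variables interpreted by coordinate 0 are identified with the fresh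
    \<open>y\<close>, which is the one to be quantified. The other coordinates move down by one in
    \<open>h\<close>; its value at the identified variables is never read.\<close>
  define f where "f i = (if g i = Inr 0 then y else i)" for i
  define h where "h i = (case g i of Inl c \<Rightarrow> Inl c | Inr j \<Rightarrow> Inr (j - 1))" for i
  obtain \<psi> where p: "wf_fm L \<psi>"
    "\<forall>(M :: ('m, 'f, 'r) struct) v. sat M v \<psi> = sat M (v \<circ> f) \<phi>"
    using ren_fm[OF g(1), of f] by blast
  have "h i \<in> gens A" for i
    using g(2)[rule_format, of i] by (auto simp: h_def split: sum.splits)
  moreover have "(\<exists>a \<in> dom M. P v a) \<longleftrightarrow> sat M (gval h v) (FEx y \<psi>)" if v: "v \<in> Env" for v
  proof -
    have "sat M ((gval h v)(y := a) \<circ> f) \<phi> = sat M (gval g (scons a v)) \<phi>" for a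
    proof (rule sat_cong)
      fix x assume "x \<in> fv \<phi>"
      then have "x \<noteq> y" using y by auto
      then show "((gval h v)(y := a) \<circ> f) x = gval g (scons a v) x"
        by (auto simp: f_def gval_def h_def split: sum.splits nat.splits)
    qed
    moreover have "P v a \<longleftrightarrow> sat M (gval g (scons a v)) \<phi>" if "a \<in> dom M" for a
      using g(3)[rule_format, of "scons a v"] v that by simp
    ultimately show ?thesis using p(2) by auto
  qed
  ultimately show ?thesis
    unfolding defP_def using p(1) by (intro exI[of _ "FEx y \<psi>"] exI[of _ h]) auto
qed

lemma defP_all:
  assumes "defP A (\<lambda>v. P (stail v) (v 0))"
  shows "defP A (\<lambda>v. \<forall>a \<in> dom M. P v a)"
  using defP_neg[OF defP_ex[of A "\<lambda>v a. \<not> P v a"]] defP_neg[OF assms] by simp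

text \<open>A formula has finitely many free variables and reads no other coordinates. This is what
  reduces quantification over a whole assignment to finitely many quantifiers.\<close>

lemma defP_support:
  assumes "defP A P"
  shows "\<exists>K. \<forall>v \<in> Env. \<forall>w \<in> Env. (\<forall>i<K. v i = w i) \<longrightarrow> P v = P w"
proof -
  from assms obtain \<phi> g where g: "wf_fm L \<phi>" "\<forall>i. g i \<in> gens A"
    "\<forall>v \<in> Env. P v \<longleftrightarrow> sat M (gval g v) \<phi>" unfolding defP_def by blast
  define S where "S = (\<lambda>i. case g i of Inl c \<Rightarrow> 0 | Inr j \<Rightarrow> j) ` fv \<phi>"
  have "finite S" by (simp add: S_def finite_fv)
  then obtain K where K: "\<forall>i \<in> S. i < K" using finite_nat_set_iff_bounded by blast
  have "P v = P w" if "v \<in> Env" "w \<in> Env" "\<forall>i<K. v i = w i" for v w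
  proof -
    have "sat M (gval g v) \<phi> = sat M (gval g w) \<phi>"
    proof (rule sat_cong)
      fix x assume "x \<in> fv \<phi>"
      then have "(case g x of Inl c \<Rightarrow> 0 | Inr j \<Rightarrow> j) < K" using K by (auto simp: S_def)
      then show "gval g v x = gval g w x" using that(3) by (auto simp: gval_def split: sum.splits)
    qed
    then show ?thesis using g(3) that by simp
  qed
  then show ?thesis by blast
qed

lemma defP_exk:
  "defP A P \<Longrightarrow> defP A (\<lambda>v. \<exists>z \<in> Env. P (\<lambda>i. if i < k then z i else v (i - k)))"
proof (induction k)
  case 0
  then show ?case using Env_ne by (subst defP_cong[where Q = P]) auto
next
  case (Suc k)
  let ?Q = "\<lambda>v. \<exists>z \<in> Env. P (\<lambda>i. if i < k then z i else v (i - k))"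
  have "defP A (\<lambda>v. \<exists>a \<in> dom M. ?Q (scons a v))"
    using Suc by (intro defP_ex) (simp cong: if_cong)
  moreover have "(\<exists>a \<in> dom M. ?Q (scons a v)) \<longleftrightarrow>
    (\<exists>z \<in> Env. P (\<lambda>i. if i < Suc k then z i else v (i - Suc k)))" if "v \<in> Env" for v
  proof
    assume "\<exists>a \<in> dom M. ?Q (scons a v)"
    then obtain a z where a: "a \<in> dom M" "z \<in> Env"
      "P (\<lambda>i. if i < k then z i else scons a v (i - k))" by blast
    have "(\<lambda>i. if i < k then z i else scons a v (i - k)) =
      (\<lambda>i. if i < Suc k then (z(k := a)) i else v (i - Suc k))"
      by (rule append_scons)
    then show "\<exists>z \<in> Env. P (\<lambda>i. if i < Suc k then z i else v (i - Suc k))"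
      using a by (intro bexI[of _ "z(k := a)"]) auto
  next
    assume "\<exists>z \<in> Env. P (\<lambda>i. if i < Suc k then z i else v (i - Suc k))"
    then obtain z where z: "z \<in> Env" "P (\<lambda>i. if i < Suc k then z i else v (i - Suc k))" by blast
    have "(\<lambda>i. if i < k then z i else scons (z k) v (i - k)) =
      (\<lambda>i. if i < Suc k then z i else v (i - Suc k))"
      using append_scons[of k z "z k" v] by (simp only: fun_upd_triv)
    then show "\<exists>a \<in> dom M. ?Q (scons a v)"
      using z by (intro bexI[of _ "z k"] bexI[of _ z]) auto
  qed
  ultimately show ?case by (subst (asm) defP_cong)
qed

lemma defP_exs:
  assumes "defP A (\<lambda>u. P (odds u) (evens u))"
  shows "defP A (\<lambda>v. \<exists>z \<in> Env. P v z)"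
proof -
  let ?P = "\<lambda>u. P (odds u) (evens u)"
  obtain K where K: "\<forall>v \<in> Env. \<forall>w \<in> Env. (\<forall>i<K. v i = w i) \<longrightarrow> ?P v = ?P w"
    using defP_support[OF assms] by blast
  \<comment> \<open>\<open>?f\<close> passes from the interleaved form to a block of
    \<open>K\<close> quantified places followed by the free ones. An even place whose half is at
    least \<open>K\<close> is sent to a wrong coordinate, but it lies beyond the support.\<close>
  let ?f = "\<lambda>i. if even i then i div 2 else K + i div 2"
  have "defP A (\<lambda>v. \<exists>z \<in> Env. ?P (\<lambda>i. (\<lambda>i. if i < K then z i else v (i - K)) (?f i)))"
    using defP_exk[OF defP_ren[OF assms, of ?f], of K] .
  moreover have "?P (\<lambda>i. (\<lambda>i. if i < K then z i else v (i - K)) (?f i)) = P v z"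
    if "v \<in> Env" "z \<in> Env" for v z
  proof -
    have "?P (\<lambda>i. (\<lambda>i. if i < K then z i else v (i - K)) (?f i)) = ?P (merge z v)"
    proof (rule K[rule_format])
      show "(\<lambda>i. (\<lambda>i. if i < K then z i else v (i - K)) (?f i)) \<in> Env"
        using that unfolding Env_def by simp
    qed (use that in \<open>auto simp: merge_def\<close>)
    then show ?thesis by simp
  qed
  ultimately show ?thesis by (subst (asm) defP_cong) (simp_all cong: bex_cong)
qed

lemma defP_alls:
  assumes "defP A (\<lambda>u. P (odds u) (evens u))"
  shows "defP A (\<lambda>v. \<forall>z \<in> Env. P v z)"
  using defP_neg[OF defP_exs[of A "\<lambda>v z. \<not> P v z"]] defP_neg[OF assms] by simp

section \<open>Definable terms and substitution\<close>

lemma defT_dom: "defT A t \<Longrightarrow> v \<in> Env \<Longrightarrow> t v \<in> dom M"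
  by (simp add: defT_def)

lemma defT_cong: "(\<And>v. v \<in> Env \<Longrightarrow> t v = s v) \<Longrightarrow> defT A t = defT A s"
proof -
  assume *: "\<And>v. v \<in> Env \<Longrightarrow> t v = s v"
  have "defP A (\<lambda>v. v 0 = t (stail v)) = defP A (\<lambda>v. v 0 = s (stail v))"
    by (rule defP_cong) (simp only: *[OF Env_stail])
  moreover have "(\<forall>v \<in> Env. t v \<in> dom M) = (\<forall>v \<in> Env. s v \<in> dom M)"
    by (simp add: * cong: ball_cong)
  ultimately show ?thesis by (simp only: defT_def)
qed

lemma defT_mono: "defT A t \<Longrightarrow> A \<inter> dom M \<subseteq> B \<Longrightarrow> defT B t"
  unfolding defT_def using defP_mono by blast

text \<open>Infinitely many terms cannot be named in one formula. The substituted values are guessed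
  by an assignment \<open>z\<close> and tied to the terms by finitely many equations, up to the
  support \<open>K\<close> of \<open>P\<close>.\<close>

lemma defP_subst:
  assumes "defP A P" "\<And>i. defT A (\<sigma> i)"
  shows "defP A (\<lambda>v. P (\<lambda>i. \<sigma> i v))"
proof -
  obtain K where K: "\<forall>v \<in> Env. \<forall>w \<in> Env. (\<forall>i<K. v i = w i) \<longrightarrow> P v = P w"
    using defP_support[OF assms(1)] by blast
  have "defP A (\<lambda>u. (\<forall>i \<in> {..<K}. evens u i = \<sigma> i (odds u)) \<and> P (evens u))"
  proof (intro defP_conj defP_fin_ball)
    fix i
    have "defP A (\<lambda>v. v 0 = \<sigma> i (stail v))" using assms(2) by (simp add: defT_def)
    from defP_ren[OF this, of "case_nat (2 * i) (\<lambda>j. 2 * j + 1)"]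
    show "defP A (\<lambda>u. evens u i = \<sigma> i (odds u))"
      unfolding evens_def odds_def[abs_def] by (simp only: nat.case)
  next
    show "defP A (\<lambda>u. P (evens u))"
      using defP_ren[OF assms(1), of "\<lambda>i. 2 * i"] unfolding evens_def[abs_def] .
  qed simp
  from defP_exs[OF this]
  have "defP A (\<lambda>v. \<exists>z \<in> Env. (\<forall>i \<in> {..<K}. z i = \<sigma> i v) \<and> P z)" .
  moreover have "(\<exists>z \<in> Env. (\<forall>i \<in> {..<K}. z i = \<sigma> i v) \<and> P z) = P (\<lambda>i. \<sigma> i v)"
    if "v \<in> Env" for v
  proof -
    have *: "(\<lambda>i. \<sigma> i v) \<in> Env" using assms(2) that by (intro EnvI) (simp add: defT_def)
    show ?thesis
    proof
      assume "\<exists>z \<in> Env. (\<forall>i \<in> {..<K}. z i = \<sigma> i v) \<and> P z"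
      then obtain z where "z \<in> Env" "\<forall>i<K. z i = \<sigma> i v" "P z" by blast
      then show "P (\<lambda>i. \<sigma> i v)" using K[rule_format, of z "\<lambda>i. \<sigma> i v"] * by simp
    next
      assume "P (\<lambda>i. \<sigma> i v)"
      then show "\<exists>z \<in> Env. (\<forall>i \<in> {..<K}. z i = \<sigma> i v) \<and> P z"
        using * by (intro bexI[of _ "\<lambda>i. \<sigma> i v"]) simp_all
    qed
  qed
  ultimately show ?thesis by (subst (asm) defP_cong)
qed

lemma defT_var: "defT A (\<lambda>v. v i)"
  unfolding defT_def using defP_eq by auto

lemma defT_ren: "defT A t \<Longrightarrow> defT A (\<lambda>v. t (\<lambda>i. v (f i)))"
  unfolding defT_def
  using defP_ren[of A "\<lambda>v. v 0 = t (stail v)" "case_nat 0 (\<lambda>i. Suc (f i))"] Env_ren[of _ f] by auto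

lemma defT_subst:
  assumes "defT A t" "\<And>i. defT A (\<sigma> i)"
  shows "defT A (\<lambda>v. t (\<lambda>i. \<sigma> i v))"
proof -
  have "defP A (\<lambda>v. P (\<lambda>i. (case i of 0 \<Rightarrow> (\<lambda>v. v 0) | Suc i \<Rightarrow> (\<lambda>v. \<sigma> i (stail v))) v))"
    if "defP A P" for P
  proof (rule defP_subst[OF that])
    fix i show "defT A (case i of 0 \<Rightarrow> (\<lambda>v. v 0) | Suc i \<Rightarrow> (\<lambda>v. \<sigma> i (stail v)))"
      using defT_var defT_ren[OF assms(2)] by (auto split: nat.splits)
  qed
  from this[of "\<lambda>v. v 0 = t (stail v)"] have "defP A (\<lambda>v. v 0 = t (\<lambda>i. \<sigma> i (stail v)))"
    using assms(1) by (simp add: defT_def)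
  moreover have "(\<lambda>i. \<sigma> i v) \<in> Env" if "v \<in> Env" for v
    using assms(2) that by (intro EnvI) (simp add: defT_def)
  ultimately show ?thesis using assms(1) by (simp add: defT_def)
qed

lemma defP_app:
  assumes "defP A (\<lambda>u. P (stail u) (u 0))" "defT A t"
  shows "defP A (\<lambda>v. P v (t v))"
proof -
  have "defP A (\<lambda>v. \<exists>a \<in> dom M. a = t v \<and> P v a)"
    using assms by (intro defP_ex defP_conj) (auto simp: defT_def)
  then show ?thesis
    using defT_dom[OF assms(2)] by (subst (asm) defP_cong[where Q = "\<lambda>v. P v (t v)"]) auto
qed

lemma defP_eqT: "defT A s \<Longrightarrow> defT A t \<Longrightarrow> defP A (\<lambda>v. s v = t v)"
proof -
  assume s: "defT A s" and t: "defT A t"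
  show "defP A (\<lambda>v. s v = t v)"
    by (rule defP_app[OF _ s, of "\<lambda>v a. a = t v"]) (use t in \<open>simp add: defT_def\<close>)
qed

lemma defP_rel:
  assumes "length ts = rar L p" "\<And>t. t \<in> set ts \<Longrightarrow> defT A t"
  shows "defP A (\<lambda>v. rint M p (map (\<lambda>t. t v) ts))"
proof -
  define n where "n = length ts"
  have "defP A (\<lambda>v. rint M p (map v [0..<n]))"
    using defP_fm[of "FRel p (map Var [0..<n])" A] assms(1) by (simp add: n_def comp_def)
  from defP_subst[OF this, of "\<lambda>i. if i < n then ts ! i else (\<lambda>v. v 0)"]
  have "defP A (\<lambda>v. rint M p (map (\<lambda>i. (if i < n then ts ! i else (\<lambda>v. v 0)) v) [0..<n]))"
    using assms(2) defT_var by (simp add: n_def)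
  moreover have "map (\<lambda>i. (if i < n then ts ! i else (\<lambda>v. v 0)) v) [0..<n] = map (\<lambda>t. t v) ts" for v
    by (rule nth_equalityI) (auto simp: n_def)
  ultimately show ?thesis by simp
qed

lemma defT_fun:
  assumes "length ts = far L f" "\<And>t. t \<in> set ts \<Longrightarrow> defT A t"
  shows "defT A (\<lambda>v. fint M f (map (\<lambda>t. t v) ts))"
proof -
  define n where "n = length ts"
  have d: "fint M f xs \<in> dom M" if "length xs = n" "set xs \<subseteq> dom M" for xs
    using str that assms(1) by (auto simp: is_struct_def n_def)
  have "defP A (\<lambda>v. v 0 = fint M f (map v [Suc 0..<Suc n]))"
    using defP_fm[of "FEq (Var 0) (App f (map Var [Suc 0..<Suc n]))" A] assms(1)
    by (simp add: n_def comp_def)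
  moreover have "map (\<lambda>i. v (Suc i)) [0..<n] = map v [Suc 0..<Suc n]" for v :: "nat \<Rightarrow> 'm"
    by (rule nth_equalityI) (auto simp del: upt_Suc)
  ultimately have "defP A (\<lambda>v. v 0 = fint M f (map (stail v) [0..<n]))" by simp
  moreover have "fint M f (map v [0..<n]) \<in> dom M" if "v \<in> Env" for v
    using that by (intro d) auto
  ultimately have "defT A (\<lambda>v. fint M f (map v [0..<n]))"
    by (simp add: defT_def)
  from defT_subst[OF this, of "\<lambda>i. if i < n then ts ! i else (\<lambda>v. v 0)"]
  have "defT A (\<lambda>v. fint M f (map (\<lambda>i. (if i < n then ts ! i else (\<lambda>v. v 0)) v) [0..<n]))"
    using assms(2) defT_var by (simp add: n_def)
  moreover have "map (\<lambda>i. (if i < n then ts ! i else (\<lambda>v. v 0)) v) [0..<n] = map (\<lambda>t. t v) ts" for v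
    by (rule nth_equalityI) (auto simp: n_def)
  ultimately show ?thesis by simp
qed

lemma defT_param: "c \<in> A \<Longrightarrow> c \<in> dom M \<Longrightarrow> defT A (\<lambda>_. c)"
proof -
  assume "c \<in> A" "c \<in> dom M"
  then have "defP A (\<lambda>v. (gval (case_nat (Inr 0) (\<lambda>_. Inl c)) v) 0 = (gval (case_nat (Inr 0) (\<lambda>_. Inl c)) v) 1)"
    by (intro defP_gval[OF defP_eq]) (auto split: nat.splits)
  then show ?thesis using \<open>c \<in> dom M\<close> by (simp add: defT_def gval_def)
qed

section \<open>Definable closure and the handling of parameters\<close>

lemma dcl_iff: "x \<in> dcl A \<longleftrightarrow> x \<in> dom M \<and> defP A (\<lambda>v. v 0 = x)"
  using Env_ne by (auto simp: dcl_def defT_def)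

lemma defT_dcl: "x \<in> dcl A \<Longrightarrow> defT A (\<lambda>_. x)"
  by (simp add: dcl_def)

lemma dcl_dom: "x \<in> dcl A \<Longrightarrow> x \<in> dom M"
  by (simp add: dcl_def)

lemma dcl_mono: "A \<inter> dom M \<subseteq> B \<Longrightarrow> dcl A \<subseteq> dcl B"
  using defT_mono by (auto simp: dcl_def)

lemma dcl_base: "x \<in> A \<Longrightarrow> x \<in> dom M \<Longrightarrow> x \<in> dcl A"
  using defT_param by (auto simp: dcl_def)

text \<open>A parameter from \<open>dcl A\<close> is the value of a constant term over
  \<open>A\<close>, and substituting that term removes it.\<close>

lemma defP_dcl:
  assumes "defP C P" "C \<inter> dom M \<subseteq> dcl A"
  shows "defP A P"
proof -
  from assms(1) obtain \<phi> g where g: "wf_fm L \<phi>" "\<forall>i. g i \<in> gens C"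
    "\<forall>v \<in> Env. P v \<longleftrightarrow> sat M (gval g v) \<phi>" unfolding defP_def by blast
  have "defP A (\<lambda>v. sat M (\<lambda>i. (case g i of Inl c \<Rightarrow> (\<lambda>_. c) | Inr j \<Rightarrow> (\<lambda>v. v j)) v) \<phi>)"
  proof (rule defP_subst[OF defP_fm[OF g(1)]])
    fix i
    show "defT A (case g i of Inl c \<Rightarrow> (\<lambda>_. c) | Inr j \<Rightarrow> (\<lambda>v. v j))"
      using g(2)[rule_format, of i] assms(2) defT_dcl defT_var by (auto split: sum.splits)
  qed
  moreover have "(\<lambda>i. (case g i of Inl c \<Rightarrow> (\<lambda>_. c) | Inr j \<Rightarrow> (\<lambda>v. v j)) v) = gval g v" for v
    by (auto simp: gval_def fun_eq_iff split: sum.splits)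
  ultimately show ?thesis using g(3) by (subst defP_cong) auto
qed

lemma defT_dcl_trans: "defT C t \<Longrightarrow> C \<inter> dom M \<subseteq> dcl A \<Longrightarrow> defT A t"
  unfolding defT_def using defP_dcl by blast

lemma dcl_trans: "C \<inter> dom M \<subseteq> dcl A \<Longrightarrow> dcl C \<subseteq> dcl A"
  using defT_dcl_trans by (auto simp: dcl_def)

lemma dcl_app: "defT A t \<Longrightarrow> (\<And>i. v i \<in> dcl A) \<Longrightarrow> t v \<in> dcl A"
  using defT_subst[of A t "\<lambda>i _. v i"] defT_dom[of A t v] EnvI[of v]
  by (simp add: dcl_def)

text \<open>The parameters from \<open>C\<close> are turned into coordinates at even places, which
  leaves a predicate over \<open>A\<close>. The places that carry no parameter need some filler
  \<open>c0\<close>, hence the condition on \<open>C\<close>.\<close>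

lemma defP_params:
  assumes "defP (A \<union> C) P" "C \<inter> dom M \<noteq> {}"
  shows "\<exists>Q s. defP A Q \<and> (\<forall>i. s i \<in> C \<inter> dom M) \<and> (\<forall>v \<in> Env. P v = Q (merge s v))"
proof -
  from assms(2) obtain c0 where c0: "c0 \<in> C \<inter> dom M" by blast
  from assms(1) obtain \<phi> g where g: "wf_fm L \<phi>" "\<forall>i. g i \<in> gens (A \<union> C)"
    "\<forall>v \<in> Env. P v \<longleftrightarrow> sat M (gval g v) \<phi>" unfolding defP_def by blast
  define h where "h i = (case g i of Inl c \<Rightarrow> if c \<in> C then Inr (2 * i) else Inl c
    | Inr j \<Rightarrow> Inr (2 * j + 1))" for i
  define s where "s i = (case g i of Inl c \<Rightarrow> if c \<in> C then c else c0 | Inr j \<Rightarrow> c0)" for i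
  have h: "h i \<in> gens A" for i
    using g(2)[rule_format, of i] by (auto simp: h_def split: sum.splits)
  have "defP A (\<lambda>v. sat M (gval h v) \<phi>)"
    by (rule defP_gval[OF defP_fm[OF g(1)] h])
  moreover have "s i \<in> C \<inter> dom M" for i
    using g(2)[rule_format, of i] c0 by (auto simp: s_def split: sum.splits)
  moreover have "gval h (merge s v) = gval g v" for v
    by (auto simp: gval_def h_def s_def merge_def fun_eq_iff split: sum.splits)
  ultimately show ?thesis using g(3)
    by (intro exI[of _ "\<lambda>v. sat M (gval h v) \<phi>"] exI[of _ s]) auto
qed

lemma defP_finite_params: "defP A P \<Longrightarrow> \<exists>B. finite B \<and> B \<subseteq> A \<and> defP B P"
proof -
  assume "defP A P"
  then obtain \<phi> g where g: "wf_fm L \<phi>" "\<forall>i. g i \<in> gens A"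
    "\<forall>v \<in> Env. P v \<longleftrightarrow> sat M (gval g v) \<phi>" unfolding defP_def by blast
  define B where "B = {c. Inl c \<in> g ` fv \<phi>}"
  have "finite B" unfolding B_def
    using finite_vimageI[of "g ` fv \<phi>" Inl] by (simp add: finite_fv vimage_def)
  moreover have "B \<subseteq> A" unfolding B_def using g(2) by (metis (no_types, lifting) gens_Inl imageE mem_Collect_eq subsetI)
  moreover have "defP B P"
  proof -
    define h where "h i = (if i \<in> fv \<phi> then g i else Inr 0)" for i
    have "sat M (gval g v) \<phi> = sat M (gval h v) \<phi>" for v
      by (rule sat_cong) (simp add: gval_def h_def)
    moreover have "h i \<in> gens B" for i
    proof (cases "i \<in> fv \<phi>")
      case True
      then show ?thesis using g(2)[rule_format, of i]
        by (cases "g i") (auto simp: h_def B_def image_iff, metis)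
    qed (simp add: h_def)
    ultimately show ?thesis unfolding defP_def using g(1,3) by blast
  qed
  ultimately show ?thesis by blast
qed

lemma dcl_finite: "x \<in> dcl A \<Longrightarrow> \<exists>B. finite B \<and> B \<subseteq> A \<and> x \<in> dcl B"
  unfolding dcl_iff using defP_finite_params by blast

text \<open>A definite description operator: the term returns the unique solution wherever there is
  exactly one. Elsewhere it returns coordinate 0, which keeps it total, definable and inside the
  universe.\<close>

lemma defT_theE:
  assumes Q: "defP A (\<lambda>u. Q (stail u) (u 0))"
  obtains F where "defT A F"
    "\<And>v x. x \<in> dom M \<Longrightarrow> Q v x \<Longrightarrow> (\<And>y. y \<in> dom M \<Longrightarrow> Q v y \<Longrightarrow> y = x) \<Longrightarrow> F v = x"
proof -
  define E where "E v \<longleftrightarrow> (\<exists>y \<in> dom M. Q v y \<and> (\<forall>y' \<in> dom M. Q v y' \<longrightarrow> y' = y))" for v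
  define F where "F v = (if E v then (SOME y. y \<in> dom M \<and> Q v y) else v 0)" for v
  have F: "F v \<in> dom M \<and> Q v (F v)" if E: "E v" for v
  proof -
    have "\<exists>y. y \<in> dom M \<and> Q v y" using E unfolding E_def by blast
    from someI_ex[OF this] show ?thesis unfolding F_def if_P[OF E] .
  qed
  have uniq: "F v = x" if "x \<in> dom M" "Q v x" "\<And>y. y \<in> dom M \<Longrightarrow> Q v y \<Longrightarrow> y = x" for v x
  proof -
    have "E v" using that unfolding E_def by blast
    then show ?thesis using F[of v] that by blast
  qed
  have 1: "defP A (\<lambda>v. Q (\<lambda>i. v (Suc (Suc i))) (v 0))"
    using defP_ren[OF Q, of "case_nat 0 (\<lambda>i. Suc (Suc i))"] by (simp only: nat.case)
  have 2: "defP A (\<lambda>v. Q (\<lambda>i. v (Suc (Suc (Suc i)))) (v 0))"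
    using defP_ren[OF Q, of "case_nat 0 (\<lambda>i. Suc (Suc (Suc i)))"] by (simp only: nat.case)
  have E: "defP A (\<lambda>u. E (stail u))"
    unfolding E_def by (rule defP_ex, rule defP_conj[OF 1], rule defP_all, rule defP_imp[OF 2 defP_eq])
  have "defP A (\<lambda>u. (E (stail u) \<longrightarrow> Q (stail u) (u 0)) \<and> (\<not> E (stail u) \<longrightarrow> u 0 = u 1))"
    by (rule defP_conj[OF defP_imp[OF E Q] defP_imp[OF defP_neg[OF E] defP_eq]])
  moreover have "((E (stail u) \<longrightarrow> Q (stail u) (u 0)) \<and> (\<not> E (stail u) \<longrightarrow> u 0 = u 1)) =
    (u 0 = F (stail u))" if u: "u \<in> Env" for u
  proof (cases "E (stail u)")
    case True
    have "Q (stail u) (u 0) = (u 0 = F (stail u))"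
    proof
      assume "Q (stail u) (u 0)"
      moreover obtain x where "\<forall>y \<in> dom M. Q (stail u) y \<longrightarrow> y = x" using True unfolding E_def by blast
      ultimately show "u 0 = F (stail u)" using F[OF True] EnvD[OF u, of 0] by metis
    qed (use F[OF True] in simp)
    then show ?thesis using True by simp
  next
    case False
    then show ?thesis by (simp add: F_def)
  qed
  ultimately have "defP A (\<lambda>u. u 0 = F (stail u))" by (subst (asm) defP_cong)
  moreover have "F v \<in> dom M" if "v \<in> Env" for v
    using F[of v] that by (cases "E v") (simp_all add: F_def)
  ultimately have "defT A F" unfolding defT_def by blast
  then show ?thesis using that uniq by blast
qed

text \<open>The parameters from \<open>range w\<close> in a definition of \<open>x\<close> are read
  as variables. The resulting relation has a unique solution at \<open>w\<close>, though perhaps not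
  at other arguments, and the description operator makes it a term.\<close>

lemma dcl_function:
  assumes "x \<in> dcl (A \<union> range w)" "w \<in> Env"
  shows "\<exists>F. defT A F \<and> F w = x"
proof -
  have x: "x \<in> dom M" "defP (A \<union> range w) (\<lambda>v. v 0 = x)"
    using assms(1) by (simp_all add: dcl_iff)
  have "w 0 \<in> range w \<inter> dom M" using assms(2) by simp
  then have "range w \<inter> dom M \<noteq> {}" by blast
  from defP_params[OF x(2) this] obtain Q s where Q: "defP A Q" "\<forall>i. s i \<in> range w \<inter> dom M"
    "\<forall>v \<in> Env. (v 0 = x) = Q (merge s v)" by blast
  have "\<forall>i. \<exists>j. s i = w j" using Q(2) by blast
  then obtain f where f: "\<forall>i. s i = w (f i)" by metis
  define R where "R u y = Q (merge (\<lambda>i. u (f i)) (\<lambda>_. y))" for u y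
  have "(\<lambda>i. u (if even i then Suc (f (i div 2)) else 0)) = merge (\<lambda>i. stail u (f i)) (\<lambda>_. u 0)"
    for u :: "nat \<Rightarrow> 'm" by (rule ext) (simp add: merge_def)
  then have "defP A (\<lambda>u. R (stail u) (u 0))"
    using defP_ren[OF Q(1), of "\<lambda>i. if even i then Suc (f (i div 2)) else 0"]
    unfolding R_def by (simp only:)
  from defT_theE[OF this] obtain F where F: "defT A F"
    "\<And>v x. x \<in> dom M \<Longrightarrow> R v x \<Longrightarrow> (\<And>y. y \<in> dom M \<Longrightarrow> R v y \<Longrightarrow> y = x) \<Longrightarrow> F v = x"
    by blast
  have "s = (\<lambda>i. w (f i))" using f by (intro ext) simp
  then have R: "R w y \<longleftrightarrow> y = x" if "y \<in> dom M" for y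
    using Q(3)[rule_format, of "\<lambda>_. y"] that by (simp add: R_def)
  have "F w = x"
    by (rule F(2)[OF x(1)]) (simp_all add: R x(1))
  then show ?thesis using F(1) by (intro exI conjI)
qed

text \<open>\<open>El H\<close>: the relation \<open>H\<close> is a partial elementary map.\<close>

definition El :: "('m \<times> 'm) set \<Rightarrow> bool" where
  "El H \<longleftrightarrow> H \<subseteq> dom M \<times> dom M \<and>
     (\<forall>Q a b. defP {} Q \<longrightarrow> (\<forall>i. (a i, b i) \<in> H) \<longrightarrow> Q a \<longrightarrow> Q b)"

end

section \<open>Generic points in o-minimal structures\<close>

text \<open>\<open>breakpoints\<close> is o-minimality stated without a list of intervals: truth
  agrees at the ends of every closed interval that misses a finite set. Saturation concerns one
  variable and countable parameter sets. Field operations enter later, as the theory of independent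
  points rests on the order.\<close>

locale o_minimal_structure = first_order_structure L M
  for L :: "('f, 'r, 'z) lang_scheme" and M :: "('m, 'f, 'r) struct" +
  fixes lt :: "'m \<Rightarrow> 'm \<Rightarrow> bool" (infix "\<sqsubset>" 50)
  assumes lt_dom: "x \<sqsubset> y \<Longrightarrow> x \<in> dom M \<and> y \<in> dom M"
    and lt_irrefl: "\<not> x \<sqsubset> x"
    and lt_trans: "x \<sqsubset> y \<Longrightarrow> y \<sqsubset> z \<Longrightarrow> x \<sqsubset> z"
    and lt_total: "x \<in> dom M \<Longrightarrow> y \<in> dom M \<Longrightarrow> x \<sqsubset> y \<or> x = y \<or> y \<sqsubset> x"
    and lt_dense: "x \<sqsubset> y \<Longrightarrow> \<exists>z. x \<sqsubset> z \<and> z \<sqsubset> y"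
    and lt_above: "x \<in> dom M \<Longrightarrow> \<exists>y. x \<sqsubset> y"
    and lt_below: "x \<in> dom M \<Longrightarrow> \<exists>y. y \<sqsubset> x"
    and lt_def: "defP {} (\<lambda>v. v 0 \<sqsubset> v 1)"
    and breakpoints: "defP (dom M) (\<lambda>v. P (v 0)) \<Longrightarrow> \<exists>B. finite B \<and> B \<subseteq> dom M \<and>
      (\<forall>x y. x \<sqsubset> y \<longrightarrow> (\<forall>b \<in> B. b \<sqsubset> x \<or> y \<sqsubset> b) \<longrightarrow> P x = P y)"
    and saturation: "countable A \<Longrightarrow> (\<And>P. P \<in> \<P> \<Longrightarrow> defP A (\<lambda>v. P (v 0))) \<Longrightarrow>
      (\<And>F. finite F \<Longrightarrow> F \<subseteq> \<P> \<Longrightarrow> \<exists>x \<in> dom M. \<forall>P \<in> F. P x) \<Longrightarrow>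
      \<exists>x \<in> dom M. \<forall>P \<in> \<P>. P x"
begin

section \<open>Breakpoints of definable sets on the line\<close>

lemma defP_lt:
  assumes "defT A s" "defT A t"
  shows "defP A (\<lambda>v. s v \<sqsubset> t v)"
proof -
  have "defP A (\<lambda>v. v 0 \<sqsubset> v 1)" by (rule defP_mono[OF lt_def]) simp
  then have "defP A (\<lambda>v. (case 0 of 0 \<Rightarrow> s | Suc _ \<Rightarrow> t) v \<sqsubset> (case 1 of 0 \<Rightarrow> s | Suc _ \<Rightarrow> t) v)"
    by (rule defP_subst[where \<sigma> = "\<lambda>i. case i of 0 \<Rightarrow> s | Suc _ \<Rightarrow> t"])
      (use assms in \<open>simp split: nat.split\<close>)
  then show ?thesis by simp
qed

text \<open>In a linear order the elements of a finite definable set can be named: \<open>x\<close>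
  is either the minimum or has some \<open>z\<close> of the set below it, which is definable by
  induction on the number of smaller elements. Cutting the set down to the part above
  \<open>z\<close> lowers that number for \<open>x\<close>.\<close>

lemma finite_in_dcl:
  assumes "defP A (\<lambda>v. P (v 0))" "finite {y \<in> dom M. P y}" "x \<in> dom M" "P x"
  shows "x \<in> dcl A"
  using assms
proof (induction "card {z \<in> dom M. P z \<and> z \<sqsubset> x}" arbitrary: P x rule: less_induct)
  case less
  have fin: "finite {z \<in> dom M. P z \<and> z \<sqsubset> x}" for x
    by (rule finite_subset[OF _ less.prems(2)]) auto
  show ?case
  proof (cases "\<exists>z \<in> dom M. P z \<and> z \<sqsubset> x")
    case True
    then obtain z where z: "z \<in> dom M" "P z" "z \<sqsubset> x" by blast
    have "{y \<in> dom M. P y \<and> y \<sqsubset> z} \<subset> {y \<in> dom M. P y \<and> y \<sqsubset> x}"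
      using z lt_trans[OF _ z(3)] lt_irrefl by blast
    then have "card {y \<in> dom M. P y \<and> y \<sqsubset> z} < card {y \<in> dom M. P y \<and> y \<sqsubset> x}"
      by (rule psubset_card_mono[OF fin])
    then have zd: "z \<in> dcl A" using less.hyps[where P = P and x = z] less.prems(1,2) z by blast
    let ?P = "\<lambda>y. P y \<and> z \<sqsubset> y"
    have "{y \<in> dom M. ?P y \<and> y \<sqsubset> x} \<subset> {y \<in> dom M. P y \<and> y \<sqsubset> x}"
      using z lt_irrefl by blast
    then have "card {y \<in> dom M. ?P y \<and> y \<sqsubset> x} < card {y \<in> dom M. P y \<and> y \<sqsubset> x}"
      by (rule psubset_card_mono[OF fin])
    moreover have "defP A (\<lambda>v. ?P (v 0))"
      by (rule defP_conj[OF less.prems(1) defP_lt[OF defT_dcl[OF zd] defT_var]])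
    moreover have "finite {y \<in> dom M. ?P y}"
      by (rule finite_subset[OF _ less.prems(2)]) auto
    ultimately show ?thesis using less.hyps[where P = ?P and x = x] less.prems z by blast
  next
    case False
    have "defP A (\<lambda>v. P (v 0) \<and> \<not> (\<exists>z \<in> dom M. P z \<and> z \<sqsubset> v 0))"
      by (intro defP_ex defP_conj defP_neg less.prems(1) defP_lt defT_var)
    moreover have "(P (v 0) \<and> \<not> (\<exists>z \<in> dom M. P z \<and> z \<sqsubset> v 0)) = (v 0 = x)" if "v \<in> Env" for v
      using False less.prems(3,4) lt_total[of "v 0" x] EnvD[OF that, of 0] by metis
    ultimately have "defP A (\<lambda>v. v 0 = x)" by (subst (asm) defP_cong)
    then show ?thesis using less.prems by (simp add: dcl_iff)
  qed
qed

lemma lt_max: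
  assumes "a \<sqsubset> x" "b \<sqsubset> x"
  shows "\<exists>c. a \<sqsubset> c \<and> b \<sqsubset> c \<and> c \<sqsubset> x"
proof -
  obtain c d where c: "a \<sqsubset> c" "c \<sqsubset> x" and d: "b \<sqsubset> d" "d \<sqsubset> x" using assms lt_dense by blast
  consider "c \<sqsubset> d" | "c = d" | "d \<sqsubset> c" using lt_total[of c d] c d lt_dom by blast
  then show ?thesis
  proof cases
    case 1
    then show ?thesis using d lt_trans[OF c(1) 1] by (intro exI[of _ d]) simp
  next
    case 2
    then show ?thesis using c d by (intro exI[of _ d]) simp
  next
    case 3
    then show ?thesis using c lt_trans[OF d(1) 3] by (intro exI[of _ c]) simp
  qed
qed

lemma lt_min:
  assumes "x \<sqsubset> a" "x \<sqsubset> b"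
  shows "\<exists>c. c \<sqsubset> a \<and> c \<sqsubset> b \<and> x \<sqsubset> c"
proof -
  obtain c d where c: "x \<sqsubset> c" "c \<sqsubset> a" and d: "x \<sqsubset> d" "d \<sqsubset> b" using assms lt_dense by blast
  consider "c \<sqsubset> d" | "c = d" | "d \<sqsubset> c" using lt_total[of c d] c d lt_dom by blast
  then show ?thesis
  proof cases
    case 1
    then show ?thesis using c lt_trans[OF 1 d(2)] by (intro exI[of _ c]) simp
  next
    case 2
    then show ?thesis using c d by (intro exI[of _ d]) simp
  next
    case 3
    then show ?thesis using d lt_trans[OF 3 c(2)] by (intro exI[of _ d]) simp
  qed
qed

lemma gap:
  assumes "finite B" "B \<subseteq> dom M" "x \<in> dom M" "x \<notin> B"
  shows "\<exists>p q. p \<sqsubset> x \<and> x \<sqsubset> q \<and> (\<forall>b \<in> B. b \<sqsubset> p \<or> q \<sqsubset> b)"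
  using assms
proof (induction B rule: finite_induct)
  case empty
  then show ?case using lt_above lt_below by blast
next
  case (insert c B)
  then obtain p q where pq: "p \<sqsubset> x" "x \<sqsubset> q" "\<forall>b \<in> B. b \<sqsubset> p \<or> q \<sqsubset> b" by auto
  from insert.prems have "c \<sqsubset> x \<or> x \<sqsubset> c" using lt_total[of c x] by auto
  then show ?case
  proof
    assume "c \<sqsubset> x"
    from lt_max[OF pq(1) this] obtain s where s: "p \<sqsubset> s" "c \<sqsubset> s" "s \<sqsubset> x" by blast
    then show ?thesis using pq lt_trans[OF _ s(1)] by (intro exI[of _ s] exI[of _ q]) auto
  next
    assume "x \<sqsubset> c"
    from lt_min[OF pq(2) this] obtain s where s: "s \<sqsubset> q" "s \<sqsubset> c" "x \<sqsubset> s" by blast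
    then show ?thesis using pq lt_trans[OF s(1)] by (intro exI[of _ p] exI[of _ s]) auto
  qed
qed

lemma interval_avoid:
  "finite S \<Longrightarrow> p \<sqsubset> q \<Longrightarrow> \<exists>x. p \<sqsubset> x \<and> x \<sqsubset> q \<and> x \<notin> S"
proof (induction S arbitrary: p q rule: finite_induct)
  case empty
  then show ?case using lt_dense by blast
next
  case (insert c S)
  obtain m where m: "p \<sqsubset> m" "m \<sqsubset> q" using lt_dense insert.prems by blast
  show ?case
  proof (cases "m \<sqsubset> c")
    case True
    obtain x where "p \<sqsubset> x" "x \<sqsubset> m" "x \<notin> S" using insert.IH[OF m(1)] by blast
    then show ?thesis using lt_trans[OF _ m(2)] lt_trans[OF _ True] lt_irrefl by (intro exI[of _ x]) auto
  next
    case False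
    obtain x where "m \<sqsubset> x" "x \<sqsubset> q" "x \<notin> S" using insert.IH[OF m(2)] by blast
    then show ?thesis using False lt_trans[OF m(1)] by (intro exI[of _ x]) auto
  qed
qed

text \<open>For a predicate, the points where this fails are the boundary points of the set that it
  defines.\<close>

definition const_near :: "('m \<Rightarrow> 'a) \<Rightarrow> 'm \<Rightarrow> bool" where
  "const_near f x \<longleftrightarrow> (\<exists>p q. p \<sqsubset> x \<and> x \<sqsubset> q \<and> (\<forall>z. p \<sqsubset> z \<longrightarrow> z \<sqsubset> q \<longrightarrow> f z = f x))"

lemma const_near_iff: "const_near f x \<longleftrightarrow> (\<exists>p \<in> dom M. \<exists>q \<in> dom M. p \<sqsubset> x \<and> x \<sqsubset> q \<and>
    (\<forall>z \<in> dom M. p \<sqsubset> z \<longrightarrow> z \<sqsubset> q \<longrightarrow> f z = f x))"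
  unfolding const_near_def using lt_dom by meson

lemma breakpoints_in_dcl:
  assumes P: "defP A (\<lambda>v. P (v 0))"
  shows "\<exists>B. finite B \<and> B \<subseteq> dcl A \<and> (\<forall>b \<in> B. \<not> const_near P b) \<and>
    (\<forall>x y. x \<sqsubset> y \<longrightarrow> (\<forall>b \<in> B. b \<sqsubset> x \<or> y \<sqsubset> b) \<longrightarrow> P x = P y)"
proof -
  define good where "good B \<longleftrightarrow> finite B \<and> B \<subseteq> dom M \<and>
    (\<forall>x y. x \<sqsubset> y \<longrightarrow> (\<forall>b \<in> B. b \<sqsubset> x \<or> y \<sqsubset> b) \<longrightarrow> P x = P y)" for B
  have "defP (dom M) (\<lambda>v. P (v 0))" using P by (rule defP_mono) simp
  from breakpoints[OF this] obtain B0 where "good B0" unfolding good_def by blast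
  then obtain B where B: "good B" "\<And>B'. good B' \<Longrightarrow> card B \<le> card B'"
    using ex_has_least_nat[of good B0 card] by blast
  have fin: "finite B" and Bd: "B \<subseteq> dom M" using B(1) by (auto simp: good_def)
  have Bc: "P x = P y" if "x \<sqsubset> y" "\<forall>b \<in> B. b \<sqsubset> x \<or> y \<sqsubset> b" for x y
    using B(1) that unfolding good_def by blast
  have 1: "\<not> const_near P b" if b: "b \<in> B" for b
  proof
    assume "const_near P b"
    then obtain p q where pq: "p \<sqsubset> b" "b \<sqsubset> q" "\<And>z. p \<sqsubset> z \<Longrightarrow> z \<sqsubset> q \<Longrightarrow> P z = P b"
      unfolding const_near_def by blast
    \<comment> \<open>The point \<open>s\<close> lies so close to \<open>b\<close> that
      \<open>P s = P b\<close>, while the interval from \<open>x\<close> to \<open>s\<close> misses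
      all of \<open>B\<close>.\<close>
    have left: "P x = P b" if x: "x \<sqsubset> b" "\<forall>c \<in> B - {b}. c \<sqsubset> x \<or> b \<sqsubset> c" for x
    proof -
      obtain s where s: "p \<sqsubset> s" "x \<sqsubset> s" "s \<sqsubset> b" using lt_max[OF pq(1) x(1)] by blast
      have "\<forall>c \<in> B. c \<sqsubset> x \<or> s \<sqsubset> c" using x(2) s(3) lt_trans[OF s(3)] by blast
      then have "P x = P s" using Bc s(2) by blast
      also have "P s = P b" by (rule pq(3)[OF s(1) lt_trans[OF s(3) pq(2)]])
      finally show ?thesis .
    qed
    have right: "P x = P b" if x: "b \<sqsubset> x" "\<forall>c \<in> B - {b}. c \<sqsubset> b \<or> x \<sqsubset> c" for x
    proof -
      obtain s where s: "s \<sqsubset> q" "s \<sqsubset> x" "b \<sqsubset> s" using lt_min[OF pq(2) x(1)] by blast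
      have "\<forall>c \<in> B. c \<sqsubset> s \<or> x \<sqsubset> c" using x(2) s(3) lt_trans[OF _ s(3)] by blast
      then have "P s = P x" using Bc s(2) by blast
      moreover have "P s = P b" by (rule pq(3)[OF lt_trans[OF pq(1) s(3)] s(1)])
      ultimately show ?thesis by simp
    qed
    have "P x = P y" if xy: "x \<sqsubset> y" "\<forall>c \<in> B - {b}. c \<sqsubset> x \<or> y \<sqsubset> c" for x y
    proof -
      have d: "x \<in> dom M" "y \<in> dom M" "b \<in> dom M" using xy(1) b Bd lt_dom by auto
      consider "b \<sqsubset> x \<or> y \<sqsubset> b" | "x = b" | "y = b" | "x \<sqsubset> b" "b \<sqsubset> y"
        using lt_total[OF d(1,3)] lt_total[OF d(2,3)] by blast
      then show ?thesis
      proof cases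
        case 1
        then show ?thesis using Bc[OF xy(1)] xy(2) by blast
      next
        case 2
        then show ?thesis using right[of y] xy by simp
      next
        case 3
        then show ?thesis using left[of x] xy by simp
      next
        case 4
        have "P x = P b" using left[of x] xy(2) 4(1) lt_trans[OF 4(2)] by blast
        moreover have "P y = P b" using right[of y] xy(2) 4(2) lt_trans[OF _ 4(1)] by blast
        ultimately show ?thesis by simp
      qed
    qed
    then have "good (B - {b})" using fin Bd by (auto simp: good_def)
    from B(2)[OF this] show False using b fin by (meson card_Diff1_less leD)
  qed
  \<comment> \<open>Conversely every boundary point belongs to \<open>B\<close>, so the boundary is
    finite.\<close>
  have "b \<in> B" if b: "b \<in> dom M" "\<not> const_near P b" for b
  proof (rule ccontr)
    assume "b \<notin> B"
    from gap[OF fin Bd b(1) this] obtain p q where pq: "p \<sqsubset> b" "b \<sqsubset> q"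
      "\<forall>c \<in> B. c \<sqsubset> p \<or> q \<sqsubset> c" by blast
    have "P z = P b" if z: "p \<sqsubset> z" "z \<sqsubset> q" for z
    proof -
      consider "z \<sqsubset> b" | "z = b" | "b \<sqsubset> z" using lt_total[of z b] b(1) lt_dom z(1) by blast
      then show ?thesis
      proof cases
        case 1
        have "\<forall>c \<in> B. c \<sqsubset> z \<or> b \<sqsubset> c" using pq(3) lt_trans[OF _ z(1)] lt_trans[OF pq(2)] by blast
        then show ?thesis using Bc[OF 1] by blast
      next
        case 3
        have "\<forall>c \<in> B. c \<sqsubset> b \<or> z \<sqsubset> c" using pq(3) lt_trans[OF _ pq(1)] lt_trans[OF z(2)] by blast
        then show ?thesis using Bc[OF 3] by blast
      qed simp
    qed
    then show False using b(2) pq(1,2) unfolding const_near_def by blast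
  qed
  then have "finite {b \<in> dom M. \<not> const_near P b}" using fin by (auto intro: finite_subset)
  moreover have "defP A (\<lambda>v. \<not> const_near P (v 0))"
  proof -
    have "defP A (\<lambda>v. P (v i))" for i using defP_ren[OF P, of "\<lambda>_. i"] .
    then show ?thesis
      unfolding const_near_iff
      by (intro defP_neg defP_ex defP_conj defP_all defP_imp defP_iff defP_lt defT_var)
  qed
  ultimately have "b \<in> dcl A" if "b \<in> B" for b
    using finite_in_dcl[of A "\<lambda>b. \<not> const_near P b" b] 1[OF that] Bd that by blast
  then have "B \<subseteq> dcl A" by blast
  then show ?thesis using fin 1 Bc by blast
qed

text \<open>Definable connectedness of intervals: a breakpoint met on the way from \<open>x\<close>
  to \<open>y\<close> would be a boundary point.\<close>

lemma const_near_connected: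
  assumes "defP A (\<lambda>v. P (v 0))" "x \<sqsubset> y"
    "\<And>b. b \<in> dom M \<Longrightarrow> \<not> b \<sqsubset> x \<Longrightarrow> \<not> y \<sqsubset> b \<Longrightarrow> const_near P b"
  shows "P x = P y"
  using breakpoints_in_dcl[OF assms(1)] assms(2,3) dcl_dom by (metis subset_iff)

text \<open>All breakpoints lie in \<open>dcl A\<close>, so a point outside \<open>dcl A\<close>
  sits in a gap between them. This is the one-variable source of all later persistence on
  boxes.\<close>

lemma const_near_generic:
  assumes "defP A (\<lambda>v. P (v 0))" "x \<in> dom M" "x \<notin> dcl A"
  shows "const_near P x"
proof (rule ccontr)
  assume *: "\<not> const_near P x"
  obtain B where B: "finite B" "B \<subseteq> dcl A" "\<forall>x y. x \<sqsubset> y \<longrightarrow> (\<forall>b \<in> B. b \<sqsubset> x \<or> y \<sqsubset> b) \<longrightarrow> P x = P y"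
    using breakpoints_in_dcl[OF assms(1)] by blast
  have "B \<subseteq> dom M" "x \<notin> B" using B(2) assms(3) dcl_dom by auto
  from gap[OF B(1) this(1) assms(2) this(2)] obtain p q where pq: "p \<sqsubset> x" "x \<sqsubset> q"
    "\<forall>c \<in> B. c \<sqsubset> p \<or> q \<sqsubset> c" by blast
  have "P z = P x" if z: "p \<sqsubset> z" "z \<sqsubset> q" for z
  proof -
    consider "z \<sqsubset> x" | "z = x" | "x \<sqsubset> z" using lt_total[of z x] assms(2) lt_dom z(1) by blast
    then show ?thesis
    proof cases
      case 1
      have "\<forall>c \<in> B. c \<sqsubset> z \<or> x \<sqsubset> c" using pq(3) lt_trans[OF _ z(1)] lt_trans[OF pq(2)] by blast
      then show ?thesis using B(3) 1 by blast
    next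
      case 3
      have "\<forall>c \<in> B. c \<sqsubset> x \<or> z \<sqsubset> c" using pq(3) lt_trans[OF _ pq(1)] lt_trans[OF z(2)] by blast
      then show ?thesis using B(3) 3 by blast
    qed simp
  qed
  then show False using * pq(1,2) unfolding const_near_def by blast
qed

text \<open>Saturation applies because finitely many finite sets cannot cover an interval of a dense
  order. Avoiding every finite set definable over \<open>A\<close> avoids \<open>dcl A\<close>, as
  the singletons of its elements are among these sets.\<close>

lemma generic_in_interval:
  assumes "countable A" "p \<sqsubset> q"
  shows "\<exists>x. p \<sqsubset> x \<and> x \<sqsubset> q \<and> x \<notin> dcl A"
proof -
  let ?F = "{Q. defP A (\<lambda>v. Q (v 0)) \<and> finite {y \<in> dom M. Q y}}"
  let ?N = "\<lambda>Q x. \<not> Q x :: bool"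
  let ?I = "\<lambda>x. p \<sqsubset> x \<and> x \<sqsubset> q"
  let ?P = "insert ?I (?N ` ?F)"
  have "\<exists>x \<in> dom M. \<forall>P \<in> ?P. P x"
  proof (rule saturation)
    show "countable (insert p (insert q A))" using assms(1) by simp
  next
    fix P assume P: "P \<in> ?P"
    have "defP (insert p (insert q A)) (\<lambda>v. p \<sqsubset> v 0 \<and> v 0 \<sqsubset> q)"
      using lt_dom[OF assms(2)] by (intro defP_conj defP_lt defT_var defT_param) simp_all
    moreover have "defP (insert p (insert q A)) (\<lambda>v. \<not> Q (v 0))" if "defP A (\<lambda>v. Q (v 0))" for Q
      using that by (intro defP_neg) (auto intro: defP_mono)
    ultimately show "defP (insert p (insert q A)) (\<lambda>v. P (v 0))" using P by blast
  next
    fix F assume F: "finite F" "F \<subseteq> ?P"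
    have "F - {?I} \<subseteq> ?N ` ?F" using F(2) by blast
    from finite_subset_image[OF _ this] F(1)
    obtain G where G: "finite G" "G \<subseteq> ?F" "F - {?I} = ?N ` G" by auto
    have "finite (\<Union>Q \<in> G. {y \<in> dom M. Q y})" using G(1,2) by blast
    from interval_avoid[OF this assms(2)] obtain x where x: "p \<sqsubset> x" "x \<sqsubset> q"
      "x \<notin> (\<Union>Q \<in> G. {y \<in> dom M. Q y})" by blast
    have xd: "x \<in> dom M" using x(1) lt_dom by blast
    have "P x" if "P \<in> F" for P
    proof (cases "P = ?I")
      case False
      then have "P \<in> ?N ` G" using that G(3) by blast
      then show ?thesis using x(3) xd by blast
    qed (use x in simp)
    then show "\<exists>x \<in> dom M. \<forall>P \<in> F. P x" using xd by blast
  qed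
  then obtain x where x: "x \<in> dom M" "\<forall>P \<in> ?P. P x" by blast
  have "x \<notin> dcl A"
  proof
    assume "x \<in> dcl A"
    then have "defP A (\<lambda>v. v 0 = x)" by (simp add: dcl_iff)
    then have "(\<lambda>y. y = x) \<in> ?F" by simp
    from x(2)[THEN bspec, OF insertI2[OF imageI[OF this]]] show False by simp
  qed
  moreover have "p \<sqsubset> x \<and> x \<sqsubset> q" using x(2) by simp
  ultimately show ?thesis by blast
qed

text \<open>If \<open>v = f w\<close> and \<open>w\<close> is not definable over \<open>v\<close>, then \<open>f\<close> takes the value \<open>v\<close> on an interval; but only
  finitely many values are taken on intervals, as \<open>f\<close> is constant on each component of the set of
  points near which it is constant. No monotonicity theorem is needed.\<close>

lemma dcl_exchange:
  assumes "v \<in> dcl (insert w A)" "v \<notin> dcl A" "w \<in> dom M"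
  shows "w \<in> dcl (insert v A)"
proof (rule ccontr)
  assume nw: "w \<notin> dcl (insert v A)"
  have vd: "v \<in> dom M" using assms(1) dcl_dom by blast
  have "v \<in> dcl (A \<union> range (\<lambda>_ :: nat. w))" using assms(1) by simp
  from dcl_function[OF this] assms(3) obtain F where F: "defT A F" "F (\<lambda>_. w) = v" by auto
  define f where "f x = F (\<lambda>_. x)" for x
  have f: "defT A (\<lambda>v. f (v i))" for i
    unfolding f_def using defT_ren[OF F(1), of "\<lambda>_. i"] .
  have fd: "x \<in> dom M \<Longrightarrow> f x \<in> dom M" for x
    using defT_dom[OF F(1), of "\<lambda>_. x"] by (simp add: f_def)
  have fw: "f w = v" using F(2) by (simp add: f_def)
  define V where "V v' \<longleftrightarrow> (\<exists>p \<in> dom M. \<exists>q \<in> dom M. p \<sqsubset> q \<and>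
    (\<forall>x \<in> dom M. p \<sqsubset> x \<longrightarrow> x \<sqsubset> q \<longrightarrow> f x = v'))" for v'
  have "defP A (\<lambda>u. V (u 0))"
    unfolding V_def
    by (intro defP_ex defP_conj defP_all defP_imp defP_lt defP_eqT defT_var f)
  moreover have "V v"
  proof -
    have "defP (insert v A) (\<lambda>u. f (u 0) = v)"
      using vd by (intro defP_eqT defT_param defT_mono[OF f]) auto
    from const_near_generic[OF this assms(3) nw] obtain p q where
      pq: "p \<sqsubset> w" "w \<sqsubset> q" "\<forall>z. p \<sqsubset> z \<longrightarrow> z \<sqsubset> q \<longrightarrow> f z = v"
      unfolding const_near_def fw by auto
    show ?thesis unfolding V_def
      using pq lt_trans[OF pq(1,2)] lt_dom[OF pq(1)] lt_dom[OF pq(2)] by blast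
  qed
  moreover have "finite {y \<in> dom M. V y}"
  proof -
    have W: "defP A (\<lambda>u. const_near f (u 0))"
      unfolding const_near_iff
      by (intro defP_ex defP_conj defP_all defP_imp defP_lt defP_eqT defT_var f)
    obtain B where B: "finite B" "B \<subseteq> dcl A"
      "\<forall>x y. x \<sqsubset> y \<longrightarrow> (\<forall>b \<in> B. b \<sqsubset> x \<or> y \<sqsubset> b) \<longrightarrow> const_near f x = const_near f y"
      using breakpoints_in_dcl[OF W] by blast
    have "\<exists>x \<in> dom M. x \<notin> B \<and> f x = y \<and> const_near f x" if Vy: "V y" for y
    proof -
      obtain p q where pq: "p \<sqsubset> q" "\<forall>x \<in> dom M. p \<sqsubset> x \<longrightarrow> x \<sqsubset> q \<longrightarrow> f x = y"
        using Vy unfolding V_def by blast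
      obtain x where x: "p \<sqsubset> x" "x \<sqsubset> q" "x \<notin> B" using interval_avoid[OF B(1) pq(1)] by blast
      have xd: "x \<in> dom M" using x(1) lt_dom by blast
      have "f x = y" using pq(2) x(1,2) xd by blast
      moreover have "const_near f x"
        unfolding const_near_iff using x(1,2) pq(2) \<open>f x = y\<close> lt_dom[OF pq(1)] by blast
      ultimately show ?thesis using x(3) xd by blast
    qed
    then obtain g where g: "\<And>y. V y \<Longrightarrow> g y \<in> dom M \<and> g y \<notin> B \<and> f (g y) = y \<and> const_near f (g y)"
      by metis
    \<comment> \<open>The set of breakpoints below \<open>g y\<close> tells in which component of
      the line minus \<open>B\<close> the point \<open>g y\<close> lies, so there are at most as
      many values as subsets of \<open>B\<close>.\<close>
    define h where "h y = {b \<in> B. b \<sqsubset> g y}" for y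
    have mono: "y = y'" if y: "V y" "V y'" "h y = h y'" and l: "g y \<sqsubset> g y'" for y y'
    proof -
      have sep: "b \<sqsubset> g y \<or> g y' \<sqsubset> b" if b: "b \<in> B" for b
      proof (cases "b \<sqsubset> g y'")
        case True
        then have "b \<in> h y'" using b by (simp add: h_def)
        then have "b \<in> h y" using y(3) by simp
        then show ?thesis by (simp add: h_def)
      next
        case False
        have "b \<in> dom M" using b B(2) dcl_dom by blast
        then show ?thesis using False lt_total[of b "g y'"] g[OF y(2)] b by blast
      qed
      have "const_near f z" if z: "z \<in> dom M" "\<not> z \<sqsubset> g y" "\<not> g y' \<sqsubset> z" for z
      proof (cases "z = g y")
        case False
        then have "g y \<sqsubset> z" using z lt_total[of z "g y"] g[OF y(1)] by blast
        moreover have "\<forall>b \<in> B. b \<sqsubset> g y \<or> z \<sqsubset> b"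
          using sep z lt_trans[of z "g y'"] lt_total[of z "g y'"] g[OF y(2)] by blast
        ultimately have "const_near f (g y) = const_near f z" using B(3) by blast
        then show ?thesis using g[OF y(1)] by blast
      qed (use g[OF y(1)] in blast)
      \<comment> \<open>Local constancy of \<open>f\<close> is passed to the predicate
        \<open>f x = f (g y)\<close>, for which connectedness of the interval is available.\<close>
      then have c: "const_near (\<lambda>x. f x = f (g y)) z"
        if "z \<in> dom M" "\<not> z \<sqsubset> g y" "\<not> g y' \<sqsubset> z" for z
        using that unfolding const_near_def by metis
      have gd: "g y \<in> dom M" using g[OF y(1)] by blast
      have "defP (insert (g y) A) (\<lambda>u. f (u 0) = f (g y))"
      proof (intro defP_eqT defT_mono[OF f])
        show "defT (insert (g y) A) (\<lambda>_. f (g y))"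
          using dcl_app[OF defT_mono[OF F(1)], of "insert (g y) A" "\<lambda>_. g y"] gd
          by (intro defT_dcl) (simp add: f_def dcl_base subset_insertI2)
      qed auto
      from const_near_connected[OF this l c] show ?thesis using g y by metis
    qed
    have "inj_on h {y \<in> dom M. V y}"
    proof (rule inj_onI)
      fix y y' assume *: "y \<in> {y \<in> dom M. V y}" "y' \<in> {y \<in> dom M. V y}" "h y = h y'"
      then have v: "V y" "V y'" by auto
      from g[OF v(1)] g[OF v(2)] have "g y \<sqsubset> g y' \<or> g y = g y' \<or> g y' \<sqsubset> g y"
        using lt_total by blast
      then show "y = y'"
        using mono[OF v *(3)] mono[OF v(2,1) *(3)[symmetric]] g[OF v(1)] g[OF v(2)] by metis
    qed
    moreover have "h ` {y \<in> dom M. V y} \<subseteq> Pow B" by (auto simp: h_def)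
    ultimately show ?thesis using B(1) by (meson finite_Pow_iff finite_imageD finite_subset)
  qed
  ultimately show False using finite_in_dcl[of A V v] vd assms(2) by blast
qed

section \<open>Independent tuples and boxes around them\<close>

definition indep :: "'m set \<Rightarrow> (nat \<Rightarrow> 'm) \<Rightarrow> nat \<Rightarrow> bool" where
  "indep A w n \<longleftrightarrow> (\<forall>i<n. w i \<in> dom M \<and> w i \<notin> dcl (A \<union> w ` {..<i}))"

lemma indep_cong: "(\<And>i. i < n \<Longrightarrow> w i = w' i) \<Longrightarrow> indep A w n = indep A w' n"
proof -
  assume *: "\<And>i. i < n \<Longrightarrow> w i = w' i"
  have "w ` {..<i} = w' ` {..<i}" if "i < n" for i using * that by (intro image_cong) auto
  then show ?thesis unfolding indep_def using * by auto
qed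

lemma indep_mono: "indep A w n \<Longrightarrow> m \<le> n \<Longrightarrow> indep A w m"
  by (auto simp: indep_def)

text \<open>By exchange: an entry that became dependent on its predecessors through \<open>c\<close>
  would make \<open>c\<close> definable from \<open>A\<close> and the tuple.\<close>

lemma indep_insert:
  assumes "indep A w n" "c \<in> dom M" "c \<notin> dcl (A \<union> w ` {..<n})"
  shows "indep (insert c A) w n"
  unfolding indep_def
proof (intro allI impI conjI notI)
  fix i assume i: "i < n"
  show "w i \<in> dom M" using assms(1) i by (simp add: indep_def)
  assume "w i \<in> dcl (insert c A \<union> w ` {..<i})"
  then have "w i \<in> dcl (insert c (A \<union> w ` {..<i}))" by simp
  moreover have "w i \<notin> dcl (A \<union> w ` {..<i})" using assms(1) i by (simp add: indep_def)
  ultimately have "c \<in> dcl (insert (w i) (A \<union> w ` {..<i}))" using dcl_exchange assms(2) by blast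
  moreover have "insert (w i) (A \<union> w ` {..<i}) \<subseteq> A \<union> w ` {..<n}" using i by auto
  ultimately show False using assms(3) dcl_mono by blast
qed

text \<open>Exchange turns independence in the given order into independence of each entry from all
  the others, as is needed to vary an arbitrary coordinate.\<close>

lemma indep_remove:
  "indep A w n \<Longrightarrow> i < n \<Longrightarrow> w i \<notin> dcl (A \<union> w ` ({..<n} - {i}))"
proof (induction n)
  case (Suc n)
  show ?case
  proof (cases "i = n")
    case True
    then have "{..<Suc n} - {i} = {..<n}" by auto
    then show ?thesis using Suc.prems True by (simp add: indep_def)
  next
    case False
    then have i: "i < n" using Suc.prems by simp
    let ?B = "A \<union> w ` ({..<n} - {i})"
    have n: "w n \<in> dom M" "w n \<notin> dcl (A \<union> w ` {..<n})" using Suc.prems by (auto simp: indep_def)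
    have "w i \<notin> dcl ?B" using Suc.IH i indep_mono[OF Suc.prems(1)] by simp
    moreover have "w n \<notin> dcl (insert (w i) ?B)"
    proof -
      have "insert (w i) ?B = A \<union> w ` {..<n}" using i by auto
      then show ?thesis using n(2) by simp
    qed
    ultimately have "w i \<notin> dcl (insert (w n) ?B)" using dcl_exchange n(1) by blast
    moreover have "A \<union> w ` ({..<Suc n} - {i}) = insert (w n) ?B" using False by (auto simp: lessThan_Suc)
    ultimately show ?thesis by simp
  qed
qed simp

definition in_box :: "nat \<Rightarrow> (nat \<Rightarrow> 'm) \<Rightarrow> (nat \<Rightarrow> 'm) \<Rightarrow> (nat \<Rightarrow> 'm) \<Rightarrow> bool" where
  "in_box n c d z \<longleftrightarrow> (\<forall>i<n. c i \<sqsubset> z i \<and> z i \<sqsubset> d i)"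

text \<open>The last coordinate receives an interval whose endpoints are generic over everything
  else. Adding them as parameters keeps the other coordinates independent, so the property of
  holding on that whole interval can be treated by induction. Arbitrary endpoints could destroy
  independence.\<close>

lemma generic_box:
  assumes "countable A" "indep A w n" "w \<in> Env" "\<And>i. n \<le> i \<Longrightarrow> w i \<in> A" "defP A P" "P w"
  shows "\<exists>c \<in> Env. \<exists>d \<in> Env. in_box n c d w \<and>
    (\<forall>z \<in> Env. in_box n c d z \<longrightarrow> (\<forall>i\<ge>n. z i = w i) \<longrightarrow> P z)"
  using assms
proof (induction n arbitrary: A w P)
  case 0
  have "z = w" if "\<forall>i\<ge>0. z i = w i" for z using that by auto
  moreover have "in_box 0 w w w" by (simp add: in_box_def)
  ultimately show ?case using 0 by (intro bexI[of _ w] conjI ballI impI) auto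
next
  case (Suc n)
  define A1 where "A1 = A \<union> w ` {..<n}"
  have cA1: "countable A1" using Suc.prems(1) by (simp add: A1_def)
  have wd: "w i \<in> dom M" for i using Suc.prems(3) by simp
  have wn: "w n \<notin> dcl A1" using Suc.prems(2) by (simp add: indep_def A1_def)
  have wA1: "w i \<in> A1" if "i \<noteq> n" for i
    using that Suc.prems(4)[of i] by (cases "i < n") (auto simp: A1_def)
  have "defP A1 (\<lambda>v. P (\<lambda>i. (if i = n then (\<lambda>v. v 0) else (\<lambda>_. w i)) v))"
  proof (rule defP_subst)
    show "defP A1 P" using Suc.prems(5) by (rule defP_mono) (auto simp: A1_def)
    show "defT A1 (if i = n then (\<lambda>v. v 0) else (\<lambda>_. w i))" for i
      using defT_var defT_param[OF wA1 wd] by auto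
  qed
  moreover have "(\<lambda>i. (if i = n then (\<lambda>v. v 0) else (\<lambda>_. w i)) v) = w(n := v 0)" for v :: "nat \<Rightarrow> 'm"
    by auto
  ultimately have "defP A1 (\<lambda>v. P (w(n := v 0)))" by simp
  from const_near_generic[OF this wd wn] obtain p q where pq: "p \<sqsubset> w n" "w n \<sqsubset> q"
    "\<forall>t. p \<sqsubset> t \<longrightarrow> t \<sqsubset> q \<longrightarrow> P (w(n := t))"
    unfolding const_near_def using Suc.prems(6) by auto
  obtain c where c: "p \<sqsubset> c" "c \<sqsubset> w n" "c \<notin> dcl A1"
    using generic_in_interval[OF cA1 pq(1)] by blast
  obtain d where d: "w n \<sqsubset> d" "d \<sqsubset> q" "d \<notin> dcl (insert c A1)"
    using generic_in_interval[OF _ pq(2), of "insert c A1"] cA1 by auto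
  have cd: "c \<in> dom M" "d \<in> dom M" using c(2) d(2) lt_dom by auto
  let ?A = "insert d (insert c A)"
  \<comment> \<open>\<open>?P\<close> overwrites coordinate \<open>n\<close>; setting its entry to
    the parameter \<open>c\<close> makes all coordinates from \<open>n\<close> on parameters
    again.\<close>
  let ?w = "w(n := c)"
  let ?P = "\<lambda>z. \<forall>t \<in> dom M. c \<sqsubset> t \<longrightarrow> t \<sqsubset> d \<longrightarrow> P (z(n := t))"
  have "indep A w n" using Suc.prems(2) indep_mono by simp
  then have "indep (insert c A) w n" using indep_insert cd(1) c(3) by (simp add: A1_def)
  then have "indep ?A w n" using indep_insert cd(2) d(3) by (simp add: A1_def)
  then have 1: "indep ?A ?w n" by (subst indep_cong[of n ?w w]) auto
  have 2: "?w \<in> Env" using Suc.prems(3) cd by simp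
  have 3: "?w i \<in> ?A" if "n \<le> i" for i using that Suc.prems(4)[of i] by auto
  have 4: "defP ?A ?P"
  proof -
    have "defP ?A (\<lambda>v. P (\<lambda>i. v (if i = n then 0 else Suc i)))"
      by (rule defP_ren, rule defP_mono[OF Suc.prems(5)]) auto
    moreover have "(\<lambda>i. v (if i = n then 0 else Suc i)) = (stail v)(n := v 0)" for v :: "nat \<Rightarrow> 'm"
      by auto
    ultimately have *: "defP ?A (\<lambda>v. P ((stail v)(n := v 0)))" by (simp only:)
    have "defT ?A (\<lambda>_. c)" "defT ?A (\<lambda>_. d)" using cd by (auto intro: defT_param)
    then show ?thesis by (intro defP_all defP_imp defP_lt defT_var *)
  qed
  have "P (?w(n := t))" if "c \<sqsubset> t" "t \<sqsubset> d" for t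
    using pq(3) lt_trans[OF c(1) that(1)] lt_trans[OF that(2) d(2)] by simp
  then have 5: "?P ?w" by blast
  have cA: "countable ?A" using Suc.prems(1) by simp
  from Suc.IH[OF cA 1 2 3 4 5] obtain c' d' where b: "c' \<in> Env" "d' \<in> Env"
    "in_box n c' d' ?w"
    "\<forall>z \<in> Env. in_box n c' d' z \<longrightarrow> (\<forall>i\<ge>n. z i = ?w i) \<longrightarrow> ?P z"
    by blast
  have "P z" if z: "z \<in> Env" "in_box (Suc n) (c'(n := c)) (d'(n := d)) z" "\<forall>i\<ge>Suc n. z i = w i" for z
  proof -
    have zi: "(c'(n := c)) i \<sqsubset> z i" "z i \<sqsubset> (d'(n := d)) i" if "i < Suc n" for i
      using z(2) that unfolding in_box_def by blast+
    have "(z(n := c)) i = ?w i" if "n \<le> i" for i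
      using z(3) that by (cases "i = n") auto
    moreover have "in_box n c' d' (z(n := c))"
      unfolding in_box_def
    proof (intro allI impI)
      fix i assume "i < n"
      then show "c' i \<sqsubset> (z(n := c)) i \<and> (z(n := c)) i \<sqsubset> d' i" using zi[of i] by simp
    qed
    ultimately have "?P (z(n := c))" using b(4) Env_upd[OF z(1) cd(1)] by blast
    moreover have "c \<sqsubset> z n" "z n \<sqsubset> d" using zi[of n] by auto
    moreover have "z n \<in> dom M" using z(1) by simp
    ultimately have "P ((z(n := c))(n := z n))" by blast
    then show ?thesis by simp
  qed
  moreover have "in_box (Suc n) (c'(n := c)) (d'(n := d)) w"
    using b(3) c(2) d(1) by (auto simp: less_Suc_eq in_box_def)
  ultimately show ?case using Env_upd[OF b(1) cd(1), of n] Env_upd[OF b(2) cd(2), of n]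
    by blast
qed

text \<open>An interval around a value is shrunk to one whose endpoints may be used as parameters
  while \<open>w\<close> stays independent.\<close>

lemma generic_interval_endpoints:
  assumes "countable A" "indep A w n" "p \<sqsubset> x" "x \<sqsubset> q"
  obtains p' q' where "p \<sqsubset> p'" "p' \<sqsubset> x" "x \<sqsubset> q'" "q' \<sqsubset> q" "indep (insert q' (insert p' A)) w n"
proof -
  have c: "countable (A \<union> w ` {..<n})" using assms(1) by simp
  obtain p' where p: "p \<sqsubset> p'" "p' \<sqsubset> x" "p' \<notin> dcl (A \<union> w ` {..<n})"
    using generic_in_interval[OF c assms(3)] by blast
  have "countable (insert p' A \<union> w ` {..<n})" using c by simp
  then obtain q' where q: "x \<sqsubset> q'" "q' \<sqsubset> q" "q' \<notin> dcl (insert p' A \<union> w ` {..<n})"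
    using generic_in_interval[OF _ assms(4)] by blast
  have d: "p' \<in> dom M" "q' \<in> dom M" using p(2) q(2) lt_dom by auto
  have "indep (insert p' A) w n" using indep_insert[OF assms(2) d(1) p(3)] .
  then have "indep (insert q' (insert p' A)) w n" using indep_insert d(2) q(3) by blast
  then show ?thesis using that p q by blast
qed

text \<open>That \<open>G z\<close> lies between two generic bounds is a definable condition true at
  \<open>w\<close>, and so it holds on a box.\<close>

lemma generic_continuous:
  assumes "countable A" "indep A w n" "w \<in> Env" "\<And>i. n \<le> i \<Longrightarrow> w i \<in> A" "defT A G"
    "p \<sqsubset> G w" "G w \<sqsubset> q"
  shows "\<exists>c \<in> Env. \<exists>d \<in> Env. in_box n c d w \<and>
    (\<forall>z \<in> Env. in_box n c d z \<longrightarrow> (\<forall>i\<ge>n. z i = w i) \<longrightarrow> p \<sqsubset> G z \<and> G z \<sqsubset> q)"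
proof -
  obtain p' q' where pq: "p \<sqsubset> p'" "p' \<sqsubset> G w" "G w \<sqsubset> q'" "q' \<sqsubset> q"
    "indep (insert q' (insert p' A)) w n"
    using generic_interval_endpoints[OF assms(1,2,6,7)] by blast
  let ?A = "insert q' (insert p' A)"
  have "defP ?A (\<lambda>z. p' \<sqsubset> G z \<and> G z \<sqsubset> q')"
    using lt_dom[OF pq(1)] lt_dom[OF pq(4)]
    by (intro defP_conj defP_lt defT_param defT_mono[OF assms(5)]) auto
  from generic_box[OF _ pq(5) assms(3) _ this] assms(1,4) pq(2,3)
  have "\<exists>c \<in> Env. \<exists>d \<in> Env. in_box n c d w \<and>
    (\<forall>z \<in> Env. in_box n c d z \<longrightarrow> (\<forall>i\<ge>n. z i = w i) \<longrightarrow> p' \<sqsubset> G z \<and> G z \<sqsubset> q')"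
    by simp
  moreover have "p \<sqsubset> y \<and> y \<sqsubset> q" if "p' \<sqsubset> y \<and> y \<sqsubset> q'" for y
    using that lt_trans[OF pq(1), of y] lt_trans[OF _ pq(4), of y] by blast
  ultimately show ?thesis by blast
qed

lemma independent_basis:
  assumes "finite C" "C \<subseteq> dom M"
  shows "\<exists>w m. indep {} w m \<and> w ` {..<m} \<subseteq> C \<and> C \<subseteq> dcl (w ` {..<m})"
  using assms
proof (induction C rule: finite_induct)
  case empty
  show ?case by (intro exI[of _ "\<lambda>_. undefined"] exI[of _ 0]) (simp add: indep_def)
next
  case (insert c C)
  then obtain w m where w: "indep {} w m" "w ` {..<m} \<subseteq> C" "C \<subseteq> dcl (w ` {..<m})" by auto
  show ?case
  proof (cases "c \<in> dcl (w ` {..<m})")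
    case True
    then show ?thesis using w by blast
  next
    case False
    let ?w = "w(m := c)"
    have im: "?w ` {..<i} = w ` {..<i}" if "i \<le> m" for i using that by (intro image_cong) auto
    have 1: "?w ` {..<Suc m} = insert c (w ` {..<m})"
      unfolding lessThan_Suc image_insert im[OF order_refl] by simp
    have 2: "indep {} ?w (Suc m)"
      unfolding indep_def
    proof (intro allI impI)
      fix i assume "i < Suc m"
      then show "?w i \<in> dom M \<and> ?w i \<notin> dcl ({} \<union> ?w ` {..<i})"
        using im[of i] w(1) False insert.prems by (cases "i = m") (auto simp: indep_def)
    qed
    have 3: "insert c C \<subseteq> dcl (insert c (w ` {..<m}))"
      using w(3) dcl_mono[of "w ` {..<m}" "insert c (w ` {..<m})"] dcl_base[of c] insert.prems by auto
    show ?thesis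
      using 2 3 w(2) unfolding 1[symmetric]
      by (intro exI[of _ ?w] exI[of _ "Suc m"] conjI) (auto simp: 1 simp del: fun_upd_apply)
  qed
qed

text \<open>Presents a definable element as definable from an independent tuple drawn from the
  parameters, the kind of point at which smoothness is known.\<close>

lemma dcl_independent:
  assumes "e \<in> dcl C"
  shows "\<exists>w m. indep {} w m \<and> w ` {..<m} \<subseteq> C \<and> e \<in> dcl (w ` {..<m})"
proof -
  obtain C' where C: "finite C'" "C' \<subseteq> C" "e \<in> dcl C'" using dcl_finite[OF assms] by blast
  obtain w m where w: "indep {} w m" "w ` {..<m} \<subseteq> C' \<inter> dom M" "C' \<inter> dom M \<subseteq> dcl (w ` {..<m})"
    using independent_basis[of "C' \<inter> dom M"] C(1) by blast
  then show ?thesis using C dcl_trans by blast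
qed

end

section \<open>Partial elementary maps and indiscernible sequences\<close>

context first_order_structure
begin

section \<open>Extension of partial elementary maps\<close>

lemma El_dom: "El H \<Longrightarrow> (a, b) \<in> H \<Longrightarrow> a \<in> dom M \<and> b \<in> dom M"
  by (auto simp: El_def)

lemma El_imp: "El H \<Longrightarrow> defP {} Q \<Longrightarrow> (\<And>i. (a i, b i) \<in> H) \<Longrightarrow> Q a \<Longrightarrow> Q b"
  unfolding El_def by blast

lemma El_iff: "El H \<Longrightarrow> defP {} Q \<Longrightarrow> (\<And>i. (a i, b i) \<in> H) \<Longrightarrow> Q a = Q b"
  using El_imp[of H Q a b] El_imp[of H "\<lambda>v. \<not> Q v" a b] defP_neg[of "{}" Q] by blast

lemma El_mono: "El H \<Longrightarrow> K \<subseteq> H \<Longrightarrow> El K"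
  unfolding El_def by (meson subset_iff order_trans)

lemma El_converse: "El H \<Longrightarrow> El (H\<inverse>)"
proof -
  assume H: "El H"
  have "H\<inverse> \<subseteq> dom M \<times> dom M" using H by (auto simp: El_def)
  moreover have "Q b" if "defP {} Q" "\<forall>i. (a i, b i) \<in> H\<inverse>" "Q a" for Q a b
    using El_iff[OF H that(1), of b a] that(2,3) by simp
  ultimately show ?thesis unfolding El_def by blast
qed

lemma El_extend:
  assumes H: "El H" and ne: "(p, q) \<in> H" and xy: "x \<in> Env" "y \<in> Env"
    and ext: "\<And>Q a b. defP {} Q \<Longrightarrow> (\<And>i. (a i, b i) \<in> H) \<Longrightarrow> Q (merge x a) \<Longrightarrow> Q (merge y b)"
  shows "El (H \<union> {(x k, y k) | k. True})"
proof -
  have "H \<union> {(x k, y k) | k. True} \<subseteq> dom M \<times> dom M" using H xy by (auto simp: El_def)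
  moreover have "Q b" if Q: "defP {} Q" and ab: "\<forall>i. (a i, b i) \<in> H \<union> {(x k, y k) | k. True}"
    and Qa: "Q a" for Q a b
  proof -
    have "\<forall>i. \<exists>k. (a i, b i) \<in> H \<or> (a i, b i) = (x k, y k)" using ab by auto
    then obtain k where k: "\<And>i. (a i, b i) \<in> H \<or> (a i, b i) = (x (k i), y (k i))" by metis
    define t where "t i = (if (a i, b i) \<in> H then 2 * i + 1 else 2 * k i)" for i
    define a' where "a' i = (if (a i, b i) \<in> H then a i else p)" for i
    define b' where "b' i = (if (a i, b i) \<in> H then b i else q)" for i
    have "merge x a' (t i) = a i \<and> merge y b' (t i) = b i" for i
      using k[of i] by (cases "(a i, b i) \<in> H") (simp_all add: t_def a'_def b'_def merge_def)
    then have a: "(\<lambda>i. merge x a' (t i)) = a" and b: "(\<lambda>i. merge y b' (t i)) = b" by auto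
    have "(a' i, b' i) \<in> H" for i using ne by (simp add: a'_def b'_def)
    then have "Q (\<lambda>i. merge y b' (t i))" using ext[OF defP_ren[OF Q, of t], of a' b'] Qa a by simp
    then show ?thesis using b by simp
  qed
  ultimately show ?thesis unfolding El_def by blast
qed

text \<open>A statement about the value \<open>G a\<close> is, after substitution, a statement about
  \<open>a\<close>, and that one is preserved.\<close>

lemma El_insert_term:
  assumes H: "El H" and G: "defT {} G" and ab: "\<And>i. (a i, b i) \<in> H"
  shows "El (insert (G a, G b) H)"
proof -
  have abE: "a \<in> Env" "b \<in> Env" using El_dom[OF H ab] by (auto intro: EnvI)
  have "El (H \<union> {((\<lambda>_. G a) k, (\<lambda>_. G b) k) | k :: nat. True})"
  proof (rule El_extend[OF H ab[of 0]])
    fix Q a' b' assume Q: "defP {} Q" and ab': "\<And>i. (a' i, b' i) \<in> H" and Qa: "Q (merge (\<lambda>_. G a) a')"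
    have "defP {} (\<lambda>u. Q (\<lambda>i. (if even i then (\<lambda>u. G (evens u)) else (\<lambda>u. odds u (i div 2))) u))"
      using defT_ren[OF G, of "\<lambda>i. 2 * i"] defT_var
      by (intro defP_subst[OF Q]) (simp add: evens_def[abs_def] odds_def)
    moreover have "(\<lambda>i. (if even i then (\<lambda>u. G (evens u)) else (\<lambda>u. odds u (i div 2))) u) =
      merge (\<lambda>_. G (evens u)) (odds u)" for u by (rule ext) (simp add: merge_def)
    ultimately have "defP {} (\<lambda>u. Q (merge (\<lambda>_. G (evens u)) (odds u)))" by simp
    from El_imp[OF H this, of "merge a a'" "merge b b'"]
    show "Q (merge (\<lambda>_. G b) b')" using Qa ab ab' by (simp add: merge_def[of _ _ i for i])
  qed (use defT_dom[OF G] abE in simp_all)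
  then show ?thesis by (rule El_mono) auto
qed

text \<open>That \<open>a\<close> is the unique solution over the parameters \<open>s\<close> is
  itself a property of \<open>a\<close> and \<open>s\<close> definable without parameters, and it
  passes to \<open>b\<close> and the images \<open>t\<close>. The empty parameter set is treated
  apart because the parameters are extracted into a sequence.\<close>

lemma El_dcl:
  assumes H: "El H" and K: "K \<subseteq> H" and ab: "(a, b) \<in> H" and a: "a \<in> dcl (fst ` K)"
  shows "b \<in> dcl (snd ` K)"
proof (cases "K = {}")
  case True
  have "defP {} (\<lambda>v. v 0 = a)" using a True by (simp add: dcl_iff)
  from El_imp[OF H this, of "\<lambda>_. a" "\<lambda>_. b"] ab have "b = a" by simp
  then show ?thesis using a True by simp
next
  case False
  have K2: "K \<subseteq> dom M \<times> dom M" using H K by (auto simp: El_def)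
  have bd: "b \<in> dom M" "a \<in> dom M" using El_dom[OF H ab] by auto
  have "defP ({} \<union> fst ` K) (\<lambda>v. v 0 = a)" using a by (simp add: dcl_iff)
  moreover have "fst ` K \<inter> dom M \<noteq> {}" using False K2 by fastforce
  ultimately obtain Q s where Q: "defP {} Q" "\<forall>i. s i \<in> fst ` K \<inter> dom M"
    "\<forall>v \<in> Env. (v 0 = a) = Q (merge s v)" using defP_params by blast
  have "\<forall>i. \<exists>y. (s i, y) \<in> K" using Q(2) by force
  then obtain t where t: "\<And>i. (s i, t i) \<in> K" by metis
  have tE: "t \<in> Env" using t K2 by (intro EnvI) blast
  define R where "R u y = Q (merge (stail u) (\<lambda>_. y))" for u y
  have R1: "defP {} (\<lambda>u. R u (u 0))"
  proof -
    have "(\<lambda>i. u (if even i then Suc (i div 2) else 0)) = merge (stail u) (\<lambda>_. u 0)" for u :: "nat \<Rightarrow> 'm"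
      by (rule ext) (simp add: merge_def)
    then show ?thesis unfolding R_def
      using defP_ren[OF Q(1), of "\<lambda>i. if even i then Suc (i div 2) else 0"] by (simp only:)
  qed
  have R2: "defP {} (\<lambda>u. R (stail u) (u 0))"
  proof -
    have "(\<lambda>i. u (if even i then Suc (Suc (i div 2)) else 0)) = merge (\<lambda>i. u (Suc (Suc i))) (\<lambda>_. u 0)"
      for u :: "nat \<Rightarrow> 'm" by (rule ext) (simp add: merge_def)
    then show ?thesis unfolding R_def
      using defP_ren[OF Q(1), of "\<lambda>i. if even i then Suc (Suc (i div 2)) else 0"] by (simp only:)
  qed
  define E where "E u \<longleftrightarrow> R u (u 0) \<and> (\<forall>y \<in> dom M. R u y \<longrightarrow> y = u 0)" for u
  have E: "defP {} E"
    unfolding E_def using R1 R2 by (intro defP_conj defP_all defP_imp defP_eq)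
  have Rs: "R (scons c s) y \<longleftrightarrow> y = a" if "y \<in> dom M" for c y
    using Q(3)[rule_format, of "\<lambda>_. y"] that by (simp add: R_def)
  have "E (scons a s)" unfolding E_def using bd by (simp add: Rs)
  moreover have "(scons a s i, scons b t i) \<in> H" for i
    using ab t K by (cases i) auto
  ultimately have E': "E (scons b t)" using El_imp[OF H E] by blast
  have "R (scons b t) y \<longleftrightarrow> y = b" if "y \<in> dom M" for y
    using E' that unfolding E_def by auto
  then have *: "Q (merge t (\<lambda>_. y)) \<longleftrightarrow> y = b" if "y \<in> dom M" for y
    using that by (simp add: R_def)
  have "defP (snd ` K) (\<lambda>v. Q (gval (\<lambda>i. if even i then Inl (t (i div 2)) else Inr 0) v))"
  proof (rule defP_gval)
    show "defP (snd ` K) Q" using Q(1) by (rule defP_mono) simp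
    show "(if even i then Inl (t (i div 2)) else Inr 0) \<in> gens (snd ` K)" for i
      using t[of "i div 2"] tE by force
  qed
  moreover have "gval (\<lambda>i. if even i then Inl (t (i div 2)) else Inr 0) v = merge t (\<lambda>_. v 0)" for v
    by (rule ext) (simp add: gval_def merge_def)
  ultimately have "defP (snd ` K) (\<lambda>v. Q (merge t (\<lambda>_. v 0)))" by simp
  then have "defP (snd ` K) (\<lambda>v. v 0 = b)"
    by (subst defP_cong[where Q = "\<lambda>v. Q (merge t (\<lambda>_. v 0))"]) (use * in simp_all)
  then show ?thesis using bd by (simp add: dcl_iff)
qed

text \<open>The new element brings along a whole sequence \<open>orb y\<close>. Taking it constant
  extends a map by one point, taking the iterated derivatives extends it by a jet; the two uses need
  saturation for different languages, so saturation enters as a hypothesis.\<close>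

lemma saturated_extension:
  assumes H: "El H" and ne: "(p, q) \<in> H" and x: "x \<in> Env"
    and orb: "\<And>y. y \<in> dom M \<Longrightarrow> orb y \<in> Env"
    and sat: "\<And>\<P>. (\<And>P. P \<in> \<P> \<Longrightarrow> \<exists>Q b. defP {} Q \<and> (\<forall>i. b i \<in> snd ` H) \<and>
        P = (\<lambda>y. Q (merge (orb y) b))) \<Longrightarrow>
      (\<And>F. finite F \<Longrightarrow> F \<subseteq> \<P> \<Longrightarrow> \<exists>y \<in> dom M. \<forall>P \<in> F. P y) \<Longrightarrow> \<exists>y \<in> dom M. \<forall>P \<in> \<P>. P y"
    and real: "\<And>Q a b. defP {} Q \<Longrightarrow> (\<And>i. (a i, b i) \<in> H) \<Longrightarrow> Q (merge x a) \<Longrightarrow>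
      \<exists>y \<in> dom M. Q (merge (orb y) b)"
  shows "\<exists>y \<in> dom M. El (H \<union> {(x k, orb y k) | k. True})"
proof -
  define \<P> where "\<P> = {P. \<exists>Q a b. defP {} Q \<and> (\<forall>i. (a i, b i) \<in> H) \<and> Q (merge x a) \<and>
    P = (\<lambda>y. Q (merge (orb y) b))}"
  have "\<exists>y \<in> dom M. \<forall>P \<in> \<P>. P y"
  proof (rule sat)
    fix P assume "P \<in> \<P>"
    then obtain Q a b where Q: "defP {} Q" "\<forall>i. (a i, b i) \<in> H" "P = (\<lambda>y. Q (merge (orb y) b))"
      unfolding \<P>_def by blast
    have "\<forall>i. b i \<in> snd ` H" using Q(2) by force
    then show "\<exists>Q b. defP {} Q \<and> (\<forall>i. b i \<in> snd ` H) \<and> P = (\<lambda>y. Q (merge (orb y) b))"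
      using Q(1,3) by blast
  next
    fix F :: "('m \<Rightarrow> bool) set" assume F: "finite F" "F \<subseteq> \<P>"
    have "\<exists>Q a b. defP {} Q \<and> (\<forall>i. (a i, b i) \<in> H) \<and> Q (merge x a) \<and>
      (\<forall>y \<in> dom M. Q (merge (orb y) b) \<longrightarrow> (\<forall>P \<in> F. P y))"
      using F
    proof (induction F rule: finite_induct)
      case empty
      show ?case
        using ne by (intro exI[of _ "\<lambda>_. True"] exI[of _ "\<lambda>_. p"] exI[of _ "\<lambda>_. q"])
          (simp add: defP_const)
    next
      case (insert P F)
      then obtain Q1 a1 b1 where 1: "defP {} Q1" "\<forall>i. (a1 i, b1 i) \<in> H" "Q1 (merge x a1)"
        "\<forall>y \<in> dom M. Q1 (merge (orb y) b1) \<longrightarrow> (\<forall>P \<in> F. P y)" by auto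
      from insert.prems obtain Q2 a2 b2 where 2: "defP {} Q2" "\<forall>i. (a2 i, b2 i) \<in> H"
        "Q2 (merge x a2)" "P = (\<lambda>y. Q2 (merge (orb y) b2))" unfolding \<P>_def by auto
      \<comment> \<open>Two conditions with separate parameter sequences are joined by interleaving
        these sequences inside the odd places, while both read the same orbit at the even
        ones.\<close>
      define Q where "Q u \<longleftrightarrow> Q1 (merge (evens u) (evens (odds u))) \<and>
        Q2 (merge (evens u) (odds (odds u)))" for u
      have "(\<lambda>i. u (if even i then 2 * (i div 2) else 2 * (2 * (i div 2)) + 1)) = merge (evens u) (evens (odds u))"
        "(\<lambda>i. u (if even i then 2 * (i div 2) else 2 * (2 * (i div 2) + 1) + 1)) = merge (evens u) (odds (odds u))"
        for u :: "nat \<Rightarrow> 'm"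
        by (simp_all only: fun_eq_iff merge_def evens_def odds_def if_distrib[of u]) simp_all
      then have "defP {} Q" unfolding Q_def
        using defP_ren[OF 1(1), of "\<lambda>i. if even i then 2 * (i div 2) else 2 * (2 * (i div 2)) + 1"]
          defP_ren[OF 2(1), of "\<lambda>i. if even i then 2 * (i div 2) else 2 * (2 * (i div 2) + 1) + 1"]
        by (intro defP_conj) (simp_all only:)
      moreover have "\<forall>i. (merge a1 a2 i, merge b1 b2 i) \<in> H"
        using 1(2) 2(2) by (simp add: merge_def)
      moreover have "Q (merge x (merge a1 a2))" using 1(3) 2(3) by (simp add: Q_def)
      moreover have "\<forall>y \<in> dom M. Q (merge (orb y) (merge b1 b2)) \<longrightarrow> (\<forall>P \<in> insert P F. P y)"
      proof (intro ballI impI)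
        fix y P' assume y: "y \<in> dom M" "Q (merge (orb y) (merge b1 b2))" "P' \<in> insert P F"
        then have "Q1 (merge (orb y) b1)" "Q2 (merge (orb y) b2)" by (simp_all add: Q_def)
        then show "P' y" using 1(4) 2(4) y(1,3) by auto
      qed
      ultimately show ?case by blast
    qed
    then obtain Q a b where Q: "defP {} Q" "\<forall>i. (a i, b i) \<in> H" "Q (merge x a)"
      "\<forall>y \<in> dom M. Q (merge (orb y) b) \<longrightarrow> (\<forall>P \<in> F. P y)" by blast
    from real[OF Q(1) spec[OF Q(2)] Q(3)] Q(4) show "\<exists>y \<in> dom M. \<forall>P \<in> F. P y" by blast
  qed
  then obtain y where y: "y \<in> dom M" "\<forall>P \<in> \<P>. P y" by blast
  have "El (H \<union> {(x k, orb y k) | k. True})"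
  proof (rule El_extend[OF H ne x orb[OF y(1)]])
    fix Q a b assume *: "defP {} Q" "\<And>i. (a i, b i) \<in> H" "Q (merge x a)"
    have "(\<lambda>y. Q (merge (orb y) b)) \<in> \<P>"
      unfolding \<P>_def mem_Collect_eq
      by (rule exI[of _ Q], rule exI[of _ a], rule exI[of _ b], intro conjI allI) (rule * refl)+
    from bspec[OF y(2) this] show "Q (merge (orb y) b)" .
  qed
  then show ?thesis using y(1) by blast
qed

end

context o_minimal_structure
begin

lemma El_extend_one:
  assumes H: "El H" "countable H" and ne: "(p, q) \<in> H" and x: "x \<in> dom M"
  shows "\<exists>y \<in> dom M. El (insert (x, y) H)"
proof -
  have "\<exists>y \<in> dom M. El (H \<union> {((\<lambda>_. x) k, (\<lambda>_. y) k) | k :: nat. True})"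
  proof (rule saturated_extension[OF H(1) ne, where orb = "\<lambda>y _. y"])
    fix \<P> :: "('m \<Rightarrow> bool) set"
    assume 1: "\<And>P. P \<in> \<P> \<Longrightarrow> \<exists>Q b. defP {} Q \<and> (\<forall>i. b i \<in> snd ` H) \<and>
        P = (\<lambda>y. Q (merge (\<lambda>_. y) b))"
      and 2: "\<And>F. finite F \<Longrightarrow> F \<subseteq> \<P> \<Longrightarrow> \<exists>y \<in> dom M. \<forall>P \<in> F. P y"
    show "\<exists>y \<in> dom M. \<forall>P \<in> \<P>. P y"
    proof (rule saturation[of "snd ` H", OF _ _ 2])
      show "countable (snd ` H)" using H(2) by simp
      fix P assume "P \<in> \<P>"
      from 1[OF this] obtain Q b where Q: "defP {} Q" "\<forall>i. b i \<in> snd ` H"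
        "P = (\<lambda>y. Q (merge (\<lambda>_. y) b))" by blast
      have bd: "b i \<in> dom M" for i using Q(2) El_dom[OF H(1)] by fastforce
      have "defP (snd ` H) (\<lambda>v. Q (gval (\<lambda>i. if even i then Inr 0 else Inl (b (i div 2))) v))"
      proof (rule defP_gval)
        show "defP (snd ` H) Q" using Q(1) by (rule defP_mono) simp
        show "(if even i then Inr 0 else Inl (b (i div 2))) \<in> gens (snd ` H)" for i
          using Q(2) bd by auto
      qed
      moreover have "gval (\<lambda>i. if even i then Inr 0 else Inl (b (i div 2))) v = merge (\<lambda>_. v 0) b" for v
        by (rule ext) (simp add: gval_def merge_def)
      ultimately show "defP (snd ` H) (\<lambda>v. P (v 0))" unfolding Q(3) by simp
    qed
  next
    fix Q a b assume Q: "defP {} Q" and ab: "\<And>i. (a i, b i) \<in> H" and Qa: "Q (merge (\<lambda>_. x) a)"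
    have "(\<lambda>i. u (if even i then 0 else Suc (i div 2))) = merge (\<lambda>_. u 0) (stail u)" for u :: "nat \<Rightarrow> 'm"
      by (rule ext) (simp add: merge_def)
    then have "defP {} (\<lambda>u. Q (merge (\<lambda>_. u 0) (stail u)))"
      using defP_ren[OF Q, of "\<lambda>i. if even i then 0 else Suc (i div 2)"] by (simp only:)
    then have "defP {} (\<lambda>u. \<exists>y \<in> dom M. Q (merge (\<lambda>_. y) u))" by (rule defP_ex)
    from El_imp[OF H(1) this, of a b] ab show "\<exists>y \<in> dom M. Q (merge (\<lambda>_. y) b)" using Qa x by blast
  qed (use x in simp_all)
  then obtain y where "y \<in> dom M" "El (H \<union> {((\<lambda>_. x) k, (\<lambda>_. y) k) | k :: nat. True})" by blast
  moreover have "H \<union> {((\<lambda>_. x) k, (\<lambda>_. y) k) | k :: nat. True} = insert (x, y) H" by auto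
  ultimately show ?thesis by auto
qed

lemma El_extend_finite:
  assumes H: "El H" "countable H" and ne: "(p, q) \<in> H" and x: "x \<in> Env"
  shows "\<exists>y. El (H \<union> (\<lambda>i. (x i, y i)) ` {..<n :: nat})"
proof (induction n)
  case 0
  then show ?case using H(1) by simp
next
  case (Suc n)
  then obtain y where y: "El (H \<union> (\<lambda>i. (x i, y i)) ` {..<n})" by blast
  have xn: "x n \<in> dom M" using x by simp
  have "(p, q) \<in> H \<union> (\<lambda>i. (x i, y i)) ` {..<n}" using ne by simp
  from El_extend_one[OF y _ this xn] obtain z where
    z: "El (insert (x n, z) (H \<union> (\<lambda>i. (x i, y i)) ` {..<n}))" using H(2) by auto
  have "(\<lambda>i. (x i, (y(n := z)) i)) ` {..<n} = (\<lambda>i. (x i, y i)) ` {..<n}"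
    by (intro image_cong) auto
  then have "(\<lambda>i. (x i, (y(n := z)) i)) ` {..<Suc n} = insert (x n, z) ((\<lambda>i. (x i, y i)) ` {..<n})"
    unfolding lessThan_Suc image_insert by simp
  then show ?case using z by (intro exI[of _ "y(n := z)"]) (simp only: Un_insert_right)
qed

text \<open>The entries of a finite list of infinite tuples form one infinite tuple; \<open>z\<close> is a filler.\<close>

definition pack :: "'m \<Rightarrow> ('i \<Rightarrow> nat \<Rightarrow> 'm) \<Rightarrow> 'i list \<Rightarrow> nat \<Rightarrow> 'm" where
  "pack z \<alpha> is k = (if fst (prod_decode k) < length is
     then \<alpha> (is ! fst (prod_decode k)) (snd (prod_decode k)) else z)"

text \<open>The terms of the sequence are infinite tuples so that a jet with derivatives of all
  orders can be one term.\<close>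

definition indisc ::
  "'m \<Rightarrow> ('i \<Rightarrow> nat \<Rightarrow> 'm) \<Rightarrow> ('i \<Rightarrow> 'i \<Rightarrow> bool) \<Rightarrow> 'm set \<Rightarrow> 'i set \<Rightarrow> bool" where
  "indisc z \<alpha> R B J \<longleftrightarrow> (\<forall>is js Q. set is \<subseteq> J \<longrightarrow> set js \<subseteq> J \<longrightarrow> sorted_wrt R is \<longrightarrow>
     sorted_wrt R js \<longrightarrow> length is = length js \<longrightarrow> defP B Q \<longrightarrow> Q (pack z \<alpha> is) = Q (pack z \<alpha> js))"

lemma indiscD: "indisc z \<alpha> R B J \<Longrightarrow> set is \<subseteq> J \<Longrightarrow> set js \<subseteq> J \<Longrightarrow> sorted_wrt R is \<Longrightarrow>
     sorted_wrt R js \<Longrightarrow> length is = length js \<Longrightarrow> defP B Q \<Longrightarrow> Q (pack z \<alpha> is) = Q (pack z \<alpha> js)"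
  unfolding indisc_def by blast

lemma indisc_mono: "indisc z \<alpha> R B J \<Longrightarrow> B' \<subseteq> B \<Longrightarrow> J' \<subseteq> J \<Longrightarrow> indisc z \<alpha> R B' J'"
  unfolding indisc_def by (metis defP_mono inf.coboundedI1 order_trans)

text \<open>The change of places that leaves out tuple number \<open>m\<close>: a packed list read
  through it is the packed list without that tuple.\<close>

definition skip :: "nat \<Rightarrow> nat \<Rightarrow> nat" where
  "skip m k = prod_encode (if fst (prod_decode k) < m then fst (prod_decode k)
     else Suc (fst (prod_decode k)), snd (prod_decode k))"

lemma pack_skip: "(\<lambda>k. pack z \<alpha> (xs @ x # ys) (skip (length xs) k)) = pack z \<alpha> (xs @ ys)"
proof
  fix k show "pack z \<alpha> (xs @ x # ys) (skip (length xs) k) = pack z \<alpha> (xs @ ys) k"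
    by (auto simp: pack_def skip_def nth_append Suc_diff_le)
qed

lemma pack_Env: "z \<in> dom M \<Longrightarrow> (\<And>i. i \<in> set is \<Longrightarrow> \<alpha> i \<in> Env) \<Longrightarrow> pack z \<alpha> is \<in> Env"
  by (rule EnvI) (simp add: pack_def)

text \<open>The breakpoints of the trace of \<open>Q\<close> at \<open>is1 @ [c1] @ is2\<close> are values \<open>G s\<close> of terms over \<open>B\<close>, and their
  position relative to \<open>e\<close> does not change when \<open>c1\<close> is replaced by \<open>c\<close> (facts \<open>sand\<close> and \<open>pos\<close>).\<close>

lemma indisc_swap:
  assumes \<alpha>: "z \<in> dom M" "\<And>i. i \<in> I \<Longrightarrow> \<alpha> i \<in> Env"
    and R: "transp R"
    and ind: "indisc z \<alpha> R B I" "indisc z \<alpha> R (insert e B) (I - {c})" and e: "e \<in> dom M"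
    and c: "R c1 c" "R c c2" "c1 \<in> I" "c2 \<in> I" "c \<in> I" "c1 \<noteq> c" "c2 \<noteq> c"
    and l1: "set is1 \<subseteq> I - {c}" "sorted_wrt R is1" "\<And>i. i \<in> set is1 \<Longrightarrow> R i c1"
    and l2: "set is2 \<subseteq> I - {c}" "sorted_wrt R is2" "\<And>i. i \<in> set is2 \<Longrightarrow> R c2 i"
    and Q: "defP (insert e B) Q"
  shows "Q (pack z \<alpha> (is1 @ [c] @ is2)) = Q (pack z \<alpha> (is1 @ [c1] @ is2))"
proof -
  have t: "R x y \<Longrightarrow> R y w \<Longrightarrow> R x w" for x y w using R by (meson transpE)
  have R1: "R i c" "R i c2" "R i c1" if "i \<in> set is1" for i using l1(3)[OF that] t c by blast+
  have R2: "R c i" "R c2 i" "R c1 i" if "i \<in> set is2" for i using l2(3)[OF that] t c by blast+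
  have c12: "R c1 c2" using t c by blast
  have R3: "R i j" if "i \<in> set is1" "j \<in> set is2" for i j using R1(1)[OF that(1)] R2(1)[OF that(2)] t by blast
  define w where "w x = pack z \<alpha> (is1 @ [x] @ is2)" for x
  have lI: "set is1 \<subseteq> I" "set is2 \<subseteq> I" using l1 l2 by auto
  have s1: "sorted_wrt R (is1 @ [x] @ is2)" if "x \<in> {c, c1, c2}" for x
    using that l1(2) l2(2) R1 R2 R3 by (auto simp: sorted_wrt_append)
  have s2: "sorted_wrt R (is1 @ [c1, c] @ is2)" "sorted_wrt R (is1 @ [c, c2] @ is2)"
    "sorted_wrt R (is1 @ [c1, c2] @ is2)"
    using l1(2) l2(2) R1 R2 R3 c(1,2) c12 by (auto simp: sorted_wrt_append)
  have wE: "w x \<in> Env" if "x \<in> I" for x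
    unfolding w_def using that lI \<alpha> by (intro pack_Env) auto
  have i1: "P (w x) = P (w y)" if "x \<in> {c, c1, c2}" "y \<in> {c, c1, c2}" "defP B P" for x y P
    unfolding w_def using that c lI s1 by (intro indiscD[OF ind(1)]) auto
  have i2: "P (w c1) = P (w c2)" if "defP (insert e B) P" for P
    unfolding w_def using that c l1(1) l2(1) s1 by (intro indiscD[OF ind(2)]) auto
  \<comment> \<open>The pairs \<open>(c1, c)\<close>, \<open>(c, c2)\<close> and
    \<open>(c1, c2)\<close> have the same relative position among the remaining indices, so
    \<open>F\<close> compares its two values in the same way for all three.\<close>
  have sand: "(F (w c1) = F (w c) \<and> F (w c) = F (w c2)) \<or>
     (F (w c1) \<sqsubset> F (w c) \<and> F (w c) \<sqsubset> F (w c2)) \<or>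
     (F (w c2) \<sqsubset> F (w c) \<and> F (w c) \<sqsubset> F (w c1))" if F: "defT B F" for F
  proof -
    let ?r1 = "\<lambda>u k. u (skip (Suc (length is1)) k)"
    let ?r2 = "\<lambda>u k. u (skip (length is1) k)"
    let ?p = "\<lambda>x y. pack z \<alpha> (is1 @ [x, y] @ is2)"
    have p1: "?r1 (?p x y) = w x" for x y
      using pack_skip[of z \<alpha> "is1 @ [x]" y is2] by (simp add: w_def)
    have p2: "?r2 (?p x y) = w y" for x y
      using pack_skip[of z \<alpha> "is1" x "y # is2"] by (simp add: w_def)
    have F1: "defT B (\<lambda>u. F (?r1 u))" and F2: "defT B (\<lambda>u. F (?r2 u))"
      by (rule defT_ren[OF F])+
    have d: "P (?p c1 c) = P (?p c c2)" "P (?p c c2) = P (?p c1 c2)" if "defP B P" for P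
      by (rule indiscD[OF ind(1) _ _ _ _ _ that]; use c lI s2 in simp)+
    note e1 = d[OF defP_lt[OF F1 F2], unfolded p1 p2]
    note e2 = d[OF defP_lt[OF F2 F1], unfolded p1 p2]
    note e3 = d[OF defP_eqT[OF F1 F2], unfolded p1 p2]
    have "F (w c1) \<in> dom M" "F (w c2) \<in> dom M" using defT_dom[OF F] wE c by blast+
    then show ?thesis using lt_total e1 e2 e3 by metis
  qed
  \<comment> \<open>Over \<open>e\<close> and \<open>B\<close> the indices \<open>c1\<close> and
    \<open>c2\<close> cannot be told apart, so both values lie on the same side of \<open>e\<close>,
    and the value at \<open>c\<close> lies between them.\<close>
  have pos: "(F (w c1) \<sqsubset> e \<longrightarrow> F (w c) \<sqsubset> e) \<and> (e \<sqsubset> F (w c1) \<longrightarrow> e \<sqsubset> F (w c)) \<and>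
    (F (w c1) = e \<longrightarrow> F (w c) = e)" if F: "defT B F" for F
  proof -
    have F': "defT (insert e B) F" using F by (rule defT_mono) auto
    have e': "defT (insert e B) (\<lambda>_. e)" using e by (intro defT_param) simp
    have "(F (w c1) \<sqsubset> e) = (F (w c2) \<sqsubset> e)" by (rule i2[OF defP_lt[OF F' e']])
    moreover have "(e \<sqsubset> F (w c1)) = (e \<sqsubset> F (w c2))" by (rule i2[OF defP_lt[OF e' F']])
    moreover have "(F (w c1) = e) = (F (w c2) = e)" by (rule i2[OF defP_eqT[OF F' e']])
    ultimately show ?thesis
      using sand[OF F] lt_trans[of "F (w c)" "F (w c1)" e] lt_trans[of "F (w c)" "F (w c2)" e]
        lt_trans[of e "F (w c1)" "F (w c)"] lt_trans[of e "F (w c2)" "F (w c)"] lt_irrefl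
        lt_trans[of "F (w c1)" "F (w c)" "F (w c2)"] lt_trans[of "F (w c2)" "F (w c)" "F (w c1)"] by metis
  qed
  have "defP (B \<union> {e}) Q" using Q by simp
  from defP_params[OF this] e obtain P s where P: "defP B P" "\<forall>i. s i \<in> {e} \<inter> dom M"
    "\<forall>v \<in> Env. Q v = P (merge s v)" by auto
  have "s = (\<lambda>_. e)" using P(2) by (intro ext) auto
  then have QP: "Q v = P (merge (\<lambda>_. e) v)" if "v \<in> Env" for v using P(3) that by simp
  define X where "X y = P (merge (\<lambda>_. y) (w c1))" for y
  have "defP (B \<union> range (w c1)) (\<lambda>v. P (gval (\<lambda>i. if even i then Inr 0 else Inl (w c1 (i div 2))) v))"
  proof (rule defP_gval)
    show "defP (B \<union> range (w c1)) P" using P(1) by (rule defP_mono) auto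
    show "(if even i then Inr 0 else Inl (w c1 (i div 2))) \<in> gens (B \<union> range (w c1))" for i
      using wE[OF c(3)] by auto
  qed
  moreover have "gval (\<lambda>i. if even i then Inr 0 else Inl (w c1 (i div 2))) v = merge (\<lambda>_. v 0) (w c1)" for v
    by (rule ext) (simp add: gval_def merge_def)
  ultimately have "defP (B \<union> range (w c1)) (\<lambda>v. X (v 0))" unfolding X_def by simp
  from breakpoints_in_dcl[OF this] obtain S where S: "finite S" "S \<subseteq> dcl (B \<union> range (w c1))"
    "\<forall>x y. x \<sqsubset> y \<longrightarrow> (\<forall>b \<in> S. b \<sqsubset> x \<or> y \<sqsubset> b) \<longrightarrow> X x = X y" by blast
  have "\<forall>s \<in> S. \<exists>F. defT B F \<and> F (w c1) = s" using dcl_function[OF _ wE[OF c(3)]] S(2) by blast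
  then obtain G where G: "\<And>s. s \<in> S \<Longrightarrow> defT B (G s) \<and> G s (w c1) = s" by metis
  define same where "same v y \<longleftrightarrow> (\<forall>s \<in> S. (s \<sqsubset> e \<longrightarrow> G s v \<sqsubset> y) \<and> (e \<sqsubset> s \<longrightarrow> y \<sqsubset> G s v) \<and>
    (s = e \<longrightarrow> y = G s v))" for v y
  \<comment> \<open>Neither \<open>e\<close> nor the breakpoints are parameters of
    \<open>\<Psi>\<close>: the relations between \<open>s\<close> and \<open>e\<close> and the truth
    value \<open>X e\<close> enter as constants. Therefore \<open>\<Psi>\<close> may be moved from
    \<open>c1\<close> to \<open>c\<close> over \<open>B\<close> alone.\<close>
  define \<Psi> where "\<Psi> v \<longleftrightarrow> (\<forall>y \<in> dom M. same v y \<longrightarrow> P (merge (\<lambda>_. y) v) = X e)" for v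
  have "defP B \<Psi>"
    unfolding \<Psi>_def same_def
  proof (rule defP_all, intro defP_imp defP_fin_ball defP_conj defP_iff)
    fix s assume s: "s \<in> S"
    have "defT B (\<lambda>v. G s (stail v))" using G[OF s] defT_ren[of B "G s" Suc] by simp
    then show "defP B (\<lambda>v. G s (stail v) \<sqsubset> v 0)" "defP B (\<lambda>v. v 0 \<sqsubset> G s (stail v))"
      "defP B (\<lambda>v. v 0 = G s (stail v))"
      by (intro defP_lt defP_eqT defT_var; assumption)+
  next
    have "(\<lambda>i. u (if even i then 0 else Suc (i div 2))) = merge (\<lambda>_. u 0) (stail u)" for u :: "nat \<Rightarrow> 'm"
      by (rule ext) (simp add: merge_def)
    then show "defP B (\<lambda>v. P (merge (\<lambda>_. v 0) (stail v)))"
      using defP_ren[OF P(1), of "\<lambda>i. if even i then 0 else Suc (i div 2)"] by (simp only:)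
  qed (rule S defP_const)+
  then have "\<Psi> (w c1) = \<Psi> (w c)" by (intro i1) auto
  moreover have "\<Psi> (w c1)"
    unfolding \<Psi>_def
  proof (intro ballI impI)
    fix y assume y: "y \<in> dom M" "same (w c1) y"
    have sm: "(s \<sqsubset> e \<longrightarrow> s \<sqsubset> y) \<and> (e \<sqsubset> s \<longrightarrow> y \<sqsubset> s) \<and> (s = e \<longrightarrow> y = s) \<and> s \<in> dom M"
      if "s \<in> S" for s
      using y(2) G[OF that] that S(2) dcl_dom unfolding same_def by auto
    consider "y \<sqsubset> e" | "y = e" | "e \<sqsubset> y" using lt_total y(1) e by blast
    then have "X y = X e"
    proof cases
      case 1
      have "s \<sqsubset> y \<or> e \<sqsubset> s" if "s \<in> S" for s using sm[OF that] lt_total[of s e] e 1 lt_irrefl by metis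
      then show ?thesis using S(3) 1 by blast
    next
      case 3
      have "s \<sqsubset> e \<or> y \<sqsubset> s" if "s \<in> S" for s using sm[OF that] lt_total[of s e] e 3 lt_irrefl by metis
      then show ?thesis using S(3) 3 by metis
    qed simp
    then show "P (merge (\<lambda>_. y) (w c1)) = X e" by (simp add: X_def)
  qed
  moreover have "same (w c) e"
    unfolding same_def using pos G by metis
  ultimately have "P (merge (\<lambda>_. e) (w c)) = X e" using e unfolding \<Psi>_def by blast
  then show ?thesis using QP wE c unfolding X_def w_def by blast
qed

text \<open>An increasing list through \<open>c\<close> is exchanged for the list in which
  \<open>c\<close> gives way to an index \<open>c1\<close> closer to \<open>c\<close> than its
  predecessors. Lists avoiding \<open>c\<close> are compared by the indiscernibility over the new
  parameter that is given for them.\<close>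

lemma indisc_insert:
  assumes \<alpha>: "z \<in> dom M" "\<And>i. i \<in> I \<Longrightarrow> \<alpha> i \<in> Env"
    and R: "transp R" "irreflp R"
    and ind: "indisc z \<alpha> R B I" "indisc z \<alpha> R (insert e B) (I - {c})" and e: "e \<in> dom M"
    and c: "c \<in> I"
    and lo: "\<And>S. finite S \<Longrightarrow> S \<subseteq> {i \<in> I. R i c} \<Longrightarrow> \<exists>j \<in> I. R j c \<and> (\<forall>i \<in> S. R i j)"
    and hi: "\<And>S. finite S \<Longrightarrow> S \<subseteq> {i \<in> I. R c i} \<Longrightarrow> \<exists>j \<in> I. R c j \<and> (\<forall>i \<in> S. R j i)"
  shows "indisc z \<alpha> R (insert e B) I"
proof -
  have irr: "\<not> R i i" for i using R(2) by (simp add: irreflp_def)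
  have swap: "\<exists>ks. set ks \<subseteq> I - {c} \<and> sorted_wrt R ks \<and> length ks = length is \<and>
    (\<forall>Q. defP (insert e B) Q \<longrightarrow> Q (pack z \<alpha> is) = Q (pack z \<alpha> ks))"
    if "set is \<subseteq> I" "sorted_wrt R is" for "is"
  proof (cases "c \<in> set is")
    case False
    then show ?thesis using that by blast
  next
    case True
    then obtain is1 is2 where l: "is = is1 @ c # is2" by (meson split_list)
    have s: "sorted_wrt R is1" "sorted_wrt R is2" "\<forall>i \<in> set is1. R i c" "\<forall>i \<in> set is2. R c i"
      "set is1 \<subseteq> I" "set is2 \<subseteq> I"
      using that unfolding l by (auto simp: sorted_wrt_append)
    have "set is1 \<subseteq> {i \<in> I. R i c}" "set is2 \<subseteq> {i \<in> I. R c i}" using s by auto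
    then obtain c1 c2 where c12: "c1 \<in> I" "R c1 c" "\<forall>i \<in> set is1. R i c1"
      "c2 \<in> I" "R c c2" "\<forall>i \<in> set is2. R c2 i"
      using lo[of "set is1"] hi[of "set is2"] by auto
    have ne: "c1 \<noteq> c" "c2 \<noteq> c" using c12 irr by auto
    have l1: "set is1 \<subseteq> I - {c}" and l2: "set is2 \<subseteq> I - {c}" using s irr by auto
    have "Q (pack z \<alpha> is) = Q (pack z \<alpha> (is1 @ [c1] @ is2))" if Q: "defP (insert e B) Q" for Q
    proof -
      have "Q (pack z \<alpha> (is1 @ [c] @ is2)) = Q (pack z \<alpha> (is1 @ [c1] @ is2))"
        by (rule indisc_swap[OF \<alpha> R(1) ind e c12(2,5,1,4) c ne l1 s(1) _ l2 s(2) _ Q])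
          (use c12 in simp_all)
      then show ?thesis by (simp add: l)
    qed
    moreover have "sorted_wrt R (is1 @ [c1] @ is2)"
    proof -
      have t: "R x y \<Longrightarrow> R y w \<Longrightarrow> R x w" for x y w using R(1) by (meson transpE)
      have "R c1 i" if "i \<in> set is2" for i using t[OF c12(2)] s(4) that by blast
      moreover have "R i j" if "i \<in> set is1" "j \<in> set is2" for i j using t s(3,4) that by blast
      ultimately show ?thesis using s c12 by (auto simp: sorted_wrt_append)
    qed
    moreover have "set (is1 @ [c1] @ is2) \<subseteq> I - {c}" using l1 l2 c12 ne by auto
    moreover have "length (is1 @ [c1] @ is2) = length is" by (simp add: l)
    ultimately show ?thesis by blast
  qed
  show ?thesis
    unfolding indisc_def
  proof (intro allI impI)
    fix "is" js Q
    assume *: "set is \<subseteq> I" "set js \<subseteq> I" "sorted_wrt R is" "sorted_wrt R js" "length is = length js"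
      and Q: "defP (insert e B) Q"
    obtain ks where k: "set ks \<subseteq> I - {c}" "sorted_wrt R ks" "length ks = length is"
      "Q (pack z \<alpha> is) = Q (pack z \<alpha> ks)" using swap[OF *(1,3)] Q by blast
    obtain ls where l: "set ls \<subseteq> I - {c}" "sorted_wrt R ls" "length ls = length js"
      "Q (pack z \<alpha> js) = Q (pack z \<alpha> ls)" using swap[OF *(2,4)] Q by blast
    have "Q (pack z \<alpha> ks) = Q (pack z \<alpha> ls)"
      using indiscD[OF ind(2) k(1) l(1) k(2) l(2) _ Q] k(3) l(3) *(5) by simp
    then show "Q (pack z \<alpha> is) = Q (pack z \<alpha> js)" using k(4) l(4) by simp
  qed
qed

text \<open>A predicate uses finitely many parameters. At each stage the full sequence is already
  indiscernible over the parameters present, which is what the one-parameter step requires besides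
  indiscernibility away from \<open>c\<close>.\<close>

lemma indisc_distal:
  assumes \<alpha>: "z \<in> dom M" "\<And>i. i \<in> I \<Longrightarrow> \<alpha> i \<in> Env"
    and R: "transp R" "irreflp R"
    and ind: "indisc z \<alpha> R {} I" "indisc z \<alpha> R B (I - {c})"
    and c: "c \<in> I"
    and lo: "\<And>S. finite S \<Longrightarrow> S \<subseteq> {i \<in> I. R i c} \<Longrightarrow> \<exists>j \<in> I. R j c \<and> (\<forall>i \<in> S. R i j)"
    and hi: "\<And>S. finite S \<Longrightarrow> S \<subseteq> {i \<in> I. R c i} \<Longrightarrow> \<exists>j \<in> I. R c j \<and> (\<forall>i \<in> S. R j i)"
    and B: "B \<subseteq> dom M"
  shows "indisc z \<alpha> R B I"
proof -
  have fin: "indisc z \<alpha> R C I" if "finite C" "C \<subseteq> B" for C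
    using that
  proof (induction C rule: finite_induct)
    case (insert e C)
    have 1: "indisc z \<alpha> R C I" using insert by blast
    have 2: "indisc z \<alpha> R (insert e C) (I - {c})"
      using indisc_mono[OF ind(2)] insert.prems by blast
    have 3: "e \<in> dom M" using insert.prems B by blast
    show ?case by (rule indisc_insert[where c = c]) (fact \<alpha> R c lo hi 1 2 3)+
  qed (rule ind(1))
  show ?thesis
    unfolding indisc_def
  proof (intro allI impI)
    fix "is" js Q
    assume *: "set is \<subseteq> I" "set js \<subseteq> I" "sorted_wrt R is" "sorted_wrt R js" "length is = length js"
      and Q: "defP B Q"
    obtain C where C: "finite C" "C \<subseteq> B" "defP C Q" using defP_finite_params[OF Q] by blast
    show "Q (pack z \<alpha> is) = Q (pack z \<alpha> js)" by (rule indiscD[OF fin[OF C(1,2)] * C(3)])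
  qed
qed

end

section \<open>Derivatives at generic points\<close>

context o_minimal_structure
begin

text \<open>The breakpoints other than \<open>x\<close> leave a gap around it. The point
  \<open>x\<close> may itself be a breakpoint, which does no harm to its right side.\<close>

lemma eventually_right:
  assumes "defP A (\<lambda>v. P (v 0))" "x \<in> dom M"
  shows "\<exists>p b. x \<sqsubset> p \<and> (\<forall>y. x \<sqsubset> y \<longrightarrow> y \<sqsubset> p \<longrightarrow> P y = b)"
proof -
  obtain B where B: "finite B" "B \<subseteq> dcl A"
    "\<forall>x y. x \<sqsubset> y \<longrightarrow> (\<forall>b \<in> B. b \<sqsubset> x \<or> y \<sqsubset> b) \<longrightarrow> P x = P y"
    using breakpoints_in_dcl[OF assms(1)] by blast
  have "finite (B - {x})" "B - {x} \<subseteq> dom M" "x \<notin> B - {x}" using B(1,2) dcl_dom by auto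
  from gap[OF this(1,2) assms(2) this(3)] obtain p q where
    pq: "p \<sqsubset> x" "x \<sqsubset> q" "\<forall>b \<in> B - {x}. b \<sqsubset> p \<or> q \<sqsubset> b" by blast
  have eq: "P y = P z" if yz: "x \<sqsubset> y" "y \<sqsubset> z" "z \<sqsubset> q" for y z
  proof -
    have "b \<sqsubset> y \<or> z \<sqsubset> b" if "b \<in> B" for b
    proof (cases "b = x")
      case False
      then have "b \<sqsubset> p \<or> q \<sqsubset> b" using pq(3) that by blast
      then show ?thesis
        using lt_trans[of b p y] lt_trans[OF pq(1) yz(1)] lt_trans[OF yz(3), of b] by blast
    qed (use yz in simp)
    then show ?thesis using B(3) yz(2) by blast
  qed
  obtain m where m: "x \<sqsubset> m" "m \<sqsubset> q" using lt_dense pq(2) by blast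
  have "P y = P m" if "x \<sqsubset> y" "y \<sqsubset> q" for y
    using eq[OF m(1) _ that(2)] eq[OF that(1) _ m(2)] lt_total[of y m] lt_dom that(1) m(1) by metis
  then show ?thesis using pq(2) by blast
qed

lemma eventually_left:
  assumes "defP A (\<lambda>v. P (v 0))" "x \<in> dom M"
  shows "\<exists>p b. p \<sqsubset> x \<and> (\<forall>y. p \<sqsubset> y \<longrightarrow> y \<sqsubset> x \<longrightarrow> P y = b)"
proof -
  obtain B where B: "finite B" "B \<subseteq> dcl A"
    "\<forall>x y. x \<sqsubset> y \<longrightarrow> (\<forall>b \<in> B. b \<sqsubset> x \<or> y \<sqsubset> b) \<longrightarrow> P x = P y"
    using breakpoints_in_dcl[OF assms(1)] by blast
  have "finite (B - {x})" "B - {x} \<subseteq> dom M" "x \<notin> B - {x}" using B(1,2) dcl_dom by auto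
  from gap[OF this(1,2) assms(2) this(3)] obtain p q where
    pq: "p \<sqsubset> x" "x \<sqsubset> q" "\<forall>b \<in> B - {x}. b \<sqsubset> p \<or> q \<sqsubset> b" by blast
  have eq: "P y = P z" if yz: "p \<sqsubset> y" "y \<sqsubset> z" "z \<sqsubset> x" for y z
  proof -
    have "b \<sqsubset> y \<or> z \<sqsubset> b" if "b \<in> B" for b
    proof (cases "b = x")
      case False
      then have "b \<sqsubset> p \<or> q \<sqsubset> b" using pq(3) that by blast
      then show ?thesis
        using lt_trans[OF _ yz(1), of b] lt_trans[OF lt_trans[OF yz(3) pq(2)], of b] by blast
    qed (use yz in simp)
    then show ?thesis using B(3) yz(2) by blast
  qed
  obtain m where m: "p \<sqsubset> m" "m \<sqsubset> x" using lt_dense pq(1) by blast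
  have "P y = P m" if "p \<sqsubset> y" "y \<sqsubset> x" for y
    using eq[OF m(1) _ that(2)] eq[OF that(1) _ m(2)] lt_total[of y m] lt_dom that(1) m(1) by metis
  then show ?thesis using pq(1) by blast
qed

text \<open>Definable completeness: by connectedness a lower set that is neither empty nor
  everything has a boundary point, and this is its supremum.\<close>

lemma definable_cut:
  assumes P: "defP A (\<lambda>v. P (v 0))" and "P a" "\<not> P b" "a \<in> dom M" "b \<in> dom M"
    and down: "\<And>x y. x \<sqsubset> y \<Longrightarrow> P y \<Longrightarrow> P x"
  shows "\<exists>D \<in> dom M. (\<forall>c. c \<sqsubset> D \<longrightarrow> P c) \<and> (\<forall>c. D \<sqsubset> c \<longrightarrow> \<not> P c)"
proof -
  have ab: "a \<sqsubset> b" using assms lt_total[of a b] by blast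
  have "\<exists>D \<in> dom M. \<not> const_near P D"
    using const_near_connected[OF P ab] assms(2,3) by blast
  then obtain D where D: "D \<in> dom M" "\<not> const_near P D" by blast
  have 1: "P c" if "c \<sqsubset> D" for c
  proof (rule ccontr)
    assume c: "\<not> P c"
    obtain d where d: "D \<sqsubset> d" using lt_above D(1) by blast
    have "\<forall>z. c \<sqsubset> z \<longrightarrow> z \<sqsubset> d \<longrightarrow> P z = P D" using c that down by blast
    then show False using D(2) that d unfolding const_near_def by blast
  qed
  have 2: "\<not> P c" if "D \<sqsubset> c" for c
  proof
    assume c: "P c"
    obtain d where d: "d \<sqsubset> D" using lt_below D(1) by blast
    have "\<forall>z. d \<sqsubset> z \<longrightarrow> z \<sqsubset> c \<longrightarrow> P z = P D" using c that down by blast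
    then show False using D(2) that d unfolding const_near_def by blast
  qed
  show ?thesis using D(1) 1 2 by blast
qed

end

text \<open>The calculus uses two facts about secants: symmetry in the end points, and the mediant
  property that a secant over two adjacent intervals lies between the secants of its parts. Field
  arithmetic is confined to the verification of these facts. \<open>org\<close> is a definable point
  that serves as filler.\<close>

locale o_minimal_slope = o_minimal_structure L M lt
  for L :: "('f, 'r, 'z) lang_scheme" and M :: "('m, 'f, 'r) struct"
    and lt :: "'m \<Rightarrow> 'm \<Rightarrow> bool" (infix "\<sqsubset>" 50) +
  fixes slope :: "'m \<Rightarrow> 'm \<Rightarrow> 'm \<Rightarrow> 'm \<Rightarrow> 'm" and org :: 'm
  assumes slope_def: "defT {} (\<lambda>v. slope (v 0) (v 1) (v 2) (v 3))"
    and slope_sym: "\<lbrakk>x \<in> dom M; y \<in> dom M; a \<in> dom M; b \<in> dom M; x \<noteq> y\<rbrakk> \<Longrightarrow>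
      slope x a y b = slope y b x a"
    and slope_gt: "\<lbrakk>x \<sqsubset> y; y \<sqsubset> z; a \<in> dom M; b \<in> dom M; d \<in> dom M; c \<sqsubset> slope x a y b;
      c \<sqsubset> slope y b z d\<rbrakk> \<Longrightarrow> c \<sqsubset> slope x a z d"
    and slope_lt: "\<lbrakk>x \<sqsubset> y; y \<sqsubset> z; a \<in> dom M; b \<in> dom M; d \<in> dom M; slope x a y b \<sqsubset> c;
      slope y b z d \<sqsubset> c\<rbrakk> \<Longrightarrow> slope x a z d \<sqsubset> c"
    and org: "org \<in> dcl {}"
begin

section \<open>Secant slopes and derivatives in one variable\<close>

lemma org_dom: "org \<in> dom M"
  using org dcl_dom by blast

lemma defT_slope:
  assumes "defT A s" "defT A t" "defT A s'" "defT A t'"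
  shows "defT A (\<lambda>v. slope (s v) (t v) (s' v) (t' v))"
proof -
  have 1: "defT A (\<lambda>v. slope (v 0) (v 1) (v 2) (v 3))" by (rule defT_mono[OF slope_def]) simp
  define \<sigma> where "\<sigma> i = (if i = 0 then s else if i = 1 then t else if i = 2 then s' else t')"
    for i :: nat
  have "defT A (\<sigma> i)" for i using assms by (simp add: \<sigma>_def)
  from defT_subst[OF 1, of \<sigma>, OF this]
  have "defT A (\<lambda>v. slope (\<sigma> 0 v) (\<sigma> 1 v) (\<sigma> 2 v) (\<sigma> 3 v))" .
  then show ?thesis by (simp add: \<sigma>_def)
qed

text \<open>The flag \<open>s\<close> chooses the direction of the comparison, so that bounds from
  below and from above share their proofs.\<close>

definition cmp :: "bool \<Rightarrow> 'm \<Rightarrow> 'm \<Rightarrow> bool" where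
  "cmp s c d \<longleftrightarrow> (if s then c \<sqsubset> d else d \<sqsubset> c)"

lemma cmp_anti: "cmp s c d \<Longrightarrow> \<not> cmp (\<not> s) c d"
  using lt_trans[of c d c] lt_trans[of d c d] lt_irrefl[of c] lt_irrefl[of d]
  by (cases s) (simp_all add: cmp_def, blast+)

lemma cmp_irrefl: "\<not> cmp s c c"
  using lt_irrefl by (simp add: cmp_def)

lemma cmp_trans: "cmp s c d \<Longrightarrow> cmp s d e \<Longrightarrow> cmp s c e"
  using lt_trans[of c d e] lt_trans[of e d c] by (cases s) (simp_all add: cmp_def)

lemma defP_cmp: "defT A s \<Longrightarrow> defT A t \<Longrightarrow> defP A (\<lambda>v. cmp b (s v) (t v))"
  unfolding cmp_def by (cases b) (auto intro: defP_lt)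

definition sl :: "('m \<Rightarrow> 'm) \<Rightarrow> 'm \<Rightarrow> 'm \<Rightarrow> 'm" where
  "sl g x y = slope x (g x) y (g y)"

definition near_right :: "('m \<Rightarrow> 'm) \<Rightarrow> bool \<Rightarrow> 'm \<Rightarrow> 'm \<Rightarrow> bool" where
  "near_right g s c x \<longleftrightarrow> (\<exists>p \<in> dom M. x \<sqsubset> p \<and> (\<forall>y \<in> dom M. x \<sqsubset> y \<longrightarrow> y \<sqsubset> p \<longrightarrow> cmp s c (sl g x y)))"

definition near_left :: "('m \<Rightarrow> 'm) \<Rightarrow> bool \<Rightarrow> 'm \<Rightarrow> 'm \<Rightarrow> bool" where
  "near_left g s c x \<longleftrightarrow> (\<exists>p \<in> dom M. p \<sqsubset> x \<and> (\<forall>y \<in> dom M. p \<sqsubset> y \<longrightarrow> y \<sqsubset> x \<longrightarrow> cmp s c (sl g x y)))"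

text \<open>\<open>deriv g x D\<close>: the derivative of \<open>g\<close> at \<open>x\<close> is \<open>D\<close>, expressed by comparing secant slopes
  with constants.\<close>

definition deriv :: "('m \<Rightarrow> 'm) \<Rightarrow> 'm \<Rightarrow> 'm \<Rightarrow> bool" where
  "deriv g x D \<longleftrightarrow> (\<forall>c \<in> dom M.
     (c \<sqsubset> D \<longrightarrow> near_right g True c x \<and> near_left g True c x) \<and>
     (D \<sqsubset> c \<longrightarrow> near_right g False c x \<and> near_left g False c x))"

context
  fixes A :: "'m set" and G :: "(nat \<Rightarrow> 'm) \<Rightarrow> 'm \<Rightarrow> 'm"
  assumes G: "defT A (\<lambda>u. G (stail u) (u 0))"
begin

lemma defT_G: "defT A (\<lambda>v. G (\<lambda>i. v (f i)) (v j))"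
  using defT_ren[OF G, of "case_nat j f"] by simp

lemma defP_near_right: "defP A (\<lambda>v. near_right (G (\<lambda>i. v (f i))) s (v j) (v k))"
  unfolding near_right_def sl_def
  by (intro defP_ex defP_conj defP_all defP_imp defP_lt defP_cmp defT_slope defT_var
      defT_G[of "\<lambda>i. Suc (Suc (f i))"])

lemma defP_near_left: "defP A (\<lambda>v. near_left (G (\<lambda>i. v (f i))) s (v j) (v k))"
  unfolding near_left_def sl_def
  by (intro defP_ex defP_conj defP_all defP_imp defP_lt defP_cmp defT_slope defT_var
      defT_G[of "\<lambda>i. Suc (Suc (f i))"])

lemma defP_deriv: "defP A (\<lambda>v. deriv (G (\<lambda>i. v (f i))) (v j) (v k))"
  unfolding deriv_def
  by (intro defP_conj defP_all defP_imp defP_lt defT_var defP_near_right[of "\<lambda>i. Suc (f i)"]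
      defP_near_left[of "\<lambda>i. Suc (f i)"])

end

text \<open>For a slope strictly between two derivatives, secants to the right of \<open>x\<close>
  would lie on both sides of it.\<close>

lemma deriv_unique:
  assumes "deriv g x D" "deriv g x D'" "D \<in> dom M" "D' \<in> dom M"
  shows "D = D'"
proof -
  have F: False if D: "deriv g x D" "deriv g x D'" "D \<sqsubset> D'" for D D'
  proof -
    obtain c where c: "D \<sqsubset> c" "c \<sqsubset> D'" using lt_dense D(3) by blast
    have cd: "c \<in> dom M" using c lt_dom by blast
    have "near_right g True c x" "near_right g False c x"
      using D c cd unfolding deriv_def by blast+
    then obtain p q where p: "x \<sqsubset> p" "\<forall>y \<in> dom M. x \<sqsubset> y \<longrightarrow> y \<sqsubset> p \<longrightarrow> cmp True c (sl g x y)"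
      and q: "x \<sqsubset> q" "\<forall>y \<in> dom M. x \<sqsubset> y \<longrightarrow> y \<sqsubset> q \<longrightarrow> cmp False c (sl g x y)"
      unfolding near_right_def by blast
    obtain y where y: "y \<sqsubset> p" "y \<sqsubset> q" "x \<sqsubset> y" using lt_min[OF p(1) q(1)] by blast
    then have "cmp True c (sl g x y)" "cmp False c (sl g x y)" using p(2) q(2) lt_dom by blast+
    then show False using cmp_anti[of True c "sl g x y"] by simp
  qed
  show ?thesis using F[OF assms(1,2)] F[OF assms(2,1)] lt_total assms(3,4) by blast
qed

context
  fixes A :: "'m set" and g :: "'m \<Rightarrow> 'm"
  assumes cA: "countable A" and g: "\<And>i. defT A (\<lambda>v. g (v i))"
begin

lemma g_dom: "x \<in> dom M \<Longrightarrow> g x \<in> dom M"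
  using defT_dom[OF g, of "\<lambda>_. x"] by simp

lemma sl_dom: "x \<in> dom M \<Longrightarrow> y \<in> dom M \<Longrightarrow> sl g x y \<in> dom M"
proof -
  assume d: "x \<in> dom M" "y \<in> dom M"
  let ?v = "\<lambda>i :: nat. if i = 0 then x else if i = 1 then g x else if i = 2 then y else g y"
  have "?v \<in> Env" using d g_dom by (intro EnvI) simp
  from defT_dom[OF slope_def this] show ?thesis by (simp add: sl_def)
qed

lemma sl_sym: "x \<in> dom M \<Longrightarrow> y \<in> dom M \<Longrightarrow> x \<noteq> y \<Longrightarrow> sl g x y = sl g y x"
  unfolding sl_def by (rule slope_sym) (simp_all add: g_dom)

lemma sl_mediant: "x \<sqsubset> y \<Longrightarrow> y \<sqsubset> z \<Longrightarrow> cmp s c (sl g x y) \<Longrightarrow> cmp s c (sl g y z) \<Longrightarrow> cmp s c (sl g x z)"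
proof -
  assume *: "x \<sqsubset> y" "y \<sqsubset> z" "cmp s c (sl g x y)" "cmp s c (sl g y z)"
  have "g x \<in> dom M" "g y \<in> dom M" "g z \<in> dom M" using g_dom lt_dom *(1,2) by blast+
  then show ?thesis
    using * slope_gt[OF *(1,2), of "g x" "g y" "g z" c] slope_lt[OF *(1,2), of "g x" "g y" "g z" c]
    by (cases s) (auto simp: cmp_def sl_def)
qed

lemma defP_sl_near:
  "defP A (\<lambda>v. near_right g s (v j) (v k))" "defP A (\<lambda>v. near_left g s (v j) (v k))"
  using defP_near_right[of A "\<lambda>_. g", OF g] defP_near_left[of A "\<lambda>_. g", OF g] by blast+

lemma defP_sl: "defP (insert c (insert x A)) (\<lambda>v. cmp s c (sl g x (v 0)))"
  if "x \<in> dom M" "c \<in> dom M"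
proof -
  have "defT (insert x A) (\<lambda>_. g x)"
    using defT_subst[OF defT_mono[OF g[of 0]], of "insert x A" "\<lambda>_ _. x"] that(1) defT_param[of x "insert x A"] by auto
  then have "defT (insert c (insert x A)) (\<lambda>_. g x)" by (rule defT_mono) auto
  moreover have "defT (insert c (insert x A)) (\<lambda>v. g (v 0))" by (rule defT_mono[OF g]) auto
  moreover have "defT (insert c (insert x A)) (\<lambda>_. c)" "defT (insert c (insert x A)) (\<lambda>_. x)"
    using that by (auto intro: defT_param)
  ultimately show ?thesis unfolding sl_def by (intro defP_cmp defT_slope defT_var)
qed

text \<open>The secants near \<open>x\<close> are eventually above, below or equal to
  \<open>c\<close>. In the third case \<open>c\<close> is the only such slope, hence definable from
  \<open>x\<close> over \<open>A\<close>, contrary to its choice.\<close>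

lemma near_right_dichotomy:
  assumes c: "c \<in> dom M" "c \<notin> dcl (insert x A)" and x: "x \<in> dom M"
  shows "near_right g True c x \<or> near_right g False c x"
proof (rule ccontr)
  assume no: "\<not> ?thesis"
  obtain p1 b1 where 1: "x \<sqsubset> p1" "\<forall>y. x \<sqsubset> y \<longrightarrow> y \<sqsubset> p1 \<longrightarrow> cmp True c (sl g x y) = b1"
    using eventually_right[OF defP_sl[OF x c(1)] x] by blast
  obtain p2 b2 where 2: "x \<sqsubset> p2" "\<forall>y. x \<sqsubset> y \<longrightarrow> y \<sqsubset> p2 \<longrightarrow> cmp False c (sl g x y) = b2"
    using eventually_right[OF defP_sl[OF x c(1)] x] by blast
  have "\<not> b1" "\<not> b2" using no 1 2 lt_dom unfolding near_right_def by blast+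
  obtain p where p: "p \<sqsubset> p1" "p \<sqsubset> p2" "x \<sqsubset> p" using lt_min[OF 1(1) 2(1)] by blast
  have pd: "p \<in> dom M" using p lt_dom by blast
  have sc: "sl g x y = c" if y: "x \<sqsubset> y" "y \<sqsubset> p" for y
  proof -
    have "\<not> cmp True c (sl g x y)" "\<not> cmp False c (sl g x y)"
      using 1(2) 2(2) \<open>\<not> b1\<close> \<open>\<not> b2\<close> y lt_trans[OF y(2) p(1)] lt_trans[OF y(2) p(2)] by blast+
    moreover have "sl g x y \<in> dom M" using sl_dom x y lt_dom by blast
    ultimately show ?thesis using lt_total[of c "sl g x y"] c(1) by (auto simp: cmp_def)
  qed
  let ?Q = "\<lambda>c'. \<exists>p \<in> dom M. x \<sqsubset> p \<and> (\<forall>y \<in> dom M. x \<sqsubset> y \<longrightarrow> y \<sqsubset> p \<longrightarrow> sl g x y = c')"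
  have gx: "defT (insert x A) (\<lambda>_. g x)"
    using defT_subst[OF defT_mono[OF g[of 0]], of "insert x A" "\<lambda>_ _. x"] x defT_param[of x "insert x A"] by auto
  have xx: "defT (insert x A) (\<lambda>_. x)" using x by (intro defT_param) auto
  have gg: "defT (insert x A) (\<lambda>v. g (v i))" for i by (rule defT_mono[OF g]) auto
  have "defP (insert x A) (\<lambda>v. ?Q (v 0))"
    unfolding sl_def
    by (intro defP_ex defP_conj defP_all defP_imp defP_lt defP_eqT defT_slope defT_var gx xx gg)
  moreover have "c' = c" if c': "?Q c'" for c'
  proof -
    obtain q where q: "x \<sqsubset> q" "\<forall>y \<in> dom M. x \<sqsubset> y \<longrightarrow> y \<sqsubset> q \<longrightarrow> sl g x y = c'" using c' by blast
    obtain y where y: "y \<sqsubset> p" "y \<sqsubset> q" "x \<sqsubset> y" using lt_min[OF p(3) q(1)] by blast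
    then show ?thesis using sc q(2) lt_dom by metis
  qed
  then have "{c' \<in> dom M. ?Q c'} \<subseteq> {c}" by blast
  then have "finite {c' \<in> dom M. ?Q c'}" by (rule finite_subset) simp
  moreover have "?Q c" using p(3) pd sc by blast
  ultimately show False using finite_in_dcl[of "insert x A" ?Q c] c by blast
qed

lemma near_left_dichotomy:
  assumes c: "c \<in> dom M" "c \<notin> dcl (insert x A)" and x: "x \<in> dom M"
  shows "near_left g True c x \<or> near_left g False c x"
proof (rule ccontr)
  assume no: "\<not> ?thesis"
  obtain p1 b1 where 1: "p1 \<sqsubset> x" "\<forall>y. p1 \<sqsubset> y \<longrightarrow> y \<sqsubset> x \<longrightarrow> cmp True c (sl g x y) = b1"
    using eventually_left[OF defP_sl[OF x c(1)] x] by blast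
  obtain p2 b2 where 2: "p2 \<sqsubset> x" "\<forall>y. p2 \<sqsubset> y \<longrightarrow> y \<sqsubset> x \<longrightarrow> cmp False c (sl g x y) = b2"
    using eventually_left[OF defP_sl[OF x c(1)] x] by blast
  have "\<not> b1" "\<not> b2" using no 1 2 lt_dom unfolding near_left_def by blast+
  obtain p where p: "p1 \<sqsubset> p" "p2 \<sqsubset> p" "p \<sqsubset> x" using lt_max[OF 1(1) 2(1)] by blast
  have pd: "p \<in> dom M" using p lt_dom by blast
  have sc: "sl g x y = c" if y: "p \<sqsubset> y" "y \<sqsubset> x" for y
  proof -
    have "\<not> cmp True c (sl g x y)" "\<not> cmp False c (sl g x y)"
      using 1(2) 2(2) \<open>\<not> b1\<close> \<open>\<not> b2\<close> y lt_trans[OF p(1) y(1)] lt_trans[OF p(2) y(1)] by blast+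
    moreover have "sl g x y \<in> dom M" using sl_dom x y lt_dom by blast
    ultimately show ?thesis using lt_total[of c "sl g x y"] c(1) by (auto simp: cmp_def)
  qed
  let ?Q = "\<lambda>c'. \<exists>p \<in> dom M. p \<sqsubset> x \<and> (\<forall>y \<in> dom M. p \<sqsubset> y \<longrightarrow> y \<sqsubset> x \<longrightarrow> sl g x y = c')"
  have gx: "defT (insert x A) (\<lambda>_. g x)"
    using defT_subst[OF defT_mono[OF g[of 0]], of "insert x A" "\<lambda>_ _. x"] x defT_param[of x "insert x A"] by auto
  have xx: "defT (insert x A) (\<lambda>_. x)" using x by (intro defT_param) auto
  have gg: "defT (insert x A) (\<lambda>v. g (v i))" for i by (rule defT_mono[OF g]) auto
  have "defP (insert x A) (\<lambda>v. ?Q (v 0))"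
    unfolding sl_def
    by (intro defP_ex defP_conj defP_all defP_imp defP_lt defP_eqT defT_slope defT_var gx xx gg)
  moreover have "c' = c" if c': "?Q c'" for c'
  proof -
    obtain q where q: "q \<sqsubset> x" "\<forall>y \<in> dom M. q \<sqsubset> y \<longrightarrow> y \<sqsubset> x \<longrightarrow> sl g x y = c'" using c' by blast
    obtain y where y: "p \<sqsubset> y" "q \<sqsubset> y" "y \<sqsubset> x" using lt_max[OF p(3) q(1)] by blast
    then show ?thesis using sc q(2) lt_dom by metis
  qed
  then have "{c' \<in> dom M. ?Q c'} \<subseteq> {c}" by blast
  then have "finite {c' \<in> dom M. ?Q c'}" by (rule finite_subset) simp
  moreover have "?Q c" using p(3) pd sc by blast
  ultimately show False using finite_in_dcl[of "insert x A" ?Q c] c by blast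
qed

text \<open>Otherwise every point near \<open>x\<close> would be a strict local extremum of \<open>g\<close> minus the linear
  function of slope \<open>c\<close>, with a uniform radius.\<close>

lemma one_sided_agree:
  assumes x: "x \<in> dom M" "x \<notin> dcl (insert c A)" and c: "c \<in> dom M"
  shows "\<not> (near_right g s c x \<and> near_left g (\<not> s) c x)"
proof
  assume "near_right g s c x \<and> near_left g (\<not> s) c x"
  then obtain p r where r: "x \<sqsubset> r" "\<forall>y \<in> dom M. x \<sqsubset> y \<longrightarrow> y \<sqsubset> r \<longrightarrow> cmp s c (sl g x y)"
    and p: "p \<sqsubset> x" "\<forall>y \<in> dom M. p \<sqsubset> y \<longrightarrow> y \<sqsubset> x \<longrightarrow> cmp (\<not> s) c (sl g x y)"
    unfolding near_right_def near_left_def by blast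
  have cc: "countable (insert c A)" using cA by simp
  have "indep (insert c A) (\<lambda>_. x) 1" using x by (simp add: indep_def)
  \<comment> \<open>The radius is made uniform by endpoints over which \<open>x\<close> is still
    generic; these are parameters of \<open>W\<close>.\<close>
  from generic_interval_endpoints[OF cc this p(1) r(1)] obtain p' r' where
    pr: "p \<sqsubset> p'" "p' \<sqsubset> x" "x \<sqsubset> r'" "r' \<sqsubset> r" "indep (insert r' (insert p' (insert c A))) (\<lambda>_. x) 1"
    by blast
  let ?A = "insert r' (insert p' (insert c A))"
  have nx: "x \<notin> dcl ?A" using pr(5) by (simp add: indep_def)
  define W where "W t \<longleftrightarrow> (\<forall>y \<in> dom M. t \<sqsubset> y \<longrightarrow> y \<sqsubset> r' \<longrightarrow> cmp s c (sl g t y)) \<and>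
    (\<forall>y \<in> dom M. p' \<sqsubset> y \<longrightarrow> y \<sqsubset> t \<longrightarrow> cmp (\<not> s) c (sl g t y))" for t
  have gg: "defT ?A (\<lambda>v. g (v i))" for i by (rule defT_mono[OF g]) auto
  have pp: "defT ?A (\<lambda>_. r')" "defT ?A (\<lambda>_. p')" "defT ?A (\<lambda>_. c)"
    using pr lt_dom c by (auto intro!: defT_param)
  have "defP ?A (\<lambda>v. W (v 0))"
    unfolding W_def sl_def
    by (intro defP_conj defP_all defP_imp defP_lt defP_cmp defT_slope defT_var gg pp)
  from const_near_generic[OF this x(1) nx] obtain a b where
    ab: "a \<sqsubset> x" "x \<sqsubset> b" "\<forall>t. a \<sqsubset> t \<longrightarrow> t \<sqsubset> b \<longrightarrow> W t = W x"
    unfolding const_near_def by blast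
  have Wx: "W x" unfolding W_def using r(2) p(2) lt_trans[OF _ pr(4)] lt_trans[OF pr(1)] by blast
  \<comment> \<open>With \<open>W\<close> true at \<open>x\<close> and at a point \<open>t\<close>
    to its right, the secant between them would lie on side \<open>s\<close> of \<open>c\<close> as
    seen from \<open>x\<close> and on the other side as seen from \<open>t\<close>.\<close>
  obtain t where t: "t \<sqsubset> b" "t \<sqsubset> r'" "x \<sqsubset> t" using lt_min[OF ab(2) pr(3)] by blast
  have td: "t \<in> dom M" using t lt_dom by blast
  have "W t" using ab(3) Wx t(1) lt_trans[OF ab(1) t(3)] by blast
  then have 1: "cmp (\<not> s) c (sl g t x)" unfolding W_def using x(1) pr(2) t(3) by blast
  have 2: "cmp s c (sl g x t)" using Wx unfolding W_def using td t(2,3) by blast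
  have "x \<noteq> t" using t(3) lt_irrefl by blast
  then show False using 1 2 sl_sym[OF x(1) td] cmp_anti by metis
qed

text \<open>If the slope were infinite near \<open>x\<close>, then all secants on an interval would be steeper than the
  secant through its endpoints.\<close>

lemma infinite_slope_impossible:
  assumes x: "x \<in> dom M" "x \<notin> dcl A"
  shows "\<exists>c \<in> dom M. \<not> (near_right g s c x \<and> near_left g s c x)"
proof (rule ccontr)
  assume "\<not> ?thesis"
  then have V: "\<forall>c \<in> dom M. near_right g s c x \<and> near_left g s c x" by blast
  let ?V = "\<lambda>x. \<forall>c \<in> dom M. near_right g s c x \<and> near_left g s c x"
  have "defP A (\<lambda>v. ?V (v 0))" by (intro defP_all defP_conj defP_sl_near)
  from const_near_generic[OF this x] V obtain a b where
    ab: "a \<sqsubset> x" "x \<sqsubset> b" "\<forall>t. a \<sqsubset> t \<longrightarrow> t \<sqsubset> b \<longrightarrow> ?V t"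
    unfolding const_near_def by blast
  obtain y0 where y0: "x \<sqsubset> y0" "y0 \<sqsubset> b" using lt_dense ab(2) by blast
  have y0d: "y0 \<in> dom M" using y0 lt_dom by blast
  \<comment> \<open>With this slope, \<open>P y0\<close> below would compare \<open>c\<close>
    strictly with itself.\<close>
  define c where "c = sl g x y0"
  have cd: "c \<in> dom M" using sl_dom x(1) y0d by (simp add: c_def)
  define P where "P y \<longleftrightarrow> (\<forall>z \<in> dom M. x \<sqsubset> z \<longrightarrow> \<not> y \<sqsubset> z \<longrightarrow> cmp s c (sl g x z))" for y
  let ?A = "insert c (insert x A)"
  have gx: "defT ?A (\<lambda>_. g x)"
    using defT_subst[OF defT_mono[OF g[of 0]], of "?A" "\<lambda>_ _. x"] x defT_param[of x "?A"] by auto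
  have xx: "defT ?A (\<lambda>_. x)" "defT ?A (\<lambda>_. c)" using x cd by (auto intro!: defT_param)
  have gg: "defT ?A (\<lambda>v. g (v i))" for i by (rule defT_mono[OF g]) auto
  have defP: "defP ?A (\<lambda>v. P (v 0))"
    unfolding P_def sl_def
    by (intro defP_neg defP_conj defP_all defP_imp defP_lt defP_cmp defT_slope defT_var gx xx gg)
  have lt_le: "\<not> w \<sqsubset> z" if "z \<sqsubset> w" for z w using that lt_trans lt_irrefl by blast
  obtain r where r: "x \<sqsubset> r" "\<forall>y \<in> dom M. x \<sqsubset> y \<longrightarrow> y \<sqsubset> r \<longrightarrow> cmp s c (sl g x y)"
    using V cd unfolding near_right_def by blast
  obtain y1 where y1: "y1 \<sqsubset> r" "y1 \<sqsubset> y0" "x \<sqsubset> y1" using lt_min[OF r(1) y0(1)] by blast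
  have le_trans: "z \<sqsubset> w" if "\<not> y \<sqsubset> z" "y \<sqsubset> w" "z \<in> dom M" for y z w
    using that lt_total[of z y] lt_dom[OF that(2)] lt_trans by blast
  have "P y1" unfolding P_def using r(2) le_trans[OF _ y1(1)] by blast
  \<comment> \<open>\<open>P\<close> is locally constant from \<open>y1\<close> to
    \<open>y0\<close>. If it holds at \<open>y\<close>, the secants from \<open>y\<close> to the
    right extend it by the mediant property. If the only failure up to \<open>y\<close> seems to be
    at \<open>y\<close> itself, the secants from \<open>y\<close> to the left produce a failure
    before \<open>y\<close>.\<close>
  moreover have "P y1 = P y0"
  proof (rule const_near_connected[OF defP y1(2)])
    fix y assume y: "y \<in> dom M" "\<not> y \<sqsubset> y1" "\<not> y0 \<sqsubset> y"
    have xy: "x \<sqsubset> y" using y(1,2) y1(3) lt_total[of y y1] lt_dom[OF y1(2)] lt_trans[OF y1(3)] by blast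
    have "y \<sqsubset> b" using le_trans[OF y(3) y0(2) y(1)] .
    then have Vy: "near_right g s c y" "near_left g s c y"
      using ab(3) lt_trans[OF ab(1) xy] cd by blast+
    show "const_near P y"
    proof (cases "P y")
      case True
      obtain q where q: "y \<sqsubset> q" "\<forall>z \<in> dom M. y \<sqsubset> z \<longrightarrow> z \<sqsubset> q \<longrightarrow> cmp s c (sl g y z)"
        using Vy(1) unfolding near_right_def by blast
      have "P z" if z: "x \<sqsubset> z" "z \<sqsubset> q" for z
        unfolding P_def
      proof (intro ballI impI)
        fix u assume u: "u \<in> dom M" "x \<sqsubset> u" "\<not> z \<sqsubset> u"
        show "cmp s c (sl g x u)"
        proof (cases "y \<sqsubset> u")
          case True
          have "cmp s c (sl g y u)" using q(2) u(1) True le_trans[OF u(3) z(2) u(1)] by blast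
          moreover have "cmp s c (sl g x y)" using \<open>P y\<close> xy y(1) lt_irrefl unfolding P_def by blast
          ultimately show ?thesis using sl_mediant[OF xy True] by blast
        next
          case False
          then show ?thesis using \<open>P y\<close> u unfolding P_def by blast
        qed
      qed
      then show ?thesis using True xy q(1) unfolding const_near_def by blast
    next
      case False
      then obtain u where u: "u \<in> dom M" "x \<sqsubset> u" "\<not> y \<sqsubset> u" "\<not> cmp s c (sl g x u)"
        unfolding P_def by blast
      show ?thesis
      proof (cases "u = y")
        case False
        then have uy: "u \<sqsubset> y" using u(1,3) y(1) lt_total[of u y] by blast
        have "\<not> P z" if "u \<sqsubset> z" for z using u lt_le[OF that] unfolding P_def by blast
        moreover obtain q where "y \<sqsubset> q" using lt_above y(1) by blast
        ultimately show ?thesis using \<open>\<not> P y\<close> uy unfolding const_near_def by blast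
      next
        case True
        obtain p where p: "p \<sqsubset> y" "\<forall>z \<in> dom M. p \<sqsubset> z \<longrightarrow> z \<sqsubset> y \<longrightarrow> cmp s c (sl g y z)"
          using Vy(2) unfolding near_left_def by blast
        obtain z where z: "p \<sqsubset> z" "x \<sqsubset> z" "z \<sqsubset> y" using lt_max[OF p(1) xy] by blast
        have zd: "z \<in> dom M" and zy: "z \<noteq> y" using z(3) lt_dom lt_irrefl by blast+
        have "cmp s c (sl g z y)" using p(2) zd z(1,3) sl_sym[OF zd y(1) zy] by metis
        then have nz: "\<not> cmp s c (sl g x z)" using sl_mediant[OF z(2,3)] u(4) True by blast
        have "\<not> P w" if "z \<sqsubset> w" for w using nz zd z(2) lt_le[OF that] unfolding P_def by blast
        moreover obtain q where "y \<sqsubset> q" using lt_above y(1) by blast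
        ultimately show ?thesis using \<open>\<not> P y\<close> z(3) unfolding const_near_def by blast
      qed
    qed
  qed
  ultimately have "cmp s c (sl g x y0)" unfolding P_def using y0(1) y0d lt_irrefl by blast
  then show False using cmp_irrefl by (simp add: c_def)
qed

text \<open>The slopes lying below all nearby secants form a definable lower set, neither empty nor
  everything because the slope at \<open>x\<close> is not infinite; its supremum is the derivative.
  For a slope generic over \<open>x\<close>, exchange keeps \<open>x\<close> generic over that
  slope, and the one-sided facts combine to a dichotomy.\<close>

lemma derivative_exists:
  assumes x: "x \<in> dom M" "x \<notin> dcl A"
  shows "\<exists>D \<in> dom M. deriv g x D"
proof -
  define X where "X s c \<longleftrightarrow> near_right g s c x \<and> near_left g s c x" for s c
  have mono: "X s c" if "cmp s c d" "X s d" for s c d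
    using that cmp_trans unfolding X_def near_right_def near_left_def by meson
  have excl: "\<not> (X True c \<and> X False c)" for c
  proof
    assume "X True c \<and> X False c"
    then obtain p q where p: "x \<sqsubset> p" "\<forall>y \<in> dom M. x \<sqsubset> y \<longrightarrow> y \<sqsubset> p \<longrightarrow> cmp True c (sl g x y)"
      and q: "x \<sqsubset> q" "\<forall>y \<in> dom M. x \<sqsubset> y \<longrightarrow> y \<sqsubset> q \<longrightarrow> cmp False c (sl g x y)"
      unfolding X_def near_right_def by blast
    obtain y where y: "y \<sqsubset> p" "y \<sqsubset> q" "x \<sqsubset> y" using lt_min[OF p(1) q(1)] by blast
    then have "cmp True c (sl g x y)" "cmp False c (sl g x y)" using p(2) q(2) lt_dom by blast+
    then show False using cmp_anti[of True c "sl g x y"] by simp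
  qed
  have dich: "X True c \<or> X False c" if c: "c \<in> dom M" "c \<notin> dcl (insert x A)" for c
  proof -
    have "x \<notin> dcl (insert c A)" using dcl_exchange[OF _ x(2) c(1)] c(2) by blast
    note one_sided_agree[OF x(1) this c(1), of True] one_sided_agree[OF x(1) this c(1), of False]
    then show ?thesis
      using near_right_dichotomy[OF c x(1)] near_left_dichotomy[OF c x(1)] unfolding X_def by auto
  qed
  have cx: "countable (insert x A)" using cA by simp
  obtain c1 c2 where c12: "c1 \<in> dom M" "\<not> X True c1" "c2 \<in> dom M" "\<not> X False c2"
    using infinite_slope_impossible[OF x] unfolding X_def by blast
  obtain a0 where "a0 \<sqsubset> c2" using lt_below c12(3) by blast
  \<comment> \<open>A generic slope below \<open>c2\<close> belongs to the lower set: otherwise, by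
    the dichotomy, nearby secants would lie below it and so below \<open>c2\<close>.\<close>
  then obtain a where a: "a \<sqsubset> c2" "a \<notin> dcl (insert x A)" using generic_in_interval[OF cx] by blast
  have "\<not> X False a" using mono[of False c2 a] a(1) c12(4) by (auto simp: cmp_def)
  then have Xa: "X True a" using dich a lt_dom by blast
  have "defP (insert x A) (\<lambda>v. X True (v 0))"
  proof -
    have "defP (insert x A) (\<lambda>v. (\<lambda>v. near_right g True (v 0) (v 1) \<and> near_left g True (v 0) (v 1))
      (gval (\<lambda>i. if i = 0 then Inr 0 else Inl x) v))"
    proof (rule defP_gval)
      show "defP (insert x A) (\<lambda>v. near_right g True (v 0) (v 1) \<and> near_left g True (v 0) (v 1))"
        by (rule defP_mono[OF defP_conj[OF defP_sl_near]]) auto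
      show "(if i = 0 then Inr 0 else Inl x) \<in> gens (insert x A)" for i :: nat using x(1) by simp
    qed
    then show ?thesis by (simp add: gval_def X_def)
  qed
  from definable_cut[OF this Xa c12(2) _ c12(1)] a(1) lt_dom mono[of True] obtain D where
    D: "D \<in> dom M" "\<forall>c. c \<sqsubset> D \<longrightarrow> X True c" "\<forall>c. D \<sqsubset> c \<longrightarrow> \<not> X True c"
    by (auto simp: cmp_def)
  \<comment> \<open>Leaving the lower set yields the opposite inequality only at generic slopes, so
    it is taken from a generic slope between \<open>D\<close> and \<open>c\<close>.\<close>
  have "X False c" if c: "D \<sqsubset> c" for c
  proof -
    obtain c' where c': "D \<sqsubset> c'" "c' \<sqsubset> c" "c' \<notin> dcl (insert x A)"
      using generic_in_interval[OF cx c] by blast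
    then have "X False c'" using dich D(3) lt_dom by blast
    then show ?thesis using mono[of False c c'] c'(2) by (simp add: cmp_def)
  qed
  then have "deriv g x D" using D(2) unfolding deriv_def X_def by blast
  then show ?thesis using D(1) by blast
qed

end

section \<open>Neighbourhoods and functions of several variables\<close>

definition patch :: "nat \<Rightarrow> (nat \<Rightarrow> 'm) \<Rightarrow> (nat \<Rightarrow> 'm) \<Rightarrow> nat \<Rightarrow> 'm" where
  "patch m z' z i = (if i < m then z' i else z i)"

lemma patch_Env: "z \<in> Env \<Longrightarrow> z' \<in> Env \<Longrightarrow> patch m z' z \<in> Env"
  unfolding patch_def[abs_def] by simp

lemma patch_patch: "patch m z'' (patch m z' z) = patch m z'' z"
  by (simp add: patch_def fun_eq_iff)

lemma in_box_patch: "in_box m c d (patch m z' z) = in_box m c d z'"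
  by (simp add: in_box_def patch_def)

text \<open>\<open>nbhd m P z\<close>: with the coordinates from \<open>m\<close> on held fixed, \<open>P\<close> holds near \<open>z\<close>.\<close>

definition nbhd :: "nat \<Rightarrow> ((nat \<Rightarrow> 'm) \<Rightarrow> bool) \<Rightarrow> (nat \<Rightarrow> 'm) \<Rightarrow> bool" where
  "nbhd m P z \<longleftrightarrow> (\<exists>c \<in> Env. \<exists>d \<in> Env. in_box m c d z \<and>
     (\<forall>z' \<in> Env. in_box m c d z' \<longrightarrow> P (patch m z' z)))"

definition contin :: "nat \<Rightarrow> ((nat \<Rightarrow> 'm) \<Rightarrow> 'm) \<Rightarrow> (nat \<Rightarrow> 'm) \<Rightarrow> bool" where
  "contin m G z \<longleftrightarrow> (\<forall>a \<in> dom M. \<forall>b \<in> dom M. a \<sqsubset> G z \<longrightarrow> G z \<sqsubset> b \<longrightarrow>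
     nbhd m (\<lambda>z'. a \<sqsubset> G z' \<and> G z' \<sqsubset> b) z)"

definition pderiv :: "((nat \<Rightarrow> 'm) \<Rightarrow> 'm) \<Rightarrow> nat \<Rightarrow> (nat \<Rightarrow> 'm) \<Rightarrow> 'm \<Rightarrow> bool" where
  "pderiv F i z D \<longleftrightarrow> deriv (\<lambda>t. F (z(i := t))) (z i) D"

lemma in_box_iff: "in_box m c d z \<longleftrightarrow> (\<forall>i \<in> {..<m}. c i \<sqsubset> z i \<and> z i \<sqsubset> d i)"
  by (auto simp: in_box_def)

text \<open>The first argument of \<open>P\<close> carries outer variables, so that a neighbourhood
  statement may occur below quantifiers, with bounds taken from them.\<close>

lemma defP_nbhd:
  assumes P2: "\<And>k f. defP A (\<lambda>u. P (\<lambda>i. u (k i)) (\<lambda>i. u (f i)))"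
  shows "defP A (\<lambda>v. nbhd m (P (\<lambda>i. v (k i))) (\<lambda>i. v (f i)))"
  unfolding nbhd_def
proof (rule defP_exs, rule defP_exs, rule defP_conj)
  show "defP A (\<lambda>u. in_box m (evens (odds u)) (evens u) (\<lambda>i. odds (odds u) (f i)))"
    unfolding in_box_iff evens_def odds_def
    by (intro defP_fin_ball defP_conj defP_lt defT_var finite_lessThan)
  show "defP A (\<lambda>u. \<forall>z' \<in> Env. in_box m (evens (odds u)) (evens u) z' \<longrightarrow>
      P (\<lambda>i. odds (odds u) (k i)) (patch m z' (\<lambda>i. odds (odds u) (f i))))"
  proof (rule defP_alls, rule defP_imp)
    show "defP A (\<lambda>u. in_box m (evens (odds (odds u))) (evens (odds u)) (evens u))"
      unfolding in_box_iff evens_def odds_def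
      by (intro defP_fin_ball defP_conj defP_lt defT_var finite_lessThan)
    \<comment> \<open>Places below three nested assignment quantifiers: each quantifier sends an
      outer place \<open>j\<close> to \<open>2 * j + 1\<close>, and the innermost assignment sits at
      the even places.\<close>
    have "(\<lambda>i. u (if i < m then 2 * i else 2 * (2 * (2 * f i + 1) + 1) + 1)) =
      patch m (evens u) (\<lambda>i. odds (odds (odds u)) (f i))" for u :: "nat \<Rightarrow> 'm"
      by (rule ext) (simp add: patch_def evens_def odds_def)
    moreover have "(\<lambda>i. u (2 * (2 * (2 * k i + 1) + 1) + 1)) = (\<lambda>i. odds (odds (odds u)) (k i))"
      for u :: "nat \<Rightarrow> 'm" by (rule ext) (simp add: evens_def odds_def)
    ultimately show "defP A (\<lambda>u. P (\<lambda>i. odds (odds (odds u)) (k i))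
        (patch m (evens u) (\<lambda>i. odds (odds (odds u)) (f i))))"
      using P2[of "\<lambda>i. 2 * (2 * (2 * k i + 1) + 1) + 1"
          "\<lambda>i. if i < m then 2 * i else 2 * (2 * (2 * f i + 1) + 1) + 1"] by (simp only:)
  qed
qed

text \<open>An open box is a neighbourhood of each of its points, so the interior of a set is
  open.\<close>

lemma nbhd_nbhd: "nbhd m P z \<Longrightarrow> nbhd m (nbhd m P) z"
proof -
  assume "nbhd m P z"
  then obtain c d where cd: "c \<in> Env" "d \<in> Env" "in_box m c d z"
    "\<forall>z' \<in> Env. in_box m c d z' \<longrightarrow> P (patch m z' z)" unfolding nbhd_def by blast
  have "nbhd m P (patch m z' z)" if "z' \<in> Env" "in_box m c d z'" for z'
    unfolding nbhd_def patch_patch using cd that by (metis in_box_patch)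
  then show ?thesis unfolding nbhd_def[of m "nbhd m P"] using cd by blast
qed

lemma nbhd_self: "z \<in> Env \<Longrightarrow> nbhd m P z \<Longrightarrow> P z"
proof -
  assume "z \<in> Env" "nbhd m P z"
  then have "P (patch m z z)" unfolding nbhd_def by blast
  moreover have "patch m z z = z" by (simp add: patch_def fun_eq_iff)
  ultimately show ?thesis by simp
qed

lemma generic_nbhd:
  assumes "countable A" "indep A w m" "w \<in> Env" "\<And>i. m \<le> i \<Longrightarrow> w i \<in> A" "defP A P" "P w"
  shows "nbhd m P w"
proof -
  from generic_box[OF assms] obtain c d where cd: "c \<in> Env" "d \<in> Env" "in_box m c d w"
    "\<forall>z \<in> Env. in_box m c d z \<longrightarrow> (\<forall>i\<ge>m. z i = w i) \<longrightarrow> P z" by blast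
  have "P (patch m z' w)" if "z' \<in> Env" "in_box m c d z'" for z'
    using cd(4) patch_Env[OF assms(3) that(1), of m] that(2)
    by (simp add: in_box_patch patch_def)
  then show ?thesis unfolding nbhd_def using cd by blast
qed

lemma generic_contin:
  assumes "countable A" "indep A w m" "w \<in> Env" "\<And>i. m \<le> i \<Longrightarrow> w i \<in> A" "defT A G"
  shows "contin m G w"
  unfolding contin_def
proof (intro ballI impI)
  fix a b assume ab: "a \<sqsubset> G w" "G w \<sqsubset> b"
  from generic_continuous[OF assms ab] obtain c d where cd: "c \<in> Env" "d \<in> Env" "in_box m c d w"
    "\<forall>z \<in> Env. in_box m c d z \<longrightarrow> (\<forall>i\<ge>m. z i = w i) \<longrightarrow> a \<sqsubset> G z \<and> G z \<sqsubset> b" by blast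
  have "a \<sqsubset> G (patch m z' w) \<and> G (patch m z' w) \<sqsubset> b" if "z' \<in> Env" "in_box m c d z'" for z'
    using cd(4) patch_Env[OF assms(3) that(1), of m] that(2)
    by (simp add: in_box_patch patch_def)
  then show "nbhd m (\<lambda>z'. a \<sqsubset> G z' \<and> G z' \<sqsubset> b) w" unfolding nbhd_def using cd by blast
qed

text \<open>\<open>U\<close> is the interior of the set of points at which all partial derivatives
  exist and are continuous. Existence and continuity at \<open>w\<close> come from independence, and
  persistence on a box puts \<open>w\<close> into the interior. All data are parameter-free so that
  elementary maps preserve them.\<close>

lemma generic_C1:
  assumes F: "defT {} F" and w: "indep {} w m" "w \<in> Env" "\<And>i. m \<le> i \<Longrightarrow> w i = org"
  obtains U PD where "defP {} U" "U w" "\<And>i. defT {} (PD i)"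
    "\<And>z. z \<in> Env \<Longrightarrow> U z \<Longrightarrow> nbhd m U z"
    "\<And>z i. z \<in> Env \<Longrightarrow> U z \<Longrightarrow> i < m \<Longrightarrow> pderiv F i z (PD i z)"
    "\<And>z i. z \<in> Env \<Longrightarrow> U z \<Longrightarrow> i < m \<Longrightarrow> contin m (PD i) z"
proof -
  have Fi: "defT A (\<lambda>u. F ((stail u)(i := u 0)))" for i A
  proof -
    have "(\<lambda>j. u (if j = i then 0 else Suc j)) = (stail u)(i := u 0)" for u :: "nat \<Rightarrow> 'm" by auto
    then have "defT {} (\<lambda>u. F ((stail u)(i := u 0)))"
      using defT_ren[OF F, of "\<lambda>j. if j = i then 0 else Suc j"] by (simp only:)
    then show ?thesis by (rule defT_mono) simp
  qed
  have pd: "defP {} (\<lambda>v. pderiv F i (\<lambda>j. v (f j)) (v k))" for i f k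
    unfolding pderiv_def by (rule defP_deriv[OF Fi])
  have "\<exists>PD. defT {} PD \<and> (\<forall>z D. D \<in> dom M \<longrightarrow> pderiv F i z D \<longrightarrow> PD z = D)" for i
  proof -
    \<comment> \<open>Derivatives are unique, so the description operator yields a total term that
      agrees with the partial derivative wherever the latter exists.\<close>
    have "defP {} (\<lambda>u. pderiv F i (stail u) (u 0))" using pd by blast
    from defT_theE[OF this] obtain PD where PD: "defT {} PD"
      "\<And>z D. D \<in> dom M \<Longrightarrow> pderiv F i z D \<Longrightarrow> (\<And>y. y \<in> dom M \<Longrightarrow> pderiv F i z y \<Longrightarrow> y = D) \<Longrightarrow> PD z = D"
      by blast
    have "PD z = D" if "D \<in> dom M" "pderiv F i z D" for z D
      using PD(2)[OF that] deriv_unique that unfolding pderiv_def by blast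
    then show ?thesis using PD(1) by blast
  qed
  then obtain PD where PD: "\<And>i. defT {} (PD i)"
    "\<And>i z D. D \<in> dom M \<Longrightarrow> pderiv F i z D \<Longrightarrow> PD i z = D" by metis
  define P where "P z \<longleftrightarrow> (\<forall>i \<in> {..<m}. (\<exists>D \<in> dom M. pderiv F i z D) \<and> contin m (PD i) z)" for z
  have cont: "defP {} (\<lambda>v. contin m (PD i) (\<lambda>j. v (f j)))" for i f
    unfolding contin_def
  proof (intro defP_all defP_imp defP_lt defT_var)
    show "defT {} (\<lambda>v. PD i (\<lambda>j. v (Suc (Suc (f j)))))" by (rule defT_ren[OF PD(1)])
    show "defT {} (\<lambda>v. PD i (\<lambda>j. v (Suc (Suc (f j)))))" by (rule defT_ren[OF PD(1)])
    have *: "defP {} (\<lambda>u. (\<lambda>k z'. k 0 \<sqsubset> PD i z' \<and> PD i z' \<sqsubset> k 1) (\<lambda>i. u (k i)) (\<lambda>i. u (f i)))" for k f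
      by (intro defP_conj defP_lt defT_var defT_ren[OF PD(1)])
    show "defP {} (\<lambda>v. nbhd m (\<lambda>z'. v (Suc 0) \<sqsubset> PD i z' \<and> PD i z' \<sqsubset> v 0) (\<lambda>j. v (Suc (Suc (f j)))))"
      using defP_nbhd[of "{}" "\<lambda>k z'. k 0 \<sqsubset> PD i z' \<and> PD i z' \<sqsubset> k 1", OF *,
          of m "\<lambda>i. 1 - i" "\<lambda>j. Suc (Suc (f j))"] by simp
  qed
  have Pf: "defP {} (\<lambda>u. P (\<lambda>i. u (f i)))" for f
    unfolding P_def
  proof (intro defP_fin_ball defP_conj cont)
    show "defP {} (\<lambda>v. \<exists>D \<in> dom M. pderiv F i (\<lambda>i. v (f i)) D)" for i
      by (rule defP_ex) (rule pd)
  qed simp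
  have U: "defP {} (nbhd m P)"
    using defP_nbhd[of "{}" "\<lambda>_. P" m id id] Pf by simp
  let ?A = "insert org {}"
  \<comment> \<open>The coordinates from \<open>m\<close> on must be parameters. They all equal
    \<open>org\<close>, which is definable and so costs no independence.\<close>
  have dclA: "dcl (?A \<union> X) = dcl X" for X
  proof
    have "org \<in> dcl X" using org dcl_mono[of "{}" X] by auto
    then show "dcl (?A \<union> X) \<subseteq> dcl X" by (intro dcl_trans) (auto intro: dcl_base)
  qed (intro dcl_mono, auto)
  have wA: "indep ?A w m" using w(1) dclA unfolding indep_def by (simp del: Un_insert_left)
  have wA2: "\<And>i. m \<le> i \<Longrightarrow> w i \<in> ?A" using w(3) by simp
  have cA: "countable ?A" by simp
  have Pw: "P w"
    unfolding P_def
  proof (intro ballI conjI)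
    fix i assume i: "i \<in> {..<m}"
    \<comment> \<open>All coordinates but the \<open>i\<close>-th become parameters;
      \<open>w i\<close> is not definable from them, so the one-variable result applies.\<close>
    let ?B = "?A \<union> w ` ({..<m} - {i})"
    have wi: "w i \<in> dom M" using w(2) by simp
    have wB: "w j \<in> ?B" if "j \<noteq> i" for j
      using that w(3)[of j] by (cases "j < m") auto
    have "defT ?B (\<lambda>v. F (\<lambda>j. (if j = i then (\<lambda>v. v k) else (\<lambda>_. w j)) v))" for k
    proof (rule defT_subst[where t = F and \<sigma> = "\<lambda>j. if j = i then (\<lambda>v. v k) else (\<lambda>_. w j)"])
      show "defT ?B F" using F by (rule defT_mono) simp
      show "defT ?B (if j = i then (\<lambda>v. v k) else (\<lambda>_. w j))" for j
        using defT_var defT_param[OF wB] w(2) by auto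
    qed
    moreover have "(\<lambda>j. (if j = i then (\<lambda>v. v k) else (\<lambda>_. w j)) v) = w(i := v k)" for v :: "nat \<Rightarrow> 'm" and k
      by auto
    ultimately have g: "defT ?B (\<lambda>v. F (w(i := v k)))" for k by simp
    have "w i \<notin> dcl ?B" using indep_remove[OF wA] i by blast
    from derivative_exists[OF _ g wi this] show "\<exists>D \<in> dom M. pderiv F i w D"
      unfolding pderiv_def by (simp only: countable_insert countable_empty countable_Un_iff
          countable_image countable_finite finite_Diff finite_lessThan finite_imageI simp_thms)
    show "contin m (PD i) w"
      by (rule generic_contin[OF cA wA w(2) wA2 defT_mono[OF PD(1)]]) simp_all
  qed
  have 1: "nbhd m P w"
    using generic_nbhd[OF cA wA w(2) wA2 defP_mono[OF Pf[of "\<lambda>i. i"]] Pw] by simp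
  have 2: "pderiv F i z (PD i z)" if z: "z \<in> Env" "nbhd m P z" "i < m" for z i
  proof -
    obtain D where "D \<in> dom M" "pderiv F i z D"
      using nbhd_self[OF z(1,2)] z(3) unfolding P_def by blast
    then show ?thesis using PD(2)[of D i z] by simp
  qed
  have 3: "contin m (PD i) z" if "z \<in> Env" "nbhd m P z" "i < m" for z i
    using nbhd_self[OF that(1,2)] that(3) unfolding P_def by blast
  show ?thesis
    by (rule that[of "nbhd m P" PD]) (fact U 1 2 3 PD(1) | rule nbhd_nbhd, assumption)+
qed

end

section \<open>Back and forth for generic derivations\<close>

lemma dom_reduct [simp]: "dom (reduct N) = dom N"
  and fint_reduct [simp]: "fint (reduct N) f = fint N (Old f)"
  and rint_reduct [simp]: "rint (reduct N) = rint N"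
  by (simp_all add: reduct_def)

lemma far_delta_lang [simp]: "far (delta_lang L) (Old f) = far L f" "far (delta_lang L) Delta = 1"
  and rar_delta_lang [simp]: "rar (delta_lang L) = rar L"
  by (simp_all add: delta_lang_def)

section \<open>Formulas of the reduct inside the expanded language\<close>

primrec emb_tm :: "'f tm \<Rightarrow> 'f dfun tm" where
  "emb_tm (Var x) = Var x"
| "emb_tm (App f ts) = App (Old f) (map emb_tm ts)"

primrec emb_fm :: "('f, 'r) fm \<Rightarrow> ('f dfun, 'r) fm" where
  "emb_fm (FEq s t) = FEq (emb_tm s) (emb_tm t)"
| "emb_fm (FRel p ts) = FRel p (map emb_tm ts)"
| "emb_fm (FNeg \<phi>) = FNeg (emb_fm \<phi>)"
| "emb_fm (FConj \<phi> \<psi>) = FConj (emb_fm \<phi>) (emb_fm \<psi>)"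
| "emb_fm (FEx x \<phi>) = FEx x (emb_fm \<phi>)"

lemma eval_emb_tm: "eval_tm N v (emb_tm t) = eval_tm (reduct N) v t"
proof (induction t)
  case (App f ts)
  then have "map (eval_tm N v \<circ> emb_tm) ts = map (eval_tm (reduct N) v) ts" by simp
  then show ?case by (simp only: emb_tm.simps eval_tm.simps map_map fint_reduct)
qed simp

lemma sat_emb_fm: "sat N v (emb_fm \<phi>) = sat (reduct N) v \<phi>"
proof (induction \<phi> arbitrary: v)
  case (FRel p ts)
  have "map (eval_tm N v \<circ> emb_tm) ts = map (eval_tm (reduct N) v) ts" by (simp add: eval_emb_tm)
  then show ?case by (simp only: emb_fm.simps sat.simps map_map rint_reduct)
qed (simp_all add: eval_emb_tm)

lemma wf_emb_tm: "wf_tm L t \<Longrightarrow> wf_tm (delta_lang L) (emb_tm t)"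
  by (induction t) auto

lemma wf_emb_fm: "wf_fm L \<phi> \<Longrightarrow> wf_fm (delta_lang L) (emb_fm \<phi>)"
  by (induction \<phi>) (auto simp: wf_emb_tm)

lemma defP_reduct:
  assumes "first_order_structure.defP L (reduct N) A P"
    and M: "first_order_structure L (reduct N)" and N: "first_order_structure (delta_lang L) N"
  shows "first_order_structure.defP (delta_lang L) N A P"
proof -
  interpret M: first_order_structure L "reduct N" by (fact M)
  interpret N: first_order_structure "delta_lang L" N by (fact N)
  have E: "M.Env = N.Env" "M.gens A = N.gens A"
    unfolding M.Env_def N.Env_def M.gens_def N.gens_def by (simp_all only: dom_reduct)
  from assms(1) obtain \<phi> g where "wf_fm L \<phi>" "\<forall>i. g i \<in> M.gens A"
    "\<forall>v \<in> M.Env. P v \<longleftrightarrow> sat (reduct N) (M.gval g v) \<phi>" unfolding M.defP_def by blast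
  then show ?thesis unfolding N.defP_def E
    by (intro exI[of _ "emb_fm \<phi>"] exI[of _ g]) (simp add: wf_emb_fm sat_emb_fm)
qed

text \<open>\<open>chain_rule\<close> condenses the axioms of a \<open>T\<close>-derivation: on a
  parameter-free open set the derivative of a value is one parameter-free term in the point and its
  derivatives. \<open>generic\<close> states genericity for sets whose projection contains a box, so
  that dimension need not be carried along. Coordinates beyond the relevant ones are set to
  \<open>org\<close>.\<close>

locale generic_derivation = o_minimal_slope L M lt slope org +
  D: first_order_structure "delta_lang L" N
  for L :: "('f, 'r) olang" and M :: "('m, 'f, 'r) struct"
    and lt :: "'m \<Rightarrow> 'm \<Rightarrow> bool" (infix "\<sqsubset>" 50) and slope org
    and N :: "('m, 'f dfun, 'r) struct" +
  fixes \<delta> :: "'m \<Rightarrow> 'm"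
  assumes M: "M = reduct N"
    and delta: "\<And>x. \<delta> x = fint N Delta [x]"
    and delta_saturation: "countable A \<Longrightarrow> (\<And>P. P \<in> \<P> \<Longrightarrow> D.defP A (\<lambda>v. P (v 0))) \<Longrightarrow>
      (\<And>F. finite F \<Longrightarrow> F \<subseteq> \<P> \<Longrightarrow> \<exists>x \<in> dom M. \<forall>P \<in> F. P x) \<Longrightarrow>
      \<exists>x \<in> dom M. \<forall>P \<in> \<P>. P x"
    and chain_rule: "\<lbrakk>defT {} F; defP {} U; \<And>i. defT {} (PD i);
      \<And>z. z \<in> Env \<Longrightarrow> U z \<Longrightarrow> nbhd m U z;
      \<And>z i. z \<in> Env \<Longrightarrow> U z \<Longrightarrow> i < m \<Longrightarrow> pderiv F i z (PD i z);
      \<And>z i. z \<in> Env \<Longrightarrow> U z \<Longrightarrow> i < m \<Longrightarrow> contin m (PD i) z\<rbrakk> \<Longrightarrow>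
      \<exists>G. defT {} G \<and> (\<forall>z \<in> Env. U z \<longrightarrow> (\<forall>i\<ge>m. z i = org) \<longrightarrow>
        \<delta> (F z) = G (merge z (\<lambda>i. if i < m then \<delta> (z i) else org)))"
    and generic: "\<lbrakk>defP (dom M) P; c \<in> Env; d \<in> Env; \<And>i. i < n \<Longrightarrow> c i \<sqsubset> d i;
      \<And>z. z \<in> Env \<Longrightarrow> in_box n c d z \<Longrightarrow>
        \<exists>t \<in> dom M. P (\<lambda>i. if i < n then z i else if i = n then t else org)\<rbrakk> \<Longrightarrow>
      \<exists>a \<in> dom M. P (\<lambda>i. if i \<le> n then (\<delta> ^^ i) a else org)"
begin

section \<open>Transfer of jets along elementary maps\<close>

lemma dom_N: "dom N = dom M"
  by (simp add: M)

lemma D_Env: "D.Env = Env"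
  unfolding Env_def D.Env_def dom_N ..

lemma delta_dom: "x \<in> dom M \<Longrightarrow> \<delta> x \<in> dom M"
  using D.str unfolding is_struct_def delta dom_N by (metis far_delta_lang(2) empty_subsetI
      insert_subset length_Cons list.set(1) list.set(2) list.size(3) One_nat_def)

lemma delta_pow_dom: "x \<in> dom M \<Longrightarrow> (\<delta> ^^ k) x \<in> dom M"
  by (induction k) (simp_all add: delta_dom)

lemma defP_delta: "defP A P \<Longrightarrow> D.defP A P"
  using defP_reduct[of L N A P] D.first_order_structure_axioms first_order_structure_axioms
  unfolding M by blast

lemma defT_delta: "D.defT A t \<Longrightarrow> D.defT A (\<lambda>v. \<delta> (t v))"
  using D.defT_fun[of "[t]" Delta A] by (simp add: delta)

lemma defT_delta_pow: "D.defT A t \<Longrightarrow> D.defT A (\<lambda>v. (\<delta> ^^ k) (t v))"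
  by (induction k) (simp_all add: defT_delta)

text \<open>The derivatives of order below \<open>n\<close> form an independent tuple, so an
  elementary map sends them to an independent tuple \<open>y\<close>. The image condition then has a
  solution in the last coordinate over a whole box around \<open>y\<close>, and genericity provides
  an actual jet satisfying it. The map \<open>j\<close> selects orders at most
  \<open>n\<close>.\<close>

lemma generic_transfer:
  assumes H: "El H" "countable H" "(p, q) \<in> H" and x: "x \<in> dom M"
    and ind: "indep (fst ` H) (\<lambda>k. (\<delta> ^^ k) x) n" and j: "\<And>k. j k \<le> n"
    and Q: "defP {} Q" "\<And>i. (a i, b i) \<in> H" "Q (merge (\<lambda>k. (\<delta> ^^ (j k)) x) a)"
  shows "\<exists>y \<in> dom M. Q (merge (\<lambda>k. (\<delta> ^^ (j k)) y) b)"
proof -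
  let ?x = "\<lambda>k. (\<delta> ^^ k) x"
  have xE: "?x \<in> Env" using delta_pow_dom[OF x] by (intro EnvI)
  have abE: "a \<in> Env" "b \<in> Env" using El_dom[OF H(1) Q(2)] by (auto intro: EnvI)
  obtain y where y: "El (H \<union> (\<lambda>i. (?x i, y i)) ` {..<Suc n})"
    using El_extend_finite[OF H xE] by blast
  let ?H = "H \<union> (\<lambda>i. (?x i, y i)) ` {..<Suc n}"
  have yd: "y i \<in> dom M" if "i \<le> n" for i
    using El_dom[OF y, of "?x i" "y i"] that by auto
  have inH: "(?x i, y i) \<in> ?H" if "i \<le> n" for i using that by auto
  define P where "P u = Q (merge (\<lambda>k. u (j k)) b)" for u
  have Qy: "P y"
    unfolding P_def
  proof (rule El_imp[OF y Q(1) _ Q(3)])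
    fix i show "(merge (\<lambda>k. ?x (j k)) a i, merge (\<lambda>k. y (j k)) b i) \<in> ?H"
      using inH[OF j] Q(2) by (simp add: merge_def)
  qed
  have P: "defP (range b) P"
  proof -
    have "defP (range b) (\<lambda>v. Q (gval (\<lambda>i. if even i then Inr (j (i div 2)) else Inl (b (i div 2))) v))"
    proof (rule defP_gval)
      show "defP (range b) Q" using Q(1) by (rule defP_mono) simp
      show "(if even i then Inr (j (i div 2)) else Inl (b (i div 2))) \<in> gens (range b)" for i
        using abE(2) by simp
    qed
    moreover have "gval (\<lambda>i. if even i then Inr (j (i div 2)) else Inl (b (i div 2))) v =
      merge (\<lambda>k. v (j k)) b" for v by (rule ext) (simp add: gval_def merge_def)
    ultimately show ?thesis unfolding P_def by simp
  qed
  let ?A = "insert org (snd ` H)"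
  \<comment> \<open>The derivative of order \<open>n\<close> itself may depend on the others; it is
    split off as \<open>t\<close> and quantified, so that only independent coordinates are
    left.\<close>
  define R where "R z t = P (\<lambda>i. if i < n then z i else if i = n then t else org)" for z t
  have R: "defP ?A (\<lambda>z. \<exists>t \<in> dom M. R z t)"
  proof (rule defP_ex)
    have bA: "range b \<subseteq> ?A" using Q(2) by force
    have "defP ?A (\<lambda>v. P (gval (\<lambda>i. if i < n then Inr (Suc i) else if i = n then Inr 0 else Inl org) v))"
    proof (rule defP_gval)
      show "defP ?A P" using P by (rule defP_mono) (use bA in auto)
      show "(if i < n then Inr (Suc i) else if i = n then Inr 0 else Inl org) \<in> gens ?A" for i
        using org_dom by simp
    qed
    moreover have "gval (\<lambda>i. if i < n then Inr (Suc i) else if i = n then Inr 0 else Inl org) v =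
      (\<lambda>i. if i < n then v (Suc i) else if i = n then v 0 else org)" for v
      by (rule ext) (simp add: gval_def)
    ultimately show "defP ?A (\<lambda>v. R (stail v) (v 0))" unfolding R_def by simp
  qed
  have PR: "P u = R u (u n)" if "u \<in> Env" for u
  proof -
    have "(\<lambda>k. (if j k < n then u (j k) else if j k = n then u n else org)) = (\<lambda>k. u (j k))"
      using j by (intro ext) (metis le_neq_implies_less)
    then show ?thesis unfolding R_def P_def by simp
  qed
  define w where "w i = (if i < n then y i else org)" for i
  have wE: "w \<in> Env" using yd org_dom by (intro EnvI) (simp add: w_def)
  have "P y = R y (y n)"
  proof -
    have "(\<lambda>k. (if j k < n then y (j k) else if j k = n then y n else org)) = (\<lambda>k. y (j k))"
      using j by (intro ext) (metis le_neq_implies_less)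
    then show ?thesis unfolding R_def P_def by simp
  qed
  moreover have "R w (y n) = R y (y n)" unfolding R_def by (rule arg_cong[where f = P]) (auto simp: w_def)
  ultimately have Rw: "\<exists>t \<in> dom M. R w t" using Qy yd[of n] by auto
  have dclA: "dcl (?A \<union> X) = dcl (snd ` H \<union> X)" for X
  proof
    have "org \<in> dcl (snd ` H \<union> X)" using org dcl_mono[of "{}" "snd ` H \<union> X"] by auto
    then show "dcl (?A \<union> X) \<subseteq> dcl (snd ` H \<union> X)" by (intro dcl_trans) (auto intro: dcl_base)
  qed (intro dcl_mono, auto)
  \<comment> \<open>A dependence among the entries of \<open>y\<close> would be carried back to the
    jet of \<open>x\<close> by the converse map.\<close>
  have wi: "indep ?A w n"
    unfolding indep_def dclA
  proof (intro allI impI conjI notI)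
    fix i assume i: "i < n"
    show "w i \<in> dom M" using wE by simp
    assume *: "w i \<in> dcl (snd ` H \<union> w ` {..<i})"
    let ?K = "(H \<union> (\<lambda>i. (?x i, y i)) ` {..<i})\<inverse>"
    have wy: "w ` {..<i} = y ` {..<i}" using i by (intro image_cong) (auto simp: w_def)
    have f: "fst ` ?K = snd ` H \<union> y ` {..<i}" by force
    have s: "snd ` ?K = fst ` H \<union> ?x ` {..<i}" by force
    have "(y i, ?x i) \<in> ?H\<inverse>" using inH[of i] i by simp
    moreover have "?K \<subseteq> ?H\<inverse>" using i by force
    moreover have "y i \<in> dcl (fst ` ?K)" unfolding f using * i by (simp add: wy) (simp add: w_def)
    ultimately have "?x i \<in> dcl (snd ` ?K)" using El_dcl[OF El_converse[OF y]] by blast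
    then show False unfolding s using ind i by (simp add: indep_def)
  qed
  have cA: "countable ?A" using H(2) by simp
  have wA: "w i \<in> ?A" if "n \<le> i" for i using that by (simp add: w_def)
  from generic_nbhd[OF cA wi wE wA R Rw] obtain c d where cd: "c \<in> Env" "d \<in> Env" "in_box n c d w"
    "\<forall>z \<in> Env. in_box n c d z \<longrightarrow> (\<exists>t \<in> dom M. R (patch n z w) t)" unfolding nbhd_def by blast
  have "\<exists>a \<in> dom M. P (\<lambda>i. if i \<le> n then (\<delta> ^^ i) a else org)"
  proof (rule generic[OF _ cd(1,2)])
    show "defP (dom M) P" using P by (rule defP_mono) (use abE in auto)
    show "c i \<sqsubset> d i" if "i < n" for i
      using cd(3) that lt_trans[of "c i" "w i" "d i"] by (simp add: in_box_def)
    fix z assume z: "z \<in> Env" "in_box n c d z"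
    have "R (patch n z w) t = P (\<lambda>i. if i < n then z i else if i = n then t else org)" for t
      unfolding R_def by (rule arg_cong[where f = P]) (simp add: patch_def fun_eq_iff)
    moreover obtain t where "t \<in> dom M" "R (patch n z w) t" using cd(4) z by blast
    ultimately show "\<exists>t \<in> dom M. P (\<lambda>i. if i < n then z i else if i = n then t else org)"
      by blast
  qed
  then obtain e where e: "e \<in> dom M" "P (\<lambda>i. if i \<le> n then (\<delta> ^^ i) e else org)" by blast
  have "P (\<lambda>i. if i \<le> n then (\<delta> ^^ i) e else org) = Q (merge (\<lambda>k. (\<delta> ^^ (j k)) e) b)"
    unfolding P_def using j by simp
  then show ?thesis using e by auto
qed

text \<open>The element \<open>e\<close> is the value of a parameter-free term at the independent
  tuple \<open>w\<close>. The smooth locus of this term contains \<open>w\<close> and hence also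
  \<open>w'\<close>, and there \<delta> of the value is one and the same term in the point and its
  derivatives. The second part records where \<open>\<delta> e\<close> is definable, for use in
  iterations.\<close>

lemma delta_step:
  assumes H: "El H" "(org, org) \<in> H" "(e, e') \<in> H" and w: "indep {} w m"
    and w': "\<And>i. i < m \<Longrightarrow> (w i, w' i) \<in> H \<and> (\<delta> (w i), \<delta> (w' i)) \<in> H"
    and e: "e \<in> dcl (w ` {..<m})"
  shows "El (insert (\<delta> e, \<delta> e') H) \<and> \<delta> e \<in> dcl (w ` {..<m} \<union> (\<lambda>i. \<delta> (w i)) ` {..<m})"
proof -
  define u where "u i = (if i < m then w i else org)" for i
  define u' where "u' i = (if i < m then w' i else org)" for i
  have uH: "(u i, u' i) \<in> H" for i using w' H(2) by (simp add: u_def u'_def)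
  have uE: "u \<in> Env" "u' \<in> Env" using El_dom[OF H(1) uH] by (auto intro: EnvI)
  have iu: "indep {} u m" using w by (subst indep_cong[of m u w]) (simp_all add: u_def)
  have "dcl (w ` {..<m}) \<subseteq> dcl ({} \<union> range u)"
    by (rule dcl_mono) (auto simp: u_def image_iff intro!: exI)
  then obtain F where F: "defT {} F" "F u = e" using dcl_function[OF _ uE(1)] e by blast
  obtain U PD where U: "defP {} U" "U u" "\<And>i. defT {} (PD i)"
    "\<And>z. z \<in> Env \<Longrightarrow> U z \<Longrightarrow> nbhd m U z"
    "\<And>z i. z \<in> Env \<Longrightarrow> U z \<Longrightarrow> i < m \<Longrightarrow> pderiv F i z (PD i z)"
    "\<And>z i. z \<in> Env \<Longrightarrow> U z \<Longrightarrow> i < m \<Longrightarrow> contin m (PD i) z"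
    by (rule generic_C1[OF F(1) iu uE(1)]) (simp add: u_def, blast)
  from chain_rule[OF F(1) U(1,3-6)] obtain G where G: "defT {} G"
    "\<And>z. z \<in> Env \<Longrightarrow> U z \<Longrightarrow> (\<forall>i\<ge>m. z i = org) \<Longrightarrow>
        \<delta> (F z) = G (merge z (\<lambda>i. if i < m then \<delta> (z i) else org))" by blast
  have U': "U u'" using El_imp[OF H(1) U(1) uH U(2)] .
  have F': "F u' = e'"
  proof -
    have "defP {} (\<lambda>v. v 0 = F (stail v))" using F(1) by (simp add: defT_def)
    from El_imp[OF H(1) this, of "case_nat e u" "case_nat e' u'"] show ?thesis
      using F(2) H(3) uH by (simp split: nat.split)
  qed
  let ?v = "merge u (\<lambda>i. if i < m then \<delta> (u i) else org)"
  let ?v' = "merge u' (\<lambda>i. if i < m then \<delta> (u' i) else org)"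
  have d: "\<delta> e = G ?v" using G(2)[OF uE(1) U(2)] F(2) by (simp add: u_def)
  have d': "\<delta> e' = G ?v'" using G(2)[OF uE(2) U'] F' by (simp add: u'_def)
  have "(?v i, ?v' i) \<in> H" for i
    using uH w' H(2) by (auto simp: merge_def u_def u'_def)
  from El_insert_term[OF H(1) G(1) this] have 1: "El (insert (\<delta> e, \<delta> e') H)" by (simp only: d d')
  let ?C = "w ` {..<m} \<union> (\<lambda>i. \<delta> (w i)) ` {..<m}"
  have o: "org \<in> dcl ?C" using org dcl_mono[of "{}" ?C] by auto
  have wC: "w i \<in> dcl ?C \<and> \<delta> (w i) \<in> dcl ?C" if "i < m" for i
    using that El_dom[OF H(1)] w'[OF that] by (auto intro!: dcl_base)
  have "G ?v \<in> dcl ?C"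
  proof (rule dcl_app[where t = G])
    show "defT ?C G" using G(1) by (rule defT_mono) simp
    show "?v i \<in> dcl ?C" for i using o wC by (simp add: merge_def u_def)
  qed
  then show ?thesis using 1 d by simp
qed

text \<open>A predicate reads finitely many coordinates, whose pairs all occur at some finite
  stage.\<close>

lemma El_chain:
  assumes H: "(p, q) \<in> H" and El: "\<And>k :: nat. El (H \<union> f ` {..k})"
  shows "El (H \<union> range f)"
proof -
  have "H \<union> range f \<subseteq> dom M \<times> dom M"
  proof
    fix x assume "x \<in> H \<union> range f"
    then obtain k where "x \<in> H \<union> f ` {..k}" by auto
    then show "x \<in> dom M \<times> dom M" using El[of k] unfolding El_def by blast
  qed
  then have sub: "a \<in> dom M \<and> b \<in> dom M" if "(a, b) \<in> H \<union> range f" for a b using that by blast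
  moreover have "Q b" if Q: "defP {} Q" and ab: "\<forall>i. (a i, b i) \<in> H \<union> range f" and Qa: "Q a" for Q a b
  proof -
    obtain K where K: "\<forall>v \<in> Env. \<forall>w \<in> Env. (\<forall>i<K. v i = w i) \<longrightarrow> Q v = Q w"
      using defP_support[OF Q] by blast
    have "\<forall>i. \<exists>k. (a i, b i) \<in> H \<union> f ` {..k}" using ab by blast
    then obtain k where k: "\<And>i. (a i, b i) \<in> H \<union> f ` {..k i}" by metis
    define m where "m = Max (k ` {..<K} \<union> {0})"
    have m: "k i \<le> m" if "i < K" for i unfolding m_def using that by (intro Max_ge) auto
    define a' where "a' i = (if i < K then a i else p)" for i
    define b' where "b' i = (if i < K then b i else q)" for i
    have ab': "(a' i, b' i) \<in> H \<union> f ` {..m}" for i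
    proof (cases "i < K")
      case True
      have "f ` {..k i} \<subseteq> f ` {..m}" using m[OF True] by (intro image_mono) auto
      then show ?thesis using k[of i] True by (auto simp: a'_def b'_def)
    qed (use H in \<open>simp add: a'_def b'_def\<close>)
    have E: "a \<in> Env" "b \<in> Env" using sub[OF spec[OF ab]] by (auto intro!: EnvI)
    have E': "a' \<in> Env" "b' \<in> Env" using El_dom[OF El ab'] by (auto intro!: EnvI)
    have "Q a'" using K[rule_format, OF E(1) E'(1)] Qa by (simp add: a'_def)
    from El_imp[OF El Q ab' this] have "Q b'" .
    then show ?thesis using K[rule_format, OF E(2) E'(2)] unfolding b'_def by simp
  qed
  ultimately show ?thesis unfolding El_def using \<open>H \<union> range f \<subseteq> dom M \<times> dom M\<close> by blast
qed

text \<open>The pair \<open>(org, org)\<close> makes the map nonempty and supplies a filler;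
  countability keeps saturation applicable.\<close>

definition dEl :: "('m \<times> 'm) set \<Rightarrow> bool" where
  "dEl H \<longleftrightarrow> El H \<and> countable H \<and> (org, org) \<in> H \<and> (\<forall>(a, b) \<in> H. (\<delta> a, \<delta> b) \<in> H)"

lemma dEl_converse: "dEl H \<Longrightarrow> dEl (H\<inverse>)"
proof -
  assume H: "dEl H"
  then have "countable (prod.swap ` H)" by (simp add: dEl_def)
  moreover have "prod.swap ` H = H\<inverse>" by force
  ultimately show ?thesis using H El_converse unfolding dEl_def by auto
qed

text \<open>The orbit of a point is its sequence of derivatives, with orders selected by
  \<open>j\<close>: the identity covers the full jet, and \<open>min k n\<close> only the part up to
  order \<open>n\<close>, with repetitions.\<close>

lemma delta_saturated_extension:
  assumes H: "El H" "countable H" "(p, q) \<in> H" and x: "x \<in> dom M"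
    and real: "\<And>Q a b. defP {} Q \<Longrightarrow> (\<And>i. (a i, b i) \<in> H) \<Longrightarrow>
      Q (merge (\<lambda>k. (\<delta> ^^ (j k)) x) a) \<Longrightarrow> \<exists>y \<in> dom M. Q (merge (\<lambda>k. (\<delta> ^^ (j k)) y) b)"
  shows "\<exists>y \<in> dom M. El (H \<union> {((\<delta> ^^ (j k)) x, (\<delta> ^^ (j k)) y) | k. True})"
proof (rule saturated_extension[OF H(1,3), where orb = "\<lambda>y k. (\<delta> ^^ (j k)) y"])
  show "(\<lambda>k. (\<delta> ^^ (j k)) y) \<in> Env" if "y \<in> dom M" for y
    using delta_pow_dom[OF that] by (intro EnvI)
  show "(\<lambda>k. (\<delta> ^^ (j k)) x) \<in> Env" using delta_pow_dom[OF x] by (intro EnvI)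
  fix \<P> :: "('m \<Rightarrow> bool) set"
  assume 1: "\<And>P. P \<in> \<P> \<Longrightarrow> \<exists>Q b. defP {} Q \<and> (\<forall>i. b i \<in> snd ` H) \<and>
      P = (\<lambda>y. Q (merge (\<lambda>k. (\<delta> ^^ (j k)) y) b))"
    and 2: "\<And>F. finite F \<Longrightarrow> F \<subseteq> \<P> \<Longrightarrow> \<exists>y \<in> dom M. \<forall>P \<in> F. P y"
  show "\<exists>y \<in> dom M. \<forall>P \<in> \<P>. P y"
  proof (rule delta_saturation[of "snd ` H", OF _ _ 2])
    show "countable (snd ` H)" using H(2) by simp
    fix P assume "P \<in> \<P>"
    from 1[OF this] obtain Q b where Q: "defP {} Q" "\<forall>i. b i \<in> snd ` H"
      "P = (\<lambda>y. Q (merge (\<lambda>k. (\<delta> ^^ (j k)) y) b))" by blast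
    have bd: "b i \<in> dom M" for i using Q(2) El_dom[OF H(1)] by fastforce
    define \<sigma> :: "nat \<Rightarrow> (nat \<Rightarrow> 'm) \<Rightarrow> 'm" where
      "\<sigma> i = (if even i then (\<lambda>v. (\<delta> ^^ (j (i div 2))) (v 0)) else (\<lambda>_. b (i div 2)))" for i
    have Q': "D.defP (snd ` H) Q" using defP_delta defP_mono[OF Q(1)] by simp
    have "D.defT (snd ` H) (\<sigma> i)" for i
    proof (cases "even i")
      case True
      then show ?thesis using defT_delta_pow[OF D.defT_var] by (simp add: \<sigma>_def)
    next
      case False
      have "D.defT (snd ` H) (\<lambda>_. b (i div 2))" using Q(2) bd dom_N by (intro D.defT_param) simp_all
      then show ?thesis using False by (simp add: \<sigma>_def)
    qed
    from D.defP_subst[OF Q', of \<sigma>, OF this] have "D.defP (snd ` H) (\<lambda>v. Q (\<lambda>i. \<sigma> i v))" .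
    moreover have "(\<lambda>i. \<sigma> i v) = merge (\<lambda>k. (\<delta> ^^ (j k)) (v 0)) b" for v
      by (rule ext) (simp add: \<sigma>_def merge_def)
    ultimately show "D.defP (snd ` H) (\<lambda>v. P (v 0))" unfolding Q(3) by simp
  qed
qed (rule real)

text \<open>If \<open>n\<close> is least with \<open>\<delta>\<^sup>n x\<close> definable over the previous derivatives, then it suffices to match the
  derivatives up to order \<open>n\<close>: the chain rule determines the others. If there is no such \<open>n\<close>, each finite
  part of the jet is matched by genericity.\<close>

lemma dEl_extend:
  assumes H: "dEl H" and x: "x \<in> dom M"
  shows "\<exists>y H'. dEl H' \<and> H \<subseteq> H' \<and> (x, y) \<in> H'"
proof -
  let ?x = "\<lambda>k. (\<delta> ^^ k) x"
  have H1: "El H" "countable H" "(org, org) \<in> H" and Hd: "\<And>a b. (a, b) \<in> H \<Longrightarrow> (\<delta> a, \<delta> b) \<in> H"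
    using H by (auto simp: dEl_def)
  have xd: "?x k \<in> dom M" for k using delta_pow_dom[OF x] .
  have "\<exists>y \<in> dom M. El (H \<union> range (\<lambda>k. (?x k, (\<delta> ^^ k) y)))"
  proof (cases "\<exists>n. ?x n \<in> dcl (fst ` H \<union> ?x ` {..<n})")
    case False
    have ind: "indep (fst ` H) ?x n" for n using False xd by (simp add: indep_def)
    have "\<exists>y \<in> dom M. El (H \<union> {(?x (id k), (\<delta> ^^ (id k)) y) | k. True})"
    proof (rule delta_saturated_extension[OF H1 x])
      fix Q a b assume Q: "defP {} Q" "\<And>i. (a i, b i) \<in> H" "Q (merge (\<lambda>k. ?x (id k)) a)"
      obtain K where K: "\<forall>v \<in> Env. \<forall>w \<in> Env. (\<forall>i<K. v i = w i) \<longrightarrow> Q v = Q w"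
        using defP_support[OF Q(1)] by blast
      have abE: "a \<in> Env" "b \<in> Env" using El_dom[OF H1(1) Q(2)] by (auto intro: EnvI)
      \<comment> \<open>The predicate reads finitely many derivatives, so all orders may be cut off
        at \<open>K\<close>.\<close>
      have eq: "Q (merge (\<lambda>k. (\<delta> ^^ (id k)) z) u) = Q (merge (\<lambda>k. (\<delta> ^^ (min k K)) z) u)"
        if "z \<in> dom M" "u \<in> Env" for z u
      proof (rule K[rule_format])
        show "merge (\<lambda>k. (\<delta> ^^ (id k)) z) u \<in> Env" "merge (\<lambda>k. (\<delta> ^^ (min k K)) z) u \<in> Env"
          using that delta_pow_dom[OF that(1)] by (auto intro!: Env_merge EnvI[of "\<lambda>k. (\<delta> ^^ _ k) z"] simp: EnvI)
        fix i assume "i < K"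
        then have "min (i div 2) K = i div 2" by simp
        then show "merge (\<lambda>k. (\<delta> ^^ (id k)) z) u i = merge (\<lambda>k. (\<delta> ^^ (min k K)) z) u i"
          by (simp add: merge_def)
      qed
      have "Q (merge (\<lambda>k. ?x (min k K)) a)" using eq[OF x abE(1)] Q(3) by simp
      from generic_transfer[OF H1 x ind[of K] _ Q(1,2) this] obtain y where
        "y \<in> dom M" "Q (merge (\<lambda>k. (\<delta> ^^ (min k K)) y) b)" by auto
      then show "\<exists>y \<in> dom M. Q (merge (\<lambda>k. (\<delta> ^^ (id k)) y) b)" using eq abE(2) by blast
    qed
    moreover have "{(?x (id k), (\<delta> ^^ (id k)) y) | k. True} = range (\<lambda>k. (?x k, (\<delta> ^^ k) y))" for y
      by auto
    ultimately show ?thesis by simp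
  next
    case True
    define n where "n = (LEAST n. ?x n \<in> dcl (fst ` H \<union> ?x ` {..<n}))"
    have xn: "?x n \<in> dcl (fst ` H \<union> ?x ` {..<n})" unfolding n_def using True by (rule LeastI_ex)
    have ind: "indep (fst ` H) ?x n"
      unfolding indep_def
    proof (intro allI impI conjI xd)
      fix i assume "i < n"
      then show "?x i \<notin> dcl (fst ` H \<union> ?x ` {..<i})" unfolding n_def by (rule not_less_Least)
    qed
    have "\<exists>y \<in> dom M. El (H \<union> {(?x (min k n), (\<delta> ^^ (min k n)) y) | k. True})"
    proof (rule delta_saturated_extension[OF H1 x])
      fix Q a b assume Q: "defP {} Q" "\<And>i. (a i, b i) \<in> H" "Q (merge (\<lambda>k. ?x (min k n)) a)"
      from generic_transfer[OF H1 x ind _ Q]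
      show "\<exists>y \<in> dom M. Q (merge (\<lambda>k. (\<delta> ^^ (min k n)) y) b)" by simp
    qed
    then obtain y where y: "y \<in> dom M"
      "El (H \<union> {(?x (min k n), (\<delta> ^^ (min k n)) y) | k. True})" by blast
    let ?f = "\<lambda>k. (?x k, (\<delta> ^^ k) y)"
    have "{(?x (min k n), (\<delta> ^^ (min k n)) y) | k. True} = ?f ` {..n}"
    proof
      show "?f ` {..n} \<subseteq> {(?x (min k n), (\<delta> ^^ (min k n)) y) | k. True}"
      proof
        fix u assume "u \<in> ?f ` {..n}"
        then obtain k where "k \<le> n" "u = ?f k" by auto
        then have "u = (?x (min k n), (\<delta> ^^ (min k n)) y)" by simp
        then show "u \<in> {(?x (min k n), (\<delta> ^^ (min k n)) y) | k. True}" by blast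
      qed
    qed auto
    then have base: "El (H \<union> ?f ` {..n})" using y(2) by simp
    let ?C = "fst ` H \<union> ?x ` {..<n}"
    \<comment> \<open>Every derivative from order \<open>n\<close> on is definable over
      \<open>?C\<close>, hence over an independent tuple from \<open>?C\<close>. Derivatives of
      members of \<open>?C\<close> lie in \<open>?C\<close> or equal the \<open>n\<close>-th
      derivative of \<open>x\<close>, which is itself definable over \<open>?C\<close>, so the
      closure does not grow.\<close>
    have main: "El (H \<union> ?f ` {..n + i}) \<and> ?x (n + i) \<in> dcl ?C" for i
    proof (induction i)
      case 0
      then show ?case using base xn by simp
    next
      case (Suc i)
      let ?H = "H \<union> ?f ` {..n + i}"
      obtain w m where w: "indep {} w m" "w ` {..<m} \<subseteq> ?C" "?x (n + i) \<in> dcl (w ` {..<m})"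
        using dcl_independent Suc.IH by blast
      have "\<exists>b. (w l, b) \<in> ?H \<and> (\<delta> (w l), \<delta> b) \<in> ?H \<and> \<delta> (w l) \<in> fst ` H \<union> ?x ` {..n}"
        if l: "l < m" for l
      proof -
        have "w l \<in> ?C" using w(2) l by blast
        then consider b where "(w l, b) \<in> H" | k where "k < n" "w l = ?x k" by force
        then show ?thesis
        proof cases
          case 1
          then show ?thesis using Hd[OF 1] by force
        next
          case 2
          have "?f k \<in> ?H" using 2(1) by auto
          moreover have "?f (Suc k) \<in> ?H"
            using 2(1) imageI[of "Suc k" "{..n + i}" ?f] by (simp del: funpow.simps)
          moreover have "?x (Suc k) \<in> ?x ` {..n}"
            using 2(1) by (intro imageI) simp
          ultimately show ?thesis unfolding 2(2) funpow.simps comp_apply by blast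
        qed
      qed
      then have "\<forall>l. \<exists>b. l < m \<longrightarrow> (w l, b) \<in> ?H \<and> (\<delta> (w l), \<delta> b) \<in> ?H \<and>
        \<delta> (w l) \<in> fst ` H \<union> ?x ` {..n}" by blast
      from choice[OF this] obtain w' where w': "\<And>l. l < m \<Longrightarrow> (w l, w' l) \<in> ?H \<and>
        (\<delta> (w l), \<delta> (w' l)) \<in> ?H \<and> \<delta> (w l) \<in> fst ` H \<union> ?x ` {..n}" by blast
      have e: "(org, org) \<in> ?H" "?f (n + i) \<in> ?H" using H1(3) by auto
      have ww: "(w l, w' l) \<in> ?H \<and> (\<delta> (w l), \<delta> (w' l)) \<in> ?H" if "l < m" for l
        using w'[OF that] by blast
      note s' = delta_step[OF conjunct1[OF Suc.IH] e w(1) ww w(3)]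
      note s = conjunct1[OF s'] conjunct2[OF s']
      have "insert (\<delta> (?x (n + i)), \<delta> ((\<delta> ^^ (n + i)) y)) ?H = H \<union> ?f ` {..n + Suc i}"
        unfolding add_Suc_right atMost_Suc image_insert Un_insert_right funpow.simps comp_apply ..
      moreover have "dcl (w ` {..<m} \<union> (\<lambda>l. \<delta> (w l)) ` {..<m}) \<subseteq> dcl ?C"
      proof (rule dcl_trans, rule subsetI)
        fix u assume u: "u \<in> (w ` {..<m} \<union> (\<lambda>l. \<delta> (w l)) ` {..<m}) \<inter> dom M"
        have n: "?x ` {..n} = insert (?x n) (?x ` {..<n})"
          unfolding lessThan_Suc_atMost[symmetric] lessThan_Suc image_insert ..
        have "u \<in> fst ` H \<union> ?x ` {..n}"
        proof (cases "u \<in> w ` {..<m}")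
          case True
          then have "u \<in> ?C" using w(2) by blast
          then show ?thesis unfolding n by blast
        next
          case False
          then show ?thesis using u w' by blast
        qed
        then consider "u \<in> ?C" | "u = ?x n" unfolding n by blast
        then show "u \<in> dcl ?C"
        proof cases
          case 1
          then show ?thesis using u dcl_base[of u ?C] by simp
        qed (use xn in simp)
      qed
      ultimately show ?case using s by auto
    qed
    have "El (H \<union> ?f ` {..k})" for k
      by (rule El_mono[OF conjunct1[OF main[of k]]]) auto
    from El_chain[OF H1(3) this] show ?thesis using y(1) by blast
  qed
  then obtain y where y: "El (H \<union> range (\<lambda>k. (?x k, (\<delta> ^^ k) y)))" by blast
  let ?H = "H \<union> range (\<lambda>k. (?x k, (\<delta> ^^ k) y))"
  have "(\<delta> (?x k), \<delta> ((\<delta> ^^ k) y)) \<in> ?H" for k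
    using rangeI[of "\<lambda>k. (?x k, (\<delta> ^^ k) y)" "Suc k"] by simp
  then have "dEl ?H" unfolding dEl_def using y H1 Hd by auto
  moreover have "(x, y) \<in> ?H" using rangeI[of "\<lambda>k. (?x k, (\<delta> ^^ k) y)" 0] by simp
  ultimately show ?thesis by blast
qed

text \<open>The value of a function symbol need not lie in the map yet. When the map is extended by
  that value, its partner has to be the corresponding value because the graph of the symbol is
  preserved.\<close>

lemma dEl_tm:
  assumes "dEl H" "wf_tm (delta_lang L) t" "v \<in> Env" "\<forall>i \<in> fv_tm t. (v i, v' i) \<in> H"
  shows "\<exists>H'. dEl H' \<and> H \<subseteq> H' \<and> (eval_tm N v t, eval_tm N v' t) \<in> H'"
  using assms
proof (induction t arbitrary: H)
  case (Var x)
  then show ?case by auto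
next
  case (App f ts)
  have "\<exists>H'. dEl H' \<and> H \<subseteq> H' \<and> (\<forall>t \<in> set us. (eval_tm N v t, eval_tm N v' t) \<in> H')"
    if "set us \<subseteq> set ts" for us
    using that
  proof (induction us)
    case Nil
    then show ?case using App.prems(1) by auto
  next
    case (Cons u us)
    then obtain H1 where H1: "dEl H1" "H \<subseteq> H1" "\<forall>t \<in> set us. (eval_tm N v t, eval_tm N v' t) \<in> H1"
      by auto
    have u: "u \<in> set ts" using Cons.prems by simp
    have "wf_tm (delta_lang L) u" "\<forall>i \<in> fv_tm u. (v i, v' i) \<in> H1"
      using App.prems(2,4) u H1(2) by auto
    from App.IH[OF u H1(1) this(1) App.prems(3) this(2)] H1 show ?case by (metis set_ConsD subset_iff)
  qed
  then obtain H1 where H1: "dEl H1" "H \<subseteq> H1" "\<forall>t \<in> set ts. (eval_tm N v t, eval_tm N v' t) \<in> H1"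
    by blast
  have El: "El H1" using H1(1) by (simp add: dEl_def)
  have len: "length ts = far (delta_lang L) f" using App.prems(2) by simp
  show ?case
  proof (cases f)
    case (Old g)
    let ?n = "far L g"
    have n: "length ts = ?n" using len Old by simp
    let ?a = "\<lambda>i. if i < ?n then eval_tm N v (ts ! i) else org"
    let ?b = "\<lambda>i. if i < ?n then eval_tm N v' (ts ! i) else org"
    have ab: "(?a i, ?b i) \<in> H1" for i
      using H1(1,3) n by (auto simp: dEl_def)
    have d: "defT {} (\<lambda>u. fint M g (map (\<lambda>i. u i) [0..<?n]))"
      using defT_fun[of "map (\<lambda>i u. u i) [0..<?n]" g "{}"] defT_var by (auto simp: comp_def)
    have abE: "?a \<in> Env" using El_dom[OF El ab] by (auto intro: EnvI)
    have ma: "map ?a [0..<?n] = map (eval_tm N v) ts" "map ?b [0..<?n] = map (eval_tm N v') ts"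
      using n by (auto intro!: nth_equalityI)
    let ?X = "fint M g (map ?a [0..<?n])"
    have "?X \<in> dom M" using defT_dom[OF d abE] by simp
    from dEl_extend[OF H1(1) this] obtain y H2 where H2: "dEl H2" "H1 \<subseteq> H2" "(?X, y) \<in> H2" by blast
    have "defP {} (\<lambda>v. v 0 = fint M g (map (\<lambda>i. v (Suc i)) [0..<?n]))" using d by (simp add: defT_def)
    moreover have "(case_nat ?X ?a i, case_nat y ?b i) \<in> H2" for i
    proof (cases i)
      case (Suc k)
      then show ?thesis using subsetD[OF H2(2) ab[of k]] by simp
    qed (use H2(3) in simp)
    moreover have "El H2" using H2(1) by (simp add: dEl_def)
    ultimately have "y = fint M g (map ?b [0..<?n])"
      using El_imp[of H2 _ "case_nat ?X ?a" "case_nat y ?b"] by fastforce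
    then have "(eval_tm N v (App f ts), eval_tm N v' (App f ts)) \<in> H2"
      using H2(3) unfolding ma by (simp add: Old M)
    then show ?thesis using H2 H1 by blast
  next
    case Delta
    then obtain u where u: "ts = [u]" using len by (auto simp: length_Suc_conv)
    have "(\<delta> (eval_tm N v u), \<delta> (eval_tm N v' u)) \<in> H1" using H1(1,3) u by (auto simp: dEl_def)
    moreover have "eval_tm N v (App f ts) = \<delta> (eval_tm N v u)" for v
      by (simp add: delta u Delta)
    ultimately show ?thesis using H1(1,2) by auto
  qed
qed

lemma dEl_tms:
  assumes "dEl H" "v \<in> Env" "\<forall>t \<in> set ts. wf_tm (delta_lang L) t \<and> (\<forall>i \<in> fv_tm t. (v i, v' i) \<in> H)"
  shows "\<exists>H'. dEl H' \<and> H \<subseteq> H' \<and> (\<forall>t \<in> set ts. (eval_tm N v t, eval_tm N v' t) \<in> H')"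
  using assms
proof (induction ts)
  case (Cons u us)
  then obtain H1 where H1: "dEl H1" "H \<subseteq> H1" "\<forall>t \<in> set us. (eval_tm N v t, eval_tm N v' t) \<in> H1"
    by auto
  have "wf_tm (delta_lang L) u" "\<forall>i \<in> fv_tm u. (v i, v' i) \<in> H1" using Cons.prems(3) H1(2) by auto
  from dEl_tm[OF H1(1) this(1) Cons.prems(2) this(2)] H1 show ?case by (metis set_ConsD subset_iff)
qed auto

text \<open>Back and forth: a witness of a quantifier is answered by an extension of the map, and
  the converse map serves the other direction. The map therefore varies during the
  induction.\<close>

theorem dEl_sat:
  assumes "dEl H" "wf_fm (delta_lang L) \<phi>" "v \<in> Env" "v' \<in> Env" "\<forall>i \<in> fv \<phi>. (v i, v' i) \<in> H"
  shows "sat N v \<phi> = sat N v' \<phi>"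
  using assms
proof (induction \<phi> arbitrary: H v v')
  case (FEq s t)
  then obtain H1 where H1: "dEl H1" "\<forall>u \<in> set [s, t]. (eval_tm N v u, eval_tm N v' u) \<in> H1"
    using dEl_tms[of H v "[s, t]" v'] by auto
  have El: "El H1" using H1(1) by (simp add: dEl_def)
  have "(\<lambda>v. v 0 = v 1) (case_nat (eval_tm N v s) (\<lambda>_. eval_tm N v t)) =
    (\<lambda>v. v 0 = v 1) (case_nat (eval_tm N v' s) (\<lambda>_. eval_tm N v' t))"
    by (rule El_iff[OF El defP_eq]) (use H1(2) in \<open>simp split: nat.split\<close>)
  then show ?case by simp
next
  case (FRel p ts)
  then obtain H1 where H1: "dEl H1" "\<forall>u \<in> set ts. (eval_tm N v u, eval_tm N v' u) \<in> H1"
    using dEl_tms[of H v ts v'] by auto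
  have El: "El H1" and o: "(org, org) \<in> H1" using H1(1) by (auto simp: dEl_def)
  let ?n = "rar L p"
  have n: "length ts = ?n" using FRel.prems(2) by simp
  let ?a = "\<lambda>v i. if i < ?n then eval_tm N v (ts ! i) else org"
  have d: "defP {} (\<lambda>u. rint M p (map (\<lambda>i. u i) [0..<?n]))"
    using defP_rel[of "map (\<lambda>i u. u i) [0..<?n]" p "{}"] defT_var by (auto simp: comp_def)
  have ma: "map (?a v) [0..<?n] = map (eval_tm N v) ts" for v
    using n by (auto intro!: nth_equalityI)
  have "rint M p (map (?a v) [0..<?n]) = rint M p (map (?a v') [0..<?n])"
    by (rule El_iff[OF El d]) (use H1(2) o n in auto)
  then show ?case unfolding ma by (simp add: M)
next
  case (FNeg \<phi>)
  have "sat N v \<phi> = sat N v' \<phi>" by (rule FNeg.IH[OF FNeg.prems(1)]) (use FNeg.prems in auto)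
  then show ?case by simp
next
  case (FConj \<phi> \<psi>)
  have "sat N v \<phi> = sat N v' \<phi>" by (rule FConj.IH(1)[OF FConj.prems(1)]) (use FConj.prems in auto)
  moreover have "sat N v \<psi> = sat N v' \<psi>" by (rule FConj.IH(2)[OF FConj.prems(1)]) (use FConj.prems in auto)
  ultimately show ?case by simp
next
  case (FEx x \<phi>)
  have wf: "wf_fm (delta_lang L) \<phi>" using FEx.prems(2) by simp
  have step: "\<exists>b \<in> dom M. sat N (u'(x := b)) \<phi>"
    if K: "dEl K" "u \<in> Env" "u' \<in> Env" "\<forall>i \<in> fv (FEx x \<phi>). (u i, u' i) \<in> K"
      and a: "a \<in> dom M" "sat N (u(x := a)) \<phi>" for K u u' a
  proof -
    obtain b K' where K': "dEl K'" "K \<subseteq> K'" "(a, b) \<in> K'" using dEl_extend[OF K(1) a(1)] by blast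
    have b: "b \<in> dom M" using K' El_dom unfolding dEl_def by blast
    have "sat N (u(x := a)) \<phi> = sat N (u'(x := b)) \<phi>"
      by (rule FEx.IH[OF K'(1) wf]) (use K K' a b in auto)
    then show ?thesis using a b by auto
  qed
  show ?case
    unfolding sat.simps dom_N
  proof
    assume "\<exists>a \<in> dom M. sat N (v(x := a)) \<phi>"
    then show "\<exists>a \<in> dom M. sat N (v'(x := a)) \<phi>"
      using step[OF FEx.prems(1,3,4,5)] by blast
  next
    assume "\<exists>a \<in> dom M. sat N (v'(x := a)) \<phi>"
    moreover have "\<forall>i \<in> fv (FEx x \<phi>). (v' i, v i) \<in> H\<inverse>" using FEx.prems(5) by simp
    ultimately show "\<exists>a \<in> dom M. sat N (v(x := a)) \<phi>"
      using step[OF dEl_converse[OF FEx.prems(1)] FEx.prems(4,3)] by blast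
  qed
qed

end

section \<open>Ordered fields\<close>

locale ordered_field_on =
  fixes R :: "'m oring" (structure)
  assumes ordered: "ordered_field R"
begin

sublocale field R
  using ordered by (simp add: ordered_field_def)

text \<open>The relation \<open>olt\<close> is arbitrary outside the carrier, so it is restricted to
  it.\<close>

definition lt :: "'m \<Rightarrow> 'm \<Rightarrow> bool" (infix "\<sqsubset>" 50) where
  "x \<sqsubset> y \<longleftrightarrow> x \<in> carrier R \<and> y \<in> carrier R \<and> olt R x y"

lemma lt_carrier: "x \<sqsubset> y \<Longrightarrow> x \<in> carrier R \<and> y \<in> carrier R"
  by (simp add: lt_def)

lemma ord_irrefl: "\<not> x \<sqsubset> x"
  using ordered by (auto simp: ordered_field_def lt_def)

lemma ord_trans: "x \<sqsubset> y \<Longrightarrow> y \<sqsubset> z \<Longrightarrow> x \<sqsubset> z"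
  using ordered unfolding ordered_field_def lt_def by blast

lemma ord_total: "x \<in> carrier R \<Longrightarrow> y \<in> carrier R \<Longrightarrow> x \<sqsubset> y \<or> x = y \<or> y \<sqsubset> x"
  using ordered unfolding ordered_field_def lt_def by blast

lemma ord_add: "x \<sqsubset> y \<Longrightarrow> z \<in> carrier R \<Longrightarrow> x \<oplus> z \<sqsubset> y \<oplus> z"
  using ordered unfolding ordered_field_def lt_def by simp

lemma ord_mult_pos: "\<zero> \<sqsubset> x \<Longrightarrow> \<zero> \<sqsubset> y \<Longrightarrow> \<zero> \<sqsubset> x \<otimes> y"
  using ordered unfolding ordered_field_def lt_def by simp

lemma ord_add_strict: "a \<sqsubset> b \<Longrightarrow> c \<sqsubset> d \<Longrightarrow> a \<oplus> c \<sqsubset> b \<oplus> d"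
proof -
  assume *: "a \<sqsubset> b" "c \<sqsubset> d"
  have car: "a \<in> carrier R" "b \<in> carrier R" "c \<in> carrier R" "d \<in> carrier R"
    using * lt_carrier by blast+
  have "a \<oplus> c \<sqsubset> b \<oplus> c" using ord_add *(1) car by simp
  moreover have "c \<oplus> b \<sqsubset> d \<oplus> b" using ord_add *(2) car by simp
  moreover have "c \<oplus> b = b \<oplus> c" "d \<oplus> b = b \<oplus> d" using car a_comm by auto
  ultimately show ?thesis using ord_trans by metis
qed

lemma ord_diff: "a \<in> carrier R \<Longrightarrow> b \<in> carrier R \<Longrightarrow> a \<sqsubset> b \<longleftrightarrow> \<zero> \<sqsubset> b \<ominus> a"
proof
  assume car: "a \<in> carrier R" "b \<in> carrier R"
  { assume "a \<sqsubset> b"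
    from ord_add[OF this, of "\<ominus> a"] show "\<zero> \<sqsubset> b \<ominus> a" using car by (simp add: minus_eq r_neg) }
  { assume "\<zero> \<sqsubset> b \<ominus> a"
    from ord_add[OF this car(1)] have "\<zero> \<oplus> a \<sqsubset> b \<ominus> a \<oplus> a" .
    moreover have "\<zero> \<oplus> a = a" "b \<ominus> a \<oplus> a = b" using car by algebra+
    ultimately show "a \<sqsubset> b" by simp }
qed

lemma ord_neg: "a \<sqsubset> b \<Longrightarrow> \<ominus> b \<sqsubset> \<ominus> a"
proof -
  assume *: "a \<sqsubset> b"
  then have car: "a \<in> carrier R" "b \<in> carrier R" using lt_carrier by auto
  have "\<ominus> a \<ominus> (\<ominus> b) = b \<ominus> a" using car by algebra
  then show ?thesis using * car ord_diff[of a b] ord_diff[of "\<ominus> b" "\<ominus> a"] by simp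
qed

lemma one_pos: "\<zero> \<sqsubset> \<one>"
proof (rule ccontr)
  assume "\<not> \<zero> \<sqsubset> \<one>"
  then have "\<one> \<sqsubset> \<zero>" using ord_total[of \<zero> \<one>] zero_not_one by auto
  then have "\<zero> \<sqsubset> \<ominus> \<one>" using ord_neg by fastforce
  then have "\<zero> \<sqsubset> (\<ominus> \<one>) \<otimes> (\<ominus> \<one>)" using ord_mult_pos by blast
  moreover have "(\<ominus> \<one>) \<otimes> (\<ominus> \<one>) = \<one>" by algebra
  ultimately show False using \<open>\<not> \<zero> \<sqsubset> \<one>\<close> by simp
qed

lemma ord_mult: "a \<sqsubset> b \<Longrightarrow> \<zero> \<sqsubset> c \<Longrightarrow> a \<otimes> c \<sqsubset> b \<otimes> c"
proof -
  assume *: "a \<sqsubset> b" "\<zero> \<sqsubset> c"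
  then have car: "a \<in> carrier R" "b \<in> carrier R" "c \<in> carrier R" using lt_carrier by auto
  have "\<zero> \<sqsubset> (b \<ominus> a) \<otimes> c" using * car ord_diff ord_mult_pos by blast
  moreover have "(b \<ominus> a) \<otimes> c = b \<otimes> c \<ominus> a \<otimes> c" using car by algebra
  ultimately show ?thesis using car ord_diff[of "a \<otimes> c" "b \<otimes> c"] by simp
qed

lemma pos_unit: "\<zero> \<sqsubset> a \<Longrightarrow> inv a \<in> carrier R \<and> a \<otimes> inv a = \<one> \<and> inv a \<otimes> a = \<one>"
proof -
  assume a: "\<zero> \<sqsubset> a"
  then have "a \<noteq> \<zero>" using ord_irrefl by blast
  then have "a \<in> Units R" using lt_carrier[OF a] field_Units by simp
  then show ?thesis using Units_r_inv Units_l_inv by auto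
qed

lemma inv_pos: "\<zero> \<sqsubset> a \<Longrightarrow> \<zero> \<sqsubset> inv a"
proof (rule ccontr)
  assume a: "\<zero> \<sqsubset> a" and n: "\<not> \<zero> \<sqsubset> inv a"
  have car: "a \<in> carrier R" "inv a \<in> carrier R" "a \<otimes> inv a = \<one>" using pos_unit[OF a] lt_carrier[OF a] by auto
  have "inv a \<noteq> \<zero>" using car by auto
  then have "inv a \<sqsubset> \<zero>" using n ord_total[of \<zero> "inv a"] car by auto
  then have "inv a \<otimes> a \<sqsubset> \<zero> \<otimes> a" using ord_mult a by blast
  then have "\<one> \<sqsubset> \<zero>" using car pos_unit[OF a] by simp
  then show False using one_pos ord_trans ord_irrefl by blast
qed

lemma ord_dense: "x \<sqsubset> y \<Longrightarrow> \<exists>z. x \<sqsubset> z \<and> z \<sqsubset> y"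
proof -
  assume xy: "x \<sqsubset> y"
  then have car: "x \<in> carrier R" "y \<in> carrier R" using lt_carrier by auto
  have two: "\<one> \<sqsubset> \<one> \<oplus> \<one>" using ord_add[OF one_pos, of \<one>] by simp
  then have "\<zero> \<sqsubset> \<one> \<oplus> \<one>" using one_pos ord_trans by blast
  then have h: "\<zero> \<sqsubset> inv (\<one> \<oplus> \<one>)" "inv (\<one> \<oplus> \<one>) \<in> carrier R" "(\<one> \<oplus> \<one>) \<otimes> inv (\<one> \<oplus> \<one>) = \<one>"
    using inv_pos pos_unit by auto
  have h1: "inv (\<one> \<oplus> \<one>) \<sqsubset> \<one>" using ord_mult[OF two h(1)] h by simp
  let ?d = "y \<ominus> x"
  have d: "\<zero> \<sqsubset> ?d" using xy car ord_diff by blast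
  let ?z = "x \<oplus> inv (\<one> \<oplus> \<one>) \<otimes> ?d"
  have "\<zero> \<sqsubset> inv (\<one> \<oplus> \<one>) \<otimes> ?d" using ord_mult_pos h d by blast
  from ord_add[OF this car(1)] have 1: "x \<sqsubset> ?z" using car h a_comm by simp
  have "inv (\<one> \<oplus> \<one>) \<otimes> ?d \<sqsubset> \<one> \<otimes> ?d" using ord_mult h1 d by blast
  from ord_add[OF this car(1)] have "inv (\<one> \<oplus> \<one>) \<otimes> ?d \<oplus> x \<sqsubset> \<one> \<otimes> ?d \<oplus> x" .
  moreover have "\<one> \<otimes> ?d \<oplus> x = y" using car by algebra
  moreover have "inv (\<one> \<oplus> \<one>) \<otimes> ?d \<oplus> x = ?z" using car h a_comm by simp
  ultimately show ?thesis using 1 by auto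
qed

lemma plus_pos: "x \<in> carrier R \<Longrightarrow> \<zero> \<sqsubset> e \<Longrightarrow> x \<sqsubset> x \<oplus> e"
  using ord_add[of \<zero> e x] lt_carrier[of \<zero> e] a_comm[of e x] by simp

lemma minus_pos: "x \<in> carrier R \<Longrightarrow> \<zero> \<sqsubset> e \<Longrightarrow> x \<ominus> e \<sqsubset> x"
proof -
  assume *: "x \<in> carrier R" "\<zero> \<sqsubset> e"
  then have e: "e \<in> carrier R" using lt_carrier by blast
  have "x \<ominus> (x \<ominus> e) = e" using * e by algebra
  then show ?thesis using ord_diff[of "x \<ominus> e" x] * e by simp
qed

lemma positives_iff: "e \<in> positives R \<longleftrightarrow> \<zero> \<sqsubset> e"
  by (auto simp: positives_def lt_def)

lemma abs_less_diff:
  assumes "x \<in> carrier R" "y \<in> carrier R" "e \<in> carrier R"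
  shows "abs_less R (y \<ominus> x) e \<longleftrightarrow> x \<ominus> e \<sqsubset> y \<and> y \<sqsubset> x \<oplus> e"
proof -
  have "y \<ominus> x \<ominus> (\<ominus> e) = y \<ominus> (x \<ominus> e)" using assms by algebra
  then have "\<ominus> e \<sqsubset> y \<ominus> x \<longleftrightarrow> x \<ominus> e \<sqsubset> y"
    using assms ord_diff[of "\<ominus> e" "y \<ominus> x"] ord_diff[of "x \<ominus> e" y] by simp
  moreover have "e \<ominus> (y \<ominus> x) = x \<oplus> e \<ominus> y" using assms by algebra
  then have "y \<ominus> x \<sqsubset> e \<longleftrightarrow> y \<sqsubset> x \<oplus> e"
    using assms ord_diff[of "y \<ominus> x" e] ord_diff[of y "x \<oplus> e"] by simp
  ultimately show ?thesis using assms by (simp add: abs_less_def lt_def)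
qed

text \<open>\<open>e\<close> is the smaller of the distances from \<open>t\<close> to
  \<open>p\<close> and to \<open>r\<close>, which is why equality is allowed.\<close>

lemma ex_below_both: "p \<sqsubset> t \<Longrightarrow> t \<sqsubset> r \<Longrightarrow> \<exists>e. \<zero> \<sqsubset> e \<and> (p = t \<ominus> e \<or> p \<sqsubset> t \<ominus> e) \<and> (t \<oplus> e = r \<or> t \<oplus> e \<sqsubset> r)"
proof -
  assume *: "p \<sqsubset> t" "t \<sqsubset> r"
  then have car: "p \<in> carrier R" "t \<in> carrier R" "r \<in> carrier R" using lt_carrier by auto
  have 1: "\<zero> \<sqsubset> t \<ominus> p" and 2: "\<zero> \<sqsubset> r \<ominus> t" using * car ord_diff by blast+
  have i: "t \<ominus> (t \<ominus> p) = p" "t \<oplus> (r \<ominus> t) = r" using car by algebra+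
  consider "t \<ominus> p \<sqsubset> r \<ominus> t" | "t \<ominus> p = r \<ominus> t" | "r \<ominus> t \<sqsubset> t \<ominus> p"
    using ord_total[of "t \<ominus> p" "r \<ominus> t"] car by auto
  then show ?thesis
  proof cases
    case 1
    have "t \<ominus> p \<oplus> t \<sqsubset> r \<ominus> t \<oplus> t" using ord_add[OF 1 car(2)] .
    moreover have "t \<ominus> p \<oplus> t = t \<oplus> (t \<ominus> p)" "r \<ominus> t \<oplus> t = r" using car by algebra+
    ultimately show ?thesis using \<open>\<zero> \<sqsubset> t \<ominus> p\<close> i(1) by (intro exI[of _ "t \<ominus> p"]) simp
  next
    case 2
    then show ?thesis using \<open>\<zero> \<sqsubset> t \<ominus> p\<close> i by (intro exI[of _ "t \<ominus> p"]) simp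
  next
    case 3
    have e: "t \<ominus> (r \<ominus> t) \<ominus> p = t \<ominus> p \<ominus> (r \<ominus> t)" using car by algebra
    have "p \<sqsubset> t \<ominus> (r \<ominus> t)"
      using 3 car ord_diff[of p "t \<ominus> (r \<ominus> t)"] ord_diff[of "r \<ominus> t" "t \<ominus> p"] e by simp
    then show ?thesis using 2 i(2) by (intro exI[of _ "r \<ominus> t"]) simp
  qed
qed

text \<open>The slope of the line through \<open>(x, a)\<close> and \<open>(y, b)\<close>; the value
  zero for equal abscissae makes it total.\<close>

definition secant :: "'m \<Rightarrow> 'm \<Rightarrow> 'm \<Rightarrow> 'm \<Rightarrow> 'm" where
  "secant x a y b = (if x = y then \<zero> else (b \<ominus> a) \<otimes> inv (y \<ominus> x))"

lemma diff_unit: "x \<in> carrier R \<Longrightarrow> y \<in> carrier R \<Longrightarrow> x \<noteq> y \<Longrightarrow> y \<ominus> x \<in> Units R"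
proof -
  assume *: "x \<in> carrier R" "y \<in> carrier R" "x \<noteq> y"
  have "y \<ominus> x \<noteq> \<zero>"
  proof
    assume "y \<ominus> x = \<zero>"
    moreover have "y = y \<ominus> x \<oplus> x" using * by algebra
    ultimately show False using * by simp
  qed
  then show ?thesis using * field_Units by simp
qed

lemma secant_closed: "\<lbrakk>x \<in> carrier R; y \<in> carrier R; a \<in> carrier R; b \<in> carrier R\<rbrakk> \<Longrightarrow>
    secant x a y b \<in> carrier R"
  using diff_unit[of x y] by (simp add: secant_def)

lemma secant_iff:
  assumes "x \<in> carrier R" "y \<in> carrier R" "a \<in> carrier R" "b \<in> carrier R" "x \<noteq> y" "r \<in> carrier R"
  shows "r = secant x a y b \<longleftrightarrow> r \<otimes> (y \<ominus> x) = b \<ominus> a"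
proof -
  have u: "y \<ominus> x \<in> Units R" by (rule diff_unit[OF assms(1,2,5)])
  have i: "inv (y \<ominus> x) \<in> carrier R" "(y \<ominus> x) \<otimes> inv (y \<ominus> x) = \<one>" "inv (y \<ominus> x) \<otimes> (y \<ominus> x) = \<one>"
    using u by auto
  show ?thesis
  proof
    assume "r = secant x a y b"
    then have "r \<otimes> (y \<ominus> x) = (b \<ominus> a) \<otimes> inv (y \<ominus> x) \<otimes> (y \<ominus> x)" using assms(5) by (simp add: secant_def)
    also have "\<dots> = b \<ominus> a" using i assms by (simp add: m_assoc)
    finally show "r \<otimes> (y \<ominus> x) = b \<ominus> a" .
  next
    assume "r \<otimes> (y \<ominus> x) = b \<ominus> a"
    then have "(b \<ominus> a) \<otimes> inv (y \<ominus> x) = r \<otimes> (y \<ominus> x) \<otimes> inv (y \<ominus> x)" by simp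
    also have "\<dots> = r" using i assms by (simp add: m_assoc)
    finally show "r = secant x a y b" using assms(5) by (simp add: secant_def)
  qed
qed

lemma secant_sym:
  assumes "x \<in> carrier R" "y \<in> carrier R" "a \<in> carrier R" "b \<in> carrier R" "x \<noteq> y"
  shows "secant x a y b = secant y b x a"
proof -
  let ?r = "secant x a y b"
  have r: "?r \<in> carrier R" by (rule secant_closed[OF assms(1-4)])
  have "?r \<otimes> (y \<ominus> x) = b \<ominus> a" using secant_iff[OF assms r] by simp
  moreover have "?r \<otimes> (x \<ominus> y) = \<ominus> (?r \<otimes> (y \<ominus> x))" using r assms by algebra
  moreover have "\<ominus> (b \<ominus> a) = a \<ominus> b" using assms by algebra
  ultimately show ?thesis using secant_iff[of y x b a ?r] assms r by simp
qed

lemma secant_less: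
  assumes "x \<sqsubset> y" "a \<in> carrier R" "b \<in> carrier R" "c \<in> carrier R"
  shows "c \<sqsubset> secant x a y b \<longleftrightarrow> c \<otimes> (y \<ominus> x) \<sqsubset> b \<ominus> a"
    and "secant x a y b \<sqsubset> c \<longleftrightarrow> b \<ominus> a \<sqsubset> c \<otimes> (y \<ominus> x)"
proof -
  have car: "x \<in> carrier R" "y \<in> carrier R" "x \<noteq> y" using assms(1) lt_carrier ord_irrefl by auto
  let ?r = "secant x a y b" and ?d = "y \<ominus> x"
  have r: "?r \<in> carrier R" using car assms secant_closed by simp
  have d: "\<zero> \<sqsubset> ?d" using assms(1) car ord_diff by blast
  have e: "?r \<otimes> ?d = b \<ominus> a" using secant_iff[OF car(1,2) assms(2,3) car(3) r] by simp
  have dd: "?d \<in> carrier R" using car by simp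
  show "c \<sqsubset> ?r \<longleftrightarrow> c \<otimes> ?d \<sqsubset> b \<ominus> a"
    using ord_mult[of c ?r ?d] ord_mult[of ?r c ?d] d e ord_total[of c ?r] assms(4) r ord_irrefl
      ord_trans[of "c \<otimes> ?d" "?r \<otimes> ?d" "c \<otimes> ?d"] by metis
  show "?r \<sqsubset> c \<longleftrightarrow> b \<ominus> a \<sqsubset> c \<otimes> ?d"
    using ord_mult[of c ?r ?d] ord_mult[of ?r c ?d] d e ord_total[of c ?r] assms(4) r ord_irrefl
      ord_trans[of "c \<otimes> ?d" "?r \<otimes> ?d" "c \<otimes> ?d"] by metis
qed

text \<open>After clearing the positive denominators, the inequality for the long interval is the
  sum of those for its two parts.\<close>

lemma secant_mediant:
  assumes "x \<sqsubset> y" "y \<sqsubset> z" "a \<in> carrier R" "b \<in> carrier R" "d \<in> carrier R"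
  shows "c \<sqsubset> secant x a y b \<Longrightarrow> c \<sqsubset> secant y b z d \<Longrightarrow> c \<sqsubset> secant x a z d"
    and "secant x a y b \<sqsubset> c \<Longrightarrow> secant y b z d \<sqsubset> c \<Longrightarrow> secant x a z d \<sqsubset> c"
proof -
  have car: "x \<in> carrier R" "y \<in> carrier R" "z \<in> carrier R" using assms lt_carrier by auto
  have xz: "x \<sqsubset> z" using assms ord_trans by blast
  have e: "c \<otimes> (y \<ominus> x) \<oplus> c \<otimes> (z \<ominus> y) = c \<otimes> (z \<ominus> x)" if "c \<in> carrier R"
    using car that by algebra
  have e2: "b \<ominus> a \<oplus> (d \<ominus> b) = d \<ominus> a" using assms by algebra
  { assume *: "c \<sqsubset> secant x a y b" "c \<sqsubset> secant y b z d"
    then have c: "c \<in> carrier R" using lt_carrier by blast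
    show "c \<sqsubset> secant x a z d"
      using * ord_add_strict[of "c \<otimes> (y \<ominus> x)" "b \<ominus> a" "c \<otimes> (z \<ominus> y)" "d \<ominus> b"] e[OF c] e2
        secant_less(1)[OF assms(1,3,4) c] secant_less(1)[OF assms(2,4,5) c] secant_less(1)[OF xz assms(3,5) c]
      by simp }
  { assume *: "secant x a y b \<sqsubset> c" "secant y b z d \<sqsubset> c"
    then have c: "c \<in> carrier R" using lt_carrier by blast
    show "secant x a z d \<sqsubset> c"
      using * ord_add_strict[of "b \<ominus> a" "c \<otimes> (y \<ominus> x)" "d \<ominus> b" "c \<otimes> (z \<ominus> y)"] e[OF c] e2
        secant_less(2)[OF assms(1,3,4) c] secant_less(2)[OF assms(2,4,5) c] secant_less(2)[OF xz assms(3,5) c]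
      by simp }
qed

text \<open>The breaks are the point itself or those endpoints that are finite.\<close>

lemma point_or_interval_breaks:
  assumes "point_or_interval R J"
  shows "\<exists>B. finite B \<and> B \<subseteq> carrier R \<and>
    (\<forall>x y. x \<sqsubset> y \<longrightarrow> (\<forall>b \<in> B. b \<sqsubset> x \<or> y \<sqsubset> b) \<longrightarrow> x \<in> J \<longleftrightarrow> y \<in> J)"
  using assms unfolding point_or_interval_def
proof
  assume "\<exists>a \<in> carrier R. J = {a}"
  then obtain a where a: "a \<in> carrier R" "J = {a}" by blast
  have "x \<noteq> a \<and> y \<noteq> a" if "x \<sqsubset> y" "a \<sqsubset> x \<or> y \<sqsubset> a" for x y
    using that ord_irrefl ord_trans by blast
  then show ?thesis using a by (intro exI[of _ "{a}"]) auto
next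
  assume "\<exists>a b. set_option a \<subseteq> carrier R \<and> set_option b \<subseteq> carrier R \<and>
        J = {x \<in> carrier R. above R a x \<and> below R b x}"
  then obtain a b where ab: "set_option a \<subseteq> carrier R" "set_option b \<subseteq> carrier R"
    "J = {x \<in> carrier R. above R a x \<and> below R b x}" by blast
  have 1: "c \<sqsubset> x \<longleftrightarrow> c \<sqsubset> y" "x \<sqsubset> c \<longleftrightarrow> y \<sqsubset> c" if "x \<sqsubset> y" "c \<sqsubset> x \<or> y \<sqsubset> c" for x y c
    using that ord_irrefl ord_trans by blast+
  have "x \<in> J \<longleftrightarrow> y \<in> J" if xy: "x \<sqsubset> y" "\<forall>c \<in> set_option a \<union> set_option b. c \<sqsubset> x \<or> y \<sqsubset> c" for x y
  proof -
    have car: "x \<in> carrier R" "y \<in> carrier R" using xy(1) lt_carrier by auto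
    have "above R a x \<longleftrightarrow> above R a y"
    proof (cases a)
      case (Some a')
      have "a' \<sqsubset> x \<longleftrightarrow> a' \<sqsubset> y" using 1(1)[OF xy(1)] xy(2) Some by simp
      then show ?thesis using Some car ab(1) by (simp add: above_def lt_def)
    qed (simp add: above_def)
    moreover have "below R b x \<longleftrightarrow> below R b y"
    proof (cases b)
      case (Some b')
      have "x \<sqsubset> b' \<longleftrightarrow> y \<sqsubset> b'" using 1(2)[OF xy(1)] xy(2) Some by simp
      then show ?thesis using Some car ab(2) by (simp add: below_def lt_def)
    qed (simp add: below_def)
    ultimately show ?thesis using car ab(3) by simp
  qed
  then show ?thesis using ab by (intro exI[of _ "set_option a \<union> set_option b"]) auto
qed

end

section \<open>From predicates on assignments back to formulas\<close>

lemma sat_foldr_FEx: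
  "sat M v (foldr FEx ys \<phi>) \<longleftrightarrow>
    (\<exists>w. (\<forall>i. i \<notin> set ys \<longrightarrow> w i = v i) \<and> (\<forall>i \<in> set ys. w i \<in> dom M) \<and> sat M w \<phi>)"
proof (induction ys arbitrary: v)
  case Nil
  have "w = v" if "\<forall>i. w i = v i" for w using that by auto
  then show ?case by auto
next
  case (Cons y ys)
  show ?case
  proof
    assume "sat M v (foldr FEx (y # ys) \<phi>)"
    then obtain a where a: "a \<in> dom M" "sat M (v(y := a)) (foldr FEx ys \<phi>)" by auto
    from a(2)[unfolded Cons.IH] obtain w where w: "\<forall>i. i \<notin> set ys \<longrightarrow> w i = (v(y := a)) i"
      "\<forall>i \<in> set ys. w i \<in> dom M" "sat M w \<phi>" by blast
    have "w y \<in> dom M" using w(1,2) a(1) by (cases "y \<in> set ys") auto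
    then show "\<exists>w. (\<forall>i. i \<notin> set (y # ys) \<longrightarrow> w i = v i) \<and> (\<forall>i \<in> set (y # ys). w i \<in> dom M) \<and> sat M w \<phi>"
      using w by (intro exI[of _ w]) auto
  next
    assume "\<exists>w. (\<forall>i. i \<notin> set (y # ys) \<longrightarrow> w i = v i) \<and> (\<forall>i \<in> set (y # ys). w i \<in> dom M) \<and> sat M w \<phi>"
    then obtain w where w: "\<forall>i. i \<notin> set (y # ys) \<longrightarrow> w i = v i"
      "\<forall>i \<in> set (y # ys). w i \<in> dom M" "sat M w \<phi>" by blast
    have "sat M (v(y := w y)) (foldr FEx ys \<phi>)"
      unfolding Cons.IH using w by (intro exI[of _ w]) auto
    then show "sat M v (foldr FEx (y # ys) \<phi>)" using w(2) by auto
  qed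
qed

lemma wf_foldr_FEx: "wf_fm L (foldr FEx ys \<phi>) = wf_fm L \<phi>"
  by (induction ys) auto

lemma fv_foldr_FEx: "fv (foldr FEx ys \<phi>) = fv \<phi> - set ys"
  by (induction ys) auto

context first_order_structure
begin

text \<open>A formula for \<open>P\<close> may still mention coordinates from \<open>n\<close> on,
  although its truth does not depend on them. Binding these by existential quantifiers leaves only
  the tuple and the parameters, the form in which definability, saturation and indiscernibility are
  stated.\<close>

lemma defP_formula:
  assumes P: "defP A P"
    and n: "\<And>v w. v \<in> Env \<Longrightarrow> w \<in> Env \<Longrightarrow> (\<And>i. i < n \<Longrightarrow> v i = w i) \<Longrightarrow> P v = P w"
  shows "\<exists>\<phi> ps. wf_fm L \<phi> \<and> set ps \<subseteq> A \<inter> dom M \<and> fv \<phi> \<subseteq> {..<n + length ps} \<and>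
    (\<forall>xs \<in> tuples (dom M) n. \<forall>v \<in> Env. (\<forall>i<n. v i = xs ! i) \<longrightarrow> P v = sat M (nth (xs @ ps)) \<phi>)"
proof -
  from P obtain \<phi> g where g: "wf_fm L \<phi>" "\<forall>i. g i \<in> gens A"
    "\<forall>v \<in> Env. P v \<longleftrightarrow> sat M (gval g v) \<phi>" unfolding defP_def by blast
  have "finite {c. Inl c \<in> g ` fv \<phi>}"
    using finite_vimageI[of "g ` fv \<phi>" Inl] by (simp add: finite_fv vimage_def)
  from finite_list[OF this] obtain ps where ps: "set ps = {c. Inl c \<in> g ` fv \<phi>}" ..
  have psA: "set ps \<subseteq> A \<inter> dom M"
  proof
    fix c assume "c \<in> set ps"
    then have "Inl c \<in> g ` fv \<phi>" using ps by simp
    then obtain i where "Inl c = g i" by (rule imageE)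
    then have "Inl c \<in> gens A" using g(2) by simp
    then show "c \<in> A \<inter> dom M" by simp
  qed
  have "\<forall>c. \<exists>k. c \<in> set ps \<longrightarrow> k < length ps \<and> ps ! k = c" by (auto simp: in_set_conv_nth)
  then obtain k where k: "\<And>c. c \<in> set ps \<Longrightarrow> k c < length ps \<and> ps ! k c = c" by metis
  let ?N = "n + length ps"
  \<comment> \<open>Coordinates below \<open>n\<close> keep their places, parameters are sent to
    their positions in \<open>ps\<close>, and the remaining coordinates are moved beyond
    \<open>?N\<close>, where they will be bound.\<close>
  define f where "f i = (case g i of Inl c \<Rightarrow> n + k c | Inr j \<Rightarrow> if j < n then j else ?N + j)" for i
  obtain \<psi> where p: "wf_fm L \<psi>" "fv \<psi> \<subseteq> f ` fv \<phi>"
    "\<forall>(M :: ('m, 'f, 'r) struct) v. sat M v \<psi> = sat M (v \<circ> f) \<phi>"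
    using ren_fm[OF g(1), of f] by blast
  have "finite (fv \<psi> - {..<?N})" by (simp add: finite_fv)
  from finite_list[OF this] obtain ys where ys: "set ys = fv \<psi> - {..<?N}" ..
  have "P v = sat M (nth (xs @ ps)) (foldr FEx ys \<psi>)"
    if xs: "xs \<in> tuples (dom M) n" and v: "v \<in> Env" "\<forall>i<n. v i = xs ! i" for xs v
  proof -
    have len: "length xs = n" using xs by (simp add: tuples_def)
    have key: "sat M w \<psi> = P v"
      if w: "\<forall>i. i \<notin> set ys \<longrightarrow> w i = (xs @ ps) ! i" "\<forall>i \<in> set ys. w i \<in> dom M" for w
    proof -
      \<comment> \<open>Witnesses of the quantifiers are read back as an assignment \<open>u\<close>
        that agrees with \<open>v\<close> below \<open>n\<close>, and \<open>P\<close> cannot tell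
        \<open>u\<close> and \<open>v\<close> apart.\<close>
      define u where "u j = (if j < n then xs ! j else if ?N + j \<in> set ys then w (?N + j) else v j)" for j
      have uE: "u \<in> Env"
      proof (rule EnvI)
        fix j show "u j \<in> dom M"
          using w(2) v EnvD[OF v(1), of j] by (cases "j < n") (auto simp: u_def)
      qed
      have "sat M w \<psi> = sat M (w \<circ> f) \<phi>" using p(3) by simp
      also have "\<dots> = sat M (\<lambda>i. if f i \<in> fv \<psi> then w (f i) else gval g u i) \<phi>"
      proof -
        have "sat M (w \<circ> f) \<phi> = sat M w \<psi>" using p(3) by simp
        also have "\<dots> = sat M (\<lambda>l. if l \<in> fv \<psi> then w l else
           (if l < n then u l else if l < ?N then ps ! (l - n) else u (l - ?N))) \<psi>"
          by (rule sat_cong) simp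
        also have "\<dots> = sat M ((\<lambda>l. if l \<in> fv \<psi> then w l else
           (if l < n then u l else if l < ?N then ps ! (l - n) else u (l - ?N))) \<circ> f) \<phi>" using p(3) by simp
        also have "\<dots> = sat M (\<lambda>i. if f i \<in> fv \<psi> then w (f i) else gval g u i) \<phi>"
        proof (rule sat_cong)
          fix i assume i: "i \<in> fv \<phi>"
          show "((\<lambda>l. if l \<in> fv \<psi> then w l else (if l < n then u l else if l < ?N then ps ! (l - n)
            else u (l - ?N))) \<circ> f) i = (if f i \<in> fv \<psi> then w (f i) else gval g u i)"
          proof (cases "g i")
            case (Inl c)
            then have "c \<in> set ps" using i ps by force
            then show ?thesis using k[of c] Inl by (simp add: f_def gval_def)
          qed (simp add: f_def gval_def)
        qed
        finally show ?thesis .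
      qed
      also have "\<dots> = sat M (gval g u) \<phi>"
      proof (rule sat_cong)
        fix i assume i: "i \<in> fv \<phi>"
        show "(if f i \<in> fv \<psi> then w (f i) else gval g u i) = gval g u i"
        proof (cases "f i \<in> fv \<psi>")
          case True
          show ?thesis
          proof (cases "g i")
            case (Inl c)
            then have "c \<in> set ps" using i ps by force
            then show ?thesis using k[of c] Inl w(1) ys len by (simp add: f_def gval_def nth_append)
          next
            case (Inr j)
            show ?thesis
            proof (cases "j < n")
              case True
              then show ?thesis using Inr w(1) ys len by (simp add: f_def gval_def nth_append u_def)
            next
              case False
              then have "?N + j \<in> set ys" using Inr \<open>f i \<in> fv \<psi>\<close> ys by (simp add: f_def)
              then show ?thesis using False Inr by (simp add: f_def gval_def u_def)
            qed
          qed
        qed simp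
      qed
      also have "\<dots> = P u" using g(3) uE by simp
      also have "\<dots> = P v" by (rule n[OF uE v(1)]) (use v(2) in \<open>simp add: u_def\<close>)
      finally show ?thesis .
    qed
    show ?thesis
      unfolding sat_foldr_FEx
    proof
      assume "P v"
      then show "\<exists>w. (\<forall>i. i \<notin> set ys \<longrightarrow> w i = (xs @ ps) ! i) \<and> (\<forall>i \<in> set ys. w i \<in> dom M) \<and> sat M w \<psi>"
        using key[of "\<lambda>i. if i \<in> set ys then v 0 else (xs @ ps) ! i"] v(1)
        by (intro exI[of _ "\<lambda>i. if i \<in> set ys then v 0 else (xs @ ps) ! i"]) simp
    qed (use key in blast)
  qed
  moreover have "fv (foldr FEx ys \<psi>) \<subseteq> {..<?N}" using ys by (auto simp: fv_foldr_FEx)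
  moreover have "wf_fm L (foldr FEx ys \<psi>)" using p(1) by (simp add: wf_foldr_FEx)
  ultimately show ?thesis using psA by (intro exI[of _ "foldr FEx ys \<psi>"] exI[of _ ps]) blast
qed

end

section \<open>O-minimal fields with a generic derivation\<close>

locale definable_field = first_order_structure L M + F: ordered_field_on "oring_of L M"
  for L :: "('f, 'r) olang" and M :: "('m, 'f, 'r) struct" +
  assumes oring_lang: "extends_oring_lang L"
    and o_min: "o_minimal L M"
    and countable_saturation: "countable A \<Longrightarrow> (\<And>P. P \<in> \<P> \<Longrightarrow> defP A (\<lambda>v. P (v 0))) \<Longrightarrow>
      (\<And>F. finite F \<Longrightarrow> F \<subseteq> \<P> \<Longrightarrow> \<exists>x \<in> dom M. \<forall>P \<in> F. P x) \<Longrightarrow>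
      \<exists>x \<in> dom M. \<forall>P \<in> \<P>. P x"
begin

abbreviation R :: "'m oring" where
  "R \<equiv> oring_of L M"

notation F.lt (infix "\<sqsubset>" 50)

lemma carrier_R [simp]: "carrier R = dom M"
  by (simp add: oring_of_def)

lemma R_closed [simp]:
  assumes "x \<in> dom M" "y \<in> dom M"
  shows "x \<oplus>\<^bsub>R\<^esub> y \<in> dom M" "x \<ominus>\<^bsub>R\<^esub> y \<in> dom M" "x \<otimes>\<^bsub>R\<^esub> y \<in> dom M"
  using F.a_closed[of x y] F.minus_closed[of x y] F.m_closed[of x y] assms by simp_all

lemma olt_R: "olt R x y = rint M (less_sym L) [x, y]"
  by (simp add: oring_of_def)

section \<open>Definability of the field operations\<close>

lemma defT_add: "defT A s \<Longrightarrow> defT A t \<Longrightarrow> defT A (\<lambda>v. s v \<oplus>\<^bsub>R\<^esub> t v)"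
  using defT_fun[of "[s, t]" "add_sym L" A] oring_lang
  by (auto simp: oring_of_def extends_oring_lang_def)

lemma defT_mult: "defT A s \<Longrightarrow> defT A t \<Longrightarrow> defT A (\<lambda>v. s v \<otimes>\<^bsub>R\<^esub> t v)"
  using defT_fun[of "[s, t]" "mul_sym L" A] oring_lang
  by (auto simp: oring_of_def extends_oring_lang_def)

lemma defT_zero: "defT A (\<lambda>v. \<zero>\<^bsub>R\<^esub>)"
  using defT_fun[of "[]" "zero_sym L" A] oring_lang
  by (auto simp: oring_of_def extends_oring_lang_def)

lemma defP_less: "defP A (\<lambda>v. v 0 \<sqsubset> v 1)"
proof -
  have "defP A (\<lambda>v. rint M (less_sym L) [v 0, v 1])"
    using defP_rel[of "[\<lambda>v. v 0, \<lambda>v. v 1]" "less_sym L" A] oring_lang defT_var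
    by (auto simp: extends_oring_lang_def)
  then show ?thesis
    by (subst defP_cong[where Q = "\<lambda>v. rint M (less_sym L) [v 0, v 1]"])
      (simp_all add: F.lt_def olt_R)
qed

lemma defT_secant: "defT A (\<lambda>v. F.secant (v 0) (v 1) (v 2) (v 3))"
proof -
  \<comment> \<open>The equation \<open>r (y - x) = b - a\<close> is written as
    \<open>r y + a = b + r x\<close>, in which only sums and products occur.\<close>
  have "defP A (\<lambda>u. (u 1 = u 3 \<and> u 0 = \<zero>\<^bsub>R\<^esub>) \<or>
    (\<not> u 1 = u 3 \<and> (u 0 \<otimes>\<^bsub>R\<^esub> u 3) \<oplus>\<^bsub>R\<^esub> u 2 = u 4 \<oplus>\<^bsub>R\<^esub> (u 0 \<otimes>\<^bsub>R\<^esub> u 1)))"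
    by (intro defP_disj defP_conj defP_neg defP_eqT defT_add defT_mult defT_zero defT_var)
  moreover have "((u 1 = u 3 \<and> u 0 = \<zero>\<^bsub>R\<^esub>) \<or>
    (\<not> u 1 = u 3 \<and> (u 0 \<otimes>\<^bsub>R\<^esub> u 3) \<oplus>\<^bsub>R\<^esub> u 2 = u 4 \<oplus>\<^bsub>R\<^esub> (u 0 \<otimes>\<^bsub>R\<^esub> u 1))) =
    (u 0 = F.secant (u 1) (u 2) (u 3) (u 4))" if u: "u \<in> Env" for u
  proof (cases "u 1 = u 3")
    case True
    then show ?thesis by (simp add: F.secant_def)
  next
    case False
    have car: "u i \<in> carrier R" for i using u by simp
    have "(u 0 \<otimes>\<^bsub>R\<^esub> u 3) \<oplus>\<^bsub>R\<^esub> u 2 = u 4 \<oplus>\<^bsub>R\<^esub> (u 0 \<otimes>\<^bsub>R\<^esub> u 1) \<longleftrightarrow>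
      u 0 \<otimes>\<^bsub>R\<^esub> (u 3 \<ominus>\<^bsub>R\<^esub> u 1) = u 4 \<ominus>\<^bsub>R\<^esub> u 2" (is "?l \<longleftrightarrow> ?r")
    proof
      assume ?l
      have "u 0 \<otimes>\<^bsub>R\<^esub> (u 3 \<ominus>\<^bsub>R\<^esub> u 1) =
        ((u 0 \<otimes>\<^bsub>R\<^esub> u 3) \<oplus>\<^bsub>R\<^esub> u 2) \<ominus>\<^bsub>R\<^esub> u 2 \<ominus>\<^bsub>R\<^esub> u 0 \<otimes>\<^bsub>R\<^esub> u 1" using car[of 0] car[of 1] car[of 2] car[of 3] by algebra
      also have "\<dots> = u 4 \<oplus>\<^bsub>R\<^esub> (u 0 \<otimes>\<^bsub>R\<^esub> u 1) \<ominus>\<^bsub>R\<^esub> u 2 \<ominus>\<^bsub>R\<^esub> u 0 \<otimes>\<^bsub>R\<^esub> u 1" using \<open>?l\<close> by simp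
      also have "\<dots> = u 4 \<ominus>\<^bsub>R\<^esub> u 2" using car[of 0] car[of 1] car[of 2] car[of 4] by algebra
      finally show ?r .
    next
      assume ?r
      have "(u 0 \<otimes>\<^bsub>R\<^esub> u 3) \<oplus>\<^bsub>R\<^esub> u 2 = u 0 \<otimes>\<^bsub>R\<^esub> (u 3 \<ominus>\<^bsub>R\<^esub> u 1) \<oplus>\<^bsub>R\<^esub> u 0 \<otimes>\<^bsub>R\<^esub> u 1 \<oplus>\<^bsub>R\<^esub> u 2"
        using car[of 0] car[of 1] car[of 2] car[of 3] by algebra
      also have "\<dots> = u 4 \<ominus>\<^bsub>R\<^esub> u 2 \<oplus>\<^bsub>R\<^esub> u 0 \<otimes>\<^bsub>R\<^esub> u 1 \<oplus>\<^bsub>R\<^esub> u 2" using \<open>?r\<close> by simp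
      also have "\<dots> = u 4 \<oplus>\<^bsub>R\<^esub> (u 0 \<otimes>\<^bsub>R\<^esub> u 1)" using car[of 0] car[of 1] car[of 2] car[of 4] by algebra
      finally show ?l .
    qed
    then show ?thesis using F.secant_iff[OF car[of 1] car[of 3] car[of 2] car[of 4] False car[of 0]] False by simp
  qed
  ultimately have "defP A (\<lambda>u. u 0 = F.secant (u 1) (u 2) (u 3) (u 4))" by (subst (asm) defP_cong)
  moreover have "F.secant (v 0) (v 1) (v 2) (v 3) \<in> dom M" if "v \<in> Env" for v
    using F.secant_closed[of "v 0" "v 2" "v 1" "v 3"] that by simp
  ultimately show ?thesis by (simp add: defT_def eval_nat_numeral)
qed

lemma defP_unary_definable:
  assumes "defP (dom M) (\<lambda>v. P (v 0))"
  shows "definable L M (dom M) 1 {[x] | x. x \<in> dom M \<and> P x}"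
proof -
  obtain \<phi> ps where p: "wf_fm L \<phi>" "set ps \<subseteq> dom M \<inter> dom M" "fv \<phi> \<subseteq> {..<1 + length ps}"
    "\<forall>xs \<in> tuples (dom M) 1. \<forall>v \<in> Env. (\<forall>i<1. v i = xs ! i) \<longrightarrow> P (v 0) = sat M (nth (xs @ ps)) \<phi>"
    using defP_formula[OF assms, of 1] by auto
  have "{[x] | x. x \<in> dom M \<and> P x} = {xs \<in> tuples (dom M) 1. sat M (nth (xs @ ps)) \<phi>}"
  proof -
    have "P x = sat M (nth ([x] @ ps)) \<phi>" if "x \<in> dom M" for x
      using p(4)[rule_format, of "[x]" "\<lambda>_. x"] that by (simp add: tuples_def)
    moreover have "xs \<in> tuples (dom M) 1 \<longleftrightarrow> (\<exists>x \<in> dom M. xs = [x])" for xs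
      by (auto simp: tuples_def length_Suc_conv)
    ultimately show ?thesis by auto
  qed
  then show ?thesis unfolding definable_def using p(1-3) by blast
qed

sublocale o_minimal_slope L M F.lt F.secant "\<zero>\<^bsub>R\<^esub>"
proof (unfold_locales, goal_cases)
  case (1 x y)
  then show ?case using F.lt_carrier[of x y] by simp
next
  case (2 x)
  then show ?case by (rule F.ord_irrefl)
next
  case (3 x y z)
  then show ?case by (rule F.ord_trans)
next
  case (4 x y)
  then show ?case using F.ord_total[of x y] by simp
next
  case (5 x y)
  then show ?case by (rule F.ord_dense)
next
  case (6 x)
  then show ?case using F.plus_pos[OF _ F.one_pos, of x] by auto
next
  case (7 x)
  then show ?case using F.minus_pos[OF _ F.one_pos, of x] by auto
next
  case 8
  show ?case by (rule defP_less)
next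
  \<comment> \<open>O-minimality presents the set as a finite union of points and intervals; the
    breaks of these pieces together are breaks of the union.\<close>
  case (9 P)
  from o_min[unfolded o_minimal_def, rule_format, OF defP_unary_definable[OF this]] obtain \<F> where
    F: "finite \<F>" "\<forall>J \<in> \<F>. point_or_interval R J"
      "{[x] | x. x \<in> dom M \<and> P x} = {[x] | x. x \<in> \<Union>\<F>}" by blast
  have "\<forall>J \<in> \<F>. \<exists>B. finite B \<and> B \<subseteq> carrier R \<and>
    (\<forall>x y. x \<sqsubset> y \<longrightarrow> (\<forall>b \<in> B. b \<sqsubset> x \<or> y \<sqsubset> b) \<longrightarrow> x \<in> J \<longleftrightarrow> y \<in> J)"
    using F(2) F.point_or_interval_breaks by blast
  from bchoice[OF this] obtain B where B: "\<forall>J \<in> \<F>. finite (B J) \<and> B J \<subseteq> carrier R \<and>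
    (\<forall>x y. x \<sqsubset> y \<longrightarrow> (\<forall>b \<in> B J. b \<sqsubset> x \<or> y \<sqsubset> b) \<longrightarrow> x \<in> J \<longleftrightarrow> y \<in> J)" by blast
  have P: "P x \<longleftrightarrow> (\<exists>J \<in> \<F>. x \<in> J)" if "x \<in> dom M" for x
  proof -
    have "[x] \<in> {[x] | x. x \<in> dom M \<and> P x} \<longleftrightarrow> [x] \<in> {[x] | x. x \<in> \<Union>\<F>}" using F(3) by simp
    then show ?thesis using that by simp
  qed
  have "P x = P y" if xy: "x \<sqsubset> y" "\<forall>b \<in> \<Union>(B ` \<F>). b \<sqsubset> x \<or> y \<sqsubset> b" for x y
  proof -
    have "x \<in> dom M" "y \<in> dom M" using F.lt_carrier[OF xy(1)] by auto
    moreover have "x \<in> J \<longleftrightarrow> y \<in> J" if "J \<in> \<F>" for J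
      using B that xy by blast
    ultimately show ?thesis using P by blast
  qed
  moreover have "finite (\<Union>(B ` \<F>))" "\<Union>(B ` \<F>) \<subseteq> dom M" using B F(1) by auto
  ultimately show ?case by blast
next
  case (10 A \<P>)
  then show ?case using countable_saturation by blast
next
  case 11
  show ?case by (rule defT_secant)
next
  case (12 x y a b)
  then show ?case using F.secant_sym[of x y a b] by simp
next
  case (13 x y z a b d c)
  then show ?case using F.secant_mediant(1)[of x y z a b d c] by simp
next
  case (14 x y z a b d c)
  then show ?case using F.secant_mediant(2)[of x y z a b d c] by simp
next
  case 15
  show ?case using defT_zero defT_dom[OF defT_zero] Env_ne by (auto simp: dcl_def)
qed

text \<open>Finite tuples become assignments by padding with zero. As zero is a definable constant,
  truncating an assignment is a substitution by terms.\<close>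

definition envl :: "'m list \<Rightarrow> nat \<Rightarrow> 'm" where
  "envl xs i = (if i < length xs then xs ! i else \<zero>\<^bsub>R\<^esub>)"

lemma envl_Env: "set xs \<subseteq> dom M \<Longrightarrow> envl xs \<in> Env"
  using org_dom by (intro EnvI) (auto simp: envl_def)

lemma tuplesD: "xs \<in> tuples S n \<Longrightarrow> length xs = n \<and> set xs \<subseteq> S"
  by (simp add: tuples_def)

abbreviation trunc :: "nat \<Rightarrow> (nat \<Rightarrow> 'm) \<Rightarrow> nat \<Rightarrow> 'm" where
  "trunc n v \<equiv> (\<lambda>i. if i < n then v i else \<zero>\<^bsub>R\<^esub>)"

lemma trunc_envl: "length xs = n \<Longrightarrow> trunc n (envl xs) = envl xs"
  by (auto simp: envl_def fun_eq_iff)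

lemma trunc_envl_append: "length xs = n \<Longrightarrow> trunc n (envl (xs @ ys)) = envl xs"
  by (auto simp: envl_def fun_eq_iff nth_append)

lemma trunc_term: "defT A (if i < n then (\<lambda>v. v i) else (\<lambda>_. \<zero>\<^bsub>R\<^esub>))"
  using defT_var defT_zero by simp

lemma trunc_app: "(\<lambda>i. (if i < n then (\<lambda>v. v i) else (\<lambda>_. \<zero>\<^bsub>R\<^esub>)) v) = trunc n v"
  by (simp add: fun_eq_iff)

lemma defP_trunc: "defP A P \<Longrightarrow> defP A (\<lambda>v. P (trunc n v))"
  using defP_subst[of A P "\<lambda>i. if i < n then (\<lambda>v. v i) else (\<lambda>_. \<zero>\<^bsub>R\<^esub>)", OF _ trunc_term]
  unfolding trunc_app .

lemma defT_trunc: "defT A t \<Longrightarrow> defT A (\<lambda>v. t (trunc n v))"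
  using defT_subst[of A t "\<lambda>i. if i < n then (\<lambda>v. v i) else (\<lambda>_. \<zero>\<^bsub>R\<^esub>)", OF _ trunc_term]
  unfolding trunc_app .

lemma defP_definable:
  assumes "defP A P"
  shows "definable L M A n {xs \<in> tuples (dom M) n. P (envl xs)}"
proof -
  have "P (trunc n v) = P (trunc n w)" if "\<And>i. i < n \<Longrightarrow> v i = w i" for v w
    using that by (intro arg_cong[where f = P]) auto
  from defP_formula[OF defP_trunc[OF assms], of n, OF this]
  obtain \<phi> ps where p: "wf_fm L \<phi>" "set ps \<subseteq> A \<inter> dom M" "fv \<phi> \<subseteq> {..<n + length ps}"
    "\<forall>xs \<in> tuples (dom M) n. \<forall>v \<in> Env. (\<forall>i<n. v i = xs ! i) \<longrightarrow> P (trunc n v) = sat M (nth (xs @ ps)) \<phi>"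
    by blast
  have "P (envl xs) = sat M (nth (xs @ ps)) \<phi>" if xs: "xs \<in> tuples (dom M) n" for xs
  proof -
    have "P (trunc n (envl xs)) = sat M (nth (xs @ ps)) \<phi>"
      using p(4)[rule_format, OF xs envl_Env] tuplesD[OF xs] by (simp add: envl_def)
    then show ?thesis using trunc_envl[of xs n] tuplesD[OF xs] by simp
  qed
  then have "{xs \<in> tuples (dom M) n. P (envl xs)} = {xs \<in> tuples (dom M) n. sat M (nth (xs @ ps)) \<phi>}"
    by blast
  then show ?thesis unfolding definable_def using p(1-3) by blast
qed

lemma definable_fun_defT:
  assumes U: "defP A U" and t: "defT A t"
  shows "definable_fun L M A n {xs \<in> tuples (dom M) n. U (envl xs)} (\<lambda>xs. t (envl xs))"
proof -
  let ?U = "{xs \<in> tuples (dom M) n. U (envl xs)}"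
  define P where "P v \<longleftrightarrow> U (trunc n v) \<and> v n = t (trunc n v)" for v
  have "defP A P" unfolding P_def by (intro defP_conj defP_trunc defP_eqT defT_trunc defT_var U t)
  from defP_definable[OF this, of "Suc n"]
  have "definable L M A (Suc n) {ys \<in> tuples (dom M) (Suc n). P (envl ys)}" .
  moreover have "{ys \<in> tuples (dom M) (Suc n). P (envl ys)} = {xs @ [t (envl xs)] | xs. xs \<in> ?U}"
  proof (intro Set.set_eqI iffI)
    fix ys assume "ys \<in> {ys \<in> tuples (dom M) (Suc n). P (envl ys)}"
    then have ys: "length ys = Suc n" "set ys \<subseteq> dom M" "P (envl ys)" by (auto simp: tuples_def)
    from ys(1) obtain xs y where xy: "ys = xs @ [y]" "length xs = n" by (cases ys rule: rev_cases) auto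
    have "trunc n (envl ys) = envl xs" unfolding xy(1) by (rule trunc_envl_append[OF xy(2)])
    moreover have "envl ys n = y" using xy by (simp add: envl_def nth_append)
    ultimately have "U (envl xs)" "y = t (envl xs)" using ys(3) by (simp_all add: P_def)
    moreover have "xs \<in> tuples (dom M) n" using xy ys by (simp add: tuples_def)
    ultimately show "ys \<in> {xs @ [t (envl xs)] | xs. xs \<in> ?U}" using xy(1) by blast
  next
    fix ys assume "ys \<in> {xs @ [t (envl xs)] | xs. xs \<in> ?U}"
    then obtain xs where xs: "ys = xs @ [t (envl xs)]" "xs \<in> tuples (dom M) n" "U (envl xs)" by blast
    have len: "length xs = n" "set xs \<subseteq> dom M" using tuplesD[OF xs(2)] by auto
    have "trunc n (envl ys) = envl xs" unfolding xs(1) by (rule trunc_envl_append[OF len(1)])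
    moreover have "envl ys n = t (envl xs)" using xs(1) len by (simp add: envl_def nth_append)
    ultimately have "P (envl ys)" using xs(3) by (simp only: P_def)
    moreover have "t (envl xs) \<in> dom M" using defT_dom[OF t envl_Env] len by blast
    ultimately show "ys \<in> {ys \<in> tuples (dom M) (Suc n). P (envl ys)}"
      using xs(1) len by (simp add: tuples_def)
  qed
  ultimately show ?thesis by (simp add: definable_fun_def)
qed

section \<open>Boxes, balls and difference quotients\<close>

lemma radius_mono: "x \<in> dom M \<Longrightarrow> e' \<sqsubset> e \<Longrightarrow> x \<ominus>\<^bsub>R\<^esub> e \<sqsubset> x \<ominus>\<^bsub>R\<^esub> e' \<and> x \<oplus>\<^bsub>R\<^esub> e' \<sqsubset> x \<oplus>\<^bsub>R\<^esub> e"
proof -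
  assume x: "x \<in> dom M" and e: "e' \<sqsubset> e"
  have car: "e' \<in> carrier R" "e \<in> carrier R" "x \<in> carrier R" using F.lt_carrier[OF e] x by auto
  have "x \<ominus>\<^bsub>R\<^esub> e' \<ominus>\<^bsub>R\<^esub> (x \<ominus>\<^bsub>R\<^esub> e) = e \<ominus>\<^bsub>R\<^esub> e'" using car by algebra
  then have "x \<ominus>\<^bsub>R\<^esub> e \<sqsubset> x \<ominus>\<^bsub>R\<^esub> e'"
    using F.ord_diff[of "x \<ominus>\<^bsub>R\<^esub> e" "x \<ominus>\<^bsub>R\<^esub> e'"] F.ord_diff[of e' e] car e by simp
  moreover have "e' \<oplus>\<^bsub>R\<^esub> x \<sqsubset> e \<oplus>\<^bsub>R\<^esub> x" using F.ord_add[OF e car(3)] .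
  ultimately show ?thesis using car F.a_comm by metis
qed

text \<open>Boxes have separate endpoints in each coordinate, while nearness uses one radius for
  all: a radius below those of the single coordinates works.\<close>

lemma box_radius:
  assumes "z \<in> Env" "in_box m c d z"
  shows "\<exists>e. \<zero>\<^bsub>R\<^esub> \<sqsubset> e \<and> (\<forall>i<m. \<forall>y. z i \<ominus>\<^bsub>R\<^esub> e \<sqsubset> y \<longrightarrow> y \<sqsubset> z i \<oplus>\<^bsub>R\<^esub> e \<longrightarrow> c i \<sqsubset> y \<and> y \<sqsubset> d i)"
  using assms(2)
proof (induction m)
  case 0
  then show ?case using F.one_pos by auto
next
  case (Suc m)
  then have "in_box m c d z" and b: "c m \<sqsubset> z m" "z m \<sqsubset> d m" by (simp_all add: in_box_def)
  from Suc.IH[OF this(1)] obtain e where e: "\<zero>\<^bsub>R\<^esub> \<sqsubset> e"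
    "\<forall>i<m. \<forall>y. z i \<ominus>\<^bsub>R\<^esub> e \<sqsubset> y \<longrightarrow> y \<sqsubset> z i \<oplus>\<^bsub>R\<^esub> e \<longrightarrow> c i \<sqsubset> y \<and> y \<sqsubset> d i" by blast
  from F.ex_below_both[OF b] obtain e' where e': "\<zero>\<^bsub>R\<^esub> \<sqsubset> e'"
    "c m = z m \<ominus>\<^bsub>R\<^esub> e' \<or> c m \<sqsubset> z m \<ominus>\<^bsub>R\<^esub> e'" "z m \<oplus>\<^bsub>R\<^esub> e' = d m \<or> z m \<oplus>\<^bsub>R\<^esub> e' \<sqsubset> d m" by blast
  obtain a where a: "a \<sqsubset> e" "a \<sqsubset> e'" "\<zero>\<^bsub>R\<^esub> \<sqsubset> a" using lt_min[OF e(1) e'(1)] by blast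
  have "c i \<sqsubset> y \<and> y \<sqsubset> d i" if i: "i < Suc m" and y: "z i \<ominus>\<^bsub>R\<^esub> a \<sqsubset> y" "y \<sqsubset> z i \<oplus>\<^bsub>R\<^esub> a" for i y
  proof (cases "i = m")
    case True
    have "z m \<ominus>\<^bsub>R\<^esub> e' \<sqsubset> y" "y \<sqsubset> z m \<oplus>\<^bsub>R\<^esub> e'"
      using radius_mono[OF EnvD[OF assms(1), of m] a(2)] y True F.ord_trans by blast+
    then show ?thesis using e'(2,3) F.ord_trans[of "c m"] F.ord_trans[of y _ "d m"] True by auto
  next
    case False
    then have "z i \<ominus>\<^bsub>R\<^esub> e \<sqsubset> y" "y \<sqsubset> z i \<oplus>\<^bsub>R\<^esub> e"
      using radius_mono[OF EnvD[OF assms(1), of i] a(1)] y F.ord_trans by blast+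
    then show ?thesis using e(2) False i by simp
  qed
  then show ?case using a(3) by blast
qed

lemma near_iff:
  assumes "u \<in> tuples (dom M) m" "v \<in> tuples (dom M) m" "e \<in> dom M"
  shows "near R e u v \<longleftrightarrow> (\<forall>i<m. u ! i \<ominus>\<^bsub>R\<^esub> e \<sqsubset> v ! i \<and> v ! i \<sqsubset> u ! i \<oplus>\<^bsub>R\<^esub> e)"
proof -
  have "abs_less R (v ! i \<ominus>\<^bsub>R\<^esub> u ! i) e \<longleftrightarrow> u ! i \<ominus>\<^bsub>R\<^esub> e \<sqsubset> v ! i \<and> v ! i \<sqsubset> u ! i \<oplus>\<^bsub>R\<^esub> e" if "i < m" for i
    using assms that by (intro F.abs_less_diff) (auto simp: tuples_def)
  then show ?thesis using assms by (auto simp: near_def list_all2_conv_all_nth tuples_def)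
qed

lemma nbhd_near:
  assumes "nbhd m P (envl u)" "u \<in> tuples (dom M) m"
  shows "\<exists>e \<in> positives R. \<forall>v \<in> tuples (dom M) m. near R e u v \<longrightarrow> P (envl v)"
proof -
  have u: "length u = m" "set u \<subseteq> dom M" using tuplesD[OF assms(2)] by auto
  obtain c d where cd: "in_box m c d (envl u)"
    "\<forall>z' \<in> Env. in_box m c d z' \<longrightarrow> P (patch m z' (envl u))" using assms(1) unfolding nbhd_def by blast
  from box_radius[OF envl_Env[OF u(2)] cd(1)] obtain e where e: "\<zero>\<^bsub>R\<^esub> \<sqsubset> e"
    "\<forall>i<m. \<forall>y. envl u i \<ominus>\<^bsub>R\<^esub> e \<sqsubset> y \<longrightarrow> y \<sqsubset> envl u i \<oplus>\<^bsub>R\<^esub> e \<longrightarrow> c i \<sqsubset> y \<and> y \<sqsubset> d i" by blast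
  have ed: "e \<in> dom M" using F.lt_carrier[OF e(1)] by simp
  have "P (envl v)" if v: "v \<in> tuples (dom M) m" "near R e u v" for v
  proof -
    have l: "length v = m" "set v \<subseteq> dom M" using tuplesD[OF v(1)] by auto
    have "in_box m c d (envl v)"
      using v(2) e(2) u l unfolding near_iff[OF assms(2) v(1) ed] in_box_def by (simp add: envl_def)
    moreover have "patch m (envl v) (envl u) = envl v" using u l by (auto simp: patch_def envl_def fun_eq_iff)
    ultimately show ?thesis using cd(2) envl_Env[OF l(2)] by metis
  qed
  moreover have "e \<in> positives R" using e(1) by (simp add: F.positives_iff)
  ultimately show ?thesis by blast
qed

lemma envl_update: "i < length u \<Longrightarrow> envl (u[i := y]) = (envl u)(i := y)"
  by (auto simp: envl_def fun_eq_iff nth_list_update)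

text \<open>The difference quotient with increment \<open>h\<close> is the secant from
  \<open>x\<close> to \<open>x + h\<close>, and comparing secants with every constant amounts to the
  condition with tolerances. Openness of \<open>U\<close> makes the requirement that the shifted
  point stays in \<open>U\<close> automatic near \<open>u\<close>.\<close>

lemma has_partial_iff:
  assumes t: "defT {} t" and U: "open_in R m U" and u: "u \<in> U" and i: "i < m"
  shows "has_partial R U (\<lambda>xs. t (envl xs)) i u D \<longleftrightarrow> D \<in> dom M \<and> pderiv t i (envl u) D"
proof -
  have um: "u \<in> tuples (dom M) m" using U u by (auto simp: open_in_def)
  have ul: "length u = m" "set u \<subseteq> dom M" using tuplesD[OF um] by auto
  define z where "z = envl u"
  define x where "x = z i"
  define g where "g s = t (z(i := s))" for s
  have zE: "z \<in> Env" using envl_Env ul by (simp add: z_def)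
  have xd: "x \<in> dom M" using zE by (simp add: x_def)
  have ui: "u ! i = x" using i ul by (simp add: x_def z_def envl_def)
  have gd: "g s \<in> dom M" if "s \<in> dom M" for s
    using defT_dom[OF t Env_upd[OF zE that]] by (simp add: g_def)
  have gx: "g x = t (envl u)" by (simp add: g_def x_def z_def)
  have fu: "t (envl (u[i := y])) = g y" for y using envl_update[of i u y] i ul by (simp add: g_def z_def)
  let ?q = "\<lambda>h. (t (envl (u[i := u ! i \<oplus>\<^bsub>R\<^esub> h])) \<ominus>\<^bsub>R\<^esub> t (envl u)) \<otimes>\<^bsub>R\<^esub> inv\<^bsub>R\<^esub> h"
  have q: "?q (y \<ominus>\<^bsub>R\<^esub> x) = sl g x y" "u ! i \<oplus>\<^bsub>R\<^esub> (y \<ominus>\<^bsub>R\<^esub> x) = y" if "y \<in> dom M" "y \<noteq> x" for y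
  proof -
    have car: "x \<in> carrier R" "y \<in> carrier R" using that(1) xd by auto
    have y: "x \<oplus>\<^bsub>R\<^esub> (y \<ominus>\<^bsub>R\<^esub> x) = y" using car by algebra
    show "u ! i \<oplus>\<^bsub>R\<^esub> (y \<ominus>\<^bsub>R\<^esub> x) = y" using y ui by simp
    show "?q (y \<ominus>\<^bsub>R\<^esub> x) = sl g x y"
      unfolding ui y fu gx[symmetric] sl_def F.secant_def using that(2) by simp
  qed
  have sd: "sl g x y \<in> dom M" if "y \<in> dom M" for y
    using F.secant_closed[of x y "g x" "g y"] that xd gd by (simp add: sl_def)
  have hy: "\<exists>y \<in> dom M. y \<noteq> x \<and> h = y \<ominus>\<^bsub>R\<^esub> x" if h: "h \<in> dom M" "h \<noteq> \<zero>\<^bsub>R\<^esub>" for h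
  proof -
    have car: "h \<in> carrier R" "x \<in> carrier R" using h xd by auto
    have 1: "h = (x \<oplus>\<^bsub>R\<^esub> h) \<ominus>\<^bsub>R\<^esub> x" using car by algebra
    have "x \<oplus>\<^bsub>R\<^esub> h \<noteq> x"
    proof
      assume "x \<oplus>\<^bsub>R\<^esub> h = x"
      then have "h = x \<ominus>\<^bsub>R\<^esub> x" using 1 by simp
      also have "\<dots> = \<zero>\<^bsub>R\<^esub>" using car by algebra
      finally show False using h by simp
    qed
    moreover have "x \<oplus>\<^bsub>R\<^esub> h \<in> dom M" using F.a_closed[OF car(2,1)] by simp
    ultimately show ?thesis using 1 by blast
  qed
  have sides: "near_right g s c x \<and> near_left g s c x"
    if "p \<sqsubset> x" "x \<sqsubset> r" "\<And>y. p \<sqsubset> y \<Longrightarrow> y \<sqsubset> r \<Longrightarrow> y \<noteq> x \<Longrightarrow> cmp s c (sl g x y)" for p r s c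
  proof -
    have pr: "p \<in> dom M" "r \<in> dom M" using that lt_dom by auto
    have "cmp s c (sl g x y)" if "x \<sqsubset> y" "y \<sqsubset> r" for y
      using \<open>\<And>y. p \<sqsubset> y \<Longrightarrow> y \<sqsubset> r \<Longrightarrow> y \<noteq> x \<Longrightarrow> cmp s c (sl g x y)\<close>
        F.ord_trans[OF \<open>p \<sqsubset> x\<close> that(1)] that F.ord_irrefl[of x] by auto
    moreover have "cmp s c (sl g x y)" if "p \<sqsubset> y" "y \<sqsubset> x" for y
      using \<open>\<And>y. p \<sqsubset> y \<Longrightarrow> y \<sqsubset> r \<Longrightarrow> y \<noteq> x \<Longrightarrow> cmp s c (sl g x y)\<close>
        F.ord_trans[OF that(2) \<open>x \<sqsubset> r\<close>] that F.ord_irrefl[of x] by auto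
    ultimately show ?thesis using that pr unfolding near_right_def near_left_def by blast
  qed
  show ?thesis
  proof
    assume hp: "has_partial R U (\<lambda>xs. t (envl xs)) i u D"
    then have Dd: "D \<in> dom M" by (simp add: has_partial_def)
    have local: "\<exists>p r. p \<sqsubset> x \<and> x \<sqsubset> r \<and> (\<forall>y. p \<sqsubset> y \<longrightarrow> y \<sqsubset> r \<longrightarrow> y \<noteq> x \<longrightarrow>
      D \<ominus>\<^bsub>R\<^esub> e \<sqsubset> sl g x y \<and> sl g x y \<sqsubset> D \<oplus>\<^bsub>R\<^esub> e)" if e: "\<zero>\<^bsub>R\<^esub> \<sqsubset> e" for e
    proof -
      have "e \<in> positives R" using e by (simp add: F.positives_iff)
      then obtain d where dp: "d \<in> positives R" and dh: "\<And>h. h \<in> dom M \<Longrightarrow> h \<noteq> \<zero>\<^bsub>R\<^esub> \<Longrightarrow> abs_less R h d \<Longrightarrow>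
        u[i := u ! i \<oplus>\<^bsub>R\<^esub> h] \<in> U \<Longrightarrow> abs_less R (?q h \<ominus>\<^bsub>R\<^esub> D) e"
        using hp[unfolded has_partial_def] by fastforce
      then have d: "\<zero>\<^bsub>R\<^esub> \<sqsubset> d" by (simp add: F.positives_iff)
      from U u obtain e0 where e0: "\<zero>\<^bsub>R\<^esub> \<sqsubset> e0" "\<forall>v \<in> tuples (dom M) m. near R e0 u v \<longrightarrow> v \<in> U"
        unfolding open_in_def by (auto simp: F.positives_iff)
      obtain d' where d': "d' \<sqsubset> d" "d' \<sqsubset> e0" "\<zero>\<^bsub>R\<^esub> \<sqsubset> d'" using lt_min[OF d e0(1)] by blast
      have ed: "e \<in> dom M" "e0 \<in> dom M" "d \<in> dom M" using F.lt_carrier e e0 d by auto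
      have "D \<ominus>\<^bsub>R\<^esub> e \<sqsubset> sl g x y \<and> sl g x y \<sqsubset> D \<oplus>\<^bsub>R\<^esub> e"
        if y: "x \<ominus>\<^bsub>R\<^esub> d' \<sqsubset> y" "y \<sqsubset> x \<oplus>\<^bsub>R\<^esub> d'" "y \<noteq> x" for y
      proof -
        have yd: "y \<in> dom M" using F.lt_carrier[OF y(1)] by simp
        have h: "y \<ominus>\<^bsub>R\<^esub> x \<in> dom M" using F.minus_closed[of y x] yd xd by simp
        have h0: "y \<ominus>\<^bsub>R\<^esub> x \<noteq> \<zero>\<^bsub>R\<^esub>" using F.diff_unit[of x y] y(3) yd xd F.field_Units by auto
        have "x \<ominus>\<^bsub>R\<^esub> d \<sqsubset> y" "y \<sqsubset> x \<oplus>\<^bsub>R\<^esub> d"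
          using radius_mono[OF xd d'(1)] y F.ord_trans by blast+
        then have hd: "abs_less R (y \<ominus>\<^bsub>R\<^esub> x) d" using F.abs_less_diff[of x y d] xd yd ed by simp
        have 1: "x \<ominus>\<^bsub>R\<^esub> e0 \<sqsubset> y" "y \<sqsubset> x \<oplus>\<^bsub>R\<^esub> e0"
          using radius_mono[OF xd d'(2)] y F.ord_trans by blast+
        have yt: "u[i := y] \<in> tuples (dom M) m"
          using ul yd set_update_subset_insert[of u i y] by (auto simp: tuples_def)
        have "near R e0 u (u[i := y])"
          unfolding near_iff[OF um yt ed(2)]
        proof (intro allI impI)
          fix j assume j: "j < m"
          have "u ! j \<in> dom M" using j ul by auto
          then show "u ! j \<ominus>\<^bsub>R\<^esub> e0 \<sqsubset> u[i := y] ! j \<and> u[i := y] ! j \<sqsubset> u ! j \<oplus>\<^bsub>R\<^esub> e0"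
            using 1 ui j ul F.plus_pos[OF _ e0(1), of "u ! j"] F.minus_pos[OF _ e0(1), of "u ! j"]
            by (cases "j = i") auto
        qed
        then have "u[i := y] \<in> U" using e0(2) yt by blast
        then have "abs_less R (?q (y \<ominus>\<^bsub>R\<^esub> x) \<ominus>\<^bsub>R\<^esub> D) e"
          using dh[OF h h0 hd] q(2)[OF yd y(3)] by simp
        then show ?thesis
          unfolding q(1)[OF yd y(3)] using F.abs_less_diff[of D "sl g x y" e] Dd ed sd[OF yd] by simp
      qed
      moreover have "x \<ominus>\<^bsub>R\<^esub> d' \<sqsubset> x" "x \<sqsubset> x \<oplus>\<^bsub>R\<^esub> d'" using F.plus_pos[OF _ d'(3), of x] F.minus_pos[OF _ d'(3), of x] xd by auto
      ultimately show ?thesis by blast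
    qed
    have "deriv g x D"
      unfolding deriv_def
    proof (intro ballI conjI impI)
      fix c assume c: "c \<in> dom M"
      { assume cD: "c \<sqsubset> D"
        \<comment> \<open>The tolerance is the distance from \<open>c\<close> to \<open>D\<close>,
          so that the lower bound \<open>D - ?e\<close> is \<open>c\<close> itself.\<close>
        let ?e = "D \<ominus>\<^bsub>R\<^esub> c"
        have "\<zero>\<^bsub>R\<^esub> \<sqsubset> ?e" using F.ord_diff[of c D] c Dd cD by simp
        from local[OF this] obtain p r where pr: "p \<sqsubset> x" "x \<sqsubset> r"
          "\<And>y. p \<sqsubset> y \<Longrightarrow> y \<sqsubset> r \<Longrightarrow> y \<noteq> x \<Longrightarrow> D \<ominus>\<^bsub>R\<^esub> ?e \<sqsubset> sl g x y" by blast
        have car: "c \<in> carrier R" "D \<in> carrier R" using c Dd by auto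
        have "D \<ominus>\<^bsub>R\<^esub> ?e = c" using car by algebra
        then have "near_right g True c x \<and> near_left g True c x"
          using pr(3) by (intro sides[OF pr(1,2)]) (simp add: cmp_def)
        then show "near_right g True c x" "near_left g True c x" by auto }
      { assume cD: "D \<sqsubset> c"
        let ?e = "c \<ominus>\<^bsub>R\<^esub> D"
        have "\<zero>\<^bsub>R\<^esub> \<sqsubset> ?e" using F.ord_diff[of D c] c Dd cD by simp
        from local[OF this] obtain p r where pr: "p \<sqsubset> x" "x \<sqsubset> r"
          "\<And>y. p \<sqsubset> y \<Longrightarrow> y \<sqsubset> r \<Longrightarrow> y \<noteq> x \<Longrightarrow> sl g x y \<sqsubset> D \<oplus>\<^bsub>R\<^esub> ?e" by blast
        have car: "c \<in> carrier R" "D \<in> carrier R" using c Dd by auto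
        have "D \<oplus>\<^bsub>R\<^esub> ?e = c" using car by algebra
        then have "near_right g False c x \<and> near_left g False c x"
          using pr(3) by (intro sides[OF pr(1,2)]) (simp add: cmp_def)
        then show "near_right g False c x" "near_left g False c x" by auto }
    qed
    then show "D \<in> dom M \<and> pderiv t i (envl u) D"
      using Dd by (simp add: pderiv_def g_def[abs_def] x_def z_def)
  next
    assume "D \<in> dom M \<and> pderiv t i (envl u) D"
    then have Dd: "D \<in> dom M" and D: "deriv g x D" by (simp_all add: pderiv_def g_def[abs_def] x_def z_def)
    show "has_partial R U (\<lambda>xs. t (envl xs)) i u D"
      unfolding has_partial_def
    proof (intro conjI ballI)
      show "D \<in> carrier R" using Dd by simp
      fix e assume "e \<in> positives R"
      then have e: "\<zero>\<^bsub>R\<^esub> \<sqsubset> e" by (simp add: F.positives_iff)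
      have ed: "e \<in> dom M" using F.lt_carrier[OF e] by simp
      let ?c1 = "D \<ominus>\<^bsub>R\<^esub> e" and ?c2 = "D \<oplus>\<^bsub>R\<^esub> e"
      have c: "?c1 \<sqsubset> D" "D \<sqsubset> ?c2" using F.plus_pos[OF _ e, of D] F.minus_pos[OF _ e, of D] Dd by auto
      have cd: "?c1 \<in> dom M" "?c2 \<in> dom M" using c lt_dom by auto
      have nr: "near_right g True ?c1 x" "near_right g False ?c2 x"
        and nl: "near_left g True ?c1 x" "near_left g False ?c2 x"
        using D c cd unfolding deriv_def by blast+
      from nr obtain p1 p2 where p1: "x \<sqsubset> p1" "\<forall>y \<in> dom M. x \<sqsubset> y \<longrightarrow> y \<sqsubset> p1 \<longrightarrow> cmp True ?c1 (sl g x y)"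
        and p2: "x \<sqsubset> p2" "\<forall>y \<in> dom M. x \<sqsubset> y \<longrightarrow> y \<sqsubset> p2 \<longrightarrow> cmp False ?c2 (sl g x y)"
        unfolding near_right_def by blast
      from nl obtain q1 q2 where q1: "q1 \<sqsubset> x" "\<forall>y \<in> dom M. q1 \<sqsubset> y \<longrightarrow> y \<sqsubset> x \<longrightarrow> cmp True ?c1 (sl g x y)"
        and q2: "q2 \<sqsubset> x" "\<forall>y \<in> dom M. q2 \<sqsubset> y \<longrightarrow> y \<sqsubset> x \<longrightarrow> cmp False ?c2 (sl g x y)"
        unfolding near_left_def by blast
      obtain r where r: "r \<sqsubset> p1" "r \<sqsubset> p2" "x \<sqsubset> r" using lt_min[OF p1(1) p2(1)] by blast
      obtain p where p: "q1 \<sqsubset> p" "q2 \<sqsubset> p" "p \<sqsubset> x" using lt_max[OF q1(1) q2(1)] by blast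
      obtain d where d: "\<zero>\<^bsub>R\<^esub> \<sqsubset> d" "p = x \<ominus>\<^bsub>R\<^esub> d \<or> p \<sqsubset> x \<ominus>\<^bsub>R\<^esub> d" "x \<oplus>\<^bsub>R\<^esub> d = r \<or> x \<oplus>\<^bsub>R\<^esub> d \<sqsubset> r"
        using F.ex_below_both[OF p(3) r(3)] by blast
      have dd: "d \<in> dom M" using F.lt_carrier[OF d(1)] by simp
      have "abs_less R (?q h \<ominus>\<^bsub>R\<^esub> D) e" if h: "h \<in> carrier R - {\<zero>\<^bsub>R\<^esub>}" "abs_less R h d" for h
      proof -
        obtain y where y: "y \<in> dom M" "y \<noteq> x" "h = y \<ominus>\<^bsub>R\<^esub> x" using hy h(1) by auto
        have "x \<ominus>\<^bsub>R\<^esub> d \<sqsubset> y" "y \<sqsubset> x \<oplus>\<^bsub>R\<^esub> d"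
          using h(2) F.abs_less_diff[of x y d] xd y dd by auto
        then have py: "p \<sqsubset> y" "y \<sqsubset> r" using d(2,3) F.ord_trans by blast+
        have "?c1 \<sqsubset> sl g x y \<and> sl g x y \<sqsubset> ?c2"
        proof (cases "x \<sqsubset> y")
          case True
          then show ?thesis using p1(2) p2(2) y(1) F.ord_trans[OF py(2) r(1)] F.ord_trans[OF py(2) r(2)]
            by (simp add: cmp_def)
        next
          case False
          then have "y \<sqsubset> x" using lt_total[of x y] xd y by blast
          then show ?thesis using q1(2) q2(2) y(1) F.ord_trans[OF p(1) py(1)] F.ord_trans[OF p(2) py(1)]
            by (simp add: cmp_def)
        qed
        then show ?thesis
          unfolding y(3) q(1)[OF y(1,2)] using F.abs_less_diff[of D "sl g x y" e] Dd ed sd[OF y(1)] by simp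
      qed
      moreover have "d \<in> positives R" using d(1) by (simp add: F.positives_iff)
      ultimately show "\<exists>d \<in> positives R. \<forall>h \<in> carrier R - {\<zero>\<^bsub>R\<^esub>}. abs_less R h d \<longrightarrow>
          u[i := u ! i \<oplus>\<^bsub>R\<^esub> h] \<in> U \<longrightarrow> abs_less R (?q h \<ominus>\<^bsub>R\<^esub> D) e"
        by blast
    qed
  qed
qed

lemma defT_finsum:
  "(\<And>i. defT A (t i)) \<Longrightarrow> defT A (\<lambda>v. \<Oplus>\<^bsub>R\<^esub>i \<in> {..<m :: nat}. t i v)"
proof (induction m)
  case 0
  then show ?case using defT_zero by simp
next
  case (Suc m)
  have "(\<Oplus>\<^bsub>R\<^esub>i \<in> {..<Suc m}. t i v) = t m v \<oplus>\<^bsub>R\<^esub> (\<Oplus>\<^bsub>R\<^esub>i \<in> {..<m}. t i v)" if "v \<in> Env" for v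
    unfolding lessThan_Suc
    by (rule F.finsum_insert) (use defT_dom[OF Suc.prems that] in auto)
  moreover have "defT A (\<lambda>v. t m v \<oplus>\<^bsub>R\<^esub> (\<Oplus>\<^bsub>R\<^esub>i \<in> {..<m}. t i v))"
    by (rule defT_add[OF Suc.prems Suc.IH[OF Suc.prems]])
  ultimately show ?case by (subst defT_cong)
qed

text \<open>The term \<open>G\<close> is the sum of the partial derivatives at the point held in the
  even places, each times the derivative of a coordinate held in the odd ones. The work lies in
  showing that \<open>t\<close> is C1 on an open set in the sense of tolerances, where
  \<open>nbhd\<close> and \<open>contin\<close> are turned into balls.\<close>

lemma T_derivation_chain_rule:
  assumes \<delta>: "T_derivation L M \<delta>"
    and t: "defT {} t" and U: "defP {} U" and PD: "\<And>i. defT {} (PD i)"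
    and op: "\<And>z. z \<in> Env \<Longrightarrow> U z \<Longrightarrow> nbhd m U z"
    and pd: "\<And>z i. z \<in> Env \<Longrightarrow> U z \<Longrightarrow> i < m \<Longrightarrow> pderiv t i z (PD i z)"
    and co: "\<And>z i. z \<in> Env \<Longrightarrow> U z \<Longrightarrow> i < m \<Longrightarrow> contin m (PD i) z"
  shows "\<exists>G. defT {} G \<and> (\<forall>z \<in> Env. U z \<longrightarrow> (\<forall>i\<ge>m. z i = \<zero>\<^bsub>R\<^esub>) \<longrightarrow>
    \<delta> (t z) = G (merge z (\<lambda>i. if i < m then \<delta> (z i) else \<zero>\<^bsub>R\<^esub>)))"
proof -
  let ?U = "{xs \<in> tuples (dom M) m. U (envl xs)}"
  let ?f = "\<lambda>xs. t (envl xs)"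
  have E: "envl u \<in> Env" if "u \<in> ?U" for u using that envl_Env tuplesD by blast
  have opU: "open_in R m ?U"
    unfolding open_in_def
  proof (intro conjI ballI)
    fix u assume u: "u \<in> ?U"
    from nbhd_near[OF op[OF E[OF u]]] u obtain e where "e \<in> positives R"
      "\<forall>v \<in> tuples (dom M) m. near R e u v \<longrightarrow> U (envl v)" by blast
    then show "\<exists>e \<in> positives R. \<forall>v \<in> tuples (carrier R) m. near R e u v \<longrightarrow> v \<in> ?U" by auto
  qed simp
  have hp: "has_partial R ?U ?f i u D \<longleftrightarrow> D = PD i (envl u)" if u: "u \<in> ?U" and i: "i < m" for u i D
  proof -
    have 1: "pderiv t i (envl u) (PD i (envl u))" using pd[OF E[OF u] _ i] u by blast
    have 2: "PD i (envl u) \<in> dom M" using defT_dom[OF PD E[OF u]] .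
    show ?thesis unfolding has_partial_iff[OF t opU u i]
      using 1 2 deriv_unique unfolding pderiv_def by blast
  qed
  have par: "partial_deriv R ?U ?f i u = PD i (envl u)" if "u \<in> ?U" "i < m" for u i
  proof -
    have "has_partial R ?U ?f i u = (\<lambda>D. D = PD i (envl u))" using hp[OF that] by (intro ext)
    then show ?thesis by (simp only: partial_deriv_def the_eq_trivial)
  qed
  have C1: "C1_on R m ?U ?f"
    unfolding C1_on_def
  proof (intro allI impI conjI ballI)
    fix i u assume "i < m" "u \<in> ?U"
    then show "\<exists>D. has_partial R ?U ?f i u D" using hp by blast
  next
    fix i assume i: "i < m"
    show "cont_on R ?U (partial_deriv R ?U ?f i)"
      unfolding cont_on_def
    proof (intro ballI)
      fix u e assume u: "u \<in> ?U" and "e \<in> positives R"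
      then have e: "\<zero>\<^bsub>R\<^esub> \<sqsubset> e" by (simp add: F.positives_iff)
      let ?D = "PD i (envl u)"
      have Dd: "?D \<in> dom M" using defT_dom[OF PD E[OF u]] .
      have ed: "e \<in> dom M" using F.lt_carrier[OF e] by simp
      have c: "?D \<ominus>\<^bsub>R\<^esub> e \<sqsubset> ?D" "?D \<sqsubset> ?D \<oplus>\<^bsub>R\<^esub> e"
        using F.plus_pos[OF _ e, of ?D] F.minus_pos[OF _ e, of ?D] Dd by auto
      have "contin m (PD i) (envl u)" using co[OF E[OF u] _ i] u by blast
      then have "nbhd m (\<lambda>z'. ?D \<ominus>\<^bsub>R\<^esub> e \<sqsubset> PD i z' \<and> PD i z' \<sqsubset> ?D \<oplus>\<^bsub>R\<^esub> e) (envl u)"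
        unfolding contin_def using c lt_dom by blast
      from nbhd_near[OF this] u obtain d where d: "d \<in> positives R"
        "\<forall>v \<in> tuples (dom M) m. near R d u v \<longrightarrow>
          ?D \<ominus>\<^bsub>R\<^esub> e \<sqsubset> PD i (envl v) \<and> PD i (envl v) \<sqsubset> ?D \<oplus>\<^bsub>R\<^esub> e" by blast
      have "abs_less R (partial_deriv R ?U ?f i v \<ominus>\<^bsub>R\<^esub> partial_deriv R ?U ?f i u) e"
        if v: "v \<in> ?U" "near R d u v" for v
        unfolding par[OF v(1) i] par[OF u i]
        using d(2) v F.abs_less_diff[of ?D "PD i (envl v)" e] Dd ed defT_dom[OF PD E[OF v(1)]] by simp
      then show "\<exists>d \<in> positives R. \<forall>v \<in> ?U. near R d u v \<longrightarrow>
        abs_less R (partial_deriv R ?U ?f i v \<ominus>\<^bsub>R\<^esub> partial_deriv R ?U ?f i u) e" using d(1) by blast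
    qed
  qed
  have df: "definable_fun L M {} m ?U ?f" by (rule definable_fun_defT[OF U t])
  have "\<forall>u \<in> ?U. \<delta> (?f u) = (\<Oplus>\<^bsub>R\<^esub>i \<in> {..<m}. partial_deriv R ?U ?f i u \<otimes>\<^bsub>R\<^esub> \<delta> (u ! i))"
    using \<delta> opU df C1 unfolding T_derivation_def by blast
  then have main: "\<delta> (?f u) = (\<Oplus>\<^bsub>R\<^esub>i \<in> {..<m}. partial_deriv R ?U ?f i u \<otimes>\<^bsub>R\<^esub> \<delta> (u ! i))"
    if "u \<in> ?U" for u using that by blast
  have \<delta>d: "\<delta> x \<in> dom M" if "x \<in> dom M" for x using \<delta> that by (auto simp: T_derivation_def)
  define G where "G v = (\<Oplus>\<^bsub>R\<^esub>i \<in> {..<m}. PD i (evens v) \<otimes>\<^bsub>R\<^esub> odds v i)" for v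
  have G: "defT {} G"
    unfolding G_def[abs_def]
  proof (intro defT_finsum defT_mult)
    fix i
    show "defT {} (\<lambda>v. PD i (evens v))" using defT_ren[OF PD, where f = "\<lambda>i. 2 * i"] by (simp add: evens_def[abs_def])
    show "defT {} (\<lambda>v. odds v i)" unfolding odds_def by (rule defT_var)
  qed
  moreover have "\<delta> (t z) = G (merge z (\<lambda>i. if i < m then \<delta> (z i) else \<zero>\<^bsub>R\<^esub>))"
    if z: "z \<in> Env" "U z" "\<forall>i\<ge>m. z i = \<zero>\<^bsub>R\<^esub>" for z
  proof -
    let ?u = "map z [0..<m]"
    have zu: "envl ?u = z" using z(3) by (auto simp: envl_def fun_eq_iff)
    have u: "?u \<in> ?U" using z zu by (auto simp: tuples_def)
    have "\<delta> (t z) = (\<Oplus>\<^bsub>R\<^esub>i \<in> {..<m}. partial_deriv R ?U ?f i ?u \<otimes>\<^bsub>R\<^esub> \<delta> (?u ! i))"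
      using main[OF u] zu by simp
    also have "\<dots> = (\<Oplus>\<^bsub>R\<^esub>i \<in> {..<m}. PD i z \<otimes>\<^bsub>R\<^esub> \<delta> (z i))"
    proof (rule F.finsum_cong')
      show "(\<lambda>i. PD i z \<otimes>\<^bsub>R\<^esub> \<delta> (z i)) \<in> {..<m} \<rightarrow> carrier R"
        using defT_dom[OF PD z(1)] \<delta>d z(1) by (auto intro!: F.m_closed[simplified])
      show "partial_deriv R ?U ?f i ?u \<otimes>\<^bsub>R\<^esub> \<delta> (?u ! i) = PD i z \<otimes>\<^bsub>R\<^esub> \<delta> (z i)" if "i \<in> {..<m}" for i
        using par[OF u, of i] that zu by simp
    qed simp
    also have "\<dots> = G (merge z (\<lambda>i. if i < m then \<delta> (z i) else \<zero>\<^bsub>R\<^esub>))"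
      unfolding G_def evens_merge odds_merge
    proof (rule F.finsum_cong')
      show "(\<lambda>i. PD i z \<otimes>\<^bsub>R\<^esub> (if i < m then \<delta> (z i) else \<zero>\<^bsub>R\<^esub>)) \<in> {..<m} \<rightarrow> carrier R"
        using defT_dom[OF PD z(1)] \<delta>d z(1) by (auto intro!: F.m_closed[simplified])
    qed auto
    finally show ?thesis .
  qed
  ultimately show ?thesis by blast
qed

section \<open>Cells and dimension\<close>

lemma cell_bound_dom: "cell_bound L M n C f \<Longrightarrow> u \<in> C \<Longrightarrow> f u \<in> dom M"
proof -
  assume "cell_bound L M n C f" and u: "u \<in> C"
  then obtain X \<phi> ps where "{u @ [f u] | u. u \<in> C} = {xs \<in> tuples (dom M) (Suc n). sat M (nth (xs @ ps)) \<phi>}"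
    unfolding cell_bound_def definable_fun_def definable_def by blast
  then have "u @ [f u] \<in> tuples (dom M) (Suc n)" using u by blast
  then show ?thesis by (simp add: tuples_def)
qed

text \<open>Bounds the dimension of a cell by the number of coordinates. Nonemptiness is included
  because the length of the type is compared with the length of a point of the cell.\<close>

lemma cell_props: "cell L M is C \<Longrightarrow> C \<noteq> {} \<and> (\<forall>u \<in> C. length u = length is) \<and> sum_list is \<le> length is"
proof (induction rule: cell.induct)
  case (band "is" C lo hi)
  then obtain u where u: "u \<in> C" by blast
  have cb: "\<forall>f \<in> set_option lo \<union> set_option hi. f u \<in> dom M"
    using band.hyps(2) u cell_bound_dom by blast
  have "\<exists>y \<in> dom M. above R (map_option (\<lambda>f. f u) lo) y \<and> below R (map_option (\<lambda>g. g u) hi) y"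
  proof (cases lo; cases hi)
    assume "lo = None" "hi = None"
    then show ?thesis using org_dom by (auto simp: above_def below_def)
  next
    fix h assume *: "lo = None" "hi = Some h"
    then obtain y where "y \<sqsubset> h u" using lt_below[of "h u"] cb by auto
    then show ?thesis using * by (intro bexI[of _ y]) (auto simp: above_def below_def F.lt_def)
  next
    fix l assume *: "lo = Some l" "hi = None"
    then obtain y where "l u \<sqsubset> y" using lt_above[of "l u"] cb by auto
    then show ?thesis using * by (intro bexI[of _ y]) (auto simp: above_def below_def F.lt_def)
  next
    fix l h assume *: "lo = Some l" "hi = Some h"
    then have "olt R (l u) (h u)" using band.hyps(3) u by simp
    then have "l u \<sqsubset> h u" using cb * by (simp add: F.lt_def)
    then obtain y where "l u \<sqsubset> y" "y \<sqsubset> h u" using lt_dense by blast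
    then show ?thesis using * by (intro bexI[of _ y]) (auto simp: above_def below_def F.lt_def)
  qed
  then show ?case using band u by fastforce
qed auto

text \<open>Each coordinate adds a band whose two bounds are constant functions.\<close>

lemma box_cell:
  assumes "c \<in> Env" "d \<in> Env" "\<And>i. i < n \<Longrightarrow> c i \<sqsubset> d i"
  shows "cell L M (replicate n 1) {xs \<in> tuples (dom M) n. in_box n c d (envl xs)}"
  using assms(3)
proof (induction n)
  case 0
  have "{xs \<in> tuples (dom M) 0. in_box 0 c d (envl xs)} = {[]}" by (auto simp: tuples_def in_box_def)
  then show ?case using cell.point by simp
next
  case (Suc n)
  let ?B = "\<lambda>n. {xs \<in> tuples (dom M) n. in_box n c d (envl xs)}"
  have IH: "cell L M (replicate n 1) (?B n)" using Suc by simp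
  have cd: "c i \<in> dom M" "d i \<in> dom M" for i using assms(1,2) by auto
  have bound: "cell_bound L M n (?B n) (\<lambda>_. a)" if a: "a \<in> dom M" for a
    unfolding cell_bound_def
  proof
    have "defP (dom M) (in_box n c d)"
      unfolding in_box_iff[abs_def]
      using cd by (intro defP_fin_ball defP_conj defP_lt defT_var defT_param finite_lessThan)
    then show "definable_fun L M (dom M) n (?B n) (\<lambda>_. a)"
      using definable_fun_defT[of "dom M" "in_box n c d" "\<lambda>_. a" n] defT_param[OF a a] by blast
    have "abs_less R (a \<ominus>\<^bsub>R\<^esub> a) e" if e: "\<zero>\<^bsub>R\<^esub> \<sqsubset> e" for e
      using F.abs_less_diff[of a a e] a F.lt_carrier[OF e] F.plus_pos[OF _ e, of a] F.minus_pos[OF _ e, of a] by simp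
    then show "cont_on R (?B n) (\<lambda>_. a)"
      using F.one_pos by (auto simp: cont_on_def F.positives_iff)
  qed
  have "cell L M (replicate n 1 @ [1]) {u @ [y] | u y. u \<in> ?B n \<and> y \<in> dom M \<and>
      above R (map_option (\<lambda>f. f u) (Some (\<lambda>_. c n))) y \<and>
      below R (map_option (\<lambda>g. g u) (Some (\<lambda>_. d n))) y}"
    by (rule cell.band[OF IH]) (use bound cd Suc.prems[of n] in \<open>auto simp: F.lt_def\<close>)
  moreover have "{u @ [y] | u y. u \<in> ?B n \<and> y \<in> dom M \<and>
      above R (map_option (\<lambda>f. f u) (Some (\<lambda>_. c n))) y \<and>
      below R (map_option (\<lambda>g. g u) (Some (\<lambda>_. d n))) y} = ?B (Suc n)" (is "?l = ?r")
  proof (intro Set.set_eqI)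
    fix xs
    show "xs \<in> ?l \<longleftrightarrow> xs \<in> ?r"
    proof (cases "\<exists>u y. xs = u @ [y] \<and> length u = n")
      case True
      then obtain u y where xs: "xs = u @ [y]" "length u = n" by blast
      have "envl xs i = envl u i" if "i < n" for i using xs that by (simp add: envl_def nth_append)
      moreover have "envl xs n = y" using xs by (simp add: envl_def nth_append)
      ultimately have "in_box (Suc n) c d (envl xs) \<longleftrightarrow> in_box n c d (envl u) \<and> c n \<sqsubset> y \<and> y \<sqsubset> d n"
        by (auto simp: in_box_def less_Suc_eq)
      then show ?thesis using xs cd
        by (auto simp: tuples_def above_def below_def F.lt_def)
    next
      case False
      then have "xs \<notin> ?l" by (auto simp: tuples_def)
      moreover have "xs \<notin> ?r" using False by (cases xs rule: rev_cases) (auto simp: tuples_def)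
      ultimately show ?thesis by blast
    qed
  qed
  ultimately show ?case by (simp add: replicate_append_same)
qed

text \<open>The projection contains the box given by \<open>c\<close> and \<open>d\<close>, a cell
  of dimension \<open>n\<close>, and no cell in \<open>n\<close> coordinates has a larger dimension.
  So the genericity axiom applies to the set cut out by \<open>P\<close>.\<close>

lemma generic_box_realised:
  assumes gen: "generic_T_derivation L M \<delta>" and P: "defP (dom M) P"
    and cd: "c \<in> Env" "d \<in> Env" "\<And>i. i < n \<Longrightarrow> c i \<sqsubset> d i"
    and ex: "\<And>z. z \<in> Env \<Longrightarrow> in_box n c d z \<Longrightarrow>
      \<exists>t \<in> dom M. P (\<lambda>i. if i < n then z i else if i = n then t else \<zero>\<^bsub>R\<^esub>)"
  shows "\<exists>a \<in> dom M. P (\<lambda>i. if i \<le> n then (\<delta> ^^ i) a else \<zero>\<^bsub>R\<^esub>)"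
proof -
  let ?A = "{xs \<in> tuples (dom M) (Suc n). P (envl xs)}"
  let ?B = "{xs \<in> tuples (dom M) n. in_box n c d (envl xs)}"
  have sub: "?B \<subseteq> take n ` ?A"
  proof
    fix u assume u: "u \<in> ?B"
    then have l: "length u = n" "set u \<subseteq> dom M" by (auto simp: tuples_def)
    obtain t where t: "t \<in> dom M" "P (\<lambda>i. if i < n then envl u i else if i = n then t else \<zero>\<^bsub>R\<^esub>)"
      using ex[OF envl_Env[OF l(2)]] u by blast
    have "envl (u @ [t]) = (\<lambda>i. if i < n then envl u i else if i = n then t else \<zero>\<^bsub>R\<^esub>)"
      using l by (auto simp: envl_def fun_eq_iff nth_append)
    then have "u @ [t] \<in> ?A" using t l by (simp add: tuples_def)
    then show "u \<in> take n ` ?A" using l by force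
  qed
  have "odim L M (take n ` ?A) = ereal (real n)"
    unfolding odim_def
  proof (rule antisym)
    have "cell L M (replicate n 1) ?B" by (rule box_cell[OF cd])
    moreover have "sum_list (replicate n (1 :: nat)) = n" by (simp add: sum_list_replicate)
    ultimately show "ereal (real n) \<le> Sup {ereal (real (sum_list is)) | is. \<exists>C. cell L M is C \<and> C \<subseteq> take n ` ?A}"
      using sub by (intro Sup_upper) (metis (mono_tags, lifting) mem_Collect_eq)
    show "Sup {ereal (real (sum_list is)) | is. \<exists>C. cell L M is C \<and> C \<subseteq> take n ` ?A} \<le> ereal (real n)"
    proof (rule Sup_least)
      fix e assume "e \<in> {ereal (real (sum_list is)) | is. \<exists>C. cell L M is C \<and> C \<subseteq> take n ` ?A}"
      then obtain "is" C where e: "e = ereal (real (sum_list is))" "cell L M is C" "C \<subseteq> take n ` ?A" by blast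
      from cell_props[OF e(2)] obtain u where u: "u \<in> C" "length u = length is" "sum_list is \<le> length is" by blast
      have "u \<in> take n ` ?A" using u(1) e(3) by blast
      then have "length u = n" by (auto simp: tuples_def)
      then show "e \<le> ereal (real n)" using u e(1) by simp
    qed
  qed
  moreover have "definable L M (dom M) (Suc n) ?A" by (rule defP_definable[OF P])
  ultimately obtain a where a: "a \<in> dom M" "jet \<delta> n a \<in> ?A"
    using gen unfolding generic_T_derivation_def by blast
  have "envl (jet \<delta> n a) = (\<lambda>i. if i \<le> n then (\<delta> ^^ i) a else \<zero>\<^bsub>R\<^esub>)"
    by (auto simp: envl_def jet_def fun_eq_iff less_Suc_eq_le simp del: upt_Suc)
  then show ?thesis using a by auto
qed

end

section \<open>Distality\<close>

text \<open>The cardinal exceeds the number of formulas, which is infinite, so countable parameter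
  sets are small. Each predicate is replaced by a formula with a list of parameters, as saturation
  demands.\<close>

lemma (in first_order_structure) saturated_countable:
  fixes \<kappa> :: "'m rel"
  assumes sat: "saturated L \<kappa> M" and \<kappa>: "|UNIV :: ('f, 'r) fm set| <o \<kappa>"
    and A: "countable A" and P: "\<And>P. P \<in> \<P> \<Longrightarrow> defP A (\<lambda>v. P (v 0))"
    and fin: "\<And>F. finite F \<Longrightarrow> F \<subseteq> \<P> \<Longrightarrow> \<exists>x \<in> dom M. \<forall>P \<in> F. P x"
  shows "\<exists>x \<in> dom M. \<forall>P \<in> \<P>. P x"
proof -
  let ?A = "A \<inter> dom M"
  have 1: "|?A| <o \<kappa>"
  proof -
    obtain f :: "'m \<Rightarrow> nat" where f: "inj_on f ?A" using A countable_def by (metis countable_Int1)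
    have "|?A| \<le>o |UNIV :: nat set|" using card_of_ordLeqI[OF f, of UNIV] by simp
    \<comment> \<open>The equations of a variable with itself give infinitely many formulas.\<close>
    moreover have "|UNIV :: nat set| \<le>o |UNIV :: ('f, 'r) fm set|"
      using card_of_ordLeqI[of "\<lambda>n. FEq (Var n) (Var n) :: ('f, 'r) fm" UNIV UNIV] by (simp add: inj_def)
    ultimately show ?thesis using \<kappa> ordLeq_transitive ordLeq_ordLess_trans by blast
  qed
  have "\<forall>P \<in> \<P>. \<exists>q. wf_fm L (fst q) \<and> set (snd q) \<subseteq> ?A \<and> fv (fst q) \<subseteq> {..<Suc (length (snd q))} \<and>
    (\<forall>x \<in> dom M. P x = sat M (nth (x # snd q)) (fst q))"
  proof
    fix P' assume "P' \<in> \<P>"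
    have "\<exists>\<phi> ps. wf_fm L \<phi> \<and> set ps \<subseteq> A \<inter> dom M \<and> fv \<phi> \<subseteq> {..<1 + length ps} \<and>
    (\<forall>xs \<in> tuples (dom M) 1. \<forall>v \<in> Env. (\<forall>i<1. v i = xs ! i) \<longrightarrow> P' (v 0) = sat M (nth (xs @ ps)) \<phi>)"
      by (rule defP_formula[OF P[OF \<open>P' \<in> \<P>\<close>]]) simp
    then obtain \<phi> ps where p: "wf_fm L \<phi>" "set ps \<subseteq> A \<inter> dom M" "fv \<phi> \<subseteq> {..<1 + length ps}"
    "\<forall>xs \<in> tuples (dom M) 1. \<forall>v \<in> Env. (\<forall>i<1. v i = xs ! i) \<longrightarrow> P' (v 0) = sat M (nth (xs @ ps)) \<phi>"
      by blast
    have "P' x = sat M (nth (x # ps)) \<phi>" if "x \<in> dom M" for x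
      using p(4)[rule_format, of "[x]" "\<lambda>_. x"] that by (simp add: tuples_def)
    then show "\<exists>q. wf_fm L (fst q) \<and> set (snd q) \<subseteq> ?A \<and> fv (fst q) \<subseteq> {..<Suc (length (snd q))} \<and>
      (\<forall>x \<in> dom M. P' x = sat M (nth (x # snd q)) (fst q))"
      using p(1-3) by (intro exI[of _ "(\<phi>, ps)"]) simp
  qed
  from bchoice[OF this] obtain q where q0: "\<forall>P \<in> \<P>. wf_fm L (fst (q P)) \<and> set (snd (q P)) \<subseteq> ?A \<and>
    fv (fst (q P)) \<subseteq> {..<Suc (length (snd (q P)))} \<and>
    (\<forall>x \<in> dom M. P x = sat M (nth (x # snd (q P))) (fst (q P)))" ..
  note q = bspec[OF q0]
  have "\<exists>x \<in> dom M. \<forall>(\<phi>, ps) \<in> F. sat M (nth (x # ps)) \<phi>" if F: "finite F" "F \<subseteq> q ` \<P>" for F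
  proof -
    obtain G where G: "finite G" "G \<subseteq> \<P>" "F = q ` G" using finite_subset_image[OF F] by blast
    obtain x where x: "x \<in> dom M" "\<forall>P \<in> G. P x" using fin[OF G(1,2)] by blast
    have "\<forall>P \<in> G. sat M (nth (x # snd (q P))) (fst (q P))" using q x G(2) by blast
    then show ?thesis using x(1) unfolding G(3) by (intro bexI[of _ x]) (simp_all add: case_prod_beta)
  qed
  then have 3: "\<forall>F. finite F \<longrightarrow> F \<subseteq> q ` \<P> \<longrightarrow>
    (\<exists>x \<in> dom M. \<forall>(\<phi>, ps) \<in> F. sat M (nth (x # ps)) \<phi>)" by blast
  have 2: "\<forall>(\<phi>, ps) \<in> q ` \<P>. wf_fm L \<phi> \<and> set ps \<subseteq> ?A \<and> fv \<phi> \<subseteq> {..<Suc (length ps)}"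
    using q by (simp add: case_prod_beta)
  have "\<exists>x \<in> dom M. \<forall>(\<phi>, ps) \<in> q ` \<P>. sat M (nth (x # ps)) \<phi>"
    using sat[unfolded saturated_def, THEN spec[of _ ?A], THEN spec[of _ "q ` \<P>"], THEN mp, OF Int_lower2,
      THEN mp, OF 1, THEN mp, OF 2, THEN mp, OF 3] .
  then obtain x where x: "x \<in> dom M" "\<forall>P \<in> \<P>. sat M (nth (x # snd (q P))) (fst (q P))"
    by (auto simp: case_prod_beta)
  have "P x" if "P \<in> \<P>" for P using q[OF that] x that by blast
  then show ?thesis using x(1) by blast
qed

text \<open>The absence of a last element makes the bound strict. It is applied to the indices
  before \<open>c\<close>, and with the reversed order to those after \<open>c\<close>.\<close>

lemma finite_strict_bound:
  assumes "transp R" "\<And>i j. i \<in> J \<Longrightarrow> j \<in> J \<Longrightarrow> R i j \<or> i = j \<or> R j i"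
    "\<And>i. i \<in> J \<Longrightarrow> \<exists>j \<in> J. R i j" "J \<noteq> {}" "finite S" "S \<subseteq> J"
  shows "\<exists>j \<in> J. \<forall>i \<in> S. R i j"
  using assms(5,6)
proof (induction S rule: finite_induct)
  case empty
  then show ?case using assms(4) by blast
next
  case (insert s S)
  then obtain j where j: "j \<in> J" "\<forall>i \<in> S. R i j" by blast
  have s: "s \<in> J" using insert by blast
  obtain k where k: "k \<in> J" "R s k" using assms(3) s by blast
  have t: "R x y \<Longrightarrow> R y w \<Longrightarrow> R x w" for x y w using assms(1) by (meson transpE)
  show ?case
  proof (cases "R s j")
    case True
    then show ?thesis using j by blast
  next
    case False
    then have "j = s \<or> R j s" using assms(2) s j(1) by blast
    then have "R j k" using k(2) t by blast
    then have "\<forall>i \<in> S. R i k" using j(2) t by blast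
    then show ?thesis using k by blast
  qed
qed

lemma length_concat_const: "(\<And>i. i \<in> set is \<Longrightarrow> length (f i) = n) \<Longrightarrow> length (concat (map f is)) = length is * n"
  by (induction "is") auto

lemma nth_concat_const:
  assumes "\<And>i. i \<in> set is \<Longrightarrow> length (f i) = n" "l < length is" "m < n"
  shows "concat (map f is) ! (l * n + m) = f (is ! l) ! m"
  using assms
proof (induction "is" arbitrary: l)
  case (Cons i "is")
  then show ?case by (cases l) (auto simp: nth_append)
qed simp

section \<open>Jets of tuples and the two forms of indiscernibility\<close>

context generic_derivation
begin

definition jets :: "'m set \<Rightarrow> 'm set" where
  "jets B = {(\<delta> ^^ k) e | e k. e \<in> insert org B}"

lemma jets_dcl: "B \<subseteq> dom M \<Longrightarrow> jets B \<subseteq> D.dcl B"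
proof
  fix x assume B: "B \<subseteq> dom M" and "x \<in> jets B"
  then obtain e k where e: "x = (\<delta> ^^ k) e" "e \<in> insert org B" by (auto simp: jets_def)
  have "org \<in> D.dcl {}"
    using org defP_delta[of "{}" "\<lambda>v. v 0 = org"] by (simp add: dcl_iff D.dcl_iff dom_N)
  then have "org \<in> D.dcl B" using D.dcl_mono[of "{}" B] by auto
  then have "e \<in> D.dcl B" using e(2) B D.dcl_base[of e B] dom_N by auto
  then show "x \<in> D.dcl B"
    unfolding e(1) using D.dcl_app[OF defT_delta_pow[OF D.defT_var[of B 0]], of "\<lambda>_. e" k] by simp
qed

lemma jets_dom: "B \<subseteq> dom M \<Longrightarrow> jets B \<subseteq> dom M"
  using delta_pow_dom org_dom by (auto simp: jets_def)

text \<open>Position \<open>prod_encode (l, k)\<close> holds the \<open>k\<close>-th derivative of the \<open>l\<close>-th entry.\<close>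

definition jet_tuple :: "nat \<Rightarrow> ('i \<Rightarrow> 'm list) \<Rightarrow> 'i \<Rightarrow> nat \<Rightarrow> 'm" where
  "jet_tuple n a i j = (if fst (prod_decode j) < n
     then (\<delta> ^^ snd (prod_decode j)) (a i ! fst (prod_decode j)) else org)"

lemma jet_tuple_Env: "a i \<in> tuples (dom M) n \<Longrightarrow> jet_tuple n a i \<in> Env"
  using org_dom by (intro EnvI) (auto simp: jet_tuple_def tuples_def intro!: delta_pow_dom)

text \<open>Derivatives are terms of the expanded language, so a predicate on packed jets becomes
  one on the concatenated finite tuples, and the jets of \<open>B\<close> are definable over
  \<open>B\<close>.\<close>

lemma indisc_jets:
  assumes ind: "indiscernible (delta_lang L) N B J r a" and B: "B \<subseteq> dom M"
    and a: "\<And>i. i \<in> J \<Longrightarrow> a i \<in> tuples (dom M) n"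
  shows "indisc org (jet_tuple n a) (strict r) (jets B) J"
  unfolding indisc_def
proof (intro allI impI)
  fix "is" js Q
  assume s: "set is \<subseteq> J" "set js \<subseteq> J" "sorted_wrt (strict r) is" "sorted_wrt (strict r) js"
    "length is = length js" and Q: "defP (jets B) Q"
  let ?len = "length is"
  define fs where "fs x = fst (prod_decode (snd (prod_decode x)))" for x
  define ks where "ks x = snd (prod_decode (snd (prod_decode x)))" for x
  \<comment> \<open>Place \<open>x\<close> of the packed jets codes a tuple number, an entry and an
    order of derivation. Entry \<open>fs x\<close> of tuple number \<open>l\<close> stands at place
    \<open>l * n + fs x\<close> of the concatenation.\<close>
  define \<sigma> :: "nat \<Rightarrow> (nat \<Rightarrow> 'm) \<Rightarrow> 'm" where
    "\<sigma> x = (if fst (prod_decode x) < ?len \<and> fs x < n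
      then (\<lambda>v. (\<delta> ^^ ks x) (v (fst (prod_decode x) * n + fs x))) else (\<lambda>_. org))" for x
  have "D.defT (jets B) (\<sigma> x)" for x
  proof (cases "fst (prod_decode x) < ?len \<and> fs x < n")
    case True
    then show ?thesis using defT_delta_pow[OF D.defT_var] by (simp add: \<sigma>_def)
  next
    case False
    have "org \<in> jets B" using exI[of "\<lambda>k. org = (\<delta> ^^ k) org" 0] by (auto simp: jets_def)
    then have "D.defT (jets B) (\<lambda>_. org)" using org_dom dom_N by (intro D.defT_param) auto
    then show ?thesis unfolding \<sigma>_def if_not_P[OF False] .
  qed
  from D.defP_subst[OF defP_delta[OF Q], of \<sigma>, OF this]
  have "D.defP (jets B) (\<lambda>v. Q (\<lambda>x. \<sigma> x v))" .
  then have 1: "D.defP B (\<lambda>v. Q (\<lambda>x. \<sigma> x v))" by (rule D.defP_dcl) (use jets_dcl[OF B] in blast)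
  have "Q (\<lambda>x. \<sigma> x v) = Q (\<lambda>x. \<sigma> x w)" if vw: "\<And>i. i < ?len * n \<Longrightarrow> v i = w i" for v w
  proof -
    have "\<sigma> x v = \<sigma> x w" for x
    proof (cases "fst (prod_decode x) < ?len \<and> fs x < n")
      case True
      have "fst (prod_decode x) * n + fs x < Suc (fst (prod_decode x)) * n" using True by simp
      also have "\<dots> \<le> ?len * n" using True by (intro mult_le_mono1) simp
      finally show ?thesis using vw True by (simp add: \<sigma>_def)
    next
      case False
      show ?thesis unfolding \<sigma>_def if_not_P[OF False] ..
    qed
    then show ?thesis by simp
  qed
  from D.defP_formula[OF 1, of "?len * n", OF this] obtain \<phi> ps where
    p: "wf_fm (delta_lang L) \<phi>" "set ps \<subseteq> B \<inter> dom N" "fv \<phi> \<subseteq> {..<?len * n + length ps}"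
    "\<forall>xs \<in> tuples (dom N) (?len * n). \<forall>v \<in> D.Env. (\<forall>i<?len * n. v i = xs ! i) \<longrightarrow>
      Q (\<lambda>x. \<sigma> x v) = sat N (nth (xs @ ps)) \<phi>" by blast
  have key: "Q (pack org (jet_tuple n a) ks) = sat N (nth (concat (map a ks) @ ps)) \<phi>"
    and len: "length (concat (map a ks)) = ?len * n"
    if ks: "set ks \<subseteq> J" "length ks = ?len" for ks
  proof -
    have l: "length (a i) = n" "set (a i) \<subseteq> dom M" if "i \<in> set ks" for i
      using a ks that by (auto simp: tuples_def)
    show len: "length (concat (map a ks)) = ?len * n" using length_concat_const[of ks a n] l ks by simp
    let ?xs = "concat (map a ks)"
    have t: "?xs \<in> tuples (dom N) (?len * n)" using len l dom_N by (auto simp: tuples_def)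
    let ?v = "\<lambda>i. if i < ?len * n then ?xs ! i else org"
    have "?v \<in> Env" using org_dom t dom_N by (intro EnvI) (auto simp: tuples_def simp del: set_concat)
    then have "Q (\<lambda>x. \<sigma> x ?v) = sat N (nth (?xs @ ps)) \<phi>" using p(4) t unfolding D_Env by auto
    moreover have "\<sigma> x ?v = pack org (jet_tuple n a) ks x" for x
    proof (cases "fst (prod_decode x) < ?len \<and> fs x < n")
      case True
      have "fst (prod_decode x) * n + fs x < Suc (fst (prod_decode x)) * n" using True by simp
      also have "\<dots> \<le> ?len * n" using True by (intro mult_le_mono1) simp
      finally have "fst (prod_decode x) * n + fs x < ?len * n" .
      then show ?thesis
        using True ks nth_concat_const[of ks a n "fst (prod_decode x)" "fs x"] l
        by (simp add: \<sigma>_def pack_def jet_tuple_def fs_def ks_def)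
    next
      case False
      show ?thesis
        unfolding \<sigma>_def if_not_P[OF False] using ks False by (auto simp: pack_def jet_tuple_def fs_def)
    qed
    ultimately show "Q (pack org (jet_tuple n a) ks) = sat N (nth (concat (map a ks) @ ps)) \<phi>" by simp
  qed
  have "sat N (nth (concat (map a is) @ ps)) \<phi> = sat N (nth (concat (map a js) @ ps)) \<phi>"
    using ind[unfolded indiscernible_def, rule_format, of \<phi> ps "is" js] p(1-3) s len[OF s(1)] by simp
  then show "Q (pack org (jet_tuple n a) is) = Q (pack org (jet_tuple n a) js)"
    using key[OF s(1)] key[OF s(2)] s(5) by simp
qed

text \<open>For two index lists of equal length, the entries of one are matched with those of the
  other, parameters are fixed, and all derivatives are included. Indiscernibility of jets says that
  this map is elementary; it is closed under \<delta> and countable, so back and forth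
  applies.\<close>

lemma indiscernible_jets:
  assumes ind: "indisc org (jet_tuple n a) (strict r) (jets B) J" and B: "B \<subseteq> dom M" "countable B"
    and a: "\<And>i. i \<in> J \<Longrightarrow> a i \<in> tuples (dom M) n"
  shows "indiscernible (delta_lang L) N B J r a"
  unfolding indiscernible_def
proof (intro allI impI)
  fix \<phi> ps "is" js
  assume wf: "wf_fm (delta_lang L) \<phi>" and ps: "set ps \<subseteq> B"
    and s: "set is \<subseteq> J" "set js \<subseteq> J" "sorted_wrt (strict r) is" "sorted_wrt (strict r) js"
    "length is = length js" and fv: "fv \<phi> \<subseteq> {..<length (concat (map a is) @ ps)}"
  let ?xs = "concat (map a is)" and ?ys = "concat (map a js)" and ?N = "length is * n"
  have l: "length (a i) = n" "set (a i) \<subseteq> dom M" if "i \<in> J" for i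
    using a[OF that] by (auto simp: tuples_def)
  have li: "\<And>i. i \<in> set is \<Longrightarrow> length (a i) = n" "\<And>i. i \<in> set js \<Longrightarrow> length (a i) = n"
    using l(1) s(1,2) by blast+
  have len: "length ?xs = ?N" "length ?ys = ?N"
    using length_concat_const[of "is" a n] length_concat_const[of js a n] li s(5) by simp_all
  have xd: "set ?xs \<subseteq> dom M" "set ?ys \<subseteq> dom M" using l s by auto
  have nd: "?xs ! i \<in> dom M" "?ys ! i \<in> dom M" if "i < ?N" for i
    using subsetD[OF xd(1) nth_mem] subsetD[OF xd(2) nth_mem] len that by simp_all
  let ?f = "\<lambda>(i, k). ((\<delta> ^^ k) (?xs ! i), (\<delta> ^^ k) (?ys ! i))"
  let ?g = "\<lambda>(e, k). ((\<delta> ^^ k) e, (\<delta> ^^ k) e)"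
  define H where "H = ?f ` ({..<?N} \<times> UNIV) \<union> ?g ` (insert org B \<times> UNIV)"
  have Hd: "H \<subseteq> dom M \<times> dom M"
    unfolding H_def using nd org_dom B(1) by (auto intro!: delta_pow_dom)
  have jB: "jets B \<subseteq> dom M" using jets_dom B(1) .
  have "El H"
    unfolding El_def
  proof (intro conjI Hd allI impI)
    fix Q u w assume Q: "defP {} Q" and uw: "\<forall>i. (u i, w i) \<in> H" and Qu: "Q u"
    have "\<exists>h. h \<in> gens (jets B) \<and> gval (\<lambda>_. h) (pack org (jet_tuple n a) is) 0 = u i \<and>
      gval (\<lambda>_. h) (pack org (jet_tuple n a) js) 0 = w i" for i
    proof -
      have "(u i, w i) \<in> H" using uw by blast
      then consider j k where "j < ?N" "u i = (\<delta> ^^ k) (?xs ! j)" "w i = (\<delta> ^^ k) (?ys ! j)"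
        | e k where "e \<in> insert org B" "u i = (\<delta> ^^ k) e" "w i = (\<delta> ^^ k) e"
        unfolding H_def by auto
      then show ?thesis
      proof cases
        case 1
        \<comment> \<open>Since a place \<open>j\<close> exists, the tuples are not empty; quotient
          and remainder by \<open>n\<close> give the tuple number and the entry.\<close>
        have n: "n > 0" using 1(1) by (cases n) auto
        have jl: "j div n < length is" using 1(1) by (simp add: less_mult_imp_div_less)
        have jm: "j mod n < n" using n by simp
        have "?xs ! j = a (is ! (j div n)) ! (j mod n)" "?ys ! j = a (js ! (j div n)) ! (j mod n)"
          using nth_concat_const[of "is" a n "j div n" "j mod n"]
            nth_concat_const[of js a n "j div n" "j mod n"] li jl jm s(5)
          by simp_all
        then show ?thesis
          using 1 jl jm s(5)
          by (intro exI[of _ "Inr (prod_encode (j div n, prod_encode (j mod n, k)))"])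
            (simp add: gval_def pack_def jet_tuple_def)
      next
        case 2
        then have "u i \<in> jets B" by (auto simp: jets_def)
        then show ?thesis using 2 jB by (intro exI[of _ "Inl (u i)"]) (auto simp: gval_def)
      qed
    qed
    then obtain h where h: "\<And>i. h i \<in> gens (jets B)"
      "\<And>i. gval (\<lambda>_. h i) (pack org (jet_tuple n a) is) 0 = u i"
      "\<And>i. gval (\<lambda>_. h i) (pack org (jet_tuple n a) js) 0 = w i" by metis
    have hu: "gval h (pack org (jet_tuple n a) is) = u" "gval h (pack org (jet_tuple n a) js) = w"
      using h(2,3) by (auto simp: gval_def fun_eq_iff)
    have "defP (jets B) (\<lambda>v. Q (gval h v))"
      by (rule defP_gval[OF defP_mono[OF Q] h(1)]) simp
    from indiscD[OF ind s this] show "Q w" using Qu hu by simp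
  qed
  moreover have "countable H" unfolding H_def using B(2) by simp
  moreover have "(org, org) \<in> H"
  proof -
    have "?g (org, 0) \<in> ?g ` (insert org B \<times> UNIV)" by (rule imageI) simp
    then show ?thesis by (simp add: H_def)
  qed
  moreover have "(\<delta> x, \<delta> y) \<in> H" if "(x, y) \<in> H" for x y
  proof -
    from that consider j k where "j < ?N" "x = (\<delta> ^^ k) (?xs ! j)" "y = (\<delta> ^^ k) (?ys ! j)"
      | e k where "e \<in> insert org B" "x = (\<delta> ^^ k) e" "y = (\<delta> ^^ k) e" unfolding H_def by auto
    then show ?thesis
    proof cases
      case 1
      have "?f (j, Suc k) \<in> ?f ` ({..<?N} \<times> UNIV)" by (rule imageI) (use 1 in simp)
      then show ?thesis using 1 by (simp add: H_def)
    next
      case 2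
      have "?g (e, Suc k) \<in> ?g ` (insert org B \<times> UNIV)" by (rule imageI) (use 2 in simp)
      then show ?thesis using 2 by (simp add: H_def)
    qed
  qed
  ultimately have dH: "dEl H" unfolding dEl_def by blast
  define v where "v xs i = (if i < ?N + length ps then (xs @ ps) ! i else org)" for xs i
  have vE: "v xs \<in> Env" if "length xs = ?N" "set xs \<subseteq> dom M" for xs
  proof (rule EnvI)
    fix i
    have "(xs @ ps) ! i \<in> set (xs @ ps)" if "i < ?N + length ps" using that \<open>length xs = ?N\<close> by (intro nth_mem) simp
    then show "v xs i \<in> dom M" using that(2) ps B(1) org_dom by (auto simp: v_def)
  qed
  have "(v ?xs i, v ?ys i) \<in> H" if "i \<in> fv \<phi>" for i
  proof -
    have i: "i < ?N + length ps" using fv that len by auto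
    show ?thesis
    proof (cases "i < ?N")
      case True
      have "?f (i, 0) \<in> ?f ` ({..<?N} \<times> UNIV)" by (rule imageI) (use True in simp)
      then show ?thesis using True len i by (simp add: H_def v_def nth_append)
    next
      case False
      have "ps ! (i - ?N) \<in> B" using ps i False by (auto intro: nth_mem)
      then have "?g (ps ! (i - ?N), 0) \<in> ?g ` (insert org B \<times> UNIV)" by (intro imageI) simp
      then show ?thesis using False len i by (simp add: H_def v_def nth_append)
    qed
  qed
  then have "sat N (v ?xs) \<phi> = sat N (v ?ys) \<phi>"
    using dEl_sat[OF dH wf vE[OF len(1) xd(1)] vE[OF len(2) xd(2)]] by blast
  moreover have "sat N (nth (xs @ ps)) \<phi> = sat N (v xs) \<phi>" if "length xs = ?N" for xs
    by (rule sat_cong) (use fv len in \<open>auto simp: v_def\<close>)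
  ultimately show "sat N (nth (?xs @ ps)) \<phi> = sat N (nth (?ys @ ps)) \<phi>" using len by simp
qed

text \<open>Indiscernibility is passed to jets, where adding the jets of the parameters is a matter
  of the language \<open>L\<close>, and is passed back. The parts before and after \<open>c\<close>
  have no endpoint towards \<open>c\<close>, so any finite set of indices on one side leaves an
  index between it and \<open>c\<close>.\<close>

lemma distal:
  assumes b: "set b \<subseteq> dom M" and r: "linear_order_on I r" and a: "a \<in> I \<rightarrow> tuples (dom M) n"
    and ind: "indiscernible (delta_lang L) N {} I r a" and c: "c \<in> I"
    and I1: "infinite_no_endpoints r {i \<in> I. strict r i c}"
    and I2: "infinite_no_endpoints r {i \<in> I. strict r c i}"
    and indb: "indiscernible (delta_lang L) N (set b) (I - {c}) r a"
  shows "indiscernible (delta_lang L) N (set b) I r a"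
proof -
  have tr: "trans r" "antisym r" and tot: "total_on I r"
    using r by (auto simp: linear_order_on_def partial_order_on_def preorder_on_def)
  have R: "transp (strict r)" "irreflp (strict r)"
    using tr by (auto simp: transp_def irreflp_def strict_def dest: transD antisymD)
  have total: "strict r i j \<or> i = j \<or> strict r j i" if "i \<in> I" "j \<in> I" for i j
    using tot that by (auto simp: total_on_def strict_def)
  have ai: "a i \<in> tuples (dom M) n" if "i \<in> I" for i using a that by blast
  let ?I1 = "{i \<in> I. strict r i c}" and ?I2 = "{i \<in> I. strict r c i}"
  have ne: "?I1 \<noteq> {}" "?I2 \<noteq> {}" using I1 I2 unfolding infinite_no_endpoints_def by (metis finite.emptyI)+
  have lo: "\<exists>j \<in> I. strict r j c \<and> (\<forall>i \<in> S. strict r i j)" if "finite S" "S \<subseteq> ?I1" for S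
  proof -
    have "\<exists>j \<in> ?I1. \<forall>i \<in> S. strict r i j"
      by (rule finite_strict_bound[OF R(1) _ _ ne(1) that])
        (use total I1 in \<open>auto simp: infinite_no_endpoints_def\<close>)
    then show ?thesis by blast
  qed
  have hi: "\<exists>j \<in> I. strict r c j \<and> (\<forall>i \<in> S. strict r j i)" if "finite S" "S \<subseteq> ?I2" for S
  proof -
    have "transp (\<lambda>i j. strict r j i)" using R(1) by (auto simp: transp_def)
    then have "\<exists>j \<in> ?I2. \<forall>i \<in> S. strict r j i"
      by (rule finite_strict_bound[OF _ _ _ ne(2) that])
        (use total I2 in \<open>auto simp: infinite_no_endpoints_def\<close>)
    then show ?thesis by blast
  qed
  have 1: "indisc org (jet_tuple n a) (strict r) {} I"
    by (rule indisc_mono[OF indisc_jets[OF ind _ ai]]) auto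
  have 2: "indisc org (jet_tuple n a) (strict r) (jets (set b)) (I - {c})"
    by (rule indisc_jets[OF indb b]) (use ai in blast)
  have \<alpha>: "jet_tuple n a i \<in> Env" if "i \<in> I" for i using jet_tuple_Env[of a i n] ai[OF that] by simp
  have jb: "jets (set b) \<subseteq> dom M" by (rule jets_dom[OF b])
  have "indisc org (jet_tuple n a) (strict r) (jets (set b)) I"
    by (rule indisc_distal[where c = c]) (fact org_dom \<alpha> R 1 2 c lo hi jb)+
  then show ?thesis by (rule indiscernible_jets) (use b ai in \<open>auto intro: countable_finite\<close>)
qed

end

text \<open>Predicates definable in the reduct are definable in the expansion, so the reduct
  inherits countable saturation from \<open>N\<close>.\<close>

lemma generic_derivation_monster:
  fixes L :: "('f, 'r) olang" and N :: "('m, 'f dfun, 'r) struct"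
  assumes L: "extends_oring_lang L" and N: "is_struct (delta_lang L) N" "is_struct L (reduct N)"
    and omin: "o_minimal L (reduct N)" and of: "ordered_field (oring_of L (reduct N))"
    and gen: "generic_T_derivation L (reduct N) (\<lambda>x. fint N Delta [x])"
    and sat: "saturated (delta_lang L) \<kappa> N" "|UNIV :: ('f dfun, 'r) fm set| <o \<kappa>"
  shows "generic_derivation L (reduct N) (ordered_field_on.lt (oring_of L (reduct N)))
    (ordered_field_on.secant (oring_of L (reduct N))) \<zero>\<^bsub>oring_of L (reduct N)\<^esub> N (\<lambda>x. fint N Delta [x])"
proof -
  interpret D: first_order_structure "delta_lang L" N by unfold_locales (fact N(1))
  interpret M0: first_order_structure L "reduct N" by unfold_locales (fact N(2))
  interpret F: ordered_field_on "oring_of L (reduct N)" by unfold_locales (fact of)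
  note dsat = D.saturated_countable[OF sat]
  have msat: "\<exists>x \<in> dom (reduct N). \<forall>P \<in> \<P>. P x"
    if "countable A" "\<And>P. P \<in> \<P> \<Longrightarrow> M0.defP A (\<lambda>v. P (v 0))"
      "\<And>F. finite F \<Longrightarrow> F \<subseteq> \<P> \<Longrightarrow> \<exists>x \<in> dom (reduct N). \<forall>P \<in> F. P x" for A \<P>
  proof -
    have "D.defP A (\<lambda>v. P (v 0))" if "P \<in> \<P>" for P
      by (rule defP_reduct[OF \<open>\<And>P. P \<in> \<P> \<Longrightarrow> M0.defP A (\<lambda>v. P (v 0))\<close>[OF that]
            M0.first_order_structure_axioms D.first_order_structure_axioms])
    then show ?thesis using dsat[OF that(1), of \<P>] that(3) by simp
  qed
  interpret M: definable_field L "reduct N"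
    by unfold_locales (fact L omin msat)+
  show ?thesis
  proof (unfold_locales, goal_cases)
    case 1
    show ?case ..
  next
    case (2 x)
    show ?case ..
  next
    case (3 A \<P>)
    then show ?case using dsat[of A \<P>] by simp
  next
    case (4 F U PD m)
    have "T_derivation L (reduct N) (\<lambda>x. fint N Delta [x])" using gen by (simp add: generic_T_derivation_def)
    from M.T_derivation_chain_rule[OF this 4] show ?case .
  next
    case (5 P c d n)
    from M.generic_box_realised[OF gen 5] show ?case .
  qed
qed

theorem theorem4p15:
  fixes L :: "('f, 'r) olang" and T :: "('f, 'r) fm set"
  assumes "extends_oring_lang L"
    and "T \<subseteq> sentences L"
    and "complete_theory TYPE('m) L T"
    and "model_complete TYPE('m) L T"
    and "o_minimal_theory TYPE('m) L T"
    and "extends_RCF TYPE('m) L T"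
  shows "distal TYPE('i) (delta_lang L) (TdG_model L T :: ('m, 'f dfun, 'r) struct \<Rightarrow> bool)"
  unfolding distal_def
proof (intro allI impI)
  fix N :: "('m, 'f dfun, 'r) struct" and b and I :: "'i set" and r c a n
  assume "monster_model (delta_lang L) (TdG_model L T) N"
  then obtain \<kappa> :: "'m rel" where N: "TdG_model L T N" and
    \<kappa>: "|UNIV :: ('f dfun, 'r) fm set| <o \<kappa>" "saturated (delta_lang L) \<kappa> N"
    unfolding monster_model_def by blast
  have M: "is_struct (delta_lang L) N" "models L T (reduct N)"
    "generic_T_derivation L (reduct N) (\<lambda>x. fint N Delta [x])" using N by (auto simp: TdG_model_def)
  have "is_struct L (reduct N)" using M(2) by (simp add: models_def)
  moreover have "o_minimal L (reduct N)" using assms(5) M(2) by (simp add: o_minimal_theory_def)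
  moreover have "ordered_field (oring_of L (reduct N))"
    using assms(6) M(2) by (simp add: extends_RCF_def real_closed_field_def)
  ultimately interpret generic_derivation L "reduct N" "ordered_field_on.lt (oring_of L (reduct N))"
    "ordered_field_on.secant (oring_of L (reduct N))" "\<zero>\<^bsub>oring_of L (reduct N)\<^esub>" N "\<lambda>x. fint N Delta [x]"
    using generic_derivation_monster[OF assms(1) M(1) _ _ _ M(3) \<kappa>(2,1)] by blast
  assume "set b \<subseteq> dom N" "linear_order_on I r" "a \<in> I \<rightarrow> tuples (dom N) n"
    "indiscernible (delta_lang L) N {} I r a" "c \<in> I"
    "infinite_no_endpoints r {i \<in> I. strict r i c}" "infinite_no_endpoints r {i \<in> I. strict r c i}"
    "indiscernible (delta_lang L) N (set b) (I - {c}) r a"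
  then show "indiscernible (delta_lang L) N (set b) I r a"
    using distal[of b I r a n c] by simp
qed

end
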